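(* Let $\mathcal{P}$ be a finite poset. Then the upper suspension algebra $K\mathcal{P}^*$ is quasi-hereditary with respect to $(\mathcal{P}_0)^{op}$, and its Ringel dual is given by \[ R(K\mathcal{P}^*,(\mathcal{P}_0)^{op}) \cong \mathcal{L}'=\begin{pmatrix} R'' & 0 \\ \begin{pmatrix} R''\\ Z_{\mathcal{P}}\end{pmatrix} & K^{\mathbf{1}}\mathcal{P}\end{pmatrix}\subseteq \mathbb{M}_{n''+n}(K). \]
   Context: $K$ is an algebraically closed field. $\mathcal{P}=(\{1,\ldots,n\},\preceq)$, $n\geq1$, is a finite poset such that $i\preceq j$ implies $i\leq j$, and the elements are numbered so that the minimal elements of $\mathcal{P}$ are $1,\ldots,n''$, where $n''=|\min(\mathcal{P})|$; put $n'=n-n''$. All modules are finite-dimensional. Incidence algebra: for a poset $\mathcal{S}=(\{1,\ldots,m\},\preceq)$ such that $i\preceq j$ implies $i\leq j$, $K\mathcal{S}=\{M\in\mathbb{M}_m(K)\mid M_{ji}\neq0\text{ implies }i\preceq j\text{ in }\mathcal{S}\}$; this applies to $\mathcal{S}=\mathcal{P}$ with $m=n$, and to the poset $\mathcal{S}=\mathcal{P}^*$ defined below with $m=n+1$ and $*$ numbered $n+1$. With $\mathbf{1}=[1,\ldots,1]^{\mathrm{tr}}\in K^n$, $K^{\mathbf{1}}\mathcal{P}=\{M\in K\mathcal{P}\mid M\mathbf{1}\in K\mathbf{1}\}$. $R''$ is the set of diagonal $n''\times n''$ matrices and $Z_{\mathcal{P}}=\{M\in\mathbb{M}_{n'\times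 n''}(K)\mid M_{ji}\neq0\text{ implies }i\preceq j+n''\text{ in }\mathcal{P}\}$. In $\mathcal{L}'$ the lower left block consists of $n\times n''$ matrices whose first $n''$ rows lie in $R''$ and whose last $n'$ rows lie in $Z_{\mathcal{P}}$. $\mathcal{P}^*=\mathcal{P}\cup\{*\}$ is the poset extending $\mathcal{P}$ with $i\prec *$ for all $i\in\mathcal{P}$; $\mathcal{P}_0=\mathcal{P}\cup\{0\}$ is the poset extending $\mathcal{P}$ with $0\prec i$ for all $i\in\mathcal{P}$; $op$ denotes the opposite poset. The simple left $K\mathcal{P}^*$-modules are indexed by $(\mathcal{P}_0)^{op}$: the simple at vertex $k\in\mathcal{P}$ has index $k$ and the simple at vertex $*$ has index $0$. Let $\Lambda$ be a finite-dimensional $K$-algebra whose isomorphism classes of simple left modules $S(i)$ are indexed by a finite poset $\mathcal{Q}$, with projective covers $P(i)$ and injective envelopes $Q(i)$. The standard module $\Delta(i)$ is the largest factor module of $P(i)$ having only composition factors $S(j)$ with $j\preceq i$; the co-standard module $\nabla(i)$ is the largest submodule of $Q(i)$ having only composition factors $S(j)$ with $j\preceq i$. $\mathcal{F}(\Delta)$ (resp. $\mathcal{F}(\nabla)$) is the full subcategory of $\Lambda$-modules having a finite filtration with all subquotients isomorphic to standard (resp. co-standard) modules. $\Lambda$ is quasi-hereditary with respect to $\mathcal{Q}$ if: (a) $\dim_K\mathrm{End}_\Lambda(\Delta(i))=1$ for each $i$; (b) $P(i)\in\mathcal{F}(\Delta)$ for each $i$; (c) $\mathrm{Ext}^1_\Lambda(\Delta(i),\Delta(j))\neq0$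 implies $i\prec j$. In that case the Ringel dual is $R(\Lambda,\mathcal{Q}):=\mathrm{End}_\Lambda(T)^{op}$, where $T$ is the unique (up to isomorphism) multiplicity-free $\Lambda$-module with $\mathrm{add}(T)=\mathcal{F}(\Delta)\cap\mathcal{F}(\nabla)$. *)

theory Defs
  imports
    "HOL-Computational_Algebra.Polynomial"
    "HOL-Algebra.QuotRing"
    "Jordan_Normal_Form.VS_Connect"
begin

hide_const (open) Modules.module_hom

section \<open>Finite-dimensional algebras and their modules\<close>

text \<open>
  The ground field is a type \<open>'k\<close>; \<^term>\<open>class_ring\<close> is that field as a record.  A \<open>K\<close>-algebra is
  a record of type \<open>('k, 'a) module\<close>: the multiplicative part of the record is the ring structure,
  \<open>smult\<close> is the action of \<open>K\<close>.  A left module over such an algebra is a record of type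
  \<open>('a, 'm) module\<close>, whose \<open>mult\<close> and \<open>one\<close> fields play no role.  The library locale
  \<^locale>\<open>Module.module\<close> is not used for these because it requires a commutative ring; its
  \<^const>\<open>module_hom\<close>, \<^const>\<open>direct_sum\<close> and \<^const>\<open>Module.submodule\<close> do not.

  Wherever a definition ranges over all finite-dimensional modules, these are taken with carrier in
  the type \<open>'k vec\<close>.  Nothing is lost: the module operations are arbitrary, and every
  \<open>d\<close>-dimensional module is isomorphic to one with carrier \<open>carrier_vec d\<close>.
\<close>

definition fd_algebra :: "('k::field, 'a) module \<Rightarrow> bool" where
  "fd_algebra A \<longleftrightarrow>
     ring A \<and> vectorspace class_ring A \<and> vectorspace.fin_dim class_ring A \<and>
     (\<forall>c. \<forall>x\<in>carrier A. \<forall>y\<in>carrier A.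
        (c \<odot>\<^bsub>A\<^esub> x) \<otimes>\<^bsub>A\<^esub> y = c \<odot>\<^bsub>A\<^esub> (x \<otimes>\<^bsub>A\<^esub> y) \<and> x \<otimes>\<^bsub>A\<^esub> (c \<odot>\<^bsub>A\<^esub> y) = c \<odot>\<^bsub>A\<^esub> (x \<otimes>\<^bsub>A\<^esub> y))"

definition algebra_isomorphic :: "('k::field, 'a) module \<Rightarrow> ('k, 'b) module \<Rightarrow> bool" where
  "algebra_isomorphic A B \<longleftrightarrow> ring_iso A B \<inter> module_hom class_ring A B \<noteq> {}"

definition op_algebra :: "('k, 'a) module \<Rightarrow> ('k, 'a) module" where
  "op_algebra A = A\<lparr>mult := \<lambda>x y. y \<otimes>\<^bsub>A\<^esub> x\<rparr>"

definition left_module :: "('k, 'a) module \<Rightarrow> ('a, 'm) module \<Rightarrow> bool" where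
  "left_module A M \<longleftrightarrow>
     ring A \<and> abelian_group M \<and>
     (\<forall>a\<in>carrier A. \<forall>x\<in>carrier M. a \<odot>\<^bsub>M\<^esub> x \<in> carrier M) \<and>
     (\<forall>a\<in>carrier A. \<forall>b\<in>carrier A. \<forall>x\<in>carrier M.
        (a \<oplus>\<^bsub>A\<^esub> b) \<odot>\<^bsub>M\<^esub> x = (a \<odot>\<^bsub>M\<^esub> x) \<oplus>\<^bsub>M\<^esub> (b \<odot>\<^bsub>M\<^esub> x)) \<and>
     (\<forall>a\<in>carrier A. \<forall>x\<in>carrier M. \<forall>y\<in>carrier M.
        a \<odot>\<^bsub>M\<^esub> (x \<oplus>\<^bsub>M\<^esub> y) = (a \<odot>\<^bsub>M\<^esub> x) \<oplus>\<^bsub>M\<^esub> (a \<odot>\<^bsub>M\<^esub> y)) \<and>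
     (\<forall>a\<in>carrier A. \<forall>b\<in>carrier A. \<forall>x\<in>carrier M.
        (a \<otimes>\<^bsub>A\<^esub> b) \<odot>\<^bsub>M\<^esub> x = a \<odot>\<^bsub>M\<^esub> (b \<odot>\<^bsub>M\<^esub> x)) \<and>
     (\<forall>x\<in>carrier M. \<one>\<^bsub>A\<^esub> \<odot>\<^bsub>M\<^esub> x = x)"

definition underlying_space :: "('k, 'a) module \<Rightarrow> ('a, 'm) module \<Rightarrow> ('k, 'm) module" where
  "underlying_space A M =
     \<lparr>carrier = carrier M, mult = mult M, one = one M, zero = zero M, add = add M,
      smult = (\<lambda>c x. (c \<odot>\<^bsub>A\<^esub> \<one>\<^bsub>A\<^esub>) \<odot>\<^bsub>M\<^esub> x)\<rparr>"

definition fd_module :: "('k::field, 'a) module \<Rightarrow> ('a, 'm) module \<Rightarrow> bool" where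
  "fd_module A M \<longleftrightarrow>
     left_module A M \<and> vectorspace.fin_dim class_ring (underlying_space A M)"

definition isomorphic :: "('k, 'a) module \<Rightarrow> ('a, 'm) module \<Rightarrow> ('a, 'n) module \<Rightarrow> bool" where
  "isomorphic A M N \<longleftrightarrow> (\<exists>f\<in>module_hom A M N. bij_betw f (carrier M) (carrier N))"

definition quotient_module :: "('a, 'm) module \<Rightarrow> 'm set \<Rightarrow> ('a, 'm set) module" where
  "quotient_module M U =
     \<lparr>carrier = a_rcosets\<^bsub>M\<^esub> U, mult = undefined, one = undefined, zero = U, add = set_add M,
      smult = (\<lambda>a X. \<Union>x\<in>X. U +>\<^bsub>M\<^esub> (a \<odot>\<^bsub>M\<^esub> x))\<rparr>"

definition simple_module :: "('k, 'a) module \<Rightarrow> ('a, 'm) module \<Rightarrow> bool" where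
  "simple_module A M \<longleftrightarrow>
     left_module A M \<and> carrier M \<noteq> {\<zero>\<^bsub>M\<^esub>} \<and>
     (\<forall>U. Module.submodule U A M \<longrightarrow> U = {\<zero>\<^bsub>M\<^esub>} \<or> U = carrier M)"

text \<open>
  Endomorphisms are composed as functions, \<open>(f \<otimes> g) x = f (g x)\<close>; extensionality makes each
  endomorphism a single element of the carrier.
\<close>
definition End_algebra :: "('k, 'a) module \<Rightarrow> ('a, 'm) module \<Rightarrow> ('k, 'm \<Rightarrow> 'm) module" where
  "End_algebra A M =
     \<lparr>carrier = module_hom A M M \<inter> extensional (carrier M),
      mult = compose (carrier M),
      one = (\<lambda>x\<in>carrier M. x),
      zero = (\<lambda>x\<in>carrier M. \<zero>\<^bsub>M\<^esub>),
      add = (\<lambda>f g. \<lambda>x\<in>carrier M. f x \<oplus>\<^bsub>M\<^esub> g x),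
      smult = (\<lambda>c f. \<lambda>x\<in>carrier M. (c \<odot>\<^bsub>A\<^esub> \<one>\<^bsub>A\<^esub>) \<odot>\<^bsub>M\<^esub> f x)\<rparr>"

text \<open>\<open>M\<close> has a finite filtration with all subquotients isomorphic to members of \<open>X\<close>.\<close>
definition filtered_by ::
    "('k, 'a) module \<Rightarrow> ('a, 'n) module set \<Rightarrow> ('a, 'm) module \<Rightarrow> bool" where
  "filtered_by A X M \<longleftrightarrow>
     (\<exists>(l::nat) U. U 0 = {\<zero>\<^bsub>M\<^esub>} \<and> U l = carrier M \<and>
        (\<forall>k\<le>l. Module.submodule (U k) A M) \<and>
        (\<forall>k<l. U k \<subseteq> U (Suc k) \<and>
           (\<exists>N\<in>X. isomorphic A (quotient_module (M\<lparr>carrier := U (Suc k)\<rparr>) (U k)) N)))"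

definition power_module :: "('a, 'm) module \<Rightarrow> nat \<Rightarrow> ('a, nat \<Rightarrow> 'm) module" where
  "power_module M m =
     \<lparr>carrier = {..<m} \<rightarrow>\<^sub>E carrier M, mult = undefined, one = undefined,
      zero = (\<lambda>i\<in>{..<m}. \<zero>\<^bsub>M\<^esub>),
      add = (\<lambda>x y. \<lambda>i\<in>{..<m}. x i \<oplus>\<^bsub>M\<^esub> y i),
      smult = (\<lambda>a x. \<lambda>i\<in>{..<m}. a \<odot>\<^bsub>M\<^esub> x i)\<rparr>"

definition in_add :: "('k::field, 'a) module \<Rightarrow> ('a, 'k vec) module \<Rightarrow> ('a, 'k vec) module \<Rightarrow> bool"
  where
  "in_add A T M \<longleftrightarrow>
     (\<exists>m (N :: ('a, 'k vec) module).
        fd_module A N \<and> isomorphic A (direct_sum M N) (power_module T m))"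

definition indecomposable :: "('k::field, 'a) module \<Rightarrow> ('a, 'k vec) module \<Rightarrow> bool" where
  "indecomposable A M \<longleftrightarrow>
     left_module A M \<and> carrier M \<noteq> {\<zero>\<^bsub>M\<^esub>} \<and>
     (\<forall>(N1 :: ('a, 'k vec) module) (N2 :: ('a, 'k vec) module).
        fd_module A N1 \<and> fd_module A N2 \<and> isomorphic A M (direct_sum N1 N2) \<longrightarrow>
        carrier N1 = {\<zero>\<^bsub>N1\<^esub>} \<or> carrier N2 = {\<zero>\<^bsub>N2\<^esub>})"

definition multiplicity_free :: "('k::field, 'a) module \<Rightarrow> ('a, 'k vec) module \<Rightarrow> bool" where
  "multiplicity_free A T \<longleftrightarrow>
     (\<forall>(N :: ('a, 'k vec) module) (N' :: ('a, 'k vec) module).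
        fd_module A N \<and> indecomposable A N \<and> fd_module A N' \<longrightarrow>
        \<not> isomorphic A T (direct_sum (direct_sum N N) N'))"

section \<open>Projective covers, injective envelopes, extensions\<close>

definition projective :: "('k::field, 'a) module \<Rightarrow> ('a, 'm) module \<Rightarrow> bool" where
  "projective A P \<longleftrightarrow>
     fd_module A P \<and>
     (\<forall>(M :: ('a, 'k vec) module) (N :: ('a, 'k vec) module).
        fd_module A M \<and> fd_module A N \<longrightarrow>
        (\<forall>g\<in>module_hom A M N. \<forall>f\<in>module_hom A P N. g ` carrier M = carrier N \<longrightarrow>
           (\<exists>h\<in>module_hom A P M. \<forall>x\<in>carrier P. g (h x) = f x)))"

definition injective :: "('k::field, 'a) module \<Rightarrow> ('a, 'm) module \<Rightarrow> bool" where
  "injective A Q \<longleftrightarrow>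
     fd_module A Q \<and>
     (\<forall>(M :: ('a, 'k vec) module) (N :: ('a, 'k vec) module).
        fd_module A M \<and> fd_module A N \<longrightarrow>
        (\<forall>g\<in>module_hom A M N. \<forall>f\<in>module_hom A M Q. inj_on g (carrier M) \<longrightarrow>
           (\<exists>h\<in>module_hom A N Q. \<forall>x\<in>carrier M. h (g x) = f x)))"

definition is_projective_cover ::
    "('k::field, 'a) module \<Rightarrow> ('a, 'm) module \<Rightarrow> ('a, 'n) module \<Rightarrow> bool" where
  "is_projective_cover A P M \<longleftrightarrow>
     projective A P \<and>
     (\<exists>p\<in>module_hom A P M. p ` carrier P = carrier M \<and>
        (\<forall>U. Module.submodule U A P \<and> U <+>\<^bsub>P\<^esub> a_kernel P M p = carrier P \<longrightarrow> U = carrier P))"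

definition is_injective_envelope ::
    "('k::field, 'a) module \<Rightarrow> ('a, 'm) module \<Rightarrow> ('a, 'n) module \<Rightarrow> bool" where
  "is_injective_envelope A Q M \<longleftrightarrow>
     injective A Q \<and>
     (\<exists>\<iota>\<in>module_hom A M Q. inj_on \<iota> (carrier M) \<and>
        (\<forall>U. Module.submodule U A Q \<and> U \<inter> \<iota> ` carrier M = {\<zero>\<^bsub>Q\<^esub>} \<longrightarrow> U = {\<zero>\<^bsub>Q\<^esub>}))"

definition projective_cover ::
    "('k::field, 'a) module \<Rightarrow> ('a, 'm) module \<Rightarrow> ('a, 'k vec) module" where
  "projective_cover A M = (SOME P. is_projective_cover A P M)"

definition injective_envelope ::
    "('k::field, 'a) module \<Rightarrow> ('a, 'm) module \<Rightarrow> ('a, 'k vec) module" where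
  "injective_envelope A M = (SOME Q. is_injective_envelope A Q M)"

text \<open>
  \<open>Ext\<^sup>1(M, N)\<close> is Yoneda's: short exact sequences \<open>0 \<rightarrow> N \<rightarrow> E \<rightarrow> M \<rightarrow> 0\<close>, given as triples
  \<open>(E, f, g)\<close>, modulo equivalence.  Its zero element is the class of the split sequences.
\<close>
definition extensions ::
    "('k::field, 'a) module \<Rightarrow> ('a, 'm) module \<Rightarrow> ('a, 'n) module \<Rightarrow>
     (('a, 'k vec) module \<times> ('n \<Rightarrow> 'k vec) \<times> ('k vec \<Rightarrow> 'm)) set" where
  "extensions A M N =
     {(E, f, g). fd_module A E \<and> f \<in> module_hom A N E \<and> g \<in> module_hom A E M \<and>
        inj_on f (carrier N) \<and> f ` carrier N = a_kernel E M g \<and> g ` carrier E = carrier M}"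

definition extension_equiv ::
    "('k::field, 'a) module \<Rightarrow> ('a, 'm) module \<Rightarrow> ('a, 'n) module \<Rightarrow>
     (('a, 'k vec) module \<times> ('n \<Rightarrow> 'k vec) \<times> ('k vec \<Rightarrow> 'm)) rel" where
  "extension_equiv A M N =
     {((E, f, g), (E', f', g')). (E, f, g) \<in> extensions A M N \<and> (E', f', g') \<in> extensions A M N \<and>
        (\<exists>h\<in>module_hom A E E'. (\<forall>x\<in>carrier N. h (f x) = f' x) \<and>
           (\<forall>y\<in>carrier E. g' (h y) = g y))}"

definition Ext1 ::
    "('k::field, 'a) module \<Rightarrow> ('a, 'm) module \<Rightarrow> ('a, 'n) module \<Rightarrow>
     (('a, 'k vec) module \<times> ('n \<Rightarrow> 'k vec) \<times> ('k vec \<Rightarrow> 'm)) set set" where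
  "Ext1 A M N = extensions A M N // extension_equiv A M N"

definition Ext1_zero ::
    "('k::field, 'a) module \<Rightarrow> ('a, 'm) module \<Rightarrow> ('a, 'n) module \<Rightarrow>
     (('a, 'k vec) module \<times> ('n \<Rightarrow> 'k vec) \<times> ('k vec \<Rightarrow> 'm)) set" where
  "Ext1_zero A M N =
     {(E, f, g) \<in> extensions A M N. \<exists>s\<in>module_hom A M E. \<forall>x\<in>carrier M. g (s x) = x}"

section \<open>Quasi-hereditary algebras and Ringel duality\<close>

text \<open>
  The indexing poset is \<open>(I, r)\<close> with \<open>(j, i) \<in> r\<close> meaning \<open>j \<preceq> i\<close>, and \<open>S i\<close> is the simple module
  of index \<open>i\<close>.
\<close>

definition indexes_simples :: "('k::field, 'a) module \<Rightarrow> 'i set \<Rightarrow> ('i \<Rightarrow> ('a, 'k vec) module) \<Rightarrow> bool"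
  where
  "indexes_simples A I S \<longleftrightarrow>
     (\<forall>i\<in>I. fd_module A (S i) \<and> simple_module A (S i)) \<and>
     (\<forall>i\<in>I. \<forall>j\<in>I. isomorphic A (S i) (S j) \<longrightarrow> i = j) \<and>
     (\<forall>M :: ('a, 'k vec) module. fd_module A M \<and> simple_module A M \<longrightarrow>
        (\<exists>i\<in>I. isomorphic A M (S i)))"

text \<open>
  A finite-dimensional module has only composition factors \<open>S j\<close> with \<open>j \<preceq> i\<close> iff it has a
  composition series with all factors among these, by the Jordan--Hoelder theorem.
\<close>
definition composition_factors_below ::
    "('k::field, 'a) module \<Rightarrow> 'i rel \<Rightarrow> ('i \<Rightarrow> ('a, 'k vec) module) \<Rightarrow> 'i \<Rightarrow>
     ('a, 'm) module \<Rightarrow> bool" where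
  "composition_factors_below A r S i M \<longleftrightarrow> filtered_by A {S j |j. (j, i) \<in> r} M"

text \<open>The largest factor module is the one by the least submodule.\<close>
definition standard ::
    "('k::field, 'a) module \<Rightarrow> 'i rel \<Rightarrow> ('i \<Rightarrow> ('a, 'k vec) module) \<Rightarrow> 'i \<Rightarrow>
     ('a, 'k vec set) module" where
  "standard A r S i =
     (let P = projective_cover A (S i)
      in quotient_module P
           (LEAST U. Module.submodule U A P \<and>
              composition_factors_below A r S i (quotient_module P U)))"

definition costandard ::
    "('k::field, 'a) module \<Rightarrow> 'i rel \<Rightarrow> ('i \<Rightarrow> ('a, 'k vec) module) \<Rightarrow> 'i \<Rightarrow>
     ('a, 'k vec) module" where
  "costandard A r S i =
     (let Q = injective_envelope A (S i)
      in Q\<lparr>carrier :=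
             (GREATEST U. Module.submodule U A Q \<and>
                composition_factors_below A r S i (Q\<lparr>carrier := U\<rparr>))\<rparr>)"

definition quasi_hereditary ::
    "('k::field, 'a) module \<Rightarrow> 'i set \<Rightarrow> 'i rel \<Rightarrow> ('i \<Rightarrow> ('a, 'k vec) module) \<Rightarrow> bool" where
  "quasi_hereditary A I r S \<longleftrightarrow>
     fd_algebra A \<and> finite I \<and> partial_order_on I r \<and> indexes_simples A I S \<and>
     (\<forall>i\<in>I. vectorspace.dim class_ring (End_algebra A (standard A r S i)) = 1) \<and>
     (\<forall>i\<in>I. filtered_by A (standard A r S ` I) (projective_cover A (S i))) \<and>
     (\<forall>i\<in>I. \<forall>j\<in>I.
        Ext1 A (standard A r S i) (standard A r S j) \<noteq>
          {Ext1_zero A (standard A r S i) (standard A r S j)} \<longrightarrow>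
        (i, j) \<in> r \<and> i \<noteq> j)"

definition characteristic_tilting_module ::
    "('k::field, 'a) module \<Rightarrow> 'i set \<Rightarrow> 'i rel \<Rightarrow> ('i \<Rightarrow> ('a, 'k vec) module) \<Rightarrow>
     ('a, 'k vec) module \<Rightarrow> bool" where
  "characteristic_tilting_module A I r S T \<longleftrightarrow>
     fd_module A T \<and> multiplicity_free A T \<and>
     (\<forall>M :: ('a, 'k vec) module. fd_module A M \<longrightarrow>
        (in_add A T M \<longleftrightarrow>
           filtered_by A (standard A r S ` I) M \<and> filtered_by A (costandard A r S ` I) M))"

definition ringel_dual ::
    "('k::field, 'a) module \<Rightarrow> 'i set \<Rightarrow> 'i rel \<Rightarrow> ('i \<Rightarrow> ('a, 'k vec) module) \<Rightarrow>
     ('k, 'k vec \<Rightarrow> 'k vec) module" where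
  "ringel_dual A I r S =
     op_algebra (End_algebra A (SOME T. characteristic_tilting_module A I r S T))"

section \<open>Incidence algebras and suspensions\<close>

text \<open>
  A poset on \<open>{1..m}\<close> is given by its order relation \<open>r\<close>.  Rows and columns are numbered from \<open>1\<close>
  in the mathematics and from \<open>0\<close> in \<^typ>\<open>'k mat\<close>, so the entry \<open>M\<^sub>j\<^sub>i\<close> is \<open>M $$ (j - 1, i - 1)\<close>.
\<close>

definition incidence_mats :: "nat \<Rightarrow> nat rel \<Rightarrow> 'k::field mat set" where
  "incidence_mats m r =
     {M \<in> carrier_mat m m. \<forall>i\<in>{1..m}. \<forall>j\<in>{1..m}. M $$ (j - 1, i - 1) \<noteq> 0 \<longrightarrow> (i, j) \<in> r}"

definition incidence_algebra :: "nat \<Rightarrow> nat rel \<Rightarrow> ('k::field, 'k mat) module" where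
  "incidence_algebra m r = (module_mat TYPE('k) m m)\<lparr>carrier := incidence_mats m r\<rparr>"

text \<open>The one-dimensional module at vertex \<open>k\<close>, on which \<open>M\<close> acts as \<open>M\<^sub>k\<^sub>k\<close>.\<close>
definition vertex_simple :: "nat \<Rightarrow> ('k::field mat, 'k vec) module" where
  "vertex_simple k =
     \<lparr>carrier = carrier_vec 1, mult = undefined, one = undefined, zero = 0\<^sub>v 1, add = (+),
      smult = (\<lambda>M v. M $$ (k - 1, k - 1) \<cdot>\<^sub>v v)\<rparr>"

text \<open>The order of \<open>\<P>\<^sup>*\<close>, with \<open>*\<close> numbered \<open>n + 1\<close>.\<close>
definition upper_ext :: "nat \<Rightarrow> nat rel \<Rightarrow> nat rel" where
  "upper_ext n r = r \<union> {1..n + 1} \<times> {n + 1}"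

text \<open>The order of \<open>\<P>\<^sub>0\<close>, on \<open>{0..n}\<close>.\<close>
definition lower_ext :: "nat \<Rightarrow> nat rel \<Rightarrow> nat rel" where
  "lower_ext n r = r \<union> {0} \<times> {0..n}"

definition upper_suspension_algebra :: "nat \<Rightarrow> nat rel \<Rightarrow> ('k::field, 'k mat) module" where
  "upper_suspension_algebra n r = incidence_algebra (n + 1) (upper_ext n r)"

definition suspension_simple :: "nat \<Rightarrow> nat \<Rightarrow> ('k::field mat, 'k vec) module" where
  "suspension_simple n i = vertex_simple (if i = 0 then n + 1 else i)"

definition minimal_elements :: "nat \<Rightarrow> nat rel \<Rightarrow> nat set" where
  "minimal_elements n r = {j \<in> {1..n}. \<forall>i\<in>{1..n}. (i, j) \<in> r \<longrightarrow> i = j}"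

definition one_incidence_mats :: "nat \<Rightarrow> nat rel \<Rightarrow> 'k::field mat set" where
  "one_incidence_mats n r =
     {M \<in> incidence_mats n r. \<exists>c. M *\<^sub>v vec n (\<lambda>_. 1) = c \<cdot>\<^sub>v vec n (\<lambda>_. 1)}"

definition diagonal_mats :: "nat \<Rightarrow> 'k::field mat set" where
  "diagonal_mats m = {M \<in> carrier_mat m m. diagonal_mat M}"

text \<open>Here and below \<open>p\<close> is the number of minimal elements of the poset.\<close>
definition Z_mats :: "nat \<Rightarrow> nat \<Rightarrow> nat rel \<Rightarrow> 'k::field mat set" where
  "Z_mats n p r =
     {M \<in> carrier_mat (n - p) p.
        \<forall>i\<in>{1..p}. \<forall>j\<in>{1..n - p}. M $$ (j - 1, i - 1) \<noteq> 0 \<longrightarrow> (i, j + p) \<in> r}"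

definition L'_algebra :: "nat \<Rightarrow> nat \<Rightarrow> nat rel \<Rightarrow> ('k::field, 'k mat) module" where
  "L'_algebra n p r = (module_mat TYPE('k) (p + n) (p + n))\<lparr>carrier :=
     {four_block_mat D (0\<^sub>m p n) (D' @\<^sub>r Z) M |D D' Z M.
        D \<in> diagonal_mats p \<and> D' \<in> diagonal_mats p \<and> Z \<in> Z_mats n p r \<and>
        M \<in> one_incidence_mats n r}\<rparr>"

end

theory Submission
 imports Defs "HOL-Library.Function_Algebras"
begin

text \<open>
A module over the incidence algebra of the suspended poset is a representation of that poset: vector spaces
\<open>M\<^sub>k\<close> for the vertices \<open>k\<close> and compatible maps \<open>M\<^sub>i \<rightarrow> M\<^sub>j\<close> for \<open>i \<preceq> j\<close>.  Projective covers and injective envelopes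
of the simple modules are interval modules: \<open>thin S\<close> has a one-dimensional component at each vertex of the
convex set \<open>S\<close> and identity maps between them.  Hence the standard module of index \<open>i \<ge> 1\<close> is
\<open>thin {k. i \<preceq> k}\<close> with \<open>k\<close> in \<open>\<P>\<close>, the one of index \<open>0\<close> is the simple module at \<open>*\<close>; the costandard modules are the simple
modules at the vertices of \<open>\<P>\<close> and, for index \<open>0\<close>, \<open>thin\<close> of all vertices.  Quasi-heredity is read off
from this (\<open>quasi_hereditary_suspension\<close>).

Tilting modules are recognised by implications \<open>a x = b z \<longrightarrow> (\<exists>w. c x = d w)\<close> with \<open>a, b, c, d\<close> in the algebra
(\<open>pp_imp\<close>).  These pass to direct summands of powers, which replaces the Krull--Schmidt theorem.  A
module with a costandard filtration has surjective maps \<open>M\<^sub>i \<rightarrow> M\<^sub>*\<close> (\<open>surj_filtered\<close>); one with a standard filtration is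
free as a representation of \<open>\<P>\<close> (\<open>free_filtered\<close>).  Both together, called \<open>tilt\<close>, force the normal
form \<open>NF m\<close> (\<open>tilt_normal_form\<close>): \<open>M\<^sub>*\<close> has dimension \<open>m 0\<close>, each of its basis vectors is lifted freely to every
minimal vertex, and there are \<open>m i\<close> further free generators at \<open>i\<close>, which are sent to \<open>0\<close> at \<open>*\<close>.
Conversely \<open>NF m\<close> has both filtrations.  Whether \<open>m i\<close> is \<open>0\<close>, or at most \<open>1\<close>, is again visible to such
formulas, so the characteristic tilting module is \<open>NF\<close> with all multiplicities \<open>1\<close>.

This module is isomorphic to \<open>TT\<close>, with one free generator sent to \<open>0\<close> at each minimal vertex and one generator
sent to the basis vector of \<open>M\<^sub>*\<close> at each vertex.  The component of \<open>TT\<close> at \<open>k\<close> consists of row vectors indexed by the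
generators at vertices below \<open>k\<close>.  An endomorphism is right multiplication by a matrix; commuting
with the maps to \<open>*\<close> means that the entries for generators of the second kind add up to \<open>0\<close> in the rows
of the first kind and to a constant in the rows of the second kind.  These matrices are the elements of \<open>\<L>'\<close>.
\<close>

section \<open>Modules and their quotients\<close>

abbreviation car where "car == carrier"

abbreviation submod where "submod == Module.submodule"

abbreviation act (\<open>(_ *[_] _)\<close> [70, 0, 71] 70) where "a *[M] x == a \<odot>\<^bsub>M\<^esub> x"

abbreviation add_in (\<open>(_ +[_] _)\<close> [65, 0, 66] 65) where "x +[M] y == x \<oplus>\<^bsub>M\<^esub> y"

abbreviation minus_in (\<open>(_ -[_] _)\<close> [65, 0, 66] 65) where "x -[M] y == x \<ominus>\<^bsub>M\<^esub> y"

abbreviation neg_in (\<open>(-[_] _)\<close> [0, 81] 80) where "-[M] x == \<ominus>\<^bsub>M\<^esub> x"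

abbreviation coset_in (\<open>(_ +>[_] _)\<close> [60, 0, 61] 60) where "U +>[M] x == U +>\<^bsub>M\<^esub> x"

abbreviation zero_in (\<open>\<zero>[_]\<close>) where "\<zero>[M] == \<zero>\<^bsub>M\<^esub>"

locale lmodule =
 fixes A :: "('k, 'a) module" and M :: "('a, 'm) module"
 assumes left_module: "left_module A M"
begin

sublocale A: ring A using left_module unfolding left_module_def by blast
sublocale M: abelian_group M using left_module unfolding left_module_def by blast

lemma smult_closed [simp, intro]:
 "a : car A ==> x : car M ==> a *[M] x : car M"
 using left_module unfolding left_module_def by blast

lemma smult_l_distr:
 "a : car A ==> b : car A ==> x : car M ==>
  (a +[A] b) *[M] x = (a *[M] x) +[M] (b *[M] x)"
 using left_module unfolding left_module_def by blast

lemma smult_r_distr: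
 "a : car A ==> x : car M ==> y : car M ==>
  a *[M] (x +[M] y) = (a *[M] x) +[M] (a *[M] y)"
 using left_module unfolding left_module_def by blast

lemma smult_assoc:
 "a : car A ==> b : car A ==> x : car M ==>
  (a \<otimes>\<^bsub>A\<^esub> b) *[M] x = a *[M] (b *[M] x)"
 using left_module unfolding left_module_def by blast

lemma smult_one [simp]: "x : car M ==> \<one>\<^bsub>A\<^esub> *[M] x = x"
 using left_module unfolding left_module_def by blast

lemma smult_zero_left [simp]:
 assumes "x : car M" shows "\<zero>[A] *[M] x = \<zero>[M]"
proof -
 have "\<zero>[A] *[M] x +[M] \<zero>[A] *[M] x = \<zero>[A] *[M] x +[M] \<zero>[M]"
  using smult_l_distr[of "\<zero>[A]" "\<zero>[A]" x] assms by simp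
 then show ?thesis using assms by (simp add: M.add.l_cancel_one)
qed

lemma smult_zero_right [simp]:
 assumes "a : car A" shows "a *[M] \<zero>[M] = \<zero>[M]"
proof -
 have "a *[M] \<zero>[M] +[M] a *[M] \<zero>[M] = a *[M] \<zero>[M] +[M] \<zero>[M]"
  using smult_r_distr[of a "\<zero>[M]" "\<zero>[M]"] assms by simp
 then show ?thesis using assms by (simp add: M.add.l_cancel_one)
qed

lemma minus_zero [simp]: "-[M] \<zero>[M] = \<zero>[M]"
 by (rule M.minus_equality) auto

lemma right_minus_eq:
 assumes "x : car M" "y : car M" shows "x -[M] y = \<zero>[M] \<longleftrightarrow> x = y"
proof
 assume *: "x -[M] y = \<zero>[M]"
 have "x = (x -[M] y) +[M] y" using assms by (simp add: a_minus_def M.a_assoc M.l_neg)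
 then show "x = y" using * assms by simp
qed (use assms in "simp add: a_minus_def M.r_neg")

lemma smult_minus_right:
 assumes "a : car A" "x : car M" shows "a *[M] (-[M] x) = -[M] (a *[M] x)"
proof -
 have "a *[M] (-[M] x) +[M] a *[M] x = \<zero>[M]"
  using smult_r_distr[of a "-[M] x" x] assms by (simp add: M.l_neg)
 then show ?thesis using assms by (simp add: M.minus_equality)
qed

lemma smult_minus_left:
 assumes "a : car A" "x : car M" shows "(-[A] a) *[M] x = -[M] (a *[M] x)"
proof -
 have "(-[A] a) *[M] x +[M] a *[M] x = \<zero>[M]"
  using smult_l_distr[of "-[A] a" a x] assms by (simp add: A.l_neg)
 then show ?thesis using assms by (simp add: M.minus_equality)
qed

end

lemmas lmI = lmodule.intro

lemma left_moduleI:
 assumes "ring A" "abelian_group M"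
  "!!a x. a : car A ==> x : car M ==> a *[M] x : car M"
  "!!a b x. a : car A ==> b : car A ==> x : car M ==>
  (a +[A] b) *[M] x = (a *[M] x) +[M] (b *[M] x)"
  "!!a x y. a : car A ==> x : car M ==> y : car M ==>
  a *[M] (x +[M] y) = (a *[M] x) +[M] (a *[M] y)"
  "!!a b x. a : car A ==> b : car A ==> x : car M ==>
  (a \<otimes>\<^bsub>A\<^esub> b) *[M] x = a *[M] (b *[M] x)"
  "!!x. x : car M ==> \<one>\<^bsub>A\<^esub> *[M] x = x"
 shows "left_module A M"
 using assms unfolding left_module_def by blast

lemma homI:
 assumes "!!x. x : car M ==> f x : car N"
  "!!x y. x : car M ==> y : car M ==> f (x +[M] y) = f x +[N] f y"
  "!!a x. a : car A ==> x : car M ==> f (a *[M] x) = a *[N] f x"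
 shows "f : module_hom A M N"
 using assms unfolding LinearCombinations.module_hom_def by auto

lemma homD:
 assumes "f : module_hom A M N"
 shows "x : car M ==> f x : car N"
  "x : car M ==> y : car M ==> f (x +[M] y) = f x +[N] f y"
  "a : car A ==> x : car M ==> f (a *[M] x) = a *[N] f x"
 using assms unfolding LinearCombinations.module_hom_def by auto

lemma hom_zero:
 assumes "left_module A M" "left_module A N" "f : module_hom A M N"
 shows "f \<zero>[M] = \<zero>[N]"
proof -
 interpret M: lmodule A M by (rule lmodule.intro) fact
 interpret N: lmodule A N by (rule lmodule.intro) fact
 have "f (\<zero>[A] *[M] \<zero>[M]) = \<zero>[A] *[N] f \<zero>[M]"
  using assms(3) by (intro homD(3)) auto
 then show ?thesis using assms(3) by (simp add: homD(1))
qed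

lemma module_hom_minus:
 assumes "left_module A M" "left_module A N" "f : module_hom A M N" "x : car M"
 shows "f (-[M] x) = -[N] f x"
proof -
 interpret M: lmodule A M by (rule lmodule.intro) fact
 interpret N: lmodule A N by (rule lmodule.intro) fact
 have "f (-[M] x) +[N] f x = \<zero>[N]"
  using homD(2)[OF assms(3), of "-[M] x" x] assms(4) hom_zero[OF assms(1-3)]
  by (simp add: M.M.l_neg)
 then show ?thesis using homD(1)[OF assms(3)] assms(4)
  by (metis M.M.a_inv_closed N.M.minus_equality)
qed

lemma hom_comp:
 assumes "f : module_hom A M N" "g : module_hom A N L"
 shows "(%x. g (f x)) : module_hom A M L"
 using assms by (intro homI) (auto simp: homD)

lemma module_hom_inv:
 assumes "left_module A M" "f : module_hom A M N" "bij_betw f (car M) (car N)"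
 shows "the_inv_into (car M) f : module_hom A N M"
proof (intro homI)
 interpret M: lmodule A M by (rule lmodule.intro) fact
 let ?g = "the_inv_into (car M) f"
 have inj: "inj_on f (car M)" and im: "f ` car M = car N"
  using assms(3) by (auto simp: bij_betw_def)
 have g: "!!y. y : car N ==> ?g y : car M" "!!y. y : car N ==> f (?g y) = y"
  using inj im by (auto intro: the_inv_into_into f_the_inv_into_f)
 show "?g x : car M" if "x : car N" for x using g that by blast
 show "?g (x +[N] y) = ?g x +[M] ?g y" if "x : car N" "y : car N" for x y
  by (rule the_inv_into_f_eq[OF inj]) (use g that homD(2)[OF assms(2)] in auto)
 show "?g (a *[N] x) = a *[M] ?g x" if "a : car A" "x : car N" for a x
  by (rule the_inv_into_f_eq[OF inj]) (use g that homD(3)[OF assms(2)] in auto)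
qed

lemma iso_refl: "isomorphic A M M"
 unfolding isomorphic_def by (intro bexI[of _ "%x. x"] homI) (auto simp: bij_betw_def)

lemma iso_sym:
 assumes "left_module A M" "isomorphic A M N" shows "isomorphic A N M"
 using assms module_hom_inv unfolding isomorphic_def by (metis bij_betw_the_inv_into)

lemma iso_trans:
 assumes "isomorphic A M N" "isomorphic A N L" shows "isomorphic A M L"
proof -
 obtain f g where fg: "f : module_hom A M N" "bij_betw f (car M) (car N)"
  "g : module_hom A N L" "bij_betw g (car N) (car L)"
  using assms unfolding isomorphic_def by blast
 then show ?thesis unfolding isomorphic_def
  using hom_comp[OF fg(1,3)] bij_betw_trans[OF fg(2,4)] by (auto simp: comp_def)
qed

lemma isomorphicE:
 assumes "isomorphic A M N" "left_module A M"
 obtains f g where "f : module_hom A M N" "g : module_hom A N M"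
  "!!x. x : car M ==> g (f x) = x" "!!y. y : car N ==> f (g y) = y"
proof -
 obtain f where f: "f : module_hom A M N" "bij_betw f (car M) (car N)"
  using assms unfolding isomorphic_def by blast
 show thesis
  by (rule that[OF f(1) module_hom_inv[OF assms(2) f]])
  (use f(2) in "auto simp: bij_betw_def intro: the_inv_into_f_f f_the_inv_into_f")
qed

lemma isomorphicI:
 assumes "f : module_hom A M N" "!!y. y : car N ==> g y : car M"
  "!!x. x : car M ==> g (f x) = x" "!!y. y : car N ==> f (g y) = y"
 shows "isomorphic A M N"
 unfolding isomorphic_def
 by (intro bexI[OF _ assms(1)] bij_betw_byWitness[where f' = g])
  (use assms in "auto dest: homD(1)")

lemma transport_module:
 fixes M :: "('a, 'm) module" and ph :: "'m => 'n"
 assumes lm: "left_module A M" and inj: "inj_on ph (car M)"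
 obtains N :: "('a, 'n) module" where "left_module A N" "isomorphic A M N"
  "ph : module_hom A M N" "car N = ph ` car M"
proof -
 interpret lmodule A M by (rule lmodule.intro) fact
 define om where "om = the_inv_into (car M) ph"
 define N :: "('a, 'n) module" where "N = (|carrier = ph ` car M, mult = undefined,
  one = undefined, zero = ph \<zero>[M], add = (%x y. ph (om x +[M] om y)), smult = (%a x. ph (a *[M] om x))|)"
 have om: "!!x. x : car M ==> om (ph x) = x"
  unfolding om_def using inj by (rule the_inv_into_f_f)
 have N: "car N = ph ` car M" "zero N = ph \<zero>[M]"
  "!!x y. x +[N] y = ph (om x +[M] om y)" "!!a x. a *[N] x = ph (a *[M] om x)"
  unfolding N_def by auto
 have lmN: "left_module A N"
 proof (intro left_moduleI abelian_groupI)
  fix x assume "x : car N"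
  then obtain u where u: "u : car M" "x = ph u" by (auto simp: N)
  show "EX y:car N. y +[N] x = \<zero>[N]"
  by (rule bexI[of _ "ph (-[M] u)"]) (use u in "auto simp: N om M.l_neg")
 qed (auto simp: N om smult_l_distr smult_r_distr smult_assoc M.a_assoc M.a_comm M.a_lcomm A.ring_axioms)
 have hom: "ph : module_hom A M N" by (intro homI) (auto simp: N om)
 have "isomorphic A M N" unfolding isomorphic_def
  by (intro bexI[OF _ hom]) (use inj N in "auto simp: bij_betw_def")
 then show thesis using that lmN hom N(1) by blast
qed

lemma submoduleI:
 assumes "left_module A M" "U \<subseteq> car M" "\<zero>[M] : U"
  "!!x y. x : U ==> y : U ==> x +[M] y : U"
  "!!a x. a : car A ==> x : U ==> a *[M] x : U"
 shows "submod U A M"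
proof -
 interpret lmodule A M by (rule lmodule.intro) fact
 have "-[M] x : U" if "x : U" for x
 proof -
  have "(-[A] \<one>\<^bsub>A\<^esub>) *[M] x = -[M] x"
  using that assms(2) by (subst smult_minus_left) auto
  then show ?thesis using assms(5)[of "-[A] \<one>\<^bsub>A\<^esub>" x] that by simp
 qed
 then show ?thesis
  unfolding Module.submodule_def Module.submodule_axioms_def
  using assms by (auto intro!: subgroup.intro simp: a_inv_def)
qed

lemma submoduleD:
 assumes "submod U A M"
 shows "U \<subseteq> car M" "\<zero>[M] : U" "x : U ==> y : U ==> x +[M] y : U"
  "a : car A ==> x : U ==> a *[M] x : U" "x : U ==> -[M] x : U"
 using assms unfolding Module.submodule_def Module.submodule_axioms_def
 by (auto dest: subgroup.subset[THEN subsetD] subgroup.one_closed subgroup.m_closed subgroup.m_inv_closed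
  simp: a_inv_def)

lemma submodule_carrier: "left_module A M ==> submod (car M) A M"
 by (rule submoduleI) (auto dest: lmodule.intro intro: lmodule.smult_closed
  abelian_monoid.zero_closed abelian_monoid.a_closed
  simp: left_module_def abelian_group_def)

lemma submodule_zero:
 assumes "left_module A M" shows "submod {\<zero>[M]} A M"
proof -
 interpret lmodule A M by (rule lmodule.intro) fact
 show ?thesis by (rule submoduleI) (auto simp: assms)
qed

lemma lm_sub:
 assumes "left_module A M" "submod U A M"
 shows "left_module A (M(|carrier := U|))"
proof -
 interpret lmodule A M by (rule lmodule.intro) fact
 note U = submoduleD[OF assms(2)]
 show ?thesis
 proof (intro left_moduleI abelian_groupI)
  fix x assume "x : car (M(|carrier := U|))"
  then show "EX y:car (M(|carrier := U|)). y +[M(|carrier := U|)] x = \<zero>[M(|carrier := U|)]"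
  using U(1) U(5)[of x] by (intro bexI[of _ "-[M] x"]) (auto simp: M.l_neg subsetD)
 qed (use U in "auto simp: subsetD M.a_assoc M.a_comm smult_l_distr smult_r_distr smult_assoc
  A.ring_axioms M.a_lcomm")
qed

lemma submodule_of_submodule:
 assumes "left_module A M" "submod V A M"
 shows "submod U A (M(|carrier := V|)) \<longleftrightarrow> submod U A M & U \<subseteq> V"
proof
 assume "submod U A (M(|carrier := V|))"
 then show "submod U A M & U \<subseteq> V"
  using submoduleD[where U = U and A = A and M = "M(|carrier := V|)"] submoduleD(1)[OF assms(2)]
  by (auto intro!: submoduleI assms)
next
 assume "submod U A M & U \<subseteq> V"
 then show "submod U A (M(|carrier := V|))"
  using submoduleD[where U = U and A = A and M = M] lm_sub[OF assms]
  by (auto intro!: submoduleI)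
qed

lemma submodule_kernel:
 assumes "left_module A M" "left_module A N" "f : module_hom A M N"
 shows "submod {x : car M. f x = \<zero>[N]} A M"
proof -
 interpret M: lmodule A M by (rule lmodule.intro) fact
 interpret N: lmodule A N by (rule lmodule.intro) fact
 show ?thesis
  by (rule submoduleI) (auto simp: assms hom_zero[OF assms] homD[OF assms(3)])
qed

lemma submodule_image:
 assumes "left_module A M" "left_module A N" "f : module_hom A M N" "submod U A M"
 shows "submod (f ` U) A N"
proof -
 note U = submoduleD[OF assms(4)]
 show ?thesis
 proof (rule submoduleI)
  show "\<zero>[N] : f ` U" using U(2) hom_zero[OF assms(1-3)] by (metis imageI)
  fix x y assume "x : f ` U" "y : f ` U"
  then obtain u v where "u : U" "v : U" "x = f u" "y = f v" by blast
  then show "x +[N] y : f ` U"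
  using U(1) U(3)[of u v] homD(2)[OF assms(3), of u v] by (auto simp: subsetD intro!: image_eqI[of _ _ "u +[M] v"])
 next
  fix a x assume "a : car A" "x : f ` U"
  then obtain u where "u : U" "x = f u" by blast
  then show "a *[N] x : f ` U"
  using U(1) U(4)[of a u] homD(3)[OF assms(3), of a u] \<open>a : car A\<close>
  by (auto simp: subsetD intro!: image_eqI[of _ _ "a *[M] u"])
 qed (use assms homD(1)[OF assms(3)] U(1) in auto)
qed

lemma lm_sum:
 assumes "left_module A M" "left_module A N" shows "left_module A (direct_sum M N)"
proof -
 interpret M: lmodule A M by (rule lmodule.intro) fact
 interpret N: lmodule A N by (rule lmodule.intro) fact
 show ?thesis
 proof (intro left_moduleI abelian_groupI)
  fix x assume "x : car (direct_sum M N)"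
  then show "EX y:car (direct_sum M N). y +[direct_sum M N] x = \<zero>[direct_sum M N]"
  by (intro bexI[of _ "(-[M] fst x, -[N] snd x)"])
  (auto simp: direct_sum_def M.M.l_neg N.M.l_neg)
 qed (auto simp: direct_sum_def M.smult_l_distr M.smult_r_distr M.smult_assoc N.smult_l_distr
  N.smult_r_distr N.smult_assoc M.M.a_assoc N.M.a_assoc M.M.a_comm N.M.a_comm M.M.a_lcomm N.M.a_lcomm M.A.ring_axioms)
qed

lemma iso_sum:
 assumes "isomorphic A M M'" "isomorphic A N N'"
 shows "isomorphic A (direct_sum M N) (direct_sum M' N')"
proof -
 obtain f g where f: "f : module_hom A M M'" "bij_betw f (car M) (car M')"
  and g: "g : module_hom A N N'" "bij_betw g (car N) (car N')"
  using assms unfolding isomorphic_def by blast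
 show ?thesis unfolding isomorphic_def
  by (intro bexI[of _ "map_prod f g"] homI)
  (use f g in "auto simp: direct_sum_def homD bij_betw_map_prod")
qed

section \<open>Quotients and filtrations\<close>

lemma quotient_module_simps:
 "car (quotient_module M U) = a_rcosets\<^bsub>M\<^esub> U" "zero (quotient_module M U) = U"
 "add (quotient_module M U) = set_add M"
 "smult (quotient_module M U) = (%a X. \<Union>x\<in>X. U +>[M] (a *[M] x))"
 by (simp_all add: quotient_module_def)

context
 fixes A :: "('k, 'a) module" and M :: "('a, 'm) module" and U
 assumes lm: "left_module A M" and sub: "submod U A M"
begin

interpretation lmodule A M by (rule lmodule.intro) (fact lm)

lemma quotient_subgroup: "abelian_subgroup U M"
 by (rule abelian_subgroupI3)
  (use sub M.abelian_group_axioms in "auto simp: Module.submodule_def additive_subgroup_def")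

interpretation U: abelian_subgroup U M by (rule quotient_subgroup)

lemma quot_carrier: "car (quotient_module M U) = (%x. U +>[M] x) ` car M"
 by (auto simp: A_RCOSETS_def' quotient_module_simps)

lemma quotient_rcos_eq:
 assumes "x : car M" "y : car M"
 shows "U +>[M] x = U +>[M] y \<longleftrightarrow> x -[M] y : U"
proof
 assume "U +>[M] x = U +>[M] y"
 then obtain u where "u : U" "x = u +[M] y"
  using U.a_rcos_self[OF assms(1)] by (auto simp: a_r_coset_def')
 then show "x -[M] y : U"
  using submoduleD(1)[OF sub] assms by (auto simp: a_minus_def M.a_assoc M.r_neg)
next
 assume *: "x -[M] y : U"
 have "x = (x -[M] y) +[M] y" using assms by (simp add: a_minus_def M.a_assoc M.l_neg)
 then have "x : U +>[M] y" using * unfolding a_r_coset_def' by blast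
 then show "U +>[M] x = U +>[M] y"
  using M.a_repr_independence[OF _ assms(2)] U.a_subgroup by metis
qed

lemma quotient_add [simp]:
 assumes "x : car M" "y : car M"
 shows "(U +>[M] x) +[quotient_module M U] (U +>[M] y) = U +>[M] (x +[M] y)"
 unfolding quotient_module_simps using assms by (rule U.a_rcos_sum)

lemma quotient_smult [simp]:
 assumes "a : car A" "x : car M"
 shows "a *[quotient_module M U] (U +>[M] x) = U +>[M] (a *[M] x)"
proof -
 have "U +>[M] (a *[M] y) = U +>[M] (a *[M] x)" if y: "y : U +>[M] x" for y
 proof -
  obtain u where u: "u : U" "y = u +[M] x" using y by (auto simp: a_r_coset_def')
  have uM: "u : car M" using u(1) submoduleD(1)[OF sub] by auto
  have "a *[M] y -[M] a *[M] x = a *[M] u"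
  using assms uM u(2) by (simp add: smult_r_distr a_minus_def M.a_assoc M.r_neg)
  then show ?thesis
  using quotient_rcos_eq[of "a *[M] y" "a *[M] x"] submoduleD(4)[OF sub assms(1) u(1)] assms uM u(2)
  by simp
 qed
 then show ?thesis unfolding quotient_module_simps using U.a_rcos_self[OF assms(2)] by blast
qed

lemma quotient_zero_iff:
 assumes "x : car M" shows "U +>[M] x = U \<longleftrightarrow> x : U"
 using quotient_rcos_eq[OF assms, of "\<zero>[M]"] assms submoduleD(1)[OF sub]
 by (simp add: a_minus_def)

lemma quotient_zero: "\<zero>[quotient_module M U] = U +>[M] \<zero>[M]"
 using quotient_zero_iff[of "\<zero>[M]"] submoduleD(2)[OF sub] by (simp add: quotient_module_simps)

lemma quotient_hom: "(%x. U +>[M] x) : module_hom A M (quotient_module M U)"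
 by (intro homI) (auto simp: quot_carrier)

lemma lm_quot: "left_module A (quotient_module M U)"
proof -
 have "abelian_group (quotient_module M U)"
 proof (rule abelian_groupI)
  fix X assume "X : car (quotient_module M U)"
  then obtain x where "x : car M" "X = U +>[M] x" by (auto simp: quot_carrier)
  then show "EX Y:car (quotient_module M U). Y +[quotient_module M U] X = \<zero>[quotient_module M U]"
  by (intro bexI[of _ "U +>[M] (-[M] x)"])
  (auto simp: quot_carrier M.l_neg quotient_zero)
 qed (auto simp: quot_carrier quotient_zero M.a_assoc M.a_comm M.a_lcomm)
 then show ?thesis
  by (intro left_moduleI)
  (auto simp: quot_carrier smult_l_distr smult_r_distr smult_assoc A.ring_axioms)
qed

lemma first_isomorphism:
 assumes lmN: "left_module A N" and q: "q : module_hom A M N" "q ` car M = car N"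
  and ker: "U = {x : car M. q x = \<zero>[N]}"
 shows "isomorphic A (quotient_module M U) N"
proof -
 interpret N: lmodule A N by (rule lmodule.intro) (fact lmN)
 have eq: "U +>[M] x = U +>[M] y \<longleftrightarrow> q x = q y" if "x : car M" "y : car M" for x y
 proof -
  have "q (x -[M] y) = q x -[N] q y"
  using that homD(2)[OF q(1)] module_hom_minus[OF lm lmN q(1)] by (simp add: a_minus_def)
  moreover have "x -[M] y : U \<longleftrightarrow> q (x -[M] y) = \<zero>[N]"
  using that by (subst ker) (simp add: a_minus_def)
  ultimately show ?thesis
  using quotient_rcos_eq[OF that] N.right_minus_eq[OF homD(1)[OF q(1)] homD(1)[OF q(1)]] that by metis
 qed
 define h where "h X = q (SOME x. x : car M & X = U +>[M] x)" for X
 have h: "h (U +>[M] x) = q x" if "x : car M" for x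
 proof -
  have "EX y. y : car M & U +>[M] x = U +>[M] y" using that by blast
  from someI_ex[OF this] show ?thesis unfolding h_def using eq that by metis
 qed
 have "h : module_hom A (quotient_module M U) N"
  by (intro homI)
  (auto simp: quot_carrier h homD[OF q(1)])
 moreover have "bij_betw h (car (quotient_module M U)) (car N)"
  unfolding bij_betw_def inj_on_def quot_carrier using q(2) by (auto simp: h eq image_image)
 ultimately show ?thesis unfolding isomorphic_def by blast
qed

lemma quotient_isomorphicD:
 assumes lmN: "left_module A N" and iso: "isomorphic A (quotient_module M U) N"
 obtains q where "q : module_hom A M N" "q ` car M = car N" "U = {x : car M. q x = \<zero>[N]}"
proof -
 obtain h where h: "h : module_hom A (quotient_module M U) N"
  "bij_betw h (car (quotient_module M U)) (car N)"
  using iso unfolding isomorphic_def by blast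
 have h0: "h U = \<zero>[N]" using hom_zero[OF lm_quot lmN h(1)] by (simp add: quotient_module_simps)
 have U: "U : car (quotient_module M U)"
  using quotient_zero_iff[of "\<zero>[M]"] submoduleD(2)[OF sub] quot_carrier
  by auto
 let ?q = "%x. h (U +>[M] x)"
 have "?q ` car M = car N"
  using h(2) unfolding bij_betw_def quot_carrier by (auto simp: image_image)
 moreover have "U = {x : car M. ?q x = \<zero>[N]}"
 proof -
  have "?q x = \<zero>[N] \<longleftrightarrow> x : U" if "x : car M" for x
  proof -
  have "U +>[M] x : car (quotient_module M U)" using that quot_carrier by auto
  then have "?q x = h U \<longleftrightarrow> U +>[M] x = U" using h(2) U unfolding bij_betw_def by (metis inj_on_eq_iff)
  then show ?thesis using h0 quotient_zero_iff[OF that] by simp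
  qed
  then show ?thesis using submoduleD(1)[OF sub] by blast
 qed
 ultimately show thesis using that hom_comp[OF quotient_hom h(1)] by blast
qed

end

lemma filtered_induct:
 assumes fil: "filtered_by A X M" and lm: "left_module A M" and X: "!!N. N : X ==> left_module A N"
  and zero: "P {\<zero>[M]}"
  and step: "!!U V N q. submod U A M ==> submod V A M ==> U \<subseteq> V ==> N : X ==>
  q : module_hom A (M(|carrier := V|)) N ==> q ` V = car N ==> U = {x : V. q x = \<zero>[N]} ==>
  P U ==> P V"
 shows "P (car M)"
proof -
 obtain l :: nat and W where W: "W 0 = {\<zero>[M]}" "W l = car M"
  "ALL k<=l. submod (W k) A M"
  "ALL k<l. W k \<subseteq> W (Suc k) &
  (EX N:X. isomorphic A (quotient_module (M(|carrier := W (Suc k)|)) (W k)) N)"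
  using fil unfolding filtered_by_def by auto
 have "k \<le> l ==> P (W k)" for k
 proof (induction k)
  case 0 then show ?case using zero W(1) by simp
 next
  case (Suc k)
  define U V where "U = W k" and "V = W (Suc k)"
  have sub: "submod U A M" "submod V A M" "U \<subseteq> V" "P U"
  using W(3,4) Suc by (auto simp: U_def V_def)
  obtain N where N: "N : X" "isomorphic A (quotient_module (M(|carrier := V|)) U) N"
  using W(4)[rule_format, of k] Suc.prems by (auto simp: U_def V_def)
  have "submod U A (M(|carrier := V|))"
  using sub submodule_of_submodule[OF lm sub(2)] by blast
  from quotient_isomorphicD[OF lm_sub[OF lm sub(2)] this X[OF N(1)] N(2)]
  obtain q where "q : module_hom A (M(|carrier := V|)) N" "q ` V = car N" "U = {x : V. q x = \<zero>[N]}"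
  by auto
  from step[OF sub(1-3) N(1) this sub(4)] show ?case unfolding V_def .
 qed
 then show ?thesis using W(2) by force
qed

lemma filtered_zero:
 assumes "left_module A M" "car M = {\<zero>[M]}"
 shows "filtered_by A X M"
 unfolding filtered_by_def using submodule_zero[OF assms(1)] assms(2)
 by (intro exI[of _ 0] exI[of _ "%_. {\<zero>[M]}"]) auto

lemma filtered_step:
 assumes lm: "left_module A M" and sub: "submod U A M" "submod V A M" "U \<subseteq> V"
  and fil: "filtered_by A X (M(|carrier := U|))"
  and N: "N : X" "left_module A N" "q : module_hom A (M(|carrier := V|)) N" "q ` V = car N"
  "U = {x : V. q x = \<zero>[N]}"
 shows "filtered_by A X (M(|carrier := V|))"
proof -
 have lmV: "left_module A (M(|carrier := V|))" using lm_sub[OF lm sub(2)] .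
 have subUV: "submod U A (M(|carrier := V|))" using sub submodule_of_submodule[OF lm sub(2)] by blast
 have iso: "isomorphic A (quotient_module (M(|carrier := V|)) U) N"
  using first_isomorphism[OF lmV subUV N(2)] N by simp
 obtain l :: nat and W where W: "W 0 = {\<zero>[M]}" "W l = U"
  "ALL k<=l. submod (W k) A (M(|carrier := U|))"
  "ALL k<l. W k \<subseteq> W (Suc k) &
  (EX N:X. isomorphic A (quotient_module (M(|carrier := W (Suc k)|)) (W k)) N)"
  using fil unfolding filtered_by_def by auto
 have W3: "ALL k<=l. submod (W k) A M & W k \<subseteq> U"
  using W(3) submodule_of_submodule[OF lm sub(1)] by blast
 show ?thesis unfolding filtered_by_def
 proof (intro exI[of _ "Suc l"] exI[of _ "W(Suc l := V)"] conjI allI impI)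
  fix k assume "k \<le> Suc l"
  then show "submod ((W(Suc l := V)) k) A (M(|carrier := V|))"
  using W3 sub submodule_of_submodule[OF lm sub(2)] by (auto simp: le_Suc_eq)
 next
  fix k assume "k < Suc l"
  then have k: "k < l \<or> k = l" by auto
  show "(W(Suc l := V)) k \<subseteq> (W(Suc l := V)) (Suc k)" using k W(2,4) sub(3) by auto
  show "EX N:X. isomorphic A (quotient_module (M(|carrier := V, carrier := (W(Suc l := V)) (Suc k)|))
  ((W(Suc l := V)) k)) N"
  proof (cases "k = l")
  case True then show ?thesis using W(2) iso N(1) by auto
  next
  case False then show ?thesis using k W(4) by simp
  qed
 qed (use W(1) in simp_all)
qed

lemma filtered_by_iso:
 assumes fil: "filtered_by A X M" and lm: "left_module A M" "left_module A M'"
  and iso: "isomorphic A M M'" and X: "!!N. N : X ==> left_module A N"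
  and X': "!!N. N : X ==> EX N':X'. left_module A N' & isomorphic A N N'"
 shows "filtered_by A X' M'"
proof -
 obtain f g where f: "f : module_hom A M M'" and g: "g : module_hom A M' M"
  and gf: "!!x. x : car M ==> g (f x) = x" and fg: "!!y. y : car M' ==> f (g y) = y"
  using isomorphicE[OF iso lm(1)] by metis
 have imM: "f ` car M = car M'"
  using homD(1)[OF f] homD(1)[OF g] fg by (auto intro!: image_eqI)
 have "filtered_by A X' (M'(|carrier := f ` car M|))"
 proof (rule filtered_induct[OF fil lm(1) X, where P = "%U. filtered_by A X' (M'(|carrier := f ` U|))"])
  have "left_module A (M'(|carrier := {\<zero>[M']}|))"
  by (intro lm_sub lm submodule_zero)
  then show "filtered_by A X' (M'(|carrier := f ` {\<zero>[M]}|))"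
  using hom_zero[OF lm f] by (intro filtered_zero) auto
 next
  fix U V N q
  assume *: "submod U A M" "submod V A M" "U \<subseteq> V" "N : X"
  "q : module_hom A (M(|carrier := V|)) N" "q ` V = car N" "U = {x : V. q x = \<zero>[N]}"
  "filtered_by A X' (M'(|carrier := f ` U|))"
  obtain N' where N': "N' : X'" "left_module A N'" "isomorphic A N N'" using X'[OF *(4)] by blast
  obtain h k where h: "h : module_hom A N N'"
  and k: "k : module_hom A N' N" "!!x. x : car N ==> k (h x) = x" "!!x. x : car N' ==> h (k x) = x"
  using isomorphicE[OF N'(3) X[OF *(4)]] by metis
  have VM: "V \<subseteq> car M" using submoduleD(1)[OF *(2)] .
  have gV: "g : module_hom A (M'(|carrier := f ` V|)) (M(|carrier := V|))"
  using VM gf homD[OF g] homD(1)[OF f]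
  by (intro homI) (auto simp: subsetD)
  have hq: "(%y. h (q (g y))) : module_hom A (M'(|carrier := f ` V|)) N'"
  by (rule hom_comp[OF hom_comp[OF gV *(5)] h])
  have im: "(%y. h (q (g y))) ` f ` V = car N'"
  proof -
  have "(%y. h (q (g y))) ` f ` V = (%x. h (q x)) ` V"
  using gf VM by (auto simp: image_image subsetD intro!: image_cong)
  also have "... = h ` car N" using *(6) by (metis image_image)
  also have "... = car N'" using homD(1)[OF h] homD(1)[OF k(1)] k(3)
  by (auto intro!: image_eqI)
  finally show ?thesis .
  qed
  have h0: "h x = \<zero>[N'] \<longleftrightarrow> x = \<zero>[N]" if "x : car N" for x
  using that k(2) hom_zero[OF X[OF *(4)] N'(2) h] hom_zero[OF N'(2) X[OF *(4)] k(1)] by metis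
  have ker: "f ` U = {y : f ` V. h (q (g y)) = \<zero>[N']}"
  proof -
  have "h (q (g (f x))) = \<zero>[N'] \<longleftrightarrow> x : U" if "x : V" for x
  using that VM gf h0[of "q x"] *(6) by (subst *(7)) (auto simp: subsetD)
  then show ?thesis using *(3) by blast
  qed
  show "filtered_by A X' (M'(|carrier := f ` V|))"
  by (rule filtered_step[OF lm(2) submodule_image[OF lm f *(1)] submodule_image[OF lm f *(2)]
  image_mono[OF *(3)] *(8) N'(1,2) hq im ker])
 qed auto
 then show ?thesis using imM by simp
qed

section \<open>Finite dimension\<close>

definition scal :: "('k, 'a) module => ('a, 'm) module => 'k => 'm => 'm" where
 "scal A M c x = (c *[A] \<one>\<^bsub>A\<^esub>) *[M] x"

text \<open>The \<open>K\<close>-subspaces of a module.\<close>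
definition kclosed :: "('k, 'a) module => ('a, 'm) module => 'm set => bool" where
 "kclosed A M U \<longleftrightarrow> U \<subseteq> car M & \<zero>[M] : U & (ALL x:U. ALL y:U. x +[M] y : U) &
  (ALL c. ALL x:U. scal A M c x : U)"

definition coordinates ::
  "('k::field, 'a) module => ('a, 'm) module => 'm set => (('m => 'k) => 'm) => bool" where
 "coordinates A M bt om \<longleftrightarrow> finite bt & bij_betw om {f. ALL t. t ~: bt --> f t = 0} (car M) &
  (ALL f g. (ALL t. t ~: bt --> f t = 0) --> (ALL t. t ~: bt --> g t = 0) --> om (%t. f t + g t) = om f +[M] om g) &
  (ALL c f. (ALL t. t ~: bt --> f t = 0) --> om (%t. c * f t) = scal A M c (om f))"

lemma fd_lm: "fd_module A M ==> left_module A M"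
 by (simp add: fd_module_def)

context
 fixes A :: "('k::field, 'a) module"
 assumes fdA: "fd_algebra A"
begin

interpretation KA: vectorspace class_ring A using fdA unfolding fd_algebra_def by blast
interpretation A: ring A using fdA unfolding fd_algebra_def by blast

lemma algebra_scalar_closed [simp]: "x : car A ==> c *[A] x : car A"
 using KA.smult_closed[of c x] by simp

lemma algebra_mult_scalar:
 "x : car A ==> y : car A ==> (c *[A] x) \<otimes>\<^bsub>A\<^esub> y = c *[A] (x \<otimes>\<^bsub>A\<^esub> y)"
 "x : car A ==> y : car A ==> x \<otimes>\<^bsub>A\<^esub> (c *[A] y) = c *[A] (x \<otimes>\<^bsub>A\<^esub> y)"
 using fdA unfolding fd_algebra_def by blast+

context
 fixes M :: "('a, 'm) module"
 assumes lm: "left_module A M"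
begin

interpretation lmodule A M by (rule lmodule.intro) (fact lm)

lemma scal_closed [simp, intro]: "x : car M ==> scal A M c x : car M"
 by (simp add: scal_def)

lemma scalar_smult: "a : car A ==> x : car M ==> (c *[A] a) *[M] x = scal A M c (a *[M] x)"
 unfolding scal_def by (simp add: algebra_mult_scalar flip: smult_assoc)

lemma smult_scal: "a : car A ==> x : car M ==> a *[M] scal A M c x = scal A M c (a *[M] x)"
 unfolding scal_def by (simp add: algebra_mult_scalar flip: smult_assoc)

lemma scal_add: "x : car M ==> y : car M ==> scal A M c (x +[M] y) = scal A M c x +[M] scal A M c y"
 by (simp add: scal_def smult_r_distr)

lemma scal_one [simp]: "x : car M ==> scal A M 1 x = x"
 using KA.smult_one[of "\<one>\<^bsub>A\<^esub>"] by (simp add: scal_def)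

lemma scal_plus: "x : car M ==> scal A M (c + d) x = scal A M c x +[M] scal A M d x"
 using KA.smult_l_distr[of c d "\<one>\<^bsub>A\<^esub>"] by (simp add: scal_def smult_l_distr)

lemma scal_scal: "x : car M ==> scal A M c (scal A M d x) = scal A M (c * d) x"
 using KA.smult_assoc1[of c d "\<one>\<^bsub>A\<^esub>"]
 by (simp add: scal_def algebra_mult_scalar(1) flip: smult_assoc)

lemma scal_zero_left [simp]: "x : car M ==> scal A M 0 x = \<zero>[M]"
 using KA.smult_l_null[of "\<one>\<^bsub>A\<^esub>"] by (simp add: scal_def)

lemma scal_zero_right [simp]: "scal A M c \<zero>[M] = \<zero>[M]"
 by (simp add: scal_def)

lemma scal_minus_one: "x : car M ==> scal A M (- 1) x = -[M] x"
 using scal_plus[of x "- 1" 1] by (simp add: M.minus_equality)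

lemma scal_eq_zero: "x : car M ==> scal A M c x = \<zero>[M] \<longleftrightarrow> c = 0 \<or> x = \<zero>[M]"
 by (metis scal_scal[of x "inverse c" c] left_inverse scal_one scal_zero_left scal_zero_right)

lemma vectorspace_underlying: "vectorspace class_ring (underlying_space A M)"
proof -
 have "Module.module class_ring (underlying_space A M)"
 proof (intro moduleI)
  show "cring (class_ring :: 'k ring)" by (meson class_field field.axioms(1) domain.axioms(1))
  show "abelian_group (underlying_space A M)"
  by (rule abelian_groupI)
  (auto simp: underlying_space_def M.a_assoc M.a_comm M.a_lcomm intro: M.l_neg bexI[of _ "-[M] x" for x])
 qed (auto simp: underlying_space_def scal_plus scal_add scal_scal simp flip: scal_def)
 then show ?thesis by (intro vectorspace.intro class_field)
qed

lemma submodule_kclosed: "submod U A M ==> kclosed A M U"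
 unfolding kclosed_def scal_def using submoduleD[of U A M] by (auto simp: subsetD)

lemma kclosed_iff: "kclosed A M U \<longleftrightarrow> LinearCombinations.submodule class_ring U (underlying_space A M)"
proof -
 interpret V: vectorspace class_ring "underlying_space A M" by (rule vectorspace_underlying)
 show ?thesis
  unfolding LinearCombinations.submodule_def kclosed_def
  by (auto simp: underlying_space_def scal_def V.module_axioms[unfolded underlying_space_def])
qed

lemma fd_module_iff:
 "fd_module A M \<longleftrightarrow> (EX B. finite B & B \<subseteq> car M & (ALL U. kclosed A M U & B \<subseteq> U --> U = car M))"
proof -
 interpret V: vectorspace class_ring "underlying_space A M" by (rule vectorspace_underlying)
 have c: "car (underlying_space A M) = car M" by (simp add: underlying_space_def)
 have "V.span B = car M \<longleftrightarrow> (ALL U. kclosed A M U & B \<subseteq> U --> U = car M)" if "B \<subseteq> car M" for B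
 proof
  assume span: "V.span B = car M"
  show "ALL U. kclosed A M U & B \<subseteq> U --> U = car M"
  proof (intro allI impI, elim conjE)
  fix U assume U: "kclosed A M U" "B \<subseteq> U"
  have "V.span B \<subseteq> U" using V.span_is_subset[OF U(2)] U(1) kclosed_iff by blast
  then show "U = car M" using span U(1) by (auto simp: kclosed_def)
  qed
 next
  assume *: "ALL U. kclosed A M U & B \<subseteq> U --> U = car M"
  have "kclosed A M (V.span B)" using V.span_is_submodule[of B] that c kclosed_iff by simp
  moreover have "B \<subseteq> V.span B" using V.in_own_span[of B] that c by simp
  ultimately show "V.span B = car M" using * by blast
 qed
 then show ?thesis unfolding fd_module_def V.fin_dim_def c using lm by blast
qed

lemma scal_hom:
 assumes "left_module A N" "f : module_hom A M N" "x : car M"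
 shows "f (scal A M c x) = scal A N c (f x)"
 using assms homD(3)[OF assms(2)] by (simp add: scal_def)

lemma ex1_implies_unique: "EX! x. P x ==> P x ==> P y ==> x = y"
 by blast

lemma fd_module_coordinates:
 assumes "fd_module A M"
 shows "EX bt om. coordinates A M bt om"
proof -
 interpret V: vectorspace class_ring "underlying_space A M" by (rule vectorspace_underlying)
 have c: "car (underlying_space A M) = car M" by (simp add: underlying_space_def)
 have "V.fin_dim" using assms by (simp add: fd_module_def)
 then obtain bt where bt: "finite bt" "V.basis bt" using V.finite_basis_exists by blast
 have btM: "bt \<subseteq> car M" using bt(2) c unfolding V.basis_def by simp
 have ex1: "EX! a. a : bt \<rightarrow>\<^sub>E UNIV & V.lincomb a bt = x" if "x : car M" for x
 proof -
  have "ALL v. v : car (underlying_space A M) -->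
  (EX! a. a : bt \<rightarrow>\<^sub>E car class_ring & V.lincomb a bt = v)"
  using V.basis_criterion[OF bt(1)] bt(2) btM[folded c] by blast
  then show ?thesis using that c by simp
 qed
 let ?F = "{f :: 'm => 'k. ALL t. t ~: bt --> f t = 0}"
 let ?om = "%f. V.lincomb f bt"
 have cong: "V.lincomb f bt = V.lincomb g bt" if "!!t. t : bt ==> f t = g t" for f g
  using that btM c by (intro V.lincomb_cong) auto
 have closed: "?om f : car M" for f using V.lincomb_closed[of bt f] btM c by simp
 have inj: "f = g" if "f : ?F" "g : ?F" "?om f = ?om g" for f g
 proof -
  have "V.lincomb (restrict f bt) bt = V.lincomb (restrict g bt) bt"
  using that(3) cong[of "restrict f bt" f] cong[of "restrict g bt" g] by simp
  then have "restrict f bt = restrict g bt"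
  by (intro ex1_implies_unique[OF ex1[OF closed[of "restrict f bt"]]]) auto
  then have eq: "f t = g t" if "t : bt" for t using that by (metis restrict_apply')
  show ?thesis
  proof
  fix t show "f t = g t" by (cases "t : bt") (use eq that(1,2) in auto)
  qed
 qed
 have surj: "x : ?om ` ?F" if x: "x : car M" for x
 proof -
  obtain a where a: "V.lincomb a bt = x" using ex1[OF x] by (elim ex1E conjE)
  have "?om (%t. if t : bt then a t else 0) = V.lincomb a bt" by (rule cong) simp
  then show ?thesis using a by (intro image_eqI[of _ _ "%t. if t : bt then a t else 0"]) simp_all
 qed
 have bij: "bij_betw ?om ?F (car M)"
  unfolding bij_betw_def using inj surj closed by (auto intro!: inj_onI)
 have add: "?om (%t. f t + g t) = ?om f +[M] ?om g" for f g
  using V.lincomb_sum[of bt f g] bt(1) btM c by (simp add: underlying_space_def)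
 have scl: "?om (%t. d * f t) = scal A M d (?om f)" for d f
  using V.lincomb_smult[of bt f d] btM c by (simp add: underlying_space_def scal_def)
 show ?thesis unfolding coordinates_def
  by (intro exI[of _ bt] exI[of _ ?om] conjI bt(1) bij) (simp_all add: add scl)
qed

end

end

lemma fd_moduleI:
 assumes "fd_algebra A" "left_module A M" "finite B" "B \<subseteq> car M"
  "!!U. kclosed A M U ==> B \<subseteq> U ==> car M \<subseteq> U"
 shows "fd_module A M"
 unfolding fd_module_iff[OF assms(1,2)]
 by (intro exI[of _ B]) (use assms in "auto simp: kclosed_def")

lemma fd_module_generators:
 assumes "fd_algebra A" "fd_module A M"
 obtains B where "finite B" "B \<subseteq> car M" "!!U x. kclosed A M U ==> B \<subseteq> U ==> x : car M ==> x : U"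
proof -
 obtain B where B: "finite B" "B \<subseteq> car M" "ALL U. kclosed A M U & B \<subseteq> U --> U = car M"
  using fd_module_iff[OF assms(1) fd_lm[OF assms(2)], THEN iffD1, OF assms(2)]
  by (elim exE conjE) (rule that)
 show thesis proof (rule that[OF B(1,2)])
  fix U x assume "kclosed A M U" "B \<subseteq> U" "x : car M"
  then show "x : U" using B(3)[rule_format, of U] by simp
 qed
qed

lemma fd_module_surj:
 assumes A: "fd_algebra A" and M: "fd_module A M" and N: "left_module A N"
  and f: "f : module_hom A M N" "f ` car M = car N"
 shows "fd_module A N"
proof -
 have lm: "left_module A M" using M by (simp add: fd_module_def)
 obtain B where B: "finite B" "B \<subseteq> car M" "!!U x. kclosed A M U ==> B \<subseteq> U ==> x : car M ==> x : U"
  using fd_module_generators[OF A M] by metis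
 show ?thesis
 proof (rule fd_moduleI[OF A N, of "f ` B"])
  fix U assume U: "kclosed A N U" "f ` B \<subseteq> U"
  have "kclosed A M {x : car M. f x : U}"
  proof -
  interpret lmodule A M by (rule lmodule.intro) (fact lm)
  show ?thesis unfolding kclosed_def
  using U(1) hom_zero[OF lm N f(1)] homD(2)[OF f(1)]
  scal_hom[OF A lm N f(1)] scal_closed[OF A lm] by (auto simp: kclosed_def)
  qed
  moreover have "B \<subseteq> {x : car M. f x : U}" using B(2) U(2) by auto
  ultimately have "x : {x : car M. f x : U}" if "x : car M" for x using B(3) that by metis
  then have "f ` car M \<subseteq> U" by auto
  then show "car N \<subseteq> U" using f(2) by simp
 qed (use B(1,2) homD(1)[OF f(1)] in auto)
qed

lemma fd_module_iso:
 assumes "fd_algebra A" "fd_module A M" "left_module A N" "isomorphic A M N"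
 shows "fd_module A N"
proof -
 obtain f where "f : module_hom A M N" "f ` car M = car N"
  using assms(4) unfolding isomorphic_def bij_betw_def by blast
 then show ?thesis using fd_module_surj[OF assms(1-3)] by simp
qed

lemma fd_module_direct_sum:
 assumes A: "fd_algebra A" and M: "fd_module A M" and N: "fd_module A N"
 shows "fd_module A (direct_sum M N)"
proof -
 have lm: "left_module A M" "left_module A N" using M N by (simp_all add: fd_module_def)
 interpret M: lmodule A M by (rule lmodule.intro) (fact lm)
 interpret N: lmodule A N by (rule lmodule.intro) (fact lm)
 obtain B where B: "finite B" "B \<subseteq> car M" "!!U x. kclosed A M U ==> B \<subseteq> U ==> x : car M ==> x : U"
  using fd_module_generators[OF A M] by metis
 obtain C where C: "finite C" "C \<subseteq> car N" "!!U x. kclosed A N U ==> C \<subseteq> U ==> x : car N ==> x : U"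
  using fd_module_generators[OF A N] by metis
 have sc: "scal A (direct_sum M N) c (x, y) = (scal A M c x, scal A N c y)" for c x y
  by (simp add: scal_def direct_sum_def)
 show ?thesis
 proof (rule fd_moduleI[OF A lm_sum[OF lm], of "(%x. (x, \<zero>[N])) ` B \<union> (%y. (\<zero>[M], y)) ` C"])
  fix U assume U: "kclosed A (direct_sum M N) U" "(%x. (x, \<zero>[N])) ` B \<union> (%y. (\<zero>[M], y)) ` C \<subseteq> U"
  have add: "(x +[M] x', y +[N] y') : U" if "(x, y) : U" "(x', y') : U" for x y x' y'
  using U(1) that unfolding kclosed_def direct_sum_def by fastforce
  have smu: "(scal A M c x, scal A N c y) : U" if "(x, y) : U" for c x y
  using U(1) that sc unfolding kclosed_def by metis
  have z: "(\<zero>[M], \<zero>[N]) : U" using U(1) unfolding kclosed_def direct_sum_def by simp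
  have cl: "kclosed A M {x : car M. (x, \<zero>[N]) : U}" unfolding kclosed_def
  using z add[of _ "\<zero>[N]" _ "\<zero>[N]"] smu[of _ "\<zero>[N]"] scal_zero_right[OF A lm(2)] scal_closed[OF A lm(1)] by auto
  have gen: "B \<subseteq> {x : car M. (x, \<zero>[N]) : U}" using B(2) U(2) by auto
  have 1: "(x, \<zero>[N]) : U" if "x : car M" for x using B(3)[OF cl gen that] by simp
  have cl: "kclosed A N {y : car N. (\<zero>[M], y) : U}" unfolding kclosed_def
  using z add[of "\<zero>[M]" _ "\<zero>[M]"] smu[of "\<zero>[M]"] scal_zero_right[OF A lm(1)] scal_closed[OF A lm(2)] by auto
  have gen: "C \<subseteq> {y : car N. (\<zero>[M], y) : U}" using C(2) U(2) by auto
  have 2: "(\<zero>[M], y) : U" if "y : car N" for y using C(3)[OF cl gen that] by simp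
  show "car (direct_sum M N) \<subseteq> U"
  proof
  fix z assume "z : car (direct_sum M N)"
  then obtain x y where "z = (x, y)" "x : car M" "y : car N" by (auto simp: direct_sum_def)
  then show "z : U" using add[OF 1 2] by auto
  qed
 qed (use B(1,2) C(1,2) in "auto simp: direct_sum_def")
qed

text \<open>A module of functions supported on a finite set, with pointwise addition and scalars.  Each finite-dimensional
module has such a copy, on which the linear algebra of \<open>vector_space\<close> is available.\<close>
definition std_module :: "'x set => ('k::field, 'a) module => ('a, 'x => 'k) module => bool" where
 "std_module bt A M \<longleftrightarrow> finite bt & left_module A M & car M = {f. ALL t. t ~: bt --> f t = 0} &
  add M = (+) & zero M = 0 & (ALL c. ALL x:car M. scal A M c x = (%t. c * x t))"

lemma fd_module_std:
 fixes M :: "('a, 'm) module" and A :: "('k::field, 'a) module"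
 assumes A: "fd_algebra A" and M: "fd_module A M"
 obtains bt and N :: "('a, 'm => 'k) module" where "std_module bt A N" "isomorphic A M N"
proof -
 have lm: "left_module A M" using M by (simp add: fd_module_def)
 interpret lmodule A M by (rule lmodule.intro) (fact lm)
 obtain bt and om :: "('m => 'k) => 'm" where co: "coordinates A M bt om"
  using fd_module_coordinates[OF A lm M] by blast
 have bt: "finite bt" and bij: "bij_betw om {f. ALL t. t ~: bt --> f t = 0} (car M)"
  using co by (simp_all add: coordinates_def)
 have add: "om (%t. f t + g t) = om f +[M] om g"
  if "ALL t. t ~: bt --> f t = 0" "ALL t. t ~: bt --> g t = 0" for f g
  using co that by (simp add: coordinates_def)
 have scl: "om (%t. c * f t) = scal A M c (om f)" if "ALL t. t ~: bt --> f t = 0" for c f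
  using co that by (simp add: coordinates_def)
 let ?F = "{f :: 'm => 'k. ALL t. t ~: bt --> f t = 0}"
 define ph where "ph = the_inv_into ?F om"
 have inj: "inj_on om ?F" and im: "om ` ?F = car M" using bij by (simp_all add: bij_betw_def)
 have om: "om f : car M" if "f : ?F" for f using im that by blast
 have ph1: "ph x : ?F" if "x : car M" for x
  unfolding ph_def using the_inv_into_into[OF inj _ subset_refl] im that by simp
 have ph2: "om (ph x) = x" if "x : car M" for x
  unfolding ph_def using f_the_inv_into_f[OF inj] im that by simp
 have ph3: "ph (om f) = f" if "f : ?F" for f
  unfolding ph_def using the_inv_into_f_f[OF inj that] .
 note ph = ph1 ph2 ph3
 have ph_add: "ph (x +[M] y) = ph x + ph y" if "x : car M" "y : car M" for x y
 proof -
  have "om (ph x + ph y) = x +[M] y" using add[of "ph x" "ph y"] ph that by (simp add: plus_fun_def)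
  moreover have "ph x + ph y : ?F" using ph(1)[OF that(1)] ph(1)[OF that(2)] by simp
  ultimately show ?thesis using ph3[of "ph x + ph y"] by simp
 qed
 have ph_scal: "ph (scal A M c x) = (%t. c * ph x t)" if "x : car M" for c x
 proof -
  have "om (%t. c * ph x t) = scal A M c x" using scl[of "ph x"] ph that by simp
  moreover have "(%t. c * ph x t) : ?F" using ph(1)[OF that] by simp
  ultimately show ?thesis using ph3[of "%t. c * ph x t"] by simp
 qed
 define N :: "('a, 'm => 'k) module" where "N = (|carrier = ?F, mult = undefined,
  one = undefined, zero = 0, add = (+), smult = (%a x. ph (a *[M] om x))|)"
 have N: "car N = ?F" "zero N = 0" "add N = (+)" "!!a x. a *[N] x = ph (a *[M] om x)"
  unfolding N_def by auto
 have om_add: "om (f + g) = om f +[M] om g" if "f : ?F" "g : ?F" for f g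
  using add[of f g] that by (simp add: plus_fun_def)
 have lmN: "left_module A N"
 proof (intro left_moduleI abelian_groupI)
  fix x assume "x : car N"
  then show "EX y:car N. y +[N] x = \<zero>[N]" by (intro bexI[of _ "- x"]) (auto simp: N)
 next
  fix a x assume "a : car A" "x : car N"
  then show "a *[N] x : car N" using ph(1) om unfolding N by blast
 next
  fix a b x assume "a : car A" "b : car A" "x : car N"
  then show "(a +[A] b) *[N] x = a *[N] x +[N] b *[N] x" "(a \<otimes>\<^bsub>A\<^esub> b) *[N] x = a *[N] (b *[N] x)"
  using om[of x] by (simp_all only: N smult_l_distr ph_add smult_closed smult_assoc ph(2))
 next
  fix a x y assume "a : car A" "x : car N" "y : car N"
  then show "a *[N] (x +[N] y) = a *[N] x +[N] a *[N] y"
  using om[of x] om[of y] by (simp only: N om_add smult_r_distr ph_add smult_closed)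
 next
  fix x assume "x : car N"
  then show "\<one>\<^bsub>A\<^esub> *[N] x = x" using om[of x] ph(3)[of x] by (simp only: N smult_one)
 qed (auto simp: N add_ac A.ring_axioms)
 have "scal A N c x = (%t. c * x t)" if "x : car N" for c x
  using that ph_scal[of "om x" c] om[of x] ph(3)[of x] unfolding N(1) by (simp add: scal_def N(4))
 then have "std_module bt A N" unfolding std_module_def using bt lmN N by simp
 moreover have "ph : module_hom A M N"
  by (intro homI) (use ph ph_add in "simp_all add: N")
 moreover have "bij_betw ph (car M) (car N)"
  unfolding ph_def N using bij by (rule bij_betw_the_inv_into)
 ultimately show thesis using that unfolding isomorphic_def by blast
qed

lemma std_module_fd:
 fixes A :: "('k::field, 'a) module" and M :: "('a, 'x => 'k) module"
 assumes A: "fd_algebra A" and M: "std_module bt A M" shows "fd_module A M"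
proof -
 have lm: "left_module A M" and fin: "finite bt" and c: "car M = {f. ALL t. t ~: bt --> f t = 0}"
  and ops: "add M = (+)" "zero M = 0" and sc: "!!c x. x : car M ==> scal A M c x = (%t. c * x t)"
  using M by (auto simp: std_module_def)
 define e :: "'x => 'x => 'k" where "e s = (%t. if t = s then 1 else 0)" for s
 show ?thesis
 proof (rule fd_moduleI[OF A lm, of "e ` bt"])
  fix U assume U: "kclosed A M U" "e ` bt \<subseteq> U"
  have "(%t. if t : S then f t else 0) : U" if "f : car M" "S \<subseteq> bt" "finite S" for f S
  using that(3,2)
  proof (induction S)
  case empty
  then show ?case using U(1) ops(2) unfolding kclosed_def by (simp add: zero_fun_def)
  next
  case (insert s S)
  have "scal A M (f s) (e s) = (%t. f s * e s t)"
  using insert.prems c by (intro sc) (auto simp: e_def)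
  moreover have "scal A M (f s) (e s) : U" using U insert.prems unfolding kclosed_def by blast
  ultimately have "(%t. if t : S then f t else 0) + (%t. f s * e s t) : U"
  using insert U(1) ops(1) unfolding kclosed_def by auto
  moreover have "(%t. if t : S then f t else 0) + (%t. f s * e s t) = (%t. if t : insert s S then f t else 0)"
  using insert.hyps by (auto simp: e_def fun_eq_iff)
  ultimately show ?case by simp
  qed
  note span = this
  show "car M \<subseteq> U"
  proof
  fix f assume f: "f : car M"
  have "(%t. if t : bt then f t else 0) = f" using f c by (auto simp: fun_eq_iff)
  then show "f : U" using span[OF f subset_refl fin] by simp
  qed
 qed (use fin c in "auto simp: e_def")
qed

lemma fd_module_vec:
 fixes M :: "('a, 'm) module" and A :: "('k::field, 'a) module"
 assumes A: "fd_algebra A" and M: "fd_module A M"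
 obtains N :: "('a, 'k vec) module" where "fd_module A N" "isomorphic A M N"
proof -
 have lm: "left_module A M" using M by (simp add: fd_module_def)
 obtain bt and N :: "('a, 'm => 'k) module" where N: "std_module bt A N" "isomorphic A M N"
  using fd_module_std[OF A M] .
 obtain l where l: "set l = bt" using N(1) finite_list unfolding std_module_def by blast
 have "inj_on (%f. vec (length l) (%i. f (l ! i))) (car N)"
 proof (rule inj_onI)
  fix f g assume fg: "f : car N" "g : car N"
  "vec (length l) (%i. f (l ! i)) = vec (length l) (%i. g (l ! i))"
  show "f = g"
  proof
  fix t show "f t = g t"
  proof (cases "t : bt")
  case True
  then obtain i where i: "i < length l" "l ! i = t" using l by (metis in_set_conv_nth)
  show ?thesis using fg(3) i by (metis index_vec)
  next
  case False then show ?thesis using fg(1,2) N(1) by (simp add: std_module_def)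
  qed
  qed
 qed
 moreover have "left_module A N" using N(1) by (simp add: std_module_def)
 ultimately obtain L :: "('a, 'k vec) module" where L: "left_module A L" "isomorphic A N L"
  using transport_module by metis
 have "isomorphic A M L" using iso_trans[OF N(2) L(2)] .
 then show thesis using that fd_module_iso[OF A M L(1)] by blast
qed

interpretation fvs: vector_space "%c (f :: 'x => 'k::field). (%t. c * f t)"
 by standard (auto simp: fun_eq_iff algebra_simps)

interpretation fvs1: vector_space_pair "%c (f :: 'x => 'k::field). (%t. c * f t)" "(*) :: 'k => 'k => 'k"
 by unfold_locales (auto simp: algebra_simps)

lemma sum_fun_apply: "(\<Sum>i\<in>I. f i) t = (\<Sum>i\<in>I. f i t)"
 by (induction I rule: infinite_finite_induct) auto

lemma finite_support_span:
 assumes "finite bt" "ALL t. t ~: bt --> f t = (0::'k::field)"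
 shows "f : fvs.span ((%s t. if t = s then 1 else 0) ` bt)"
proof -
 have eq: "f = (\<Sum>s\<in>bt. (%t. f s * (if t = s then 1 else 0)))"
 proof
  fix t show "f t = (\<Sum>s\<in>bt. (%t. f s * (if t = s then 1 else 0))) t"
  using assms by (cases "t : bt") (auto simp: sum_fun_apply if_distrib[of "(*) _"] cong: if_cong)
 qed
 show ?thesis
  by (subst eq, intro fvs.span_sum fvs.span_scale fvs.span_base) auto
qed


text \<open>A basis of \<open>W\<close> is extended to one of \<open>K\<close>; the new vectors are coordinates modulo
\<open>W\<close>.\<close>
lemma complement_basis:
 fixes W K :: "('x => 'k::field) set"
 assumes bt: "finite bt" and W: "fvs.subspace W" and K: "fvs.subspace K" and WK: "W \<subseteq> K"
  and supp: "!!f t. f : K ==> t ~: bt ==> f t = 0"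
 obtains m :: nat and g where "!!b. b < m ==> g b : K"
  "!!x. x : K ==> EX al. x - (\<Sum>b<m. (%t. al b * g b t)) : W"
  "!!al b. (\<Sum>b<m. (%t. al b * g b t)) : W ==> b < m ==> al b = 0"
proof -
 obtain B1 where B1: "B1 \<subseteq> W" "fvs.independent B1" "W \<subseteq> fvs.span B1"
  using fvs.maximal_independent_subset by blast
 have "B1 \<subseteq> K" using B1(1) WK by blast
 obtain B where B: "B1 \<subseteq> B" "B \<subseteq> K" "fvs.independent B" "K \<subseteq> fvs.span B"
  using fvs.maximal_independent_subset_extend[OF \<open>B1 \<subseteq> K\<close> B1(2)] by blast
 have "K \<subseteq> fvs.span ((%s t. if t = s then 1 else 0) ` bt)"
  using finite_support_span[OF bt] supp by blast
 then have finB: "finite B" using fvs.independent_span_bound[OF _ B(3)] bt B(2) by blast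
 then have finB1: "finite B1" using B(1) finite_subset by blast
 define C where "C = B - B1"
 have finC: "finite C" using finB by (simp add: C_def)
 have BC: "B = B1 \<union> C" "B1 \<inter> C = {}" using B(1) by (auto simp: C_def)
 obtain g where g: "bij_betw g {..<card C} C"
  using ex_bij_betw_nat_finite[OF finC] by (auto simp: atLeast0LessThan)
 have reindex: "(\<Sum>b<card C. (%t. u (g b) * g b t)) = (\<Sum>v\<in>C. (%t. u v * v t))" for u
  by (rule sum.reindex_bij_betw[OF g, of "%v. (%t. u v * v t)"])
 have split: "(\<Sum>v\<in>B. (%t. u v * v t)) = (\<Sum>v\<in>B1. (%t. u v * v t)) + (\<Sum>v\<in>C. (%t. u v * v t))" for u
  unfolding BC(1) by (rule sum.union_disjoint[OF finB1 finC BC(2)])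
 show thesis
 proof (rule that[of "card C" g])
  show "g b : K" if "b < card C" for b
  using that g B(2) unfolding C_def bij_betw_def by blast
 next
  fix x assume "x : K"
  then obtain u where u: "x = (\<Sum>v\<in>B. (%t. u v * v t))" using B(4) fvs.span_finite[OF finB] by blast
  have "(\<Sum>v\<in>B1. (%t. u v * v t)) : W"
  using B1(1) by (intro fvs.subspace_sum[OF W] fvs.subspace_scale[OF W]) blast
  then have "x - (\<Sum>b<card C. (%t. u (g b) * g b t)) : W" unfolding reindex u split by simp
  then show "EX al. x - (\<Sum>b<card C. (%t. al b * g b t)) : W" by (intro exI[of _ "%b. u (g b)"])
 next
  fix al b assume al: "(\<Sum>b<card C. (%t. al b * g b t)) : W" and b: "b < card C"
  define u where "u v = al (the_inv_into {..<card C} g v)" for v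
  have ug: "u (g b) = al b" if "b < card C" for b
  using g that by (simp add: u_def bij_betw_def the_inv_into_f_f)
  obtain w where w: "(\<Sum>b<card C. (%t. al b * g b t)) = (\<Sum>v\<in>B1. (%t. w v * v t))"
  using al B1(3) fvs.span_finite[OF finB1] by blast
  define v where "v x = (if x : B1 then - w x else u x)" for x
  have "(\<Sum>x\<in>B1. (%t. v x * x t)) = - (\<Sum>x\<in>B1. (%t. w x * x t))"
  by (auto simp: v_def fun_eq_iff sum_fun_apply sum_negf)
  moreover have "(\<Sum>x\<in>C. (%t. v x * x t)) = (\<Sum>x\<in>C. (%t. u x * x t))"
  using BC(2) by (intro sum.cong) (auto simp: v_def)
  moreover have "(\<Sum>x\<in>C. (%t. u x * x t)) = (\<Sum>b<card C. (%t. al b * g b t))"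
  unfolding reindex[symmetric] by (intro sum.cong) (auto simp: ug)
  ultimately have "(\<Sum>x\<in>B. (%t. v x * x t)) = 0" unfolding split w by simp
  moreover have "g b : B" "g b ~: B1" using g b BC unfolding bij_betw_def by auto
  ultimately have "v (g b) = 0" using fvs.independentD[OF B(3) finB subset_refl] by blast
  then show "al b = 0" using \<open>g b ~: B1\<close> ug[OF b] by (simp add: v_def)
 qed
qed

lemma functional_extension:
 fixes xi :: "'m => 'k::field" and M :: "('a, 'm) module"
 assumes A: "fd_algebra A" and M: "fd_module A M" and U: "kclosed A M U"
  and add: "!!x y. x : U ==> y : U ==> xi (x +[M] y) = xi x + xi y"
  and scl: "!!c x. x : U ==> xi (scal A M c x) = c * xi x"
 obtains ph :: "'m => 'k" where "!!x y. x : car M ==> y : car M ==> ph (x +[M] y) = ph x + ph y"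
  "!!c x. x : car M ==> ph (scal A M c x) = c * ph x" "!!x. x : U ==> ph x = xi x"
proof -
 have lm: "left_module A M" using M by (simp add: fd_module_def)
 obtain bt and N :: "('a, 'm => 'k) module" where N: "std_module bt A N" "isomorphic A M N"
  using fd_module_std[OF A M] .
 have lmN: "left_module A N" and cN: "car N = {f. ALL t. t ~: bt --> f t = 0}"
  and ops: "add N = (+)" "zero N = 0" and sc: "!!c x. x : car N ==> scal A N c x = (%t. c * x t)"
  using N(1) by (auto simp: std_module_def)
 obtain f g where f: "f : module_hom A M N" and g: "g : module_hom A N M"
  and gf: "!!x. x : car M ==> g (f x) = x" and fg: "!!y. y : car N ==> f (g y) = y"
  using isomorphicE[OF N(2) lm] by metis
 have UM: "U \<subseteq> car M" and U0: "\<zero>[M] : U" and Ua: "!!x y. x : U ==> y : U ==> x +[M] y : U"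
  and Us: "!!c x. x : U ==> scal A M c x : U" using U by (auto simp: kclosed_def)
 obtain B where B: "B \<subseteq> f ` U" "fvs.independent B" "f ` U \<subseteq> fvs.span B"
  using fvs.maximal_independent_subset by blast
 obtain h where h: "Vector_Spaces.linear (%c f. (%t. c * f t)) (*) h" "ALL x:B. h x = xi (g x)"
  using fvs1.linear_independent_extend[OF B(2), of "%x. xi (g x)"] by blast
 have h_add: "h (x + y) = h x + h y" and h_scl: "h (%t. c * x t) = c * h x" for x y c
  using h(1) unfolding Vector_Spaces.linear_iff by auto
 have xi0: "xi \<zero>[M] = 0" using scl[OF U0, of 0] scal_zero_left[OF A lm] UM U0 by auto
 have h0: "h 0 = 0" using h_scl[of 0 0] by (simp add: zero_fun_def)
 have f0: "f \<zero>[M] = 0" using hom_zero[OF lm lmN f] ops by simp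
 have fadd: "f (x +[M] y) = f x + f y" if "x : car M" "y : car M" for x y
  using homD(2)[OF f that] ops by simp
 have fscl: "f (scal A M c x) = (%t. c * f x t)" if "x : car M" for c x
  using scal_hom[OF A lm lmN f that] sc homD(1)[OF f that] by simp
 define T where "T = {f x |x. x : U & h (f x) = xi x}"
 have "fvs.subspace T"
 proof (rule fvs.subspaceI)
  show "0 : T" unfolding T_def using U0 f0 h0 xi0 by (auto intro!: exI[of _ "\<zero>[M]"])
 next
  fix x y assume "x : T" "y : T"
  then obtain u v where "u : U" "v : U" "x = f u" "y = f v" "h x = xi u" "h y = xi v" unfolding T_def by auto
  then show "x + y : T" unfolding T_def mem_Collect_eq
  using Ua fadd UM by (intro exI[of _ "u +[M] v"]) (auto simp: add h_add subsetD)
 next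
  fix c x assume "x : T"
  then obtain u where "u : U" "x = f u" "h x = xi u" unfolding T_def by auto
  then show "(%t. c * x t) : T" unfolding T_def mem_Collect_eq
  using Us fscl UM by (intro exI[of _ "scal A M c u"]) (auto simp: scl h_scl subsetD)
 qed
 moreover have "B \<subseteq> T" unfolding T_def using B(1) h(2) gf UM by fastforce
 ultimately have "fvs.span B \<subseteq> T" by (simp add: fvs.span_minimal)
 then have fT: "f x : T" if "x : U" for x using that B(3) by blast
 show thesis
 proof (rule that[of "%x. h (f x)"])
  fix x assume x: "x : U"
  obtain u where u: "f x = f u" "u : U" "h (f u) = xi u" using fT[OF x] unfolding T_def by auto
  then have "x = u" using gf UM x by (metis subsetD)
  then show "h (f x) = xi x" using u by simp
 qed (simp_all add: fadd fscl h_add h_scl)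
qed

section \<open>Conditions inherited by direct summands\<close>

lemma ds_simps:
 "car (direct_sum M N) = car M \<times> car N" "\<zero>[direct_sum M N] = (\<zero>[M], \<zero>[N])"
 "(x, y) +[direct_sum M N] (x', y') = (x +[M] x', y +[N] y')"
 "a *[direct_sum M N] (x, y) = (a *[M] x, a *[N] y)"
 by (simp_all add: direct_sum_def)

lemma scal_direct_sum: "scal A (direct_sum M N) c (x, y) = (scal A M c x, scal A N c y)"
 by (simp add: scal_def direct_sum_def)

text \<open>Its truth in a direct sum is its truth in both summands, because witnesses can be chosen componentwise.\<close>
definition pp_imp :: "('k, 'a) module => ('a, 'm) module => 'a => 'a => 'a => 'a => bool" where
 "pp_imp A M a b c d \<longleftrightarrow> (ALL x:car M. ALL z:car M.
  a *[M] x = b *[M] z --> (EX w:car M. c *[M] x = d *[M] w))"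

lemma pp_imp_iso:
 assumes lm: "left_module A M" and iso: "isomorphic A M N"
  and abcd: "a : car A" "b : car A" "c : car A" "d : car A"
  and M: "pp_imp A M a b c d"
 shows "pp_imp A N a b c d"
 unfolding pp_imp_def
proof (intro ballI impI)
 obtain f g where f: "f : module_hom A M N" and g: "g : module_hom A N M"
  and gf: "!!x. x : car M ==> g (f x) = x" and fg: "!!y. y : car N ==> f (g y) = y"
  using isomorphicE[OF iso lm] by metis
 fix x z assume x: "x : car N" and z: "z : car N" and eq: "a *[N] x = b *[N] z"
 have "a *[M] g x = b *[M] g z"
  using arg_cong[OF eq, of g] homD(3)[OF g] x z abcd by simp
 then obtain w where w: "w : car M" "c *[M] g x = d *[M] w"
  using M homD(1)[OF g] x z unfolding pp_imp_def by blast
 have "c *[N] x = d *[N] f w"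
  using arg_cong[OF w(2), of f] homD(3)[OF f] homD(1)[OF g] fg x w(1) abcd by simp
 then show "EX w:car N. c *[N] x = d *[N] w" using w(1) homD(1)[OF f] by blast
qed

lemma pp_imp_direct_sum:
 assumes lm: "left_module A M" "left_module A N"
  and abcd: "a : car A" "b : car A" "c : car A" "d : car A"
 shows "pp_imp A (direct_sum M N) a b c d \<longleftrightarrow> pp_imp A M a b c d & pp_imp A N a b c d"
proof -
 interpret M: lmodule A M by (rule lmodule.intro) (fact lm)
 interpret N: lmodule A N by (rule lmodule.intro) (fact lm)
 show ?thesis
 proof (intro iffI conjI)
  assume *: "pp_imp A (direct_sum M N) a b c d"
  show "pp_imp A M a b c d" unfolding pp_imp_def
  proof (intro ballI impI)
  fix x z assume "x : car M" "z : car M" "a *[M] x = b *[M] z"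
  then show "EX w:car M. c *[M] x = d *[M] w"
  using *[unfolded pp_imp_def, rule_format, of "(x, \<zero>[N])" "(z, \<zero>[N])"] abcd
  by (auto simp: ds_simps)
  qed
  show "pp_imp A N a b c d" unfolding pp_imp_def
  proof (intro ballI impI)
  fix x z assume "x : car N" "z : car N" "a *[N] x = b *[N] z"
  then show "EX w:car N. c *[N] x = d *[N] w"
  using *[unfolded pp_imp_def, rule_format, of "(\<zero>[M], x)" "(\<zero>[M], z)"] abcd
  by (auto simp: ds_simps)
  qed
 next
  assume *: "pp_imp A M a b c d & pp_imp A N a b c d"
  show "pp_imp A (direct_sum M N) a b c d" unfolding pp_imp_def
  proof (intro ballI impI)
  fix x z assume xz: "x : car (direct_sum M N)" "z : car (direct_sum M N)"
  "a *[direct_sum M N] x = b *[direct_sum M N] z"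
  obtain x1 x2 z1 z2 where [simp]: "x = (x1, x2)" "z = (z1, z2)" by (cases x, cases z)
  have "x1 : car M" "z1 : car M" "a *[M] x1 = b *[M] z1"
  "x2 : car N" "z2 : car N" "a *[N] x2 = b *[N] z2"
  using xz by (simp_all add: ds_simps)
  then obtain u v where "u : car M" "c *[M] x1 = d *[M] u"
  "v : car N" "c *[N] x2 = d *[N] v"
  using *[unfolded pp_imp_def] by meson
  then show "EX w:car (direct_sum M N). c *[direct_sum M N] x = d *[direct_sum M N] w"
  by (intro bexI[of _ "(u, v)"]) (auto simp: ds_simps)
  qed
 qed
qed

text \<open>The image under \<open>c\<close> of the kernel of \<open>a\<close> has dimension at most one modulo the image
of \<open>d\<close>.\<close>
definition pp_rank1 :: "('k::field, 'a) module => ('a, 'm) module => 'a => 'a => 'a => bool" where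
 "pp_rank1 A M a c d \<longleftrightarrow> (ALL x:car M. ALL y:car M. a *[M] x = \<zero>[M] --> a *[M] y = \<zero>[M] -->
  (EX s t. (s, t) ~= (0, 0) & (EX w:car M. c *[M] (scal A M s x +[M] scal A M t y) = d *[M] w)))"

lemma pp_rank1D:
 assumes "pp_rank1 A M a c d" "x : car M" "y : car M" "a *[M] x = \<zero>[M]" "a *[M] y = \<zero>[M]"
 obtains s t w where "(s, t) ~= (0, 0)" "w : car M" "c *[M] (scal A M s x +[M] scal A M t y) = d *[M] w"
 using assms unfolding pp_rank1_def by blast

lemma pp_rank1_iso:
 assumes A: "fd_algebra A" and lm: "left_module A M" "left_module A N" and iso: "isomorphic A M N"
  and acd: "a : car A" "c : car A" "d : car A" and M: "pp_rank1 A M a c d"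
 shows "pp_rank1 A N a c d"
 unfolding pp_rank1_def
proof (intro ballI impI)
 obtain f g where f: "f : module_hom A M N" and g: "g : module_hom A N M"
  and gf: "!!x. x : car M ==> g (f x) = x" and fg: "!!y. y : car N ==> f (g y) = y"
  using isomorphicE[OF iso lm(1)] by metis
 interpret M: lmodule A M by (rule lmodule.intro) (fact lm)
 fix x y assume x: "x : car N" and y: "y : car N"
  and eq: "a *[N] x = \<zero>[N]" "a *[N] y = \<zero>[N]"
 have gxy: "g x : car M" "g y : car M" using homD(1)[OF g] x y by auto
 have "a *[M] g x = \<zero>[M]" "a *[M] g y = \<zero>[M]"
  using arg_cong[OF eq(1), of g] arg_cong[OF eq(2), of g] homD(3)[OF g] x y acd
  hom_zero[OF lm(2,1) g] by simp_all
 then obtain s t w where w: "(s, t) ~= (0, 0)" "w : car M"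
  "c *[M] (scal A M s (g x) +[M] scal A M t (g y)) = d *[M] w"
  using M gxy unfolding pp_rank1_def by blast
 have "c *[N] (scal A N s x +[N] scal A N t y) = d *[N] f w"
  using arg_cong[OF w(3), of f] gxy acd w(2) fg x y scal_closed[OF A lm(1)]
  by (simp add: homD[OF f] scal_hom[OF A lm f])
 then show "EX s t. (s, t) ~= (0, 0) & (EX w:car N. c *[N] (scal A N s x +[N] scal A N t y) = d *[N] w)"
  using w(1,2) homD(1)[OF f] by blast
qed

lemma pp_rank1_direct_sum:
 assumes A: "fd_algebra A" and lm: "left_module A M" "left_module A N"
  and acd: "a : car A" "c : car A" "d : car A" and r: "pp_rank1 A (direct_sum M N) a c d"
 shows "pp_rank1 A M a c d" and "pp_imp A M a \<zero>[A] c d \<or> pp_imp A N a \<zero>[A] c d"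
proof -
 interpret M: lmodule A M by (rule lmodule.intro) (fact lm)
 interpret N: lmodule A N by (rule lmodule.intro) (fact lm)
 have sc: "scal A (direct_sum M N) c (x, y) = (scal A M c x, scal A N c y)" for c x y
  by (rule scal_direct_sum)
 show "pp_rank1 A M a c d" unfolding pp_rank1_def
 proof (intro ballI impI)
  fix x y assume xy: "x : car M" "y : car M" "a *[M] x = \<zero>[M]" "a *[M] y = \<zero>[M]"
  have "(x, \<zero>[N]) : car (direct_sum M N)" "(y, \<zero>[N]) : car (direct_sum M N)"
  "a *[direct_sum M N] (x, \<zero>[N]) = \<zero>[direct_sum M N]" "a *[direct_sum M N] (y, \<zero>[N]) = \<zero>[direct_sum M N]"
  using xy acd by (simp_all add: ds_simps)
  from pp_rank1D[OF r this] obtain s t w where "(s, t) ~= (0, 0)" "w : car (direct_sum M N)"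
  "c *[direct_sum M N] (scal A (direct_sum M N) s (x, \<zero>[N]) +[direct_sum M N] scal A (direct_sum M N) t (y, \<zero>[N]))
  = d *[direct_sum M N] w"
  by blast
  then show "EX s t. (s, t) ~= (0, 0) & (EX w:car M. c *[M] (scal A M s x +[M] scal A M t y) = d *[M] w)"
  unfolding sc by (intro exI[of _ s] exI[of _ t] conjI bexI[of _ "fst w"]; cases w) (auto simp: ds_simps)
 qed
 show "pp_imp A M a \<zero>[A] c d \<or> pp_imp A N a \<zero>[A] c d"
 proof (rule disjCI)
  assume "\<not> pp_imp A N a \<zero>[A] c d"
  then obtain y where y: "y : car N" "a *[N] y = \<zero>[N]" "!!w. w : car N ==> c *[N] y ~= d *[N] w"
  unfolding pp_imp_def by auto
  show "pp_imp A M a \<zero>[A] c d" unfolding pp_imp_def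
  proof (intro ballI impI)
  fix x z assume x: "x : car M" "z : car M" "a *[M] x = \<zero>[A] *[M] z"
  have "(x, \<zero>[N]) : car (direct_sum M N)" "(\<zero>[M], y) : car (direct_sum M N)"
  "a *[direct_sum M N] (x, \<zero>[N]) = \<zero>[direct_sum M N]" "a *[direct_sum M N] (\<zero>[M], y) = \<zero>[direct_sum M N]"
  using x y acd by (simp_all add: ds_simps)
  from pp_rank1D[OF r this] obtain s t w where w: "(s, t) ~= (0, 0)" "w : car (direct_sum M N)"
  "c *[direct_sum M N] (scal A (direct_sum M N) s (x, \<zero>[N]) +[direct_sum M N] scal A (direct_sum M N) t (\<zero>[M], y))
  = d *[direct_sum M N] w"
  by blast
  obtain u v where uv: "w = (u, v)" "u : car M" "v : car N" using w(2) by (auto simp: ds_simps)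
  have 1: "scal A M s (c *[M] x) = d *[M] u" and 2: "scal A N t (c *[N] y) = d *[N] v"
  using w(3) uv x(1) y(1) acd scal_closed[OF A lm(1)] scal_closed[OF A lm(2)]
  unfolding sc scal_zero_right[OF A lm(1)] scal_zero_right[OF A lm(2)]
  by (auto simp: ds_simps smult_scal[OF A lm(1)] smult_scal[OF A lm(2)])
  have "t = 0"
  proof (rule ccontr)
  assume "t ~= 0"
  then have "c *[N] y = scal A N (inverse t) (scal A N t (c *[N] y))"
  using y(1) acd by (simp add: scal_scal[OF A lm(2)] scal_one[OF A lm(2)])
  then have "c *[N] y = d *[N] scal A N (inverse t) v"
  unfolding 2 using uv(3) acd by (simp add: smult_scal[OF A lm(2)])
  then show False using y(3)[of "scal A N (inverse t) v"] uv(3) scal_closed[OF A lm(2)] by blast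
  qed
  then have "s ~= 0" using w(1) by simp
  then have "c *[M] x = scal A M (inverse s) (scal A M s (c *[M] x))"
  using x(1) acd by (simp add: scal_scal[OF A lm(1)] scal_one[OF A lm(1)])
  then have "c *[M] x = d *[M] scal A M (inverse s) u"
  unfolding 1 using uv(2) acd by (simp add: smult_scal[OF A lm(1)])
  then show "EX w:car M. c *[M] x = d *[M] w" using uv(2) scal_closed[OF A lm(1)] by blast
  qed
 qed
qed

lemma left_module_power: 
 assumes "left_module A M" shows "left_module A (power_module M m)"
proof -
 interpret lmodule A M by (rule lmodule.intro) fact
 show ?thesis
 proof (intro left_moduleI abelian_groupI)
  fix x assume "x : car (power_module M m)"
  then show "EX y:car (power_module M m). y +[power_module M m] x = \<zero>[power_module M m]"
  by (intro bexI[of _ "\<lambda>i\<in>{..<m}. -[M] x i"])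
  (auto simp: power_module_def M.l_neg PiE_iff intro!: restrict_ext)
 qed (auto simp: power_module_def PiE_iff smult_l_distr smult_r_distr smult_assoc M.a_assoc M.a_comm M.a_lcomm
  A.ring_axioms extensional_def intro!: restrict_ext ext)
qed

lemma power_module_Suc:
 assumes "left_module A M"
 shows "isomorphic A (direct_sum (power_module M m) M) (power_module M (Suc m))"
proof -
 interpret lmodule A M by (rule lmodule.intro) fact
 let ?f = "%(x, y). (\<lambda>i\<in>{..<Suc m}. if i < m then x i else y)"
 have hom: "?f : module_hom A (direct_sum (power_module M m) M) (power_module M (Suc m))"
 proof (rule homI)
  fix x assume "x : car (direct_sum (power_module M m) M)"
  then show "?f x : car (power_module M (Suc m))"
  by (cases x) (auto simp: ds_simps power_module_def PiE_iff)
 next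
  fix x y assume "x : car (direct_sum (power_module M m) M)" "y : car (direct_sum (power_module M m) M)"
  then show "?f (x +[direct_sum (power_module M m) M] y) = ?f x +[power_module M (Suc m)] ?f y"
  by (cases x; cases y; intro ext) (auto simp: ds_simps power_module_def restrict_def)
 next
  fix a x assume "a : car A" "x : car (direct_sum (power_module M m) M)"
  then show "?f (a *[direct_sum (power_module M m) M] x) = a *[power_module M (Suc m)] ?f x"
  by (cases x; intro ext) (auto simp: ds_simps power_module_def restrict_def)
 qed
 show ?thesis
 proof (rule isomorphicI[OF hom])
  fix y assume y: "y : car (power_module M (Suc m))"
  then show "(restrict y {..<m}, y m) : car (direct_sum (power_module M m) M)"
  by (auto simp: ds_simps power_module_def PiE_iff)
  have "?f (restrict y {..<m}, y m) i = y i" for i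
  using y by (cases "i < m"; cases "i = m") (auto simp: power_module_def PiE_iff extensional_def)
  then show "?f (restrict y {..<m}, y m) = y" by (rule ext)
 next
  fix x assume "x : car (direct_sum (power_module M m) M)"
  then obtain u v where x: "x = (u, v)" "u : {..<m} \<rightarrow>\<^sub>E car M" "v : car M"
  by (auto simp: ds_simps power_module_def)
  have "restrict (?f x) {..<m} = restrict u {..<m}" unfolding x by (intro restrict_ext) simp
  also have "... = u" using x(2) by (simp add: PiE_restrict)
  finally show "(restrict (?f x) {..<m}, ?f x m) = x" unfolding x by simp
 qed
qed

lemma pp_imp_power:
 assumes "left_module A M" "a : car A" "b : car A" "c : car A" "d : car A"
  and "pp_imp A M a b c d"
 shows "pp_imp A (power_module M m) a b c d"
proof (induction m)
 case 0
 then show ?case by (auto simp: pp_imp_def power_module_def)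
next
 case (Suc m)
 have "pp_imp A (direct_sum (power_module M m) M) a b c d"
  using pp_imp_direct_sum[OF left_module_power[OF assms(1)] assms(1-5)] Suc assms(6) by simp
 then show ?case
  using pp_imp_iso[OF lm_sum[OF left_module_power[OF assms(1)] assms(1)]
  power_module_Suc[OF assms(1)] assms(2-5)] by simp
qed

section \<open>Extensions\<close>

text \<open>All split sequences are equivalent, and one exists, since the direct sum has a copy on vectors.\<close>
lemma Ext1_eq_zeroI:
 fixes M :: "('a, 'm) module" and N :: "('a, 'n) module" and A :: "('k::field, 'a) module"
 assumes A: "fd_algebra A" and M: "fd_module A M" and N: "fd_module A N"
  and split: "!!E f g. (E, f, g) : extensions A M N ==> EX s:module_hom A M E. ALL x:car M. g (s x) = x"
 shows "Ext1 A M N = {Ext1_zero A M N}"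
proof -
 have lm: "left_module A M" "left_module A N" using M N by (simp_all add: fd_module_def)
 interpret M: lmodule A M by (rule lmodule.intro) (fact lm)
 interpret N: lmodule A N by (rule lmodule.intro) (fact lm)
 have zero: "Ext1_zero A M N = extensions A M N" unfolding Ext1_zero_def using split by auto
 have equiv: "extension_equiv A M N = extensions A M N \<times> extensions A M N"
 proof -
  have "EX h:module_hom A E E'. (ALL x:car N. h (f x) = f' x) & (ALL y:car E. g' (h y) = g y)"
  if e: "(E, f, g) : extensions A M N" and e': "(E', f', g') : extensions A M N" for E f g E' f' g'
  proof -
  have E: "fd_module A E" "f : module_hom A N E" "g : module_hom A E M" "inj_on f (car N)"
  "f ` car N = {x : car E. g x = \<zero>[M]}"
  using e by (auto simp: extensions_def a_kernel_def')
  have E': "fd_module A E'" "f' : module_hom A N E'" "g' : module_hom A E' M"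
  "f' ` car N = {x : car E'. g' x = \<zero>[M]}"
  using e' by (auto simp: extensions_def a_kernel_def')
  have lmE: "left_module A E" "left_module A E'" using E(1) E'(1) by (simp_all add: fd_module_def)
  interpret E: lmodule A E by (rule lmodule.intro) (fact lmE)
  interpret E': lmodule A E' by (rule lmodule.intro) (fact lmE)
  obtain s where s: "s : module_hom A M E" "!!x. x : car M ==> g (s x) = x" using split[OF e] by blast
  obtain s' where s': "s' : module_hom A M E'" "!!x. x : car M ==> g' (s' x) = x" using split[OF e'] by blast
  define rh where "rh y = the_inv_into (car N) f (y -[E] s (g y))" for y
  have sg: "s (g y) : car E" if "y : car E" for y
  using that homD(1)[OF s(1)] homD(1)[OF E(3)] by blast
  have ker: "y -[E] s (g y) : f ` car N" if "y : car E" for y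
  proof -
  have gy: "g y : car M" using homD(1)[OF E(3) that] .
  have "g (-[E] s (g y)) = -[M] g y"
  using module_hom_minus[OF lmE(1) lm(1) E(3) sg[OF that]] s(2)[OF gy] by simp
  then have "g (y -[E] s (g y)) = \<zero>[M]"
  using that sg[OF that] gy by (simp add: a_minus_def homD(2)[OF E(3)] M.M.r_neg)
  then show ?thesis unfolding E(5) using that sg[OF that] by (simp add: a_minus_def)
  qed
  have rh: "rh y : car N" "f (rh y) = y -[E] s (g y)" if "y : car E" for y
  unfolding rh_def using the_inv_into_into[OF E(4) ker[OF that] subset_refl]
  f_the_inv_into_f[OF E(4) ker[OF that]] by simp_all
  have rhI: "rh y = x" if "x : car N" "y : car E" "f x = y -[E] s (g y)" for x y
  using that rh[OF that(2)] E(4) by (metis inj_onD)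
  have rhhom: "rh : module_hom A E N"
  proof (rule homI)
  fix x y assume xy: "x : car E" "y : car E"
  have gxy: "g x : car M" "g y : car M" using xy homD(1)[OF E(3)] by auto
  show "rh (x +[E] y) = rh x +[N] rh y"
  proof (rule rhI)
  show "f (rh x +[N] rh y) = x +[E] y -[E] s (g (x +[E] y))"
  using xy gxy sg rh by (simp add: homD(2)[OF E(2)] homD(2)[OF E(3)] homD(2)[OF s(1)]
  a_minus_def E.M.minus_add E.M.a_ac)
  qed (use xy rh in auto)
  next
  fix a x assume ax: "a : car A" "x : car E"
  show "rh (a *[E] x) = a *[N] rh x"
  proof (rule rhI)
  show "f (a *[N] rh x) = a *[E] x -[E] s (g (a *[E] x))"
  using ax sg[OF ax(2)] rh[OF ax(2)] homD(1)[OF E(3) ax(2)]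
  by (simp add: homD(3)[OF E(2)] homD(3)[OF E(3)] homD(3)[OF s(1)]
  a_minus_def E.smult_r_distr E.smult_minus_right)
  qed (use ax rh in auto)
  qed (use rh in auto)
  define h where "h y = f' (rh y) +[E'] s' (g y)" for y
  have f'rh: "(%y. f' (rh y)) : module_hom A E E'" by (rule hom_comp[OF rhhom E'(2)])
  have s'g: "(%y. s' (g y)) : module_hom A E E'" by (rule hom_comp[OF E(3) s'(1)])
  have hhom: "h : module_hom A E E'"
  unfolding h_def
  by (rule homI)
  (use homD[OF f'rh] homD[OF s'g] in "auto simp: E'.smult_r_distr E'.M.a_ac")
  have hf: "h (f x) = f' x" if x: "x : car N" for x
  proof -
  have fx: "f x : car E" "g (f x) = \<zero>[M]" using x E(5) by auto
  have "rh (f x) = x"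
  by (rule rhI[OF x fx(1)]) (use fx hom_zero[OF lm(1) lmE(1) s(1)] in "simp add: a_minus_def")
  then show ?thesis
  unfolding h_def using fx hom_zero[OF lm(1) lmE(2) s'(1)] homD(1)[OF E'(2) x] by simp
  qed
  have gh: "g' (h y) = g y" if y: "y : car E" for y
  proof -
  have "f' (rh y) : car E'" "g' (f' (rh y)) = \<zero>[M]" using rh(1)[OF y] E'(4) by auto
  then show ?thesis unfolding h_def
  using homD(1)[OF s'g y] s'(2)[OF homD(1)[OF E(3) y]] homD(1)[OF E(3) y]
  by (simp add: homD(2)[OF E'(3)])
  qed
  show ?thesis using hhom hf gh by blast
  qed
  then show ?thesis unfolding extension_equiv_def by auto
 qed
 have "extensions A M N ~= {}"
 proof -
  obtain E :: "('a, 'k vec) module" where E: "fd_module A E" "isomorphic A (direct_sum N M) E"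
  using fd_module_vec[OF A fd_module_direct_sum[OF A N M]] by blast
  obtain e e' where e: "e : module_hom A (direct_sum N M) E" "e' : module_hom A E (direct_sum N M)"
  "!!x. x : car (direct_sum N M) ==> e' (e x) = x" "!!y. y : car E ==> e (e' y) = y"
  using isomorphicE[OF E(2) lm_sum[OF lm(2,1)]] by metis
  have 1: "(%x. (x, \<zero>[M])) : module_hom A N (direct_sum N M)" "snd : module_hom A (direct_sum N M) M"
  by (auto intro!: homI simp: direct_sum_def)
  have c: "car (direct_sum N M) = car N \<times> car M" by (simp add: direct_sum_def)
  have f: "(%x. e (x, \<zero>[M])) : module_hom A N E" and g: "(%y. snd (e' y)) : module_hom A E M"
  using hom_comp[OF 1(1) e(1)] hom_comp[OF e(2) 1(2)] by auto
  have inj: "inj_on (%x. e (x, \<zero>[M])) (car N)"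
  using e(3) c by (intro inj_on_inverseI[of _ "%y. fst (e' y)"]) auto
  have im: "(%x. e (x, \<zero>[M])) ` car N = {y : car E. snd (e' y) = \<zero>[M]}"
  proof (intro equalityI subsetI)
  fix y assume y: "y : {y : car E. snd (e' y) = \<zero>[M]}"
  then have "y = e (fst (e' y), \<zero>[M])" using e(4) by (metis (mono_tags, lifting) mem_Collect_eq prod.collapse)
  moreover have "e' y : car (direct_sum N M)" using y homD(1)[OF e(2)] by auto
  then have "fst (e' y) : car N" using c by (auto simp: mem_Times_iff)
  ultimately show "y : (%x. e (x, \<zero>[M])) ` car N" by blast
  qed (use e(3) c homD(1)[OF f] in auto)
  have surj: "(%y. snd (e' y)) ` car E = car M"
  proof (intro equalityI subsetI)
  fix x assume "x : car M"
  then have "(\<zero>[N], x) : car (direct_sum N M)" using c by simp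
  then show "x : (%y. snd (e' y)) ` car E"
  using e(3) homD(1)[OF e(1)] by (intro image_eqI[of _ _ "e (\<zero>[N], x)"]) auto
  qed (use homD(1)[OF g] in auto)
  have "(E, %x. e (x, \<zero>[M]), %y. snd (e' y)) : extensions A M N"
  using E(1) f g inj im surj by (simp add: extensions_def a_kernel_def')
  then show ?thesis by blast
 qed
 then show ?thesis unfolding Ext1_def equiv zero quotient_def by auto
qed

section \<open>The algebra of a suspended poset\<close>

lemma index_mult_sum:
 assumes "M : carrier_mat N N" "M' : carrier_mat N N" "a < N" "b < N"
 shows "(M * M') $$ (a, b) = (\<Sum>l<N. M $$ (a, l) * M' $$ (l, b))"
 using assms by (simp add: scalar_prod_def atLeast0LessThan)

lemma left_module_bij:
 assumes lm: "left_module A M" and f: "f : module_hom A M N" "bij_betw f (car M) (car N)"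
  and zero: "f \<zero>[M] = \<zero>[N]"
 shows "left_module A N"
proof -
 interpret lmodule A M by (rule lmodule.intro) fact
 have im: "car N = f ` car M" using f(2) by (simp add: bij_betw_def)
 have add: "f x +[N] f y = f (x +[M] y)" if "x : car M" "y : car M" for x y
  using homD(2)[OF f(1) that] by simp
 have smu: "a *[N] f x = f (a *[M] x)" if "a : car A" "x : car M" for a x
  using homD(3)[OF f(1) that] by simp
 show ?thesis
 proof (intro left_moduleI abelian_groupI)
  fix x assume "x : car N"
  then obtain u where u: "u : car M" "x = f u" by (auto simp: im)
  show "EX y:car N. y +[N] x = \<zero>[N]"
  by (rule bexI[of _ "f (-[M] u)"]) (use u in "auto simp: im add M.l_neg zero")
 qed (auto simp: im add smu smult_l_distr smult_r_distr smult_assoc M.a_assoc M.a_comm M.a_lcomm A.ring_axioms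
  simp flip: zero)
qed

locale suspension =
 fixes n :: nat and r :: "nat rel" and K :: "'k::field itself"
 assumes po: "partial_order_on {1..n} r" and le: "!!i j. (i, j) : r ==> i \<le> j"
begin

abbreviation KP :: "('k, 'k mat) module" where "KP \<equiv> upper_suspension_algebra n r"

definition q :: "nat rel" where "q = upper_ext n r"

definition V :: "nat set" where "V = {1..n + 1}"

lemma r_dom: "(i, j) : r ==> i : {1..n} & j : {1..n}"
 using partial_order_onD(4)[OF po] by auto

lemma r_refl: "i : {1..n} ==> (i, i) : r"
 using partial_order_onD(1)[OF po] by (simp add: refl_on_def)

lemma r_trans: "(i, j) : r ==> (j, k) : r ==> (i, k) : r"
 using partial_order_onD(2)[OF po] by (meson transD)

lemma r_antisym: "(i, j) : r ==> (j, i) : r ==> i = j"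
 using le by (meson antisym)

lemma q_iff: "(i, j) : q \<longleftrightarrow> (i, j) : r \<or> i : V & j = n + 1"
 by (auto simp: q_def upper_ext_def V_def)

lemma q_dom: "(i, j) : q ==> i : V & j : V"
 using r_dom by (force simp: q_iff V_def)

lemma q_le: "(i, j) : q ==> i \<le> j"
 using le by (auto simp: q_iff V_def)

lemma q_refl: "i : V ==> (i, i) : q"
 using r_refl by (auto simp: q_iff V_def le_Suc_eq)

lemma q_star: "i : V ==> (i, Suc n) : q"
 by (auto simp: q_iff)

lemma q_star_left: "(Suc n, j) : q ==> j = Suc n"
 using q_le q_dom by (fastforce simp: V_def)

lemma q_trans: "(i, j) : q ==> (j, k) : q ==> (i, k) : q"
 using r_trans[of i j k] r_dom[of i j] r_dom[of j k] by (auto simp: q_iff V_def)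

lemma q_antisym: "(i, j) : q ==> (j, i) : q ==> i = j"
 using q_le by (meson antisym)

lemma q_r: "j \<le> n ==> (i, j) : q \<longleftrightarrow> (i, j) : r"
 by (auto simp: q_iff)

lemma V_star [simp]: "Suc n : V" by (simp add: V_def)

lemma finite_V [simp]: "finite V" by (simp add: V_def)

lemma V_cases: "k : V \<longleftrightarrow> k : {1..n} \<or> k = Suc n" by (auto simp: V_def)

definition ent :: "'k mat => nat => nat => 'k" where
 "ent M j i = M $$ (j - 1, i - 1)"

lemma ent_simps [simp]:
 assumes "a : V" "b : V"
 shows "ent (mat (Suc n) (Suc n) f) a b = f (a - 1, b - 1)"
  "M : carrier_mat (Suc n) (Suc n) ==> M' : carrier_mat (Suc n) (Suc n) ==> ent (M + M') a b = ent M a b + ent M' a b"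
  "M : carrier_mat (Suc n) (Suc n) ==> ent (c \<cdot>\<^sub>m M) a b = c * ent M a b"
  "ent (0\<^sub>m (Suc n) (Suc n)) a b = 0" "ent (1\<^sub>m (Suc n)) a b = (if a = b then 1 else 0)"
 using assms by (auto simp: ent_def V_def)

lemma V_pred: "a : V ==> b : V ==> a - Suc 0 = b - Suc 0 \<longleftrightarrow> a = b" "a : V ==> Suc (a - Suc 0) = a"
 by (auto simp: V_def)

lemma KP_simps [simp]:
 "mult KP = (*)" "add KP = (+)" "one KP = 1\<^sub>m (Suc n)" "zero KP = 0\<^sub>m (Suc n) (Suc n)" "smult KP = (\<cdot>\<^sub>m)"
 by (simp_all add: upper_suspension_algebra_def incidence_algebra_def module_mat_def)

lemma carrier_KP: "car KP = {M : carrier_mat (Suc n) (Suc n).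
  ALL i:V. ALL j:V. ent M j i ~= 0 --> (i, j) : q}"
 by (simp add: upper_suspension_algebra_def incidence_algebra_def incidence_mats_def q_def V_def ent_def)

lemma KP_mat: "M : car KP ==> M : carrier_mat (Suc n) (Suc n)"
 by (simp add: carrier_KP)

lemma KP_dim: "M : car KP ==> dim_row M = Suc n" "M : car KP ==> dim_col M = Suc n"
 by (auto simp: carrier_KP)

lemma KP_entry: "M : car KP ==> i : V ==> j : V ==> (i, j) ~: q ==> ent M j i = 0"
 by (auto simp: carrier_KP)

lemma KP_I:
 assumes "M : carrier_mat (Suc n) (Suc n)"
  "!!i j. i : V ==> j : V ==> (i, j) ~: q ==> ent M j i = 0"
 shows "M : car KP"
 using assms by (auto simp: carrier_KP)

lemma sum_lessThan_V: "(\<Sum>l<Suc n. f l) = (\<Sum>l\<in>V. f (l - 1))"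
 by (rule sum.reindex_bij_witness[of _ "%l. l - 1" Suc]) (auto simp: V_def)

lemma KP_mult_entry:
 assumes "M : carrier_mat (Suc n) (Suc n)" "M' : carrier_mat (Suc n) (Suc n)" "k : V" "i : V"
 shows "ent (M * M') k i = (\<Sum>j\<in>V. ent M k j * ent M' j i)"
 using index_mult_sum[OF assms(1,2), of "k - 1" "i - 1"] assms(3,4)
  sum_lessThan_V[of "%l. M $$ (k - 1, l) * M' $$ (l, i - 1)"]
 by (auto simp: ent_def V_def)

lemma KP_closed [simp, intro]:
 "M : car KP ==> M' : car KP ==> M + M' : car KP"
 "M : car KP ==> M' : car KP ==> M * M' : car KP"
 "M : car KP ==> c \<cdot>\<^sub>m M : car KP"
 "1\<^sub>m (Suc n) : car KP" "0\<^sub>m (Suc n) (Suc n) : car KP"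
proof -
 assume M: "M : car KP"
 show "c \<cdot>\<^sub>m M : car KP"
  using M by (intro KP_I) (auto simp: KP_mat KP_entry)
next
 assume M: "M : car KP" and M': "M' : car KP"
 show "M + M' : car KP"
  using M M' by (intro KP_I) (auto simp: KP_mat KP_entry)
 show "M * M' : car KP"
 proof (rule KP_I)
  fix i k assume ik: "i : V" "k : V" "(i, k) ~: q"
  have "ent M k j * ent M' j i = 0" if j: "j : V" for j
  using ik j KP_entry[OF M j ik(2)] KP_entry[OF M' ik(1) j] q_trans by auto
  then show "ent (M * M') k i = 0"
  unfolding KP_mult_entry[OF KP_mat[OF M] KP_mat[OF M'] ik(2,1)] by simp
 qed (rule mult_carrier_mat[OF KP_mat[OF M] KP_mat[OF M']])
next
 show "1\<^sub>m (Suc n) : car KP" by (rule KP_I) (auto simp: q_refl)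
 show "0\<^sub>m (Suc n) (Suc n) : car KP" by (rule KP_I) auto
qed

lemma ring_KP: "ring KP"
proof (rule ringI)
 show "abelian_group KP"
 proof (rule abelian_groupI)
  fix x assume x: "x : car KP"
  have "(- 1) \<cdot>\<^sub>m x + x = 0\<^sub>m (Suc n) (Suc n)" using x by (intro eq_matI) (auto simp: KP_dim)
  then show "EX y:car KP. y +[KP] x = \<zero>[KP]" using x by (intro bexI[of _ "(- 1) \<cdot>\<^sub>m x"]) auto
 qed (auto simp: KP_mat intro: comm_add_mat[of _ "Suc n" "Suc n"] assoc_add_mat[of _ "Suc n" "Suc n"])
 show "monoid KP"
  by (rule monoidI) (auto simp: KP_mat assoc_mult_mat[of _ "Suc n" "Suc n" _ "Suc n" _ "Suc n"]
  left_mult_one_mat[of _ "Suc n" "Suc n"] right_mult_one_mat[of _ "Suc n" "Suc n"])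
qed (auto simp: KP_mat add_mult_distrib_mat[of _ "Suc n" "Suc n" _ _ "Suc n"]
  mult_add_distrib_mat[of _ "Suc n" "Suc n" _ "Suc n"])

definition E :: "nat => nat => 'k mat" where
 "E j i = mat (Suc n) (Suc n) (%(a, b). if a = j - 1 & b = i - 1 then 1 else 0)"

abbreviation Es where "Es == E (Suc n)"

text \<open>The sum of the units \<open>E k j\<close> with \<open>j\<close> in \<open>S\<close>: it maps a module onto the
sum of the images at \<open>k\<close> of its components at \<open>S\<close>.\<close>
definition R :: "nat => nat set => 'k mat" where
 "R k S = mat (Suc n) (Suc n) (%(a, b). if a = k - 1 & Suc b : S then 1 else 0)"

lemma E_entry [simp]:
 assumes "i : V" "j : V" "a : V" "b : V"
 shows "ent (E j i) a b = (if a = j & b = i then 1 else 0)"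
 using assms by (simp add: E_def V_pred)

lemma R_entry [simp]:
 assumes "k : V" "a : V" "b : V"
 shows "ent (R k S) a b = (if a = k & b : S then 1 else 0)"
 using assms by (simp add: R_def V_pred)

lemma E_mat [simp]: "E j i : carrier_mat (Suc n) (Suc n)" by (simp add: E_def)
lemma R_mat [simp]: "R k S : carrier_mat (Suc n) (Suc n)" by (simp add: R_def)

lemma E_closed [simp, intro]: "(i, j) : q ==> E j i : car KP"
 by (rule KP_I) (use q_dom in auto)

lemma R_closed: "k : V ==> (!!j. j : S ==> (j, k) : q) ==> R k S : car KP"
 by (rule KP_I) auto

lemma KP_eqI:
 assumes "M : carrier_mat (Suc n) (Suc n)" "M' : carrier_mat (Suc n) (Suc n)"
  "!!a b. a : V ==> b : V ==> ent M a b = ent M' a b"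
 shows "M = M'"
proof (rule eq_matI)
 fix i j assume "i < dim_row M'" "j < dim_col M'"
 then show "M $$ (i, j) = M' $$ (i, j)"
  using assms(3)[of "Suc i" "Suc j"] assms(1,2) by (auto simp: V_def ent_def)
qed (use assms in auto)

lemma E_mult:
 assumes "(i, j) : q" "(l, k) : q"
 shows "E k l * E j i = (if l = j then E k i else 0\<^sub>m (Suc n) (Suc n))"
proof (rule KP_eqI)
 fix a b assume ab: "a : V" "b : V"
 have V: "i : V" "j : V" "l : V" "k : V" using assms q_dom by auto
 have "ent (E k l * E j i) a b = (\<Sum>c\<in>V. if c = l then (if a = k & l = j & b = i then 1 else 0) else 0)"
  unfolding KP_mult_entry[OF E_mat E_mat ab]
  by (intro sum.cong) (use ab V in auto)
 also have "... = (if a = k & l = j & b = i then 1 else 0)" using V by simp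
 finally show "ent (E k l * E j i) a b = ent (if l = j then E k i else 0\<^sub>m (Suc n) (Suc n)) a b"
  using ab V by auto
qed (auto intro!: mult_carrier_mat[of _ "Suc n" "Suc n"])

lemma R_insert:
 assumes "k : V" "j : V" "j ~: S" shows "R k (insert j S) = R k S + E k j"
 by (rule KP_eqI) (use assms in auto)

lemma R_empty: "k : V ==> R k {} = 0\<^sub>m (Suc n) (Suc n)"
 by (rule KP_eqI) auto

lemma KP_induct [consumes 1, case_names zero add unit]:
 assumes M: "M : car KP" and zero: "P (0\<^sub>m (Suc n) (Suc n))"
  and add: "!!a b. a : car KP ==> b : car KP ==> P a ==> P b ==> P (a + b)"
  and unit: "!!c i j. (i, j) : q ==> P (c \<cdot>\<^sub>m E j i)"
 shows "P M"
proof -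
 define D where "D S = mat (Suc n) (Suc n) (%(a, b). if (Suc b, Suc a) : S then M $$ (a, b) else 0)" for S
 have D: "ent (D S) a b = (if (b, a) : S then ent M a b else 0)"
  if "a : V" "b : V" for S a b using that by (simp add: D_def V_pred) (simp add: ent_def)
 have Dmat: "D S : carrier_mat (Suc n) (Suc n)" for S by (simp add: D_def)
 have DKP: "D S : car KP" for S
  by (rule KP_I) (auto simp: Dmat D KP_entry[OF M])
 have "P (D S)" if "finite S" "S \<subseteq> q" for S using that
 proof (induction S)
  case empty
  have "D {} = 0\<^sub>m (Suc n) (Suc n)" by (intro eq_matI) (auto simp: D_def)
  then show ?case using zero by simp
 next
  case (insert x S)
  obtain i j where x: "x = (i, j)" by (cases x)
  have ij: "(i, j) : q" "i : V" "j : V" using insert.prems q_dom x by auto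
  have "D (insert x S) = D S + ent M j i \<cdot>\<^sub>m E j i"
  using insert.hyps ij x by (intro KP_eqI) (auto simp: D Dmat)
  then show ?case using insert.IH insert.prems add[OF DKP KP_closed(3)[OF E_closed[OF ij(1)]]] unit[OF ij(1)] by simp
 qed
 moreover have "finite q" by (rule finite_subset[of _ "V \<times> V"]) (use q_dom in auto)
 ultimately have "P (D q)" by blast
 moreover have "D q = M"
  by (rule KP_eqI) (use M in "auto simp: D Dmat KP_entry[OF M] KP_mat")
 ultimately show ?thesis by simp
qed

lemma fdKP: "fd_algebra KP"
proof -
 interpret ring KP by (rule ring_KP)
 have mod: "Module.module class_ring KP"
 proof (rule moduleI)
  show "cring (class_ring :: 'k ring)" by (meson class_field field.axioms(1) domain.axioms(1))
  show "abelian_group KP" by (rule abelian_group_axioms)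
  fix c d :: 'k and x y assume "x : car KP" "y : car KP"
  then have "x : carrier_mat (Suc n) (Suc n)" "y : carrier_mat (Suc n) (Suc n)" by (simp_all add: KP_mat)
  then show "c *[KP] (x +[KP] y) = c *[KP] x +[KP] c *[KP] y"
  by (intro KP_eqI) (simp_all add: distrib_left)
 next
  fix c d :: 'k and x assume x: "x : car KP"
  then have x': "x : carrier_mat (Suc n) (Suc n)" by (simp add: KP_mat)
  then show "(c +[class_ring] d) *[KP] x = c *[KP] x +[KP] d *[KP] x"
  by (intro KP_eqI) (simp_all add: distrib_right)
  show "(c \<otimes>\<^bsub>class_ring\<^esub> d) *[KP] x = c *[KP] (d *[KP] x)"
  proof -
  have "(c * d) \<cdot>\<^sub>m x = c \<cdot>\<^sub>m (d \<cdot>\<^sub>m x)" using x' by (intro eq_matI) auto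
  then show ?thesis by simp
  qed
  show "\<one>\<^bsub>class_ring\<^esub> *[KP] x = x" 
  proof -
  have "1 \<cdot>\<^sub>m x = x" using x' by (intro eq_matI) auto
  then show ?thesis by simp
  qed
  show "c *[KP] x : car KP" using x by simp
 qed
 then interpret VS: vectorspace class_ring KP by (intro vectorspace.intro class_field)
 have "VS.span ((%(i, j). E j i) ` q) = car KP"
 proof
  have sub: "(%(i, j). E j i) ` q \<subseteq> car KP" by auto
  show "VS.span ((%(i, j). E j i) ` q) \<subseteq> car KP" using VS.span_is_subset2[OF sub] .
  have S: "LinearCombinations.submodule class_ring (VS.span ((%(i, j). E j i) ` q)) KP"
  using VS.span_is_submodule[OF sub] .
  show "car KP \<subseteq> VS.span ((%(i, j). E j i) ` q)"
  proof
  fix M assume "M : car KP"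
  then show "M : VS.span ((%(i, j). E j i) ` q)"
  proof (induction M rule: KP_induct)
  case zero then show ?case using LinearCombinations.submodule.zero_closed[OF S] by simp
  next
  case (add a b) then show ?case using LinearCombinations.submodule.m_closed[OF S, of a b] by simp
  next
  case (unit c i j)
  have "E j i : VS.span ((%(i, j). E j i) ` q)" using VS.in_own_span[OF sub] unit by auto
  then show ?case using LinearCombinations.submodule.smult_closed[OF S, of c "E j i"] by simp
  qed
  qed
 qed
 moreover have "finite ((%(i, j). E j i) ` q)"
  by (rule finite_imageI) (rule finite_subset[of _ "V \<times> V"], use q_dom in auto)
 ultimately have "VS.fin_dim" unfolding VS.fin_dim_def
  by (intro exI[of _ "(%(i, j). E j i) ` q"]) auto
 moreover have "(c \<cdot>\<^sub>m x) * y = c \<cdot>\<^sub>m (x * y) & x * (c \<cdot>\<^sub>m y) = c \<cdot>\<^sub>m (x * y)"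
  if "x : car KP" "y : car KP" for c x y
  using mult_smult_distrib[OF KP_mat[OF that(1)] KP_mat[OF that(2)]]
  mult_smult_assoc_mat[OF KP_mat[OF that(1)] KP_mat[OF that(2)]] by simp
 ultimately show ?thesis unfolding fd_algebra_def
  using ring_KP VS.vectorspace_axioms by simp
qed

section \<open>Modules as representations of the poset\<close>

lemma scalKP: "M : car KP ==> left_module KP X ==> x : car X ==> (c \<cdot>\<^sub>m M) *[X] x = scal KP X c (M *[X] x)"
 using scalar_smult[OF fdKP] by simp

lemma E_smult:
 assumes "left_module KP M" "x : car M" "(i, j) : q" "(l, k) : q"
 shows "E k l *[M] (E j i *[M] x) = (if l = j then E k i *[M] x else \<zero>[M])"
proof -
 interpret lmodule KP M by (rule lmodule.intro) fact
 have "E k l *[M] (E j i *[M] x) = (E k l * E j i) *[M] x"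
  using smult_assoc[of "E k l" "E j i" x] assms by simp
 then show ?thesis using E_mult[OF assms(3,4)] smult_zero_left[OF assms(2)] by simp
qed

lemma hom_criterion:
 assumes lm: "left_module KP M" "left_module KP N"
  and closed: "!!x. x : car M ==> f x : car N"
  and add: "!!x y. x : car M ==> y : car M ==> f (x +[M] y) = f x +[N] f y"
  and scl: "!!c x. x : car M ==> f (scal KP M c x) = scal KP N c (f x)"
  and E: "!!i j x. (i, j) : q ==> x : car M ==> f (E j i *[M] x) = E j i *[N] f x"
 shows "f : module_hom KP M N"
proof (rule homI)
 interpret M: lmodule KP M by (rule lmodule.intro) fact
 interpret N: lmodule KP N by (rule lmodule.intro) fact
 have f0: "f \<zero>[M] = \<zero>[N]"
  using scl[of "\<zero>[M]" 0] scal_zero_left[OF fdKP lm(1)] scal_zero_left[OF fdKP lm(2)] closed by simp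
 fix a x assume "a : car KP" and x: "x : car M"
 then show "f (a *[M] x) = a *[N] f x"
 proof (induction a rule: KP_induct)
  case zero then show ?case using M.smult_zero_left[OF x] N.smult_zero_left[OF closed[OF x]] f0 by simp
 next
  case (add a b)
  then show ?case using M.smult_l_distr[of a b x] N.smult_l_distr[of a b "f x"] assms(4) closed[OF x] x by simp
 next
  case (unit c i j)
  then show ?case using x closed[OF x] by (simp add: scalKP lm scl E)
 qed
qed (use assms in auto)

lemma submodule_criterion:
 assumes lm: "left_module KP M" and U: "kclosed KP M U"
  and E: "!!i j x. (i, j) : q ==> x : U ==> E j i *[M] x : U"
 shows "submod U KP M"
proof (rule submoduleI[OF lm])
 interpret M: lmodule KP M by (rule lmodule.intro) fact
 have UM: "U \<subseteq> car M" using U by (simp add: kclosed_def)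
 fix a x assume "a : car KP" and x: "x : U"
 then have xM: "x : car M" using UM by auto
 from \<open>a : car KP\<close> x show "a *[M] x : U"
 proof (induction a rule: KP_induct)
  case zero then show ?case using M.smult_zero_left[OF xM] U by (simp add: kclosed_def)
 next
  case (add a b)
  then show ?case using M.smult_l_distr[of a b x] U xM by (simp add: kclosed_def)
 next
  case (unit c i j)
  then show ?case using U E xM by (simp add: scalKP lm kclosed_def)
 qed
qed (use U in "auto simp: kclosed_def")

text \<open>The identity is the sum of the \<open>E k k\<close>, so a vector is the sum of its components \<open>E k k
x\<close>.\<close>
lemma kclosed_components:
 assumes lm: "left_module KP M" and U: "kclosed KP M U" and x: "x : car M"
  and E: "!!k. k : V ==> E k k *[M] x : U"
 shows "x : U"
proof -
 interpret M: lmodule KP M by (rule lmodule.intro) fact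
 define D :: "nat set => 'k mat" where "D S = mat (Suc n) (Suc n) (%(a, b). if a = b & Suc a : S then 1 else 0)" for S
 have D: "ent (D S) a b = (if a = b & a : S then 1 else 0)" if "a : V" "b : V" for S a b
  using that by (auto simp: D_def V_pred)
 have Dmat: "D S : carrier_mat (Suc n) (Suc n)" for S by (simp add: D_def)
 have DKP: "D S : car KP" for S
  by (rule KP_I) (auto simp: D Dmat q_refl)
 have "D S *[M] x : U" if "finite S" "S \<subseteq> V" for S using that
 proof (induction S)
  case empty
  have "D {} = 0\<^sub>m (Suc n) (Suc n)" by (intro eq_matI) (auto simp: D_def)
  then show ?case using M.smult_zero_left[OF x] U by (simp add: kclosed_def)
 next
  case (insert k S)
  have "D (insert k S) = D S + E k k"
  using insert.hyps insert.prems by (intro KP_eqI) (auto simp: D Dmat)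
  then have "D (insert k S) *[M] x = D S *[M] x +[M] E k k *[M] x"
  using M.smult_l_distr[OF DKP, of "E k k" x] x insert.prems q_refl by simp
  then show ?case using insert U E by (simp add: kclosed_def)
 qed
 from this[OF finite_V subset_refl] have "D V *[M] x : U" .
 moreover have "D V = 1\<^sub>m (Suc n)" by (rule KP_eqI) (auto simp: D Dmat)
 ultimately show ?thesis using M.smult_one[OF x] by simp
qed

lemma kclosed_zero: "left_module KP M ==> kclosed KP M {\<zero>[M]}"
 using submodule_kclosed[OF fdKP _ submodule_zero] by blast

lemma zero_components:
 assumes "left_module KP M" "x : car M" "!!k. k : V ==> E k k *[M] x = \<zero>[M]"
 shows "x = \<zero>[M]"
 using kclosed_components[OF assms(1) kclosed_zero[OF assms(1)] assms(2)] assms(3) by simp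


section \<open>Modules with a combinatorial basis\<close>

definition cdata :: "'x set => ('x => nat) => (nat => 'x => 'x option) => bool" where
 "cdata J vt mv \<longleftrightarrow> finite J & (ALL t:J. vt t : V & mv (vt t) t = Some t) &
  (ALL t:J. ALL l u. (vt t, l) : q --> mv l t = Some u -->
  u : J & vt u = l & (ALL l'. (l, l') : q --> mv l' u = mv l' t)) &
  (ALL t:J. ALL l l'. (vt t, l) : q --> mv l t = None --> (l, l') : q --> mv l' t = None)"

text \<open>The basis vector \<open>t\<close> sits at the vertex \<open>vt t\<close>; the structure map to
\<open>l\<close> sends it to the basis vector \<open>mv l t\<close>, or to \<open>0\<close> for
\<open>None\<close>.\<close>
definition cmod :: "'x set => ('x => nat) => (nat => 'x => 'x option) => ('k mat, 'x => 'k) module" where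
 "cmod J vt mv = (|carrier = {f. ALL t. t ~: J --> f t = 0}, mult = undefined, one = undefined,
  zero = 0, add = (+),
  smult = (%M f u. if u : J then \<Sum>t\<in>J. if mv (vt u) t = Some u then ent M (vt u) (vt t) * f t else 0
  else 0)|)"

lemma cmod_simps [simp]:
 "car (cmod J vt mv) = {f. ALL t. t ~: J --> f t = 0}" "zero (cmod J vt mv) = 0" "add (cmod J vt mv) = (+)"
 by (simp_all add: cmod_def)

lemma cmod_smult:
 "(M *[cmod J vt mv] f) u =
  (if u : J then \<Sum>t\<in>J. if mv (vt u) t = Some u then ent M (vt u) (vt t) * f t else 0 else 0)"
 by (simp add: cmod_def)

context
 fixes J :: "'x set" and vt mv
 assumes cd: "cdata J vt mv"
begin

lemma cdata_facts:
 "finite J" "t : J ==> vt t : V" "t : J ==> mv (vt t) t = Some t"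
 "t : J ==> (vt t, l) : q ==> mv l t = Some u ==> u : J & vt u = l"
 "t : J ==> (vt t, l) : q ==> mv l t = Some u ==> (l, l') : q ==> mv l' u = mv l' t"
 "t : J ==> (vt t, l) : q ==> mv l t = None ==> (l, l') : q ==> mv l' t = None"
 using cd unfolding cdata_def by blast+

lemma cmod_scalar:
 assumes "f : car (cmod J vt mv)"
 shows "(c \<cdot>\<^sub>m 1\<^sub>m (Suc n)) *[cmod J vt mv] f = (%t. c * f t)"
proof
 fix u
 show "((c \<cdot>\<^sub>m 1\<^sub>m (Suc n)) *[cmod J vt mv] f) u = c * f u"
 proof (cases "u : J")
  case True
  have "(if mv (vt u) t = Some u then ent (c \<cdot>\<^sub>m 1\<^sub>m (Suc n)) (vt u) (vt t) * f t else 0)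
  = (if t = u then c * f u else 0)" if "t : J" for t
  proof (cases "vt t = vt u")
  case True' : True
  then show ?thesis using cdata_facts(2,3)[OF that] cdata_facts(2,3)[OF True] by auto
  next
  case False then show ?thesis using cdata_facts(2)[OF that] cdata_facts(2)[OF True] by auto
  qed
  then show ?thesis unfolding cmod_smult using True cdata_facts(1) by (simp cong: sum.cong)
 next
  case False then show ?thesis using assms by (simp add: cmod_smult)
 qed
qed

lemma left_module_cmod: "left_module KP (cmod J vt mv)"
proof (intro left_moduleI abelian_groupI ring_KP)
 fix x assume "x : car (cmod J vt mv)"
 then show "EX y:car (cmod J vt mv). y +[cmod J vt mv] x = \<zero>[cmod J vt mv]"
  by (intro bexI[of _ "- x"]) auto
next
 fix M x assume "M : car KP" "x : car (cmod J vt mv)"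
 then show "M *[cmod J vt mv] x : car (cmod J vt mv)" by (auto simp: cmod_smult)
next
 fix M N x assume M: "M : car KP" "N : car KP" and x: "x : car (cmod J vt mv)"
 show "(M +[KP] N) *[cmod J vt mv] x = M *[cmod J vt mv] x +[cmod J vt mv] N *[cmod J vt mv] x"
 proof
  fix u show "((M +[KP] N) *[cmod J vt mv] x) u = (M *[cmod J vt mv] x +[cmod J vt mv] N *[cmod J vt mv] x) u"
  proof (cases "u : J")
  case True
  have "(\<Sum>t\<in>J. if mv (vt u) t = Some u then ent (M + N) (vt u) (vt t) * x t else 0) =
  (\<Sum>t\<in>J. (if mv (vt u) t = Some u then ent M (vt u) (vt t) * x t else 0) +
  (if mv (vt u) t = Some u then ent N (vt u) (vt t) * x t else 0))"
  by (rule sum.cong) (use M True in "simp_all add: cdata_facts(2) KP_mat distrib_right")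
  then show ?thesis using True by (simp add: cmod_smult sum.distrib)
  qed (simp add: cmod_smult)
 qed
 show "(M \<otimes>\<^bsub>KP\<^esub> N) *[cmod J vt mv] x = M *[cmod J vt mv] (N *[cmod J vt mv] x)"
 proof
  fix w
  show "((M \<otimes>\<^bsub>KP\<^esub> N) *[cmod J vt mv] x) w = (M *[cmod J vt mv] (N *[cmod J vt mv] x)) w"
  proof (cases "w : J")
  case w: True
  define a where "a u t = (if mv (vt w) u = Some w then ent M (vt w) (vt u) *
  (if mv (vt u) t = Some u then ent N (vt u) (vt t) * x t else 0) else 0)" for u t
  have step: "(\<Sum>u\<in>J. a u t) = (if mv (vt w) t = Some w then ent (M * N) (vt w) (vt t) * x t else 0)"
  if t: "t : J" for t
  proof -
  have "(\<Sum>u\<in>J. a u t) = (\<Sum>l\<in>V. \<Sum>u\<in>{u : J. vt u = l}. a u t)"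
  by (rule sum.group[symmetric]) (use cdata_facts(1,2) in auto)
  also have "... = (\<Sum>l\<in>V. if mv (vt w) t = Some w then ent M (vt w) l * ent N l (vt t) * x t else 0)"
  proof (rule sum.cong[OF refl])
  fix l assume l: "l : V"
  show "(\<Sum>u\<in>{u : J. vt u = l}. a u t) =
  (if mv (vt w) t = Some w then ent M (vt w) l * ent N l (vt t) * x t else 0)"
  proof (cases "(vt t, l) : q & (l, vt w) : q")
  case False
  then have "ent M (vt w) l = 0 \<or> ent N l (vt t) = 0"
  using KP_entry[OF M(1) l cdata_facts(2)[OF w]] KP_entry[OF M(2) cdata_facts(2)[OF t] l] by auto
  then have "a u t = 0" if "vt u = l" for u using that by (auto simp: a_def)
  then show ?thesis using \<open>ent M (vt w) l = 0 \<or> ent N l (vt t) = 0\<close> by auto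
  next
  case True
  show ?thesis
  proof (cases "mv l t")
  case None
  then have "a u t = 0" if "vt u = l" for u using that by (simp add: a_def)
  then show ?thesis using cdata_facts(6)[OF t _ None] True by simp
  next
  case (Some u0)
  have u0: "u0 : J" "vt u0 = l" "mv (vt w) u0 = mv (vt w) t"
  using cdata_facts(4,5)[OF t _ Some] True by auto
  have "(\<Sum>u\<in>{u : J. vt u = l}. a u t) = (\<Sum>u\<in>{u : J. vt u = l}. if u = u0 then a u0 t else 0)"
  by (rule sum.cong) (use Some in "auto simp: a_def")
  also have "... = a u0 t" using u0 cdata_facts(1) by simp
  also have "... = (if mv (vt w) t = Some w then ent M (vt w) l * ent N l (vt t) * x t else 0)"
  unfolding a_def u0(2) u0(3) Some by (simp only: simp_thms if_True mult.assoc)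
  finally show ?thesis .
  qed
  qed
  qed
  also have "... = (if mv (vt w) t = Some w then ent (M * N) (vt w) (vt t) * x t else 0)"
  using KP_mult_entry[OF KP_mat[OF M(1)] KP_mat[OF M(2)] cdata_facts(2)[OF w] cdata_facts(2)[OF t]]
  by (simp add: sum_distrib_right)
  finally show ?thesis .
  qed
  have "(M *[cmod J vt mv] (N *[cmod J vt mv] x)) w = (\<Sum>u\<in>J. \<Sum>t\<in>J. a u t)"
  using w by (auto simp: cmod_smult a_def sum_distrib_left intro!: sum.cong)
  also have "... = (\<Sum>t\<in>J. \<Sum>u\<in>J. a u t)" by (rule sum.swap)
  also have "... = (\<Sum>t\<in>J. if mv (vt w) t = Some w then ent (M * N) (vt w) (vt t) * x t else 0)"
  by (rule sum.cong[OF refl step])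
  finally show ?thesis using w by (simp add: cmod_smult)
  qed (simp add: cmod_smult)
 qed
next
 fix M x y assume "M : car KP" "x : car (cmod J vt mv)" "y : car (cmod J vt mv)"
 show "M *[cmod J vt mv] (x +[cmod J vt mv] y) = M *[cmod J vt mv] x +[cmod J vt mv] M *[cmod J vt mv] y"
 proof
  fix u show "(M *[cmod J vt mv] (x +[cmod J vt mv] y)) u =
  (M *[cmod J vt mv] x +[cmod J vt mv] M *[cmod J vt mv] y) u"
  proof (cases "u : J")
  case True
  have "(\<Sum>t\<in>J. if mv (vt u) t = Some u then ent M (vt u) (vt t) * (x t + y t) else 0) =
  (\<Sum>t\<in>J. (if mv (vt u) t = Some u then ent M (vt u) (vt t) * x t else 0) +
  (if mv (vt u) t = Some u then ent M (vt u) (vt t) * y t else 0))"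
  by (rule sum.cong) (simp_all add: distrib_left)
  then show ?thesis using True by (simp add: cmod_smult sum.distrib cong: if_cong)
  qed (simp add: cmod_smult)
 qed
next
 fix x assume "x : car (cmod J vt mv)"
 moreover have "1 \<cdot>\<^sub>m 1\<^sub>m (Suc n) = (1\<^sub>m (Suc n) :: 'k mat)" by (rule eq_matI) auto
 ultimately show "\<one>\<^bsub>KP\<^esub> *[cmod J vt mv] x = x" using cmod_scalar[of x 1] by simp
qed (auto simp: add_ac)

lemma std_cmod: "std_module J KP (cmod J vt mv)"
 using left_module_cmod cdata_facts(1) cmod_scalar by (simp add: std_module_def scal_def)

lemma fd_cmod: "fd_module KP (cmod J vt mv)"
 by (rule std_module_fd[OF fdKP std_cmod])

lemma cmod_E:
 assumes "(i, j) : q"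
 shows "(E j i *[cmod J vt mv] f) u =
  (if u : J & vt u = j then \<Sum>t\<in>J. if vt t = i & mv j t = Some u then f t else 0 else 0)"
proof -
 have "i : V" "j : V" using assms q_dom by auto
 then have "(if mv (vt u) t = Some u then ent (E j i) (vt u) (vt t) * f t else 0) =
  (if vt u = j then if vt t = i & mv j t = Some u then f t else 0 else 0)" if "u : J" "t : J" for t
  using cdata_facts(2)[OF that(1)] cdata_facts(2)[OF that(2)] by auto
 then show ?thesis by (auto simp: cmod_smult intro!: sum.cong sum.neutral)
qed

end

lemma scal_cmod: "cdata J vt mv ==> f : car (cmod J vt mv) ==> scal KP (cmod J vt mv) c f = (%t. c * f t)"
 using cmod_scalar by (simp add: scal_def)

subsection \<open>Interval modules\<close>

definition convex :: "nat set => bool" where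
 "convex S \<longleftrightarrow> S \<subseteq> V & (ALL i:S. ALL k:S. ALL j. (i, j) : q --> (j, k) : q --> j : S)"

definition thin :: "nat set => ('k mat, nat => 'k) module" where
 "thin S = cmod S (%t. t) (%l _. if l : S then Some l else None)"

lemma thin_cdata: "convex S ==> cdata S (%t. t) (%l _. if l : S then Some l else None)"
proof -
 assume S: "convex S"
 then have SV: "S \<subseteq> V" by (simp add: convex_def)
 have mid: "j : S" if "i : S" "k : S" "(i, j) : q" "(j, k) : q" for i j k
  using S that unfolding convex_def by blast
 show ?thesis
  unfolding cdata_def
 proof (intro conjI ballI allI impI)
  show "finite S" using SV finite_subset finite_V by blast
  fix t assume t: "t : S"
  show "t : V" using t SV by blast
  show "(if t : S then Some t else None) = Some t" using t by simp
  fix l u assume u: "(if l : S then Some l else None) = Some u"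
  show "u : S" "u = l" using u by (auto split: if_splits)
 next
  fix t l l' assume "t : S" "(t, l) : q" "(if l : S then Some l else None) = None" "(l, l') : q"
  then have "l' ~: S" using mid[of t l' l] by (auto split: if_splits)
  then show "(if l' : S then Some l' else None) = None" by simp
 qed simp
qed

lemma thin_simps [simp]:
 "car (thin S) = {f. ALL t. t ~: S --> f t = 0}" "zero (thin S) = 0" "add (thin S) = (+)"
 by (simp_all add: thin_def)

lemma lm_thin: "convex S ==> left_module KP (thin S)"
 unfolding thin_def by (rule left_module_cmod) (rule thin_cdata)

lemma fd_thin: "convex S ==> fd_module KP (thin S)"
 unfolding thin_def by (rule fd_cmod) (rule thin_cdata)

lemma scal_thin: "convex S ==> f : car (thin S) ==> scal KP (thin S) c f = (%t. c * f t)"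
 unfolding thin_def by (rule scal_cmod[OF thin_cdata])

lemma thin_smult:
 "(M *[thin S] f) u = (if u : S then \<Sum>t\<in>S. ent M u t * f t else 0)"
 by (simp add: thin_def cmod_smult)

lemma thin_E:
 assumes "convex S" "(i, j) : q" "f : car (thin S)"
 shows "E j i *[thin S] f = (%u. if u = j & j : S then f i else 0)"
proof
 fix u
 have SV: "S \<subseteq> V" and fin: "finite S"
  using assms(1) finite_subset[OF _ finite_V] unfolding convex_def by blast+
 have ij: "i : V" "j : V" using assms(2) q_dom by auto
 have "(E j i *[thin S] f) u = (if u = j then f i else 0)" if u: "u : S"
 proof -
  have "ent (E j i) u t * f t = (if t = i then (if u = j then f i else 0) else 0)" if "t : S" for t
  using that u SV ij by (simp add: subsetD)
  then have "(E j i *[thin S] f) u = (\<Sum>t\<in>S. if t = i then (if u = j then f i else 0) else 0)"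
  using u by (simp add: thin_smult)
  also have "... = (if u = j then f i else 0)" using fin assms(3) by simp
  finally show ?thesis .
 qed
 then show "(E j i *[thin S] f) u = (if u = j & j : S then f i else 0)"
  by (cases "u : S") (auto simp: thin_smult)
qed

lemma convex_singleton [simp]: "k : V ==> convex {k}"
 unfolding convex_def by (auto dest: q_antisym)

lemma vertex_simple_iso:
 assumes k: "k : V"
 shows "left_module KP (vertex_simple k)" "isomorphic KP (thin {k}) (vertex_simple k)"
proof -
 let ?f = "%f :: nat => 'k. vec 1 (%_. f k)"
 have hom: "?f : module_hom KP (thin {k}) (vertex_simple k)"
  by (rule homI) (auto simp: vertex_simple_def thin_smult ent_def intro!: eq_vecI)
 have "?f ` car (thin {k}) = car (vertex_simple k)"
 proof (intro equalityI subsetI)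
  fix v :: "'k vec" assume "v : car (vertex_simple k)"
  then have "v = ?f (%t. if t = k then v $ 0 else 0)" by (auto simp: vertex_simple_def intro!: eq_vecI)
  then show "v : ?f ` car (thin {k})" by (intro image_eqI[of _ _ "%t. if t = k then v $ 0 else 0"]) auto
 qed (use homD(1)[OF hom] in blast)
 moreover have "inj_on ?f (car (thin {k}))"
 proof (rule inj_onI)
  fix f g assume "f : car (thin {k})" "g : car (thin {k})" "?f f = ?f g"
  then have "f k = g k" "!!t. t ~= k ==> f t = g t" using index_vec[of 0 1] by (metis less_one, simp)
  then show "f = g" by (metis ext)
 qed
 ultimately have bij: "bij_betw ?f (car (thin {k})) (car (vertex_simple k))" by (simp add: bij_betw_def)
 have "?f \<zero>[thin {k}] = \<zero>[vertex_simple k]" by (auto simp: vertex_simple_def intro!: eq_vecI)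
 then show "left_module KP (vertex_simple k)"
  using left_module_bij[OF lm_thin hom bij] k by simp
 show "isomorphic KP (thin {k}) (vertex_simple k)" using hom bij unfolding isomorphic_def by blast
qed

end

section \<open>Uniqueness of projective covers and injective envelopes\<close>

lemma set_addE:
 assumes "z : U <+>\<^bsub>M\<^esub> W" obtains u w where "u : U" "w : W" "z = u +[M] w"
 using assms unfolding set_add_def' by blast

lemma set_addI: "u : U ==> w : W ==> z = u +[M] w ==> z : U <+>\<^bsub>M\<^esub> W"
 unfolding set_add_def' by blast

lemma set_add_eq_carrier:
 assumes "left_module A M" "U \<subseteq> car M" "W \<subseteq> car M"
  "!!x. x : car M ==> EX u:U. x -[M] u : W"
 shows "U <+>\<^bsub>M\<^esub> W = car M"
proof -
 interpret lmodule A M by (rule lmodule.intro) fact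
 show ?thesis
 proof (intro equalityI subsetI)
  fix z assume "z : U <+>\<^bsub>M\<^esub> W"
  then show "z : car M" by (rule set_addE) (use assms in auto)
 next
  fix z assume z: "z : car M"
  then obtain u where u: "u : U" "z -[M] u : W" using assms(4) by blast
  have "u : car M" using u(1) assms(2) by blast
  then have "z = u +[M] (z -[M] u)" using z by (simp add: a_minus_def M.a_comm[of u] M.a_assoc M.l_neg)
  with u show "z : U <+>\<^bsub>M\<^esub> W" by (rule set_addI)
 qed
qed

lemma module_hom_diff:
 assumes "left_module A M" "left_module A N" "f : module_hom A M N" "x : car M" "y : car M"
 shows "f (x -[M] y) = f x -[N] f y"
proof -
 interpret M: lmodule A M by (rule lmodule.intro) fact
 show ?thesis using assms(4,5)
  by (simp add: a_minus_def homD(2)[OF assms(3)] module_hom_minus[OF assms(1-3)])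
qed

lemma module_hom_id: "(%x. x) : module_hom A M M"
 by (rule homI) auto

lemma projective_lift:
 fixes A :: "('k::field, 'a) module" and M N :: "('a, 'k vec) module"
 assumes "projective A P" "fd_module A M" "fd_module A N" "g : module_hom A M N" "f : module_hom A P N"
  "g ` car M = car N"
 obtains h where "h : module_hom A P M" "!!x. x : car P ==> g (h x) = f x"
proof -
 have "EX h:module_hom A P M. ALL x:car P. g (h x) = f x"
  using conjunct2[OF assms(1)[unfolded projective_def], rule_format, OF conjI[OF assms(2,3)] assms(4,5,6)] .
 then show ?thesis using that by blast
qed

lemma is_projective_coverE:
 assumes "is_projective_cover A P S"
 obtains p where "projective A P" "p : module_hom A P S" "p ` car P = car S"
  "!!U. submod U A P ==> U <+>\<^bsub>P\<^esub> a_kernel P S p = car P ==> U = car P"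
proof -
 have 1: "projective A P" by (rule conjunct1[OF assms[unfolded is_projective_cover_def]])
 show thesis
  using conjunct2[OF assms[unfolded is_projective_cover_def]]
 proof (rule bexE)
  fix p assume p: "p : module_hom A P S" and *: "p ` car P = car S &
  (ALL U. submod U A P & U <+>\<^bsub>P\<^esub> a_kernel P S p = car P --> U = car P)"
  show thesis
  by (rule that[OF 1 p conjunct1[OF *]]) (rule conjunct2[OF *, rule_format, OF conjI])
 qed
qed

lemma is_injective_envelopeE:
 assumes "is_injective_envelope A Q S"
 obtains i where "injective A Q" "i : module_hom A S Q" "inj_on i (car S)"
  "!!U. submod U A Q ==> U \<inter> i ` car S = {\<zero>[Q]} ==> U = {\<zero>[Q]}"
proof -
 have 1: "injective A Q" by (rule conjunct1[OF assms[unfolded is_injective_envelope_def]])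
 show thesis
  using conjunct2[OF assms[unfolded is_injective_envelope_def]]
 proof (rule bexE)
  fix i assume i: "i : module_hom A S Q" and *: "inj_on i (car S) &
  (ALL U. submod U A Q & U \<inter> i ` car S = {\<zero>[Q]} --> U = {\<zero>[Q]})"
  show thesis
  by (rule that[OF 1 i conjunct1[OF *]]) (rule conjunct2[OF *, rule_format, OF conjI])
 qed
qed

lemma injective_extend:
 fixes A :: "('k::field, 'a) module" and M N :: "('a, 'k vec) module"
 assumes "injective A Q" "fd_module A M" "fd_module A N" "g : module_hom A M N" "f : module_hom A M Q"
  "inj_on g (car M)"
 obtains h where "h : module_hom A N Q" "!!x. x : car M ==> h (g x) = f x"
proof -
 have "EX h:module_hom A N Q. ALL x:car M. h (g x) = f x"
  using conjunct2[OF assms(1)[unfolded injective_def], rule_format, OF conjI[OF assms(2,3)] assms(4,5,6)] .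
 then show ?thesis using that by blast
qed

lemma projective_cover_unique:
 fixes A :: "('k::field, 'a) module" and P P' S :: "('a, 'k vec) module"
 assumes P: "is_projective_cover A P S" and P': "is_projective_cover A P' S" and S: "fd_module A S"
 shows "isomorphic A P P'"
proof -
 obtain p where p: "p : module_hom A P S" "p ` car P = car S" and pP: "projective A P"
  and sup: "!!U. submod U A P ==> U <+>\<^bsub>P\<^esub> a_kernel P S p = car P ==> U = car P"
  using is_projective_coverE[OF P] by metis
 obtain p' where p': "p' : module_hom A P' S" "p' ` car P' = car S" and pP': "projective A P'"
  and sup': "!!U. submod U A P' ==> U <+>\<^bsub>P'\<^esub> a_kernel P' S p' = car P' ==> U = car P'"
  using is_projective_coverE[OF P'] by metis
 have fd: "fd_module A P" "fd_module A P'" using pP pP' by (simp_all add: projective_def)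
 note lm = fd[THEN fd_lm] S[THEN fd_lm]
 interpret S: lmodule A S by (rule lmI) (rule lm)
 interpret P: lmodule A P by (rule lmI) (rule lm)
 interpret P': lmodule A P' by (rule lmI) (rule lm)
 obtain h where h: "h : module_hom A P P'" "!!x. x : car P ==> p' (h x) = p x"
  using projective_lift[OF pP fd(2) S p'(1) p(1) p'(2)] by metis
 have hs: "h ` car P = car P'"
 proof (rule sup')
  show "submod (h ` car P) A P'"
  by (rule submodule_image[OF lm(1,2) h(1) submodule_carrier[OF lm(1)]])
  show "h ` car P <+>\<^bsub>P'\<^esub> a_kernel P' S p' = car P'"
  proof (rule set_add_eq_carrier[OF lm(2)])
  show "h ` car P \<subseteq> car P'" using homD(1)[OF h(1)] by auto
  show "a_kernel P' S p' \<subseteq> car P'" by (auto simp: a_kernel_def')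
  fix y assume y: "y : car P'"
  then have "p' y : p ` car P" using p(2) homD(1)[OF p'(1)] by blast
  then obtain x where x: "x : car P" "p' y = p x" by blast
  have hx: "h x : car P'" using homD(1)[OF h(1) x(1)] .
  have "p' (y -[P'] h x) = \<zero>[S]"
  using module_hom_diff[OF lm(2,3) p'(1) y hx] h(2)[OF x(1)] x homD(1)[OF p(1) x(1)]
  by (simp add: S.right_minus_eq)
  moreover have "y -[P'] h x : car P'" using y hx by (simp add: a_minus_def)
  ultimately show "EX u:h ` car P. y -[P'] u : a_kernel P' S p'"
  using x(1) by (auto simp: a_kernel_def')
  qed
 qed
 obtain s where s: "s : module_hom A P' P" "!!y. y : car P' ==> h (s y) = y"
  using projective_lift[OF pP' fd h(1) module_hom_id hs] by metis
 have ss: "s ` car P' = car P"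
 proof (rule sup)
  show "submod (s ` car P') A P"
  by (rule submodule_image[OF lm(2,1) s(1) submodule_carrier[OF lm(2)]])
  show "s ` car P' <+>\<^bsub>P\<^esub> a_kernel P S p = car P"
  proof (rule set_add_eq_carrier[OF lm(1)])
  show "s ` car P' \<subseteq> car P" using homD(1)[OF s(1)] by auto
  show "a_kernel P S p \<subseteq> car P" by (auto simp: a_kernel_def')
  fix x assume x: "x : car P"
  have hx: "h x : car P'" using homD(1)[OF h(1) x] .
  have shx: "s (h x) : car P" using homD(1)[OF s(1) hx] .
  have "p (s (h x)) = p x" using h(2)[OF shx] h(2)[OF x] s(2)[OF hx] by simp
  then have "p (x -[P] s (h x)) = \<zero>[S]"
  using module_hom_diff[OF lm(1,3) p(1) x shx] homD(1)[OF p(1) x] by (simp add: S.right_minus_eq)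
  moreover have "x -[P] s (h x) : car P" using x shx by (simp add: a_minus_def)
  ultimately show "EX u:s ` car P'. x -[P] u : a_kernel P S p"
  using hx by (auto simp: a_kernel_def')
  qed
 qed
 show ?thesis
 proof (rule isomorphicI[OF h(1), of s])
  fix x assume "x : car P"
  then obtain y where y: "y : car P'" "x = s y" using ss by blast
  then show "s (h x) = x" using s(2) by simp
 qed (use s homD(1)[OF s(1)] in auto)
qed

lemma injective_envelope_unique:
 fixes A :: "('k::field, 'a) module" and Q Q' S :: "('a, 'k vec) module"
 assumes Q: "is_injective_envelope A Q S" and Q': "is_injective_envelope A Q' S" and S: "fd_module A S"
 shows "isomorphic A Q Q'"
proof -
 obtain i where i: "i : module_hom A S Q" "inj_on i (car S)" and pQ: "injective A Q"
  and ess: "!!U. submod U A Q ==> U \<inter> i ` car S = {\<zero>[Q]} ==> U = {\<zero>[Q]}"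
  using is_injective_envelopeE[OF Q] by metis
 obtain i' where i': "i' : module_hom A S Q'" "inj_on i' (car S)" and pQ': "injective A Q'"
  and ess': "!!U. submod U A Q' ==> U \<inter> i' ` car S = {\<zero>[Q']} ==> U = {\<zero>[Q']}"
  using is_injective_envelopeE[OF Q'] by metis
 have fd: "fd_module A Q" "fd_module A Q'" using pQ pQ' by (simp_all add: injective_def)
 note lm = fd[THEN fd_lm] S[THEN fd_lm]
 interpret S: lmodule A S by (rule lmI) (rule lm)
 interpret Q: lmodule A Q by (rule lmI) (rule lm)
 interpret Q': lmodule A Q' by (rule lmI) (rule lm)
 have ker_inj: "inj_on f (car X)"
  if "left_module A X" "left_module A Y" "f : module_hom A X Y" "{x : car X. f x = \<zero>[Y]} = {\<zero>[X]}"
  for f and X :: "('a, 'k vec) module" and Y :: "('a, 'k vec) module"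
 proof (rule inj_onI)
  interpret X: lmodule A X by (rule lmI) (rule that(1))
  interpret Y: lmodule A Y by (rule lmI) (rule that(2))
  fix x y assume xy: "x : car X" "y : car X" "f x = f y"
  have "f (x -[X] y) = \<zero>[Y]"
  using module_hom_diff[OF that(1-3) xy(1,2)] xy(3) homD(1)[OF that(3) xy(1)] homD(1)[OF that(3) xy(2)]
  by (simp add: Y.right_minus_eq)
  moreover have "x -[X] y : car X" using xy by (simp add: a_minus_def)
  ultimately have "x -[X] y : {x : car X. f x = \<zero>[Y]}" by simp
  then show "x = y" unfolding that(4) using X.right_minus_eq[OF xy(1,2)] by simp
 qed
 obtain h where h: "h : module_hom A Q Q'" "!!x. x : car S ==> h (i x) = i' x"
  using injective_extend[OF pQ' S fd(1) i(1) i'(1) i(2)] by metis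
 have h0: "{x : car Q. h x = \<zero>[Q']} = {\<zero>[Q]}"
 proof (rule ess)
  show "submod {x : car Q. h x = \<zero>[Q']} A Q" by (rule submodule_kernel[OF lm(1,2) h(1)])
  have "x = \<zero>[Q]" if x: "x : car Q" "h x = \<zero>[Q']" "x : i ` car S" for x
  proof -
  obtain v where v: "v : car S" "x = i v" using x(3) by blast
  then have "i' v = i' \<zero>[S]" using h(2)[OF v(1)] x(2) hom_zero[OF lm(3,2) i'(1)] by simp
  then have "v = \<zero>[S]" using inj_onD[OF i'(2) _ v(1)] by simp
  then show ?thesis using v(2) hom_zero[OF lm(3,1) i(1)] by simp
  qed
  moreover have "\<zero>[Q] : i ` car S" using hom_zero[OF lm(3,1) i(1)] by (metis S.M.zero_closed imageI)
  ultimately show "{x : car Q. h x = \<zero>[Q']} \<inter> i ` car S = {\<zero>[Q]}"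
  using hom_zero[OF lm(1,2) h(1)] by auto
 qed
 have hinj: "inj_on h (car Q)" by (rule ker_inj[OF lm(1,2) h(1) h0])
 obtain s where s: "s : module_hom A Q' Q" "!!x. x : car Q ==> s (h x) = x"
  using injective_extend[OF pQ fd h(1) module_hom_id hinj] by metis
 have s0: "{x : car Q'. s x = \<zero>[Q]} = {\<zero>[Q']}"
 proof (rule ess')
  show "submod {x : car Q'. s x = \<zero>[Q]} A Q'" by (rule submodule_kernel[OF lm(2,1) s(1)])
  have "x = \<zero>[Q']" if x: "x : car Q'" "s x = \<zero>[Q]" "x : i' ` car S" for x
  proof -
  obtain v where v: "v : car S" "x = i' v" using x(3) by blast
  have iv: "i v : car Q" using homD(1)[OF i(1) v(1)] .
  have "i v = \<zero>[Q]" using s(2)[OF iv] h(2)[OF v(1)] v(2) x(2) by simp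
  then show ?thesis using h(2)[OF v(1)] v(2) hom_zero[OF lm(1,2) h(1)] by simp
  qed
  moreover have "\<zero>[Q'] : i' ` car S" using hom_zero[OF lm(3,2) i'(1)] by (metis S.M.zero_closed imageI)
  ultimately show "{x : car Q'. s x = \<zero>[Q]} \<inter> i' ` car S = {\<zero>[Q']}"
  using hom_zero[OF lm(2,1) s(1)] by auto
 qed
 have sinj: "inj_on s (car Q')" by (rule ker_inj[OF lm(2,1) s(1) s0])
 show ?thesis
 proof (rule isomorphicI[OF h(1), of s])
  fix y assume y: "y : car Q'"
  then have sy: "s y : car Q" using homD(1)[OF s(1)] by blast
  then have "s (h (s y)) = s y" using s(2) by blast
  then show "h (s y) = y" using inj_onD[OF sinj _ homD(1)[OF h(1) sy] y] by blast
 qed (use s homD(1)[OF s(1)] in auto)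
qed

lemma is_projective_cover_iso:
 fixes S :: "('a, 'n) module"
 assumes A: "fd_algebra (A :: ('k::field, 'a) module)" and P: "is_projective_cover A P S"
  and lm: "left_module A P'" and iso: "isomorphic A P P'"
 shows "is_projective_cover A P' S"
proof -
 obtain p where p: "p : module_hom A P S" "p ` car P = car S" and pP: "projective A P"
  and sup: "!!U. submod U A P ==> U <+>\<^bsub>P\<^esub> a_kernel P S p = car P ==> U = car P"
  using is_projective_coverE[OF P] by metis
 have fdP: "fd_module A P" using pP by (simp add: projective_def)
 have lmP: "left_module A P" using fdP by (simp add: fd_module_def)
 obtain f g where f: "f : module_hom A P P'" and g: "g : module_hom A P' P"
  and gf: "!!x. x : car P ==> g (f x) = x" and fg: "!!y. y : car P' ==> f (g y) = y"
  using isomorphicE[OF iso lmP] by metis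
 have gim: "g ` car P' = car P"
 proof (intro equalityI subsetI)
  fix x assume "x : car P"
  then show "x : g ` car P'" using gf homD(1)[OF f] by (intro image_eqI[of _ _ "f x"]) auto
 qed (use homD(1)[OF g] in auto)
 have "projective A P'" unfolding projective_def
 proof (intro conjI allI impI ballI)
  show "fd_module A P'" by (rule fd_module_iso[OF A fdP lm iso])
  fix M N :: "('a, 'k vec) module" and u v
  assume MN: "fd_module A M & fd_module A N" "u : module_hom A M N" "v : module_hom A P' N" "u ` car M = car N"
  obtain h where h: "h : module_hom A P M" "!!x. x : car P ==> u (h x) = v (f x)"
  using projective_lift[OF pP _ _ MN(2) hom_comp[OF f MN(3)] MN(4)] MN(1) by metis
  show "EX h:module_hom A P' M. ALL x:car P'. u (h x) = v x"
  using hom_comp[OF g h(1)] h(2) fg homD(1)[OF g] by (intro bexI[of _ "%x. h (g x)"]) auto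
 qed
 moreover have "U = car P'"
  if U: "submod U A P'" "U <+>\<^bsub>P'\<^esub> a_kernel P' S (%x. p (g x)) = car P'" for U
 proof -
  have UP: "U \<subseteq> car P'" using submoduleD(1)[OF U(1)] .
  have "g ` U = car P"
  proof (rule sup)
  show "submod (g ` U) A P" by (rule submodule_image[OF lm lmP g U(1)])
  show "g ` U <+>\<^bsub>P\<^esub> a_kernel P S p = car P"
  proof (intro equalityI subsetI)
  fix x assume "x : g ` U <+>\<^bsub>P\<^esub> a_kernel P S p"
  then obtain a b where "a : g ` U" "b : a_kernel P S p" "x = a +[P] b" by (rule set_addE)
  then show "x : car P"
  using UP homD(1)[OF g] lmI[OF lmP] abelian_monoid.a_closed[of P a b] lmP
  by (auto simp: a_kernel_def' left_module_def abelian_group_def)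
  next
  fix x assume x: "x : car P"
  then have "f x : U <+>\<^bsub>P'\<^esub> a_kernel P' S (%x. p (g x))" using U(2) homD(1)[OF f] by blast
  then obtain a b where ab: "a : U" "b : a_kernel P' S (%x. p (g x))" "f x = a +[P'] b" by (rule set_addE)
  have b: "b : car P'" "p (g b) = \<zero>[S]" using ab(2) by (auto simp: a_kernel_def')
  have "x = g a +[P] g b" using gf[OF x] ab(1,3) b(1) UP homD(2)[OF g, of a b] by auto
  moreover have "g b : a_kernel P S p" using b homD(1)[OF g] by (auto simp: a_kernel_def')
  ultimately show "x : g ` U <+>\<^bsub>P\<^esub> a_kernel P S p" using ab(1) by (blast intro: set_addI)
  qed
  qed
  show "U = car P'"
  proof
  show "car P' \<subseteq> U"
  proof
  fix y assume y: "y : car P'"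
  then have "g y : g ` U" using \<open>g ` U = car P\<close> homD(1)[OF g] by blast
  then obtain u where "u : U" "g y = g u" by blast
  then show "y : U" using fg[OF y] fg[of u] UP by auto
  qed
  qed (rule UP)
 qed
 moreover have "(%x. p (g x)) : module_hom A P' S" by (rule hom_comp[OF g p(1)])
 moreover have "(%x. p (g x)) ` car P' = car S" using gim p(2) by (metis image_image)
 ultimately show ?thesis unfolding is_projective_cover_def by (intro conjI bexI[of _ "%x. p (g x)"] allI impI) (assumption | elim conjE)+
qed

lemma is_injective_envelope_iso:
 fixes S :: "('a, 'n) module"
 assumes A: "fd_algebra (A :: ('k::field, 'a) module)" and Q: "is_injective_envelope A Q S"
  and lm: "left_module A Q'" and iso: "isomorphic A Q Q'"
 shows "is_injective_envelope A Q' S"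
proof -
 obtain i where i: "i : module_hom A S Q" "inj_on i (car S)" and pQ: "injective A Q"
  and ess: "!!U. submod U A Q ==> U \<inter> i ` car S = {\<zero>[Q]} ==> U = {\<zero>[Q]}"
  using is_injective_envelopeE[OF Q] by metis
 have fdQ: "fd_module A Q" using pQ by (simp add: injective_def)
 have lmQ: "left_module A Q" using fdQ by (simp add: fd_module_def)
 obtain f g where f: "f : module_hom A Q Q'" and g: "g : module_hom A Q' Q"
  and gf: "!!x. x : car Q ==> g (f x) = x" and fg: "!!y. y : car Q' ==> f (g y) = y"
  using isomorphicE[OF iso lmQ] by metis
 have "injective A Q'" unfolding injective_def
 proof (intro conjI allI impI ballI)
  show "fd_module A Q'" by (rule fd_module_iso[OF A fdQ lm iso])
  fix M N :: "('a, 'k vec) module" and u v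
  assume MN: "fd_module A M & fd_module A N" "u : module_hom A M N" "v : module_hom A M Q'" "inj_on u (car M)"
  obtain h where h: "h : module_hom A N Q" "!!x. x : car M ==> h (u x) = g (v x)"
  using injective_extend[OF pQ _ _ MN(2) hom_comp[OF MN(3) g] MN(4)] MN(1) by metis
  show "EX h:module_hom A N Q'. ALL x:car M. h (u x) = v x"
  using hom_comp[OF h(1) f] h(2) fg homD(1)[OF MN(3)] by (intro bexI[of _ "%x. f (h x)"]) auto
 qed
 moreover have "U = {\<zero>[Q']}"
  if U: "submod U A Q'" "U \<inter> (%x. f (i x)) ` car S = {\<zero>[Q']}" for U
 proof -
  have UQ: "U \<subseteq> car Q'" using submoduleD(1)[OF U(1)] .
  have z: "g \<zero>[Q'] = \<zero>[Q]" "f \<zero>[Q] = \<zero>[Q']" using hom_zero lm lmQ f g by metis+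
  have gU: "g ` U = {\<zero>[Q]}"
  proof (rule ess)
  show "submod (g ` U) A Q" by (rule submodule_image[OF lm lmQ g U(1)])
  show "g ` U \<inter> i ` car S = {\<zero>[Q]}"
  proof (intro equalityI subsetI)
  fix x assume "x : g ` U \<inter> i ` car S"
  then obtain u v where uv: "u : U" "x = g u" "v : car S" "x = i v" by blast
  have "f (i v) = u" using uv fg UQ by (metis subsetD)
  then have "u : U \<inter> (%x. f (i x)) ` car S" using uv by blast
  then have "u = \<zero>[Q']" using U(2) by blast
  then show "x : {\<zero>[Q]}" using uv(2) z by simp
  next
  fix x assume "x : {\<zero>[Q]}"
  then have x: "x = \<zero>[Q]" by simp
  have "\<zero>[Q'] : (%x. f (i x)) ` car S" using U(2) by blast
  then obtain v where v: "v : car S" "\<zero>[Q'] = f (i v)" by blast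
  then have "i v = \<zero>[Q]" using gf[OF homD(1)[OF i(1) v(1)]] z(1) by simp
  then show "x : g ` U \<inter> i ` car S" using x v(1) z(1) submoduleD(2)[OF U(1)] by (metis IntI imageI)
  qed
  qed
  have "u = \<zero>[Q']" if "u : U" for u
  proof -
  have "g u = \<zero>[Q]" using gU that by blast
  then show ?thesis using fg[of u] UQ that z(2) by auto
  qed
  then show "U = {\<zero>[Q']}" using submoduleD(2)[OF U(1)] by blast
 qed
 moreover have "(%x. f (i x)) : module_hom A S Q'" by (rule hom_comp[OF i(1) f])
 moreover have "inj_on (%x. f (i x)) (car S)"
 proof (rule inj_onI)
  fix x y assume xy: "x : car S" "y : car S" "f (i x) = f (i y)"
  have "i x = i y"
  using arg_cong[OF xy(3), of g]
  unfolding gf[OF homD(1)[OF i(1) xy(1)]] gf[OF homD(1)[OF i(1) xy(2)]] .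
  then show "x = y" using xy(1,2) by (rule inj_onD[OF i(2)])
 qed
 ultimately show ?thesis unfolding is_injective_envelope_def by (intro conjI bexI[of _ "%x. f (i x)"] allI impI) (assumption | elim conjE)+
qed

context suspension begin

section \<open>Composition factors\<close>

lemma scal_submodule [simp]: "scal KP (M(|carrier := U|)) = scal KP M"
 by (simp add: scal_def fun_eq_iff)

lemma E_smult_id:
 assumes "left_module KP M" "x : car M" "(i, j) : q"
 shows "E j j *[M] (E j i *[M] x) = E j i *[M] x" "E j i *[M] (E i i *[M] x) = E j i *[M] x"
 using E_smult[OF assms(1,2)] assms(3) q_dom[OF assms(3)] q_refl by simp_all

lemma E_smult_closed [simp]:
 assumes "left_module KP M" "x : car M" "(i, j) : q" shows "E j i *[M] x : car M"
proof -
 interpret lmodule KP M by (rule lmodule.intro) fact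
 show ?thesis using assms by simp
qed

lemma thin_E_id:
 assumes "convex S" "k : V" "f : car (thin S)"
 shows "E k k *[thin S] f = (%u. if u = k then f k else 0)"
 using thin_E[OF assms(1) q_refl[OF assms(2)] assms(3)] assms(3) by (auto simp: fun_eq_iff)

text \<open>Modulo \<open>U\<close> the vector \<open>y\<close> spans a copy of the simple module at \<open>k\<close>.\<close>
lemma add_vector:
 assumes lm: "left_module KP M" and U: "submod U KP M"
  and fil: "filtered_by KP X (M(|carrier := U|))" and k: "k : V" and X: "thin {k} : X"
  and y: "y : car M" "E k k *[M] y = y"
  and E: "!!j. (k, j) : q ==> j ~= k ==> E j k *[M] y : U"
 shows "EX U'. submod U' KP M & U \<subseteq> U' & y : U' & filtered_by KP X (M(|carrier := U'|))"
proof (cases "y : U")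
 case True then show ?thesis using U fil by blast
next
 case False
 interpret lmodule KP M by (rule lmodule.intro) fact
 note A = fdKP
 note UD = submoduleD[OF U]
 have Ukc: "kclosed KP M U" by (rule submodule_kclosed[OF A lm U])
 have Us: "scal KP M c u : U" if "u : U" for c u using Ukc that by (simp add: kclosed_def)
 have UM: "u : car M" if "u : U" for u using UD(1) that by blast
 have sy: "scal KP M c y : car M" for c by (rule scal_closed[OF A lm y(1)])
 define w where "w u c = u +[M] scal KP M c y" for u c
 have wM: "w u c : car M" if "u : U" for u c using UM[OF that] sy by (simp add: w_def)
 have w_add: "w u c +[M] w u' c' = w (u +[M] u') (c + c')" if "u : U" "u' : U" for u u' c c'
  using UM[OF that(1)] UM[OF that(2)] sy by (simp add: w_def scal_plus[OF A lm y(1)] M.a_ac)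
 have w_scal: "scal KP M d (w u c) = w (scal KP M d u) (d * c)" if "u : U" for u c d
  using UM[OF that] sy by (simp add: w_def scal_add[OF A lm] scal_scal[OF A lm y(1)])
 have uniq: "c = c'" if "w u c = w u' c'" "u : U" "u' : U" for u u' c c'
 proof (rule ccontr)
  assume ne: "c ~= c'"
  have "w u c +[M] w (-[M] u') (- c') = w u' c' +[M] w (-[M] u') (- c')" using that(1) by simp
  then have "w (u +[M] -[M] u') (c - c') = w \<zero>[M] 0"
  using w_add that(2,3) UD(5)[OF that(3)] UM[OF that(3)] by (simp add: M.r_neg)
  then have *: "w (u +[M] -[M] u') (c - c') = \<zero>[M]" using scal_zero_left[OF A lm y(1)] by (simp add: w_def)
  define v where "v = u +[M] -[M] u'"
  have v: "v : U" using that(2,3) UD(3,5) by (simp add: v_def)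
  have "scal KP M (c - c') y = -[M] v"
  using * UM[OF v] sy[of "c - c'"] unfolding w_def v_def[symmetric]
  by (metis M.a_comm M.minus_equality M.minus_minus)
  then have "scal KP M (c - c') y : U" using UD(5)[OF v] by simp
  then have "scal KP M (inverse (c - c')) (scal KP M (c - c') y) : U" by (rule Us)
  then have "y : U" using ne by (simp add: scal_scal[OF A lm y(1)] scal_one[OF A lm y(1)])
  then show False using False by simp
 qed
 define U' where "U' = {w u c |u c. u : U}"
 have UU': "u : U'" if "u : U" for u
 proof -
  have "u = w u 0" using UM[OF that] scal_zero_left[OF A lm y(1)] by (simp add: w_def)
  then show ?thesis using that unfolding U'_def by blast
 qed
 have yU': "y : U'"
 proof -
  have "y = w \<zero>[M] 1" using y(1) scal_one[OF A lm y(1)] by (simp add: w_def)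
  then show ?thesis using UD(2) unfolding U'_def by blast
 qed
 have Ew: "EX v:U. E j i *[M] w u c = w v (if i = k & j = k then c else 0)" if u: "u : U" and ij: "(i, j) : q" for u c i j
 proof -
  have e: "E j i : car KP" using ij by simp
  have 1: "E j i *[M] w u c = E j i *[M] u +[M] scal KP M c (E j i *[M] y)"
  using UM[OF u] sy e y(1) by (simp add: w_def smult_r_distr smult_scal[OF A lm])
  have Eu: "E j i *[M] u : U" by (rule UD(4)[OF e u])
  have Eiy: "E j i *[M] y = (if i = k then E j k *[M] y else \<zero>[M])"
  using E_smult[OF lm y(1) q_refl[OF k] ij] y(2) by simp
  show ?thesis
  proof (cases "i = k & j = k")
  case True
  then have "E j i *[M] w u c = w (E j i *[M] u) c" using 1 y(2) by (simp add: w_def)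
  then show ?thesis using Eu True by auto
  next
  case False
  have "E j i *[M] y : U"
  unfolding Eiy using E ij False UD(2) by auto
  then have v: "E j i *[M] u +[M] scal KP M c (E j i *[M] y) : U" using UD(3)[OF Eu Us] by blast
  have "E j i *[M] w u c = w (E j i *[M] u +[M] scal KP M c (E j i *[M] y)) 0"
  unfolding 1 using UM[OF v] scal_zero_left[OF A lm y(1)] by (simp add: w_def)
  then show ?thesis using v False by auto
  qed
 qed
 have subU': "submod U' KP M"
 proof (rule submodule_criterion[OF lm])
  show "kclosed KP M U'" unfolding kclosed_def
  proof (intro conjI ballI allI)
  show "U' \<subseteq> car M" unfolding U'_def using wM by blast
  show "\<zero>[M] : U'" using UU' UD(2) by blast
  next
  fix a b assume "a : U'" "b : U'"
  then obtain u c u' c' where "a = w u c" "b = w u' c'" "u : U" "u' : U" unfolding U'_def by blast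
  then show "a +[M] b : U'" using w_add UD(3) unfolding U'_def by blast
  next
  fix d a assume "a : U'"
  then obtain u c where "a = w u c" "u : U" unfolding U'_def by blast
  then show "scal KP M d a : U'" using w_scal Us unfolding U'_def by blast
  qed
  fix i j a assume ij: "(i, j) : q" and "a : U'"
  then obtain u c where "a = w u c" "u : U" unfolding U'_def by blast
  then show "E j i *[M] a : U'" using Ew[OF _ ij, of u c] unfolding U'_def by auto
 qed
 define co where "co z = (THE c. EX u:U. z = w u c)" for z
 have co: "co (w u c) = c" if "u : U" for u c
  unfolding co_def using that uniq by (intro the_equality) auto
 let ?q = "%z t. if t = k then co z else 0"
 note cv = convex_singleton[OF k]
 have lmU': "left_module KP (M(|carrier := U'|))" by (rule lm_sub[OF lm subU'])
 have q: "?q : module_hom KP (M(|carrier := U'|)) (thin {k})"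
 proof (rule hom_criterion[OF lmU' lm_thin[OF cv]])
  fix a b assume "a : car (M(|carrier := U'|))" "b : car (M(|carrier := U'|))"
  then obtain u c u' c' where "a = w u c" "b = w u' c'" "u : U" "u' : U" unfolding U'_def by auto
  then show "?q (a +[M(|carrier := U'|)] b) = ?q a +[thin {k}] ?q b"
  using w_add UD(3) co by (auto simp: fun_eq_iff)
 next
  fix d a assume "a : car (M(|carrier := U'|))"
  then obtain u c where "a = w u c" "u : U" unfolding U'_def by auto
  then show "?q (scal KP (M(|carrier := U'|)) d a) = scal KP (thin {k}) d (?q a)"
  using w_scal Us co by (subst scal_thin[OF cv]) (auto simp: fun_eq_iff)
 next
  fix i j a assume ij: "(i, j) : q" and "a : car (M(|carrier := U'|))"
  then obtain u c where a: "a = w u c" "u : U" unfolding U'_def by auto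
  obtain v where v: "v : U" "E j i *[M] w u c = w v (if i = k & j = k then c else 0)" using Ew[OF a(2) ij] by blast
  show "?q (E j i *[M(|carrier := U'|)] a) = E j i *[thin {k}] ?q a"
  proof -
  have coE: "co (E j i *[M] a) = (if i = k & j = k then c else 0)"
  unfolding a(1) v(2) by (rule co[OF v(1)])
  have coa: "co a = c" unfolding a(1) by (rule co[OF a(2)])
  have th: "E j i *[thin {k}] ?q a = (%u. if u = j & j : {k} then (?q a) i else 0)"
  by (rule thin_E[OF cv ij]) simp
  have e: "E j i *[M(|carrier := U'|)] a = E j i *[M] a" by simp
  show ?thesis unfolding e coE th[unfolded coa] coa by (rule ext) auto
  qed
 qed simp
 have im: "?q ` U' = car (thin {k})"
 proof (intro equalityI subsetI)
  fix f assume f: "f : car (thin {k})"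
  have "co (w \<zero>[M] (f k)) = f k" by (rule co[OF UD(2)])
  moreover have "(if t = k then f k else 0) = f t" for t using f by (cases "t = k") simp_all
  ultimately have fq: "f = ?q (w \<zero>[M] (f k))" by (simp only:)
  have wU': "w \<zero>[M] (f k) : U'" using UD(2) unfolding U'_def by blast
  show "f : ?q ` U'" by (rule image_eqI, rule fq, rule wU')
 qed auto
 have ker: "U = {z : U'. ?q z = \<zero>[thin {k}]}"
 proof (intro equalityI subsetI)
  fix u assume u: "u : U"
  have "u = w u 0" using UM[OF u] scal_zero_left[OF A lm y(1)] by (simp add: w_def)
  then have "co u = 0" using co[OF u, of 0] by simp
  then have "?q u = 0" by (simp only: zero_fun_def if_cancel)
  then show "u : {z : U'. ?q z = \<zero>[thin {k}]}" using UU'[OF u] by simp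
 next
  fix z assume z: "z : {z : U'. ?q z = \<zero>[thin {k}]}"
  then obtain u c where uc: "z = w u c" "u : U" unfolding U'_def by blast
  have "?q z = 0" using z by simp
  from fun_cong[OF this, of k] have "co z = 0" by simp
  then have "c = 0" using co[OF uc(2), of c] unfolding uc(1) by simp
  then have "z = u" unfolding uc(1) w_def using UM[OF uc(2)] scal_zero_left[OF A lm y(1)] by simp
  then show "z : U" using uc by simp
 qed
 have UU'': "U \<subseteq> U'" using UU' by blast
 have "filtered_by KP X (M(|carrier := U'|))"
  by (rule filtered_step[OF lm U subU' UU'' fil X lm_thin[OF cv] q im ker])
 then show ?thesis using subU' UU'' yU' by blast
qed

text \<open>Composition series exist, with factors at the vertices where the module is nonzero only.\<close>
lemma filtered_components:
 assumes M: "fd_module KP M" and S: "!!k x. k : V ==> k ~: S ==> x : car M ==> E k k *[M] x = \<zero>[M]"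
 shows "filtered_by KP ((%k. thin {k}) ` S) M"
proof -
 let ?X = "(%k. thin {k}) ` S"
 note A = fdKP
 have lm: "left_module KP M" using M by (simp add: fd_module_def)
 interpret lmodule KP M by (rule lmodule.intro) fact
 obtain B where B: "finite B" "B \<subseteq> car M"
  "!!U x. kclosed KP M U ==> B \<subseteq> U ==> x : car M ==> x : U"
  using fd_module_generators[OF A M] by metis
 define good where "good U \<longleftrightarrow> submod U KP M & filtered_by KP ?X (M(|carrier := U|))" for U
 have "EX U. good U & (ALL k:V. k + m > Suc n --> (ALL x:car M. E k k *[M] x : U))" for m
 proof (induction m)
  case 0
  have "left_module KP (M(|carrier := {\<zero>[M]}|))" by (intro lm_sub lm submodule_zero)
  then have "good {\<zero>[M]}" unfolding good_def using submodule_zero[OF lm] by (auto intro: filtered_zero)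
  then show ?case by (intro exI[of _ "{\<zero>[M]}"]) (auto simp: V_def)
 next
  case (Suc m)
  then obtain U where U: "good U" "!!k x. k : V ==> k + m > Suc n ==> x : car M ==> E k k *[M] x : U" by blast
  define k where "k = Suc n - m"
  show ?case
  proof (cases "k : V")
  case False
  then have "ALL k:V. k + Suc m > Suc n --> k + m > Suc n" by (auto simp: k_def V_def)
  then show ?thesis using U by blast
  next
  case k: True
  have Ek: "E k k : car KP" using q_refl[OF k] by simp
  have "EX U'. good U' & U \<subseteq> U' & (ALL b:B'. E k k *[M] b : U')" if "finite B'" "B' \<subseteq> B" for B'
  using that
  proof (induction B')
  case empty then show ?case using U(1) by blast
  next
  case (insert b B')
  then obtain U' where U': "good U'" "U \<subseteq> U'" "ALL b:B'. E k k *[M] b : U'" by auto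
  have b: "b : car M" using insert.prems B(2) by blast
  have sub': "submod U' KP M" and fil': "filtered_by KP ?X (M(|carrier := U'|))"
  using U'(1) by (simp_all add: good_def)
  show ?case
  proof (cases "k : S")
  case False
  then have "E k k *[M] b : U'" using S[OF k False b] submoduleD(2)[OF sub'] by simp
  then show ?thesis using U' by (intro exI[of _ U']) simp
  next
  case True
  have y: "E k k *[M] b : car M" using Ek b by simp
  have "EX W. submod W KP M & U' \<subseteq> W & E k k *[M] b : W & filtered_by KP ?X (M(|carrier := W|))"
  proof (rule add_vector[OF lm sub' fil' k _ y])
  show "thin {k} : ?X" using True by blast
  show "E k k *[M] (E k k *[M] b) = E k k *[M] b" by (rule E_smult_id(1)[OF lm b q_refl[OF k]])
  fix j assume j: "(k, j) : q" "j ~= k"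
  have jV: "j : V" "j + m > Suc n" using j q_dom[OF j(1)] q_le[OF j(1)] by (auto simp: k_def)
  have "E j k *[M] b : car M" using j b by simp
  then have "E j j *[M] (E j k *[M] b) : U'" using U(2)[OF jV] U'(2) by blast
  then show "E j k *[M] (E k k *[M] b) : U'" using E_smult_id[OF lm b j(1)] by simp
  qed
  then obtain W where W: "submod W KP M" "U' \<subseteq> W" "E k k *[M] b : W"
  "filtered_by KP ?X (M(|carrier := W|))" by blast
  show ?thesis
  using W U'(2,3) by (intro exI[of _ W]) (auto simp: good_def)
  qed
  qed
  from this[OF B(1) subset_refl] obtain U' where U': "good U'" "U \<subseteq> U'" "ALL b:B. E k k *[M] b : U'" by blast
  have kc: "kclosed KP M U'" using U'(1) submodule_kclosed[OF A lm] by (simp add: good_def)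
  have "kclosed KP M {x : car M. E k k *[M] x : U'}"
  using kc Ek scal_closed[OF A lm] unfolding kclosed_def
  by (auto simp: smult_r_distr smult_scal[OF A lm])
  moreover have "B \<subseteq> {x : car M. E k k *[M] x : U'}" using B(2) U'(3) by blast
  ultimately have new: "E k k *[M] x : U'" if "x : car M" for x using B(3)[of "{x : car M. E k k *[M] x : U'}" x] that by simp
  have "E l l *[M] x : U'" if l: "l : V" "l + Suc m > Suc n" and x: "x : car M" for l x
  proof (cases "l = k")
  case True then show ?thesis using new x by simp
  next
  case False
  then have "l + m > Suc n" using l by (auto simp: k_def)
  then show ?thesis using U(2)[OF l(1) _ x] U'(2) by blast
  qed
  then show ?thesis using U'(1) by (intro exI[of _ U']) simp
  qed
 qed
 from this[of "Suc n"] obtain U where U: "good U" "ALL k:V. k + Suc n > Suc n --> (ALL x:car M. E k k *[M] x : U)"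
  by blast
 have sub: "submod U KP M" using U(1) by (simp add: good_def)
 have "U = car M"
 proof
  show "U \<subseteq> car M" by (rule submoduleD(1)[OF sub])
  show "car M \<subseteq> U"
  proof
  fix x assume x: "x : car M"
  show "x : U"
  by (rule kclosed_components[OF lm submodule_kclosed[OF A lm sub] x]) (use U(2) x in "auto simp: V_def")
  qed
 qed
 then show ?thesis using U(1) by (simp add: good_def)
qed

lemma filtered_componentsD:
 assumes fil: "filtered_by KP X M" and lm: "left_module KP M" and XS: "!!N. N : X ==> left_module KP N"
  and k: "k : V" and Xk: "!!N x. N : X ==> x : car N ==> E k k *[N] x = \<zero>[N]"
 shows "ALL x:car M. E k k *[M] x = \<zero>[M]"
proof (rule filtered_induct[OF fil lm XS])
 interpret lmodule KP M by (rule lmodule.intro) fact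
 have Ek: "E k k : car KP" using q_refl[OF k] by simp
 show "ALL x:{\<zero>[M]}. E k k *[M] x = \<zero>[M]" using Ek by simp
 fix U W N h
 assume *: "submod U KP M" "submod W KP M" "U \<subseteq> W" "N : X"
  "h : module_hom KP (M(|carrier := W|)) N" "h ` W = car N" "U = {x : W. h x = \<zero>[N]}"
  "ALL x:U. E k k *[M] x = \<zero>[M]"
 show "ALL x:W. E k k *[M] x = \<zero>[M]"
 proof
  fix x assume x: "x : W"
  have xM: "x : car M" using x submoduleD(1)[OF *(2)] by blast
  have ExW: "E k k *[M] x : W" by (rule submoduleD(4)[OF *(2) Ek x])
  have "h (E k k *[M] x) = E k k *[N] h x" using homD(3)[OF *(5) Ek, of x] x by simp
  also have "... = \<zero>[N]" using Xk[OF *(4)] *(6) x by blast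
  finally have "E k k *[M] x : U" unfolding *(7) using ExW by simp
  then have "E k k *[M] (E k k *[M] x) = \<zero>[M]" using *(8) by blast
  then show "E k k *[M] x = \<zero>[M]" using E_smult_id(1)[OF lm xM q_refl[OF k]] by simp
 qed
qed simp

definition vx :: "nat => nat" where "vx i = (if i = 0 then Suc n else i)"

definition below :: "nat => nat set" where "below i = {k : V. i = 0 \<or> (i, k) : r}"

abbreviation Sim :: "nat => ('k mat, 'k vec) module" where "Sim \<equiv> suspension_simple n"
abbreviation ord :: "nat rel" where "ord \<equiv> (lower_ext n r)\<inverse>"

abbreviation Del where "Del == standard KP ord Sim"
abbreviation Nab where "Nab == costandard KP ord Sim"
abbreviation Hom where "Hom == module_hom KP"


lemma Sim_vx: "Sim i = vertex_simple (vx i)"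
 by (simp add: suspension_simple_def vx_def)

lemma vx_V [simp]: "i : {0..n} ==> vx i : V" by (auto simp: vx_def V_def)

lemma below_eq: "i : {0..n} ==> vx ` {j. (j, i) : ord} = below i"
proof (intro equalityI subsetI)
 fix k assume i: "i : {0..n}" and "k : vx ` {j. (j, i) : ord}"
 then obtain j where j: "k = vx j" "(i, j) : lower_ext n r" by auto
 then show "k : below i" using r_dom[of i j] by (auto simp: lower_ext_def below_def vx_def V_def)
next
 fix k assume i: "i : {0..n}" and k: "k : below i"
 show "k : vx ` {j. (j, i) : ord}"
 proof (cases "i = 0")
  case True
  show ?thesis
  proof (cases "k = Suc n")
  case k': True then show ?thesis using True by (intro image_eqI[of _ _ 0]) (auto simp: vx_def lower_ext_def)
  next
  case False then show ?thesis using True k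
  by (intro image_eqI[of _ _ k]) (auto simp: vx_def lower_ext_def below_def V_def)
  qed
 next
  case False
  then have "(i, k) : r" using k by (simp add: below_def)
  then show ?thesis using r_dom[of i k] by (intro image_eqI[of _ _ k]) (auto simp: vx_def lower_ext_def)
 qed
qed

lemma left_module_Sim: "i : {0..n} ==> left_module KP (Sim i)"
 using vertex_simple_iso(1) by (simp add: Sim_vx)

lemma ord_dom: "(j, i) : ord ==> j : {0..n} & i : {0..n}"
 using r_dom[of i j] by (auto simp: lower_ext_def)

lemma composition_factors_belowI:
 assumes i: "i : {0..n}" and M: "fd_module KP M"
  and E: "!!k x. k : V ==> k ~: below i ==> x : car M ==> E k k *[M] x = \<zero>[M]"
 shows "composition_factors_below KP ord Sim i M"
 unfolding composition_factors_below_def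
proof (rule filtered_by_iso)
 show "filtered_by KP ((%k. thin {k}) ` below i) M" by (rule filtered_components[OF M E])
 have bV: "below i \<subseteq> V" by (auto simp: below_def)
 show "left_module KP M" using M by (simp add: fd_module_def)
 then show "left_module KP M" .
 fix N assume "N : (%k. thin {k}) ` below i"
 then obtain k where k: "k : below i" "N = thin {k}" by blast
 then obtain j where j: "k = vx j" "(j, i) : ord" using below_eq[OF i] by blast
 have kV: "k : V" using k bV by blast
 show "left_module KP N" using k lm_thin[OF convex_singleton[OF kV]] by simp
 show "EX N':{Sim j |j. (j, i) : ord}. left_module KP N' & isomorphic KP N N'"
  using j k vertex_simple_iso[OF kV] by (intro bexI[of _ "Sim j"]) (auto simp: Sim_vx)
qed (rule iso_refl)

lemma composition_factors_belowD:
 assumes i: "i : {0..n}" and lm: "left_module KP M" and cf: "composition_factors_below KP ord Sim i M"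
  and k: "k : V" "k ~: below i" and x: "x : car M"
 shows "E k k *[M] x = \<zero>[M]"
proof -
 have "ALL x:car M. E k k *[M] x = \<zero>[M]"
 proof (rule filtered_componentsD[OF cf[unfolded composition_factors_below_def] lm _ k(1)])
  fix N :: "('k mat, 'k vec) module" assume "N : {Sim j |j. (j, i) : ord}"
  then obtain j where j: "N = Sim j" "(j, i) : ord" by blast
  have j0: "j : {0..n}" using ord_dom[OF j(2)] by blast
  show "left_module KP N" using j(1) left_module_Sim[OF j0] by simp
  have "vx j : below i" using below_eq[OF i] j(2) by blast
  then have ne: "vx j ~= k" using k(2) by blast
  fix x assume "x : car N"
  then have x: "x : carrier_vec 1" by (simp add: j(1) Sim_vx vertex_simple_def)
  have "E k k $$ (vx j - 1, vx j - 1) = 0"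
  using E_entry[OF k(1) k(1) vx_V[OF j0] vx_V[OF j0]] ne by (simp add: ent_def)
  then show "E k k *[N] x = \<zero>[N]" using x by (auto simp: j(1) Sim_vx vertex_simple_def intro!: eq_vecI)
 qed
 then show ?thesis using x by blast
qed

section \<open>The simple modules\<close>

definition up :: "nat => nat set" where "up i = {k. (i, k) : q}"
definition down :: "nat => nat set" where "down i = {k. (k, i) : q}"
definition unit :: "nat => nat => 'k" where "unit k = (%t. if t = k then 1 else 0)"

lemma convex_up: "convex (up i)"
 unfolding convex_def up_def using q_dom q_trans by blast

lemma convex_down: "convex (down i)"
 unfolding convex_def down_def using q_dom q_trans by blast

lemma convexD: "convex S ==> k : S ==> k : V"
 by (auto simp: convex_def)

lemma unit_thin [simp]: "k : S ==> unit k : car (thin S)"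
 by (auto simp: unit_def)

lemma thin_E_unit:
 assumes "convex S" "(i, j) : q" "i : S"
 shows "E j i *[thin S] unit i = (if j : S then unit j else 0)"
 using thin_E[OF assms(1,2) unit_thin[OF assms(3)]] by (auto simp: unit_def fun_eq_iff)

text \<open>An interval module with least element \<open>v\<close> is generated at \<open>v\<close>; the relations on the
generator are that it vanishes outside \<open>S\<close>.\<close>
lemma thin_hom_exists:
 assumes S: "convex S" and v: "v : S" "!!k. k : S ==> (v, k) : q"
  and lm: "left_module KP X" and y: "y : car X" "E v v *[X] y = y"
  and out: "!!k. (v, k) : q ==> k ~: S ==> E k v *[X] y = \<zero>[X]"
 shows "EX h:Hom (thin S) X. h (unit v) = y"
proof -
 interpret lmodule KP X by (rule lmodule.intro) fact
 note A = fdKP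
 have vV: "v : V" by (rule convexD[OF S v(1)])
 define col :: "(nat => 'k) => 'k mat" where
  "col ph = mat (Suc n) (Suc n) (%(a, b). if Suc b = v then ph (Suc a) else 0)" for ph
 have col: "ent (col ph) a b = (if b = v then ph a else 0)" if "a : V" "b : V" for ph a b
  using that by (simp add: col_def V_pred)
 have col_mat: "col ph : carrier_mat (Suc n) (Suc n)" for ph by (simp add: col_def)
 have colKP: "col ph : car KP" if "ph : car (thin S)" for ph
 proof (rule KP_I[OF col_mat])
  fix i j assume ij: "i : V" "j : V" "(i, j) ~: q"
  show "ent (col ph) j i = 0"
  proof (cases "i = v & j : S")
  case True then show ?thesis using v(2)[of j] ij by simp
  next
  case False then show ?thesis using that ij by (auto simp: col)
  qed
 qed
 have col_E: "E l j * col ph = ph j \<cdot>\<^sub>m E l v" if "j : V" "l : V" for ph j l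
 proof (rule KP_eqI)
  fix a b assume ab: "a : V" "b : V"
  have "ent (E l j * col ph) a b = (\<Sum>c\<in>V. if c = j then (if a = l & b = v then ph j else 0) else 0)"
  unfolding KP_mult_entry[OF E_mat col_mat ab]
  by (rule sum.cong) (use ab that in "auto simp: col")
  also have "... = (if a = l & b = v then ph j else 0)" using that by simp
  finally show "ent (E l j * col ph) a b = ent (ph j \<cdot>\<^sub>m E l v) a b" using ab that vV by simp
 qed (use col_mat in \<open>auto intro!: mult_carrier_mat[of _ "Suc n" "Suc n"]\<close>)
 let ?h = "%ph. col ph *[X] y"
 have hom: "?h : Hom (thin S) X"
 proof (rule hom_criterion[OF lm_thin[OF S] lm])
  fix ph assume ph: "ph : car (thin S)"
  show "?h ph : car X" by (rule smult_closed[OF colKP[OF ph] y(1)])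
  show "?h (scal KP (thin S) c ph) = scal KP X c (?h ph)" for c
  proof -
  have "col (%t. c * ph t) = c \<cdot>\<^sub>m col ph"
  by (rule KP_eqI) (use col_mat in "simp_all add: col")
  then show ?thesis using scalKP[OF colKP[OF ph] lm y(1)] scal_thin[OF S ph] by simp
  qed
  show "?h (ph +[thin S] om) = ?h ph +[X] ?h om" if om: "om : car (thin S)" for om
  proof -
  have "col (ph + om) = col ph + col om"
  by (rule KP_eqI) (use col_mat in "simp_all add: col")
  then show ?thesis using smult_l_distr[OF colKP[OF ph] colKP[OF om] y(1)] by simp
  qed
  fix j l assume jl: "(j, l) : q"
  have V: "j : V" "l : V" using q_dom[OF jl] by auto
  have th: "E l j *[thin S] ph = (%u. if u = l & l : S then ph j else 0)" by (rule thin_E[OF S jl ph])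
  have 1: "E l j *[X] ?h ph = (ph j \<cdot>\<^sub>m E l v) *[X] y"
  using smult_assoc[OF E_closed[OF jl] colKP[OF ph] y(1)] col_E[OF V] by simp
  show "?h (E l j *[thin S] ph) = E l j *[X] ?h ph"
  proof (cases "l : S")
  case True
  have "col (E l j *[thin S] ph) = ph j \<cdot>\<^sub>m E l v"
  by (rule KP_eqI[OF col_mat]) (use V vV True in "auto simp: col th")
  then show ?thesis using 1 by simp
  next
  case False
  have "col (E l j *[thin S] ph) = 0\<^sub>m (Suc n) (Suc n)"
  by (rule KP_eqI[OF col_mat]) (use False in "auto simp: col th")
  then have L: "?h (E l j *[thin S] ph) = \<zero>[X]" using smult_zero_left[OF y(1)] by simp
  have "(ph j \<cdot>\<^sub>m E l v) *[X] y = \<zero>[X]"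
  proof (cases "ph j = 0")
  case True
  have "(0 :: 'k) \<cdot>\<^sub>m E l v = 0\<^sub>m (Suc n) (Suc n)" by (rule KP_eqI) (use V vV in auto)
  then show ?thesis using True smult_zero_left[OF y(1)] by simp
  next
  case nz: False
  then have "j : S" using ph by auto
  then have vl: "(v, l) : q" using v(2) jl q_trans by blast
  then show ?thesis using scalKP[OF E_closed[OF vl] lm y(1)] out[OF vl False] scal_zero_right[OF A lm] by simp
  qed
  then show ?thesis using 1 L by simp
  qed
 qed
 have "?h (unit v) = y"
 proof -
  have "col (unit v) = E v v" by (rule KP_eqI[OF col_mat]) (use vV in "auto simp: col unit_def")
  then show ?thesis using y(2) by simp
 qed
 then show ?thesis by (rule bexI[OF _ hom])
qed

lemma indexes_simples_Sim: "indexes_simples KP {0..n} Sim"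
 unfolding indexes_simples_def
proof (intro conjI ballI allI impI)
 fix i assume i: "i : {0..n}"
 have k: "vx i : V" using i by simp
 note vs = vertex_simple_iso[OF k]
 show "fd_module KP (Sim i)" unfolding Sim_vx
  by (rule fd_module_iso[OF fdKP fd_thin[OF convex_singleton[OF k]] vs])
 show "simple_module KP (Sim i)" unfolding simple_module_def
 proof (intro conjI allI impI)
  show lm: "left_module KP (Sim i)" by (rule left_module_Sim[OF i])
  have c: "car (Sim i) = carrier_vec 1" "\<zero>[Sim i] = 0\<^sub>v 1" by (simp_all add: Sim_vx vertex_simple_def)
  have "unit_vec 1 0 : (carrier_vec 1 :: 'k vec set)" "unit_vec 1 0 ~= (0\<^sub>v 1 :: 'k vec)"
  by (auto dest: arg_cong[of _ _ "%v. v $ 0"])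
  then show "car (Sim i) ~= {\<zero>[Sim i]}" unfolding c by blast
  fix U assume U: "submod U KP (Sim i)"
  show "U = {\<zero>[Sim i]} \<or> U = car (Sim i)"
  proof (rule disjCI)
  assume "U ~= car (Sim i)"
  have UD: "U \<subseteq> carrier_vec 1" using submoduleD(1)[OF U] c by simp
  have "u = 0\<^sub>v 1" if u: "u : U" for u
  proof (rule ccontr)
  assume "u ~= 0\<^sub>v 1"
  have ud: "u : carrier_vec 1" using UD u by blast
  have u0: "u $ 0 ~= 0"
  proof
  assume "u $ 0 = 0"
  then have "u = 0\<^sub>v 1" using ud by (intro eq_vecI) auto
  then show False using \<open>u ~= 0\<^sub>v 1\<close> by simp
  qed
  have "v : U" if v: "v : carrier_vec 1" for v
  proof -
  let ?c = "v $ 0 / u $ 0"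
  have "(?c \<cdot>\<^sub>m 1\<^sub>m (Suc n)) *[Sim i] u : U" by (rule submoduleD(4)[OF U]) (use u in auto)
  moreover have "(?c \<cdot>\<^sub>m 1\<^sub>m (Suc n)) *[Sim i] u = v"
  using v ud u0 k by (intro eq_vecI) (auto simp: Sim_vx vertex_simple_def V_def)
  ultimately show ?thesis by simp
  qed
  then show False using \<open>U ~= car (Sim i)\<close> UD c by blast
  qed
  then have "U \<subseteq> {\<zero>[Sim i]}" unfolding c(2) by blast
  then show "U = {\<zero>[Sim i]}" using submoduleD(2)[OF U] by blast
  qed
 qed
next
 fix i j assume ij: "i : {0..n}" "j : {0..n}" "isomorphic KP (Sim i) (Sim j)"
 show "i = j"
 proof (rule ccontr)
  assume "i ~= j"
  then have ne: "vx i ~= vx j" using ij by (auto simp: vx_def split: if_splits)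
  obtain f g where f: "f : Hom (Sim i) (Sim j)" and g: "g : Hom (Sim j) (Sim i)"
  and gf: "!!x. x : car (Sim i) ==> g (f x) = x"
  using isomorphicE[OF ij(3) left_module_Sim[OF ij(1)]] by metis
  let ?e = "unit_vec 1 0 :: 'k vec"
  have e: "?e : car (Sim i)" by (simp add: Sim_vx vertex_simple_def)
  have Ei: "E (vx i) (vx i) : car KP" using q_refl[OF vx_V[OF ij(1)]] by simp
  have 1: "E (vx i) (vx i) *[Sim i] ?e = ?e"
  using E_entry[of "vx i" "vx i" "vx i" "vx i"] vx_V[OF ij(1)]
  by (intro eq_vecI) (auto simp: Sim_vx vertex_simple_def ent_def)
  have fe: "f ?e : carrier_vec 1" using homD(1)[OF f e] by (simp add: Sim_vx vertex_simple_def)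
  have "f ?e = E (vx i) (vx i) *[Sim j] f ?e" using homD(3)[OF f Ei e] 1 by simp
  also have "... = \<zero>[Sim j]"
  using E_entry[of "vx i" "vx i" "vx j" "vx j"] vx_V[OF ij(1)] vx_V[OF ij(2)] ne fe
  by (intro eq_vecI) (auto simp: Sim_vx vertex_simple_def ent_def)
  finally have "?e = \<zero>[Sim i]"
  using gf[OF e] hom_zero[OF left_module_Sim[OF ij(2)] left_module_Sim[OF ij(1)] g] by simp
  then have "?e $ 0 = (0\<^sub>v 1 :: 'k vec) $ 0" by (simp add: Sim_vx vertex_simple_def)
  then show False by simp
 qed
next
 fix M :: "('k mat, 'k vec) module" assume M: "fd_module KP M & simple_module KP M"
 then have lm: "left_module KP M" by (simp add: fd_module_def)
 have simple: "U = {\<zero>[M]} \<or> U = car M" if "submod U KP M" for U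
  using M that unfolding simple_module_def by simp
 interpret lmodule KP M by (rule lmodule.intro) fact
 note A = fdKP
 have "car M ~= {\<zero>[M]}" using M unfolding simple_module_def by simp
 then have "EX x:car M. x ~= \<zero>[M]" using M.zero_closed by blast
 then obtain x where x: "x : car M" "x ~= \<zero>[M]" by blast
 define T where "T = {k : V. EX x:car M. E k k *[M] x ~= \<zero>[M]}"
 have "T ~= {}" using zero_components[OF lm x(1)] x unfolding T_def by blast
 have finT: "finite T" by (simp add: T_def)
 define k where "k = Max T"
 have "k : T" unfolding k_def using finT \<open>T ~= {}\<close> by (rule Max_in)
 then obtain z where k: "k : V" and z: "z : car M" "E k k *[M] z ~= \<zero>[M]" unfolding T_def by blast
 define y where "y = E k k *[M] z"
 have y: "y : car M" "y ~= \<zero>[M]" "E k k *[M] y = y"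
  using z q_refl[OF k] E_smult_id(1)[OF lm z(1) q_refl[OF k]] by (simp_all add: y_def)
 have above: "E j k *[M] y = \<zero>[M]" if "(k, j) : q" "j ~= k" for j
 proof (rule ccontr)
  assume "E j k *[M] y ~= \<zero>[M]"
  moreover have "E j j *[M] (E j k *[M] y) = E j k *[M] y" by (rule E_smult_id(1)[OF lm y(1) that(1)])
  moreover have "E j k *[M] y : car M" using that y by simp
  ultimately have "j : T" unfolding T_def using q_dom[OF that(1)] by auto
  then have "j \<le> k" unfolding k_def using finT by simp
  then show False using q_le[OF that(1)] that(2) by simp
 qed
 have fil0: "filtered_by KP {thin {k}} (M(|carrier := {\<zero>[M]}|))"
  by (rule filtered_zero) (use lm_sub[OF lm submodule_zero[OF lm]] in auto)
 obtain U where U: "submod U KP M" "y : U" "filtered_by KP {thin {k}} (M(|carrier := U|))"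
  using add_vector[OF lm submodule_zero[OF lm] fil0 k _ y(1,3)] above by auto
 have "U = car M" using simple[OF U(1)] U(2) y(2) by auto
 then have fil: "filtered_by KP {thin {k}} M" using U(3) by simp
 have out: "E j j *[M] x = \<zero>[M]" if "j : V" "j ~= k" "x : car M" for j x
 proof -
  have "ALL x:car M. E j j *[M] x = \<zero>[M]"
  proof (rule filtered_componentsD[OF fil lm _ that(1)])
  fix N x assume "N : {thin {k}}" "x : car N"
  then show "E j j *[N] x = \<zero>[N]" using thin_E_id[OF convex_singleton[OF k] that(1), of x] that(2) by (auto simp: fun_eq_iff)
  qed (use lm_thin[OF convex_singleton[OF k]] in simp)
  then show ?thesis using that(3) by blast
 qed
 note S = convex_singleton[OF k]
 note lmT = lm_thin[OF S]
 have "EX h:Hom (thin {k}) M. h (unit k) = y"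
 proof (rule thin_hom_exists[OF S _ _ lm y(1) y(3)])
  fix l assume "(k, l) : q" "l ~: {k}" then show "E l k *[M] y = \<zero>[M]" using above by simp
 qed (use q_refl[OF k] in simp_all)
 then obtain h where h: "h : Hom (thin {k}) M" "h (unit k) = y" by (rule bexE)
 have uk: "unit k : car (thin {k})" by (rule unit_thin) simp
 have "y : h ` car (thin {k})" using uk h(2) by (intro image_eqI[where x = "unit k"]) simp_all
 then have im: "h ` car (thin {k}) = car M"
  using simple[OF submodule_image[OF lmT lm h(1) submodule_carrier[OF lmT]]] y(2) by blast
 have "inj_on h (car (thin {k}))"
 proof (rule inj_onI)
  fix f g assume fg: "f : car (thin {k})" "g : car (thin {k})" "h f = h g"
  have e: "h u = scal KP M (u k) y" if u: "u : car (thin {k})" for u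
  proof -
  have "u = scal KP (thin {k}) (u k) (unit k)" unfolding scal_thin[OF S uk] by (rule ext) (use u in "simp add: unit_def")
  then have "h u = h (scal KP (thin {k}) (u k) (unit k))" by simp
  then show ?thesis unfolding scal_hom[OF A lmT lm h(1) uk] h(2) .
  qed
  have "scal KP M (f k - g k) y +[M] scal KP M (g k) y = scal KP M (g k) y"
  using scal_plus[OF A lm y(1), of "f k - g k" "g k"] fg(3) e[OF fg(1)] e[OF fg(2)] by simp
  then have "scal KP M (f k - g k) y = \<zero>[M]" using scal_closed[OF A lm y(1)] by (simp add: M.add.r_cancel_one)
  then have "f k = g k" using scal_eq_zero[OF A lm y(1)] y(2) by simp
  then show "f = g" by (intro ext) (use fg in "simp, metis")
 qed
 then have "isomorphic KP (thin {k}) M" unfolding isomorphic_def bij_betw_def using im by (intro bexI[OF _ h(1)] conjI)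
 from iso_sym[OF lmT this] have "isomorphic KP M (thin {k})" .
 then have iso: "isomorphic KP M (vertex_simple k)" using iso_trans vertex_simple_iso(2)[OF k] by blast
 define i where "i = (if k = Suc n then 0 else k)"
 have "i : {0..n}" "Sim i = vertex_simple k" using k by (auto simp: i_def Sim_vx vx_def V_def)
 then show "EX i:{0..n}. isomorphic KP M (Sim i)" using iso by (intro bexI[of _ i]) simp_all
qed

end

section \<open>Endomorphism algebras\<close>

lemma End_algebra_simps:
 "car (End_algebra A M) = module_hom A M M \<inter> extensional (car M)"
 "mult (End_algebra A M) = compose (car M)"
 "one (End_algebra A M) = (\<lambda>x\<in>car M. x)" "zero (End_algebra A M) = (\<lambda>x\<in>car M. \<zero>[M])"
 "add (End_algebra A M) = (%f g. \<lambda>x\<in>car M. f x +[M] g x)"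
 "smult (End_algebra A M) = (%c f. \<lambda>x\<in>car M. scal A M c (f x))"
 by (simp_all add: End_algebra_def scal_def)

context
 fixes A :: "('k::field, 'a) module" and M :: "('a, 'm) module"
 assumes A: "fd_algebra A" and lm: "left_module A M"
begin

interpretation lmodule A M by (rule lmI) (rule lm)

lemma End_memI: "f : module_hom A M M ==> restrict f (car M) : car (End_algebra A M)"
 unfolding End_algebra_simps
 by (intro IntI restrict_extensional homI) (auto simp: homD)

lemma End_eqI:
 assumes "f : car (End_algebra A M)" "g : car (End_algebra A M)" "!!x. x : car M ==> f x = g x"
 shows "f = g"
 by (rule extensionalityI[of _ "car M"]) (use assms in "auto simp: End_algebra_simps")

lemma End_hom: "f : car (End_algebra A M) ==> f : module_hom A M M"
 by (simp add: End_algebra_simps)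

lemma End_add_closed:
 assumes "f : module_hom A M M" "g : module_hom A M M"
 shows "(%x. f x +[M] g x) : module_hom A M M"
 using assms by (intro homI) (auto simp: homD smult_r_distr M.a_ac)

lemma End_scal_closed:
 assumes "f : module_hom A M M"
 shows "(%x. scal A M c (f x)) : module_hom A M M"
proof (intro homI)
 note f = homD[OF assms]
 fix x y assume xy: "x : car M" "y : car M"
 show "scal A M c (f x) : car M" using scal_closed[OF A lm f(1)[OF xy(1)]] .
 show "scal A M c (f (x +[M] y)) = scal A M c (f x) +[M] scal A M c (f y)"
  unfolding f(2)[OF xy] by (rule scal_add[OF A lm f(1)[OF xy(1)] f(1)[OF xy(2)]])
next
 note f = homD[OF assms]
 fix a x assume ax: "a : car A" "x : car M"
 show "scal A M c (f (a *[M] x)) = a *[M] scal A M c (f x)"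
  unfolding f(3)[OF ax] using smult_scal[OF A lm ax(1) f(1)[OF ax(2)]] by simp
qed

lemma vectorspace_End: "vectorspace class_ring (End_algebra A M)"
proof -
 let ?E = "End_algebra A M"
 have cl: "f x : car M" if "f : car ?E" "x : car M" for f x
  using homD(1)[OF End_hom[OF that(1)] that(2)] .
 have add: "f +[?E] g : car ?E" if "f : car ?E" "g : car ?E" for f g
  using End_memI[OF End_add_closed[OF End_hom[OF that(1)] End_hom[OF that(2)]]] by (simp add: End_algebra_simps(5))
 have add_app: "(f +[?E] g) x = f x +[M] g x" if "x : car M" for f g x
  using that by (simp add: End_algebra_simps(5))
 have scl: "c *[?E] f : car ?E" if "f : car ?E" for c f
  using End_memI[OF End_scal_closed[OF End_hom[OF that]]] by (simp add: End_algebra_simps(6))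
 have scl_app: "(c *[?E] f) x = scal A M c (f x)" if "x : car M" for c f x
  using that by (simp add: End_algebra_simps(6))
 have zero_hom: "(%x. \<zero>[M]) : module_hom A M M" by (rule homI) auto
 have zero: "\<zero>[?E] : car ?E" using End_memI[OF zero_hom] by (simp add: End_algebra_simps(4))
 have zero_app: "\<zero>[?E] x = \<zero>[M]" if "x : car M" for x using that by (simp add: End_algebra_simps(4))
 have ab: "abelian_group ?E"
 proof (rule abelian_groupI)
  fix f g h assume f: "f : car ?E" "g : car ?E" "h : car ?E"
  show "f +[?E] g : car ?E" by (rule add[OF f(1,2)])
  show "f +[?E] g +[?E] h = f +[?E] (g +[?E] h)"
  by (rule End_eqI) (use f cl in "simp_all add: add add_app M.a_assoc")
  show "f +[?E] g = g +[?E] f"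
  by (rule End_eqI) (use f cl in "simp_all add: add add_app M.a_comm")
  show "\<zero>[?E] +[?E] f = f"
  by (rule End_eqI) (use f cl in "simp_all add: add add_app zero zero_app")
  have neg: "(- 1) *[?E] f : car ?E" by (rule scl[OF f(1)])
  have "(- 1) *[?E] f +[?E] f = \<zero>[?E]"
  proof (rule End_eqI[OF add[OF neg f(1)] zero])
  fix x assume x: "x : car M"
  show "((- 1) *[?E] f +[?E] f) x = \<zero>[?E] x"
  using scal_minus_one[OF A lm cl[OF f(1) x]] cl[OF f(1) x] x
  by (simp add: add_app scl_app zero_app M.l_neg)
  qed
  then show "EX y:car ?E. y +[?E] f = \<zero>[?E]" using neg by blast
 qed (rule zero)
 have "Module.module class_ring ?E"
 proof (rule moduleI)
  show "cring (class_ring :: 'k ring)" by (meson class_field field.axioms(1) domain.axioms(1))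
  show "abelian_group ?E" by (rule ab)
  fix c d :: 'k and f g assume f: "f : car ?E" "g : car ?E"
  show "c *[?E] (f +[?E] g) = c *[?E] f +[?E] c *[?E] g"
  by (rule End_eqI) (use f cl in "simp_all add: add scl add_app scl_app scal_add[OF A lm]")
 next
  fix c d :: 'k and f assume f: "f : car ?E"
  show "c *[?E] f : car ?E" by (rule scl[OF f])
  show "(c +[class_ring] d) *[?E] f = c *[?E] f +[?E] d *[?E] f"
  by (rule End_eqI) (use f cl in "simp_all add: add scl add_app scl_app scal_plus[OF A lm]")
  show "(c \<otimes>\<^bsub>class_ring\<^esub> d) *[?E] f = c *[?E] (d *[?E] f)"
  by (rule End_eqI) (use f cl in "simp_all add: scl scl_app scal_scal[OF A lm]")
  show "\<one>\<^bsub>class_ring\<^esub> *[?E] f = f"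
  by (rule End_eqI) (use f cl in "simp_all add: scl scl_app scal_one[OF A lm]")
 qed
 then show ?thesis by (intro vectorspace.intro class_field)
qed

lemma End_dim_one:
 assumes ne: "car M ~= {\<zero>[M]}"
  and hom: "!!f. f : module_hom A M M ==> EX c. ALL x:car M. f x = scal A M c x"
 shows "vectorspace.dim class_ring (End_algebra A M) = 1"
proof -
 let ?E = "End_algebra A M"
 interpret VS: vectorspace class_ring ?E by (rule vectorspace_End)
 define I where "I = (\<lambda>x\<in>car M. x)"
 have I: "I : car ?E" unfolding I_def by (rule End_memI[OF module_hom_id])
 have span: "VS.span {I} = car ?E"
 proof
  show "VS.span {I} \<subseteq> car ?E" by (rule VS.span_is_subset2) (use I in simp)
  show "car ?E \<subseteq> VS.span {I}"
  proof
  fix f assume f: "f : car ?E"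
  obtain c where c: "ALL x:car M. f x = scal A M c x" using hom[OF End_hom[OF f]] by blast
  have S: "LinearCombinations.submodule class_ring (VS.span {I}) ?E" by (rule VS.span_is_submodule) (use I in simp)
  have cI: "c *[?E] I : VS.span {I}"
  using LinearCombinations.submodule.smult_closed[OF S, of c I] VS.in_own_span[of "{I}"] I by simp
  have "f = c *[?E] I"
  proof (rule End_eqI[OF f])
  show "c *[?E] I : car ?E" using VS.smult_closed[of c I] I by simp
  fix x assume "x : car M"
  then show "f x = (c *[?E] I) x" using c by (simp add: End_algebra_simps(6) I_def)
  qed
  then show "f : VS.span {I}" using cI by simp
  qed
 qed
 have "I ~= \<zero>[?E]"
 proof
  assume I0: "I = \<zero>[?E]"
  have "x = \<zero>[M]" if "x : car M" for x
  using fun_cong[OF I0, of x] that by (simp add: I_def End_algebra_simps(4))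
  then show False using ne M.zero_closed by blast
 qed
 moreover have "VS.span {} = {\<zero>[?E]}" by (rule VS.span_empty)
 ultimately have nospan: "VS.span {} ~= car ?E" using I by auto
 show ?thesis unfolding VS.dim_def
 proof (rule Least_equality)
  show "EX B. finite B & card B = 1 & B \<subseteq> car ?E & VS.span B = car ?E"
  using I span by (intro exI[of _ "{I}"]) simp
  fix m assume "EX B. finite B & card B = m & B \<subseteq> car ?E & VS.span B = car ?E"
  then obtain B where B: "finite B" "card B = m" "VS.span B = car ?E" by blast
  show "1 \<le> m"
  proof (rule ccontr)
  assume "\<not> 1 \<le> m"
  then have "card B = 0" using B(2) by simp
  then have "B = {}" using B(1) by (simp only: card_0_eq)
  then show False using B(3) nospan by simp
  qed
 qed
qed

end

context suspension begin

section \<open>Standard and costandard modules\<close>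

lemma thin_hom_eq:
 assumes S: "convex S" and v: "v : S" "!!k. k : S ==> (v, k) : q"
  and lm: "left_module KP X" and h: "h : Hom (thin S) X" "h' : Hom (thin S) X"
  and eq: "h (unit v) = h' (unit v)" and ph: "ph : car (thin S)"
 shows "h ph = h' ph"
proof -
 interpret lmodule KP X by (rule lmodule.intro) fact
 note A = fdKP
 note lmT = lm_thin[OF S]
 have kc: "kclosed KP (thin S) {om : car (thin S). h om = h' om}"
  unfolding kclosed_def
 proof (intro conjI ballI allI)
  show "\<zero>[thin S] : {om : car (thin S). h om = h' om}"
  using hom_zero[OF lmT lm h(1)] hom_zero[OF lmT lm h(2)] by simp
 next
  fix x y assume "x : {om : car (thin S). h om = h' om}" "y : {om : car (thin S). h om = h' om}"
  then show "x +[thin S] y : {om : car (thin S). h om = h' om}"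
  using homD(2)[OF h(1), of x y] homD(2)[OF h(2), of x y] by simp
 next
  fix c x assume "x : {om : car (thin S). h om = h' om}"
  then show "scal KP (thin S) c x : {om : car (thin S). h om = h' om}"
  using scal_hom[OF A lmT lm h(1), of x c] scal_hom[OF A lmT lm h(2), of x c] scal_closed[OF A lmT, of x c] by simp
 qed blast
 have "ph : {om : car (thin S). h om = h' om}"
 proof (rule kclosed_components[OF lmT kc ph])
  fix k assume k: "k : V"
  have e: "E k k *[thin S] ph = (%u. if u = k then ph k else 0)" by (rule thin_E_id[OF S k ph])
  show "E k k *[thin S] ph : {om : car (thin S). h om = h' om}"
  proof (cases "k : S")
  case True
  have uk: "E k v *[thin S] unit v = unit k" using thin_E_unit[OF S v(2)[OF True] v(1)] True by simp
  have "E k k *[thin S] ph = scal KP (thin S) (ph k) (unit k)"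
  unfolding e scal_thin[OF S unit_thin[OF True]] by (rule ext) (simp add: unit_def)
  moreover have "h (unit k) = h' (unit k)"
  unfolding uk[symmetric] homD(3)[OF h(1) E_closed[OF v(2)[OF True]] unit_thin[OF v(1)]]
  homD(3)[OF h(2) E_closed[OF v(2)[OF True]] unit_thin[OF v(1)]] eq ..
  moreover have "scal KP (thin S) (ph k) (unit k) : car (thin S)" by (rule scal_closed[OF A lmT unit_thin[OF True]])
  ultimately show ?thesis
  using scal_hom[OF A lmT lm h(1) unit_thin[OF True], of "ph k"] scal_hom[OF A lmT lm h(2) unit_thin[OF True], of "ph k"] by simp
  next
  case False
  have "E k k *[thin S] ph = \<zero>[thin S]" unfolding e using ph False by (auto simp: zero_fun_def)
  then show ?thesis using kc by (simp only: kclosed_def)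
  qed
 qed
 then show ?thesis by blast
qed

lemma thin_restrict:
 assumes S: "convex S" "convex S'" "S' \<subseteq> S" and low: "!!j l. j : S ==> l : S' ==> (j, l) : q ==> j : S'"
 shows "(%ph t. if t : S' then ph t else 0) : Hom (thin S) (thin S')"
proof (rule hom_criterion[OF lm_thin[OF S(1)] lm_thin[OF S(2)]])
 fix ph c assume ph: "ph : car (thin S)"
 have r: "(%t. if t : S' then ph t else 0) : car (thin S')" by simp
 show "(%t. if t : S' then scal KP (thin S) c ph t else 0) = scal KP (thin S') c (%t. if t : S' then ph t else 0)"
  unfolding scal_thin[OF S(2) r] scal_thin[OF S(1) ph] by (rule ext) simp
next
 fix ph i j assume ph: "ph : car (thin S)" and ij: "(i, j) : q"
 have r: "(%t. if t : S' then ph t else 0) : car (thin S')" by simp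
 show "(%t. if t : S' then (E j i *[thin S] ph) t else 0) = E j i *[thin S'] (%t. if t : S' then ph t else 0)"
  unfolding thin_E[OF S(2) ij r] thin_E[OF S(1) ij ph]
 proof
  fix t show "(if t : S' then if t = j & j : S then ph i else 0 else 0) =
  (if t = j & j : S' then if i : S' then ph i else 0 else 0)"
  proof (cases "t = j & j : S' & i ~: S'")
  case True
  then have "i ~: S" using low ij by blast
  then show ?thesis using True ph by simp
  qed (use S(3) in auto)
 qed
qed (auto simp: fun_eq_iff)

lemma thin_incl:
 assumes S: "convex S" "convex S'" "S' \<subseteq> S" and high: "!!j l. j : S' ==> l : S ==> (j, l) : q ==> l : S'"
 shows "(%ph. ph) : Hom (thin S') (thin S)" "submod (car (thin S')) KP (thin S)"
proof -
 have sub: "car (thin S') \<subseteq> car (thin S)" using S(3) by auto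
 show hom: "(%ph. ph) : Hom (thin S') (thin S)"
 proof (rule hom_criterion[OF lm_thin[OF S(2)] lm_thin[OF S(1)]])
  fix ph assume ph: "ph : car (thin S')"
  show phS: "ph : car (thin S)" using ph sub by blast
  show "scal KP (thin S') c ph = scal KP (thin S) c ph" for c
  unfolding scal_thin[OF S(2) ph] scal_thin[OF S(1) phS] ..
  fix i j assume ij: "(i, j) : q"
  show "E j i *[thin S'] ph = E j i *[thin S] ph"
  unfolding thin_E[OF S(2) ij ph] thin_E[OF S(1) ij phS]
  proof
  fix u show "(if u = j & j : S' then ph i else 0) = (if u = j & j : S then ph i else 0)"
  proof (cases "i : S'")
  case True then show ?thesis using high[OF True _ ij] S(3) by auto
  next
  case False then show ?thesis using ph by simp
  qed
  qed
 qed simp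
 have "(%ph. ph) ` car (thin S') = car (thin S')" by simp
 then show "submod (car (thin S')) KP (thin S)"
  using submodule_image[OF lm_thin[OF S(2)] lm_thin[OF S(1)] hom
  submodule_carrier[OF lm_thin[OF S(2)]]] by simp
qed

lemma projective_thin_up:
 assumes i: "i : V" shows "projective KP (thin (up i))"
 unfolding projective_def
proof (intro conjI allI impI ballI)
 note S = convex_up[of i]
 have v: "i : up i" "!!k. k : up i ==> (i, k) : q" using q_refl[OF i] by (auto simp: up_def)
 show "fd_module KP (thin (up i))" by (rule fd_thin[OF S])
 fix M N :: "('k mat, 'k vec) module" and g f
 assume MN: "fd_module KP M & fd_module KP N" and g: "g : Hom M N" and f: "f : Hom (thin (up i)) N"
  and surj: "g ` car M = car N"
 have lm: "left_module KP M" "left_module KP N" using MN by (simp_all add: fd_module_def)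
 have Ei: "E i i : car KP" using q_refl[OF i] by simp
 have fu: "f (unit i) : car N" by (rule homD(1)[OF f unit_thin[OF v(1)]])
 then obtain y where y: "y : car M" "g y = f (unit i)" using surj by (metis imageE)
 let ?y = "E i i *[M] y"
 have yM: "?y : car M" by (rule E_smult_closed[OF lm(1) y(1) q_refl[OF i]])
 have uu: "E i i *[thin (up i)] unit i = unit i" using thin_E_unit[OF S q_refl[OF i] v(1)] v(1) by simp
 have gy: "g ?y = f (unit i)"
  using homD(3)[OF g Ei y(1)] y(2) homD(3)[OF f Ei unit_thin[OF v(1)]] uu by simp
 have "EX h:Hom (thin (up i)) M. h (unit i) = ?y"
  by (rule thin_hom_exists[OF S v lm(1) yM E_smult_id(1)[OF lm(1) y(1) q_refl[OF i]]])
  (auto simp: up_def)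
 then obtain h where h: "h : Hom (thin (up i)) M" "h (unit i) = ?y" by blast
 have "g (h ph) = f ph" if "ph : car (thin (up i))" for ph
 proof -
  have e: "(%x. g (h x)) (unit i) = f (unit i)" using gy by (simp only: h(2))
  show ?thesis using thin_hom_eq[OF S v lm(2) hom_comp[OF h(1) g] f e that] by simp
 qed
 then show "EX h:Hom (thin (up i)) M. ALL x:car (thin (up i)). g (h x) = f x" using h(1) by blast
qed

text \<open>A submodule that covers the simple factor module contains a vector with coordinate \<open>1\<close> at
\<open>i\<close>, hence the generator.\<close>
lemma thin_up_cover:
 assumes i: "i : V" shows "is_projective_cover KP (thin (up i)) (vertex_simple i)"
proof -
 note S = convex_up[of i]
 note lmT = lm_thin[OF S]
 have v: "i : up i" "!!k. k : up i ==> (i, k) : q" using q_refl[OF i] by (auto simp: up_def)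
 have r: "(%ph t. if t : {i} then ph t else 0) : Hom (thin (up i)) (thin {i})"
 proof (rule thin_restrict[OF S convex_singleton[OF i]])
  show "{i} \<subseteq> up i" using v(1) by simp
  fix j l assume jl: "j : up i" "l : {i}" "(j, l) : q"
  have "(j, i) : q" using jl(2,3) by simp
  from q_antisym[OF this v(2)[OF jl(1)]] show "j : {i}" by simp
 qed
 obtain f where f: "f : Hom (thin {i}) (vertex_simple i)" "bij_betw f (car (thin {i})) (car (vertex_simple i))"
  using vertex_simple_iso(2)[OF i] unfolding isomorphic_def by blast
 let ?p = "%ph. f (%t. if t : {i} then ph t else 0)"
 have p: "?p : Hom (thin (up i)) (vertex_simple i)" by (rule hom_comp[OF r f(1)])
 have im: "?p ` car (thin (up i)) = car (vertex_simple i)"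
 proof (intro equalityI subsetI)
  fix w :: "'k vec" assume "w : car (vertex_simple i)"
  then obtain ph where ph: "ph : car (thin {i})" "w = f ph" using f(2) unfolding bij_betw_def by blast
  have "(%t. if t : {i} then ph t else 0) = ph" by (rule ext) (use ph(1) in simp)
  moreover have "ph : car (thin (up i))" using ph(1) v(1) by auto
  ultimately show "w : ?p ` car (thin (up i))" using ph(2) by (intro image_eqI[of _ _ ph]) simp_all
 next
  fix w assume "w : ?p ` car (thin (up i))"
  then obtain ph where ph: "w = ?p ph" "ph : car (thin (up i))" by (rule imageE)
  show "w : car (vertex_simple i)" unfolding ph(1) by (rule homD(1)[OF p ph(2)])
 qed
 have ker: "ph i = 0" if ph: "ph : car (thin (up i))" "?p ph = \<zero>[vertex_simple i]" for ph
 proof -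
  have "f (%t. if t : {i} then ph t else 0) = f \<zero>[thin {i}]"
  using ph(2) hom_zero[OF lm_thin[OF convex_singleton[OF i]] vertex_simple_iso(1)[OF i] f(1)] by simp
  then have "(%t. if t : {i} then ph t else 0) = \<zero>[thin {i}]"
  using f(2) unfolding bij_betw_def by (elim conjE, intro inj_onD[of f "car (thin {i})"]) simp_all
  from fun_cong[OF this, of i] show ?thesis by simp
 qed
 have sup: "U = car (thin (up i))"
  if U: "submod U KP (thin (up i))" "U <+>\<^bsub>thin (up i)\<^esub> a_kernel (thin (up i)) (vertex_simple i) ?p = car (thin (up i))" for U
 proof -
  note UD = submoduleD[OF U(1)]
  have kc: "kclosed KP (thin (up i)) U" by (rule submodule_kclosed[OF fdKP lmT U(1)])
  have "unit i : U <+>\<^bsub>thin (up i)\<^esub> a_kernel (thin (up i)) (vertex_simple i) ?p" unfolding U(2) by (rule unit_thin[OF v(1)])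
  then obtain u w where uw: "u : U" "w : a_kernel (thin (up i)) (vertex_simple i) ?p" "unit i = u +[thin (up i)] w"
  by (rule set_addE)
  have "w i = 0" using uw(2) ker[of w] by (simp add: a_kernel_def')
  then have ui: "u i = 1" using fun_cong[OF uw(3), of i] by (simp add: unit_def)
  have uT: "u : car (thin (up i))" using UD(1) uw(1) by blast
  have "E i i *[thin (up i)] u = unit i" unfolding thin_E_id[OF S i uT] unit_def ui ..
  then have unitU: "unit i : U" using UD(4)[OF E_closed[OF q_refl[OF i]] uw(1)] by simp
  have "ph : U" if ph: "ph : car (thin (up i))" for ph
  proof (rule kclosed_components[OF lmT kc ph])
  fix k assume k: "k : V"
  have e: "E k k *[thin (up i)] ph = (%u. if u = k then ph k else 0)" by (rule thin_E_id[OF S k ph])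
  show "E k k *[thin (up i)] ph : U"
  proof (cases "k : up i")
  case True
  have "unit k : U"
  using UD(4)[OF E_closed[OF v(2)[OF True]] unitU] thin_E_unit[OF S v(2)[OF True] v(1)] True by simp
  moreover have "E k k *[thin (up i)] ph = scal KP (thin (up i)) (ph k) (unit k)"
  unfolding e scal_thin[OF S unit_thin[OF True]] by (rule ext) (simp add: unit_def)
  ultimately show ?thesis using kc by (simp add: kclosed_def)
  next
  case False
  have "E k k *[thin (up i)] ph = \<zero>[thin (up i)]" unfolding e using ph False by (auto simp: zero_fun_def)
  then show ?thesis using UD(2) by simp
  qed
  qed
  then show ?thesis using UD(1) by blast
 qed
 show ?thesis unfolding is_projective_cover_def
  by (rule conjI[OF projective_thin_up[OF i]], rule bexI[OF _ p], rule conjI[OF im])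
  (intro allI impI, elim conjE, rule sup)
qed

lemma injective_thin_down:
 assumes i: "i : V" shows "injective KP (thin (down i))"
 unfolding injective_def
proof (intro conjI allI impI ballI)
 note S = convex_down[of i]
 note A = fdKP
 note lmT = lm_thin[OF S]
 have v: "i : down i" using q_refl[OF i] by (simp add: down_def)
 show "fd_module KP (thin (down i))" by (rule fd_thin[OF S])
 fix M N :: "('k mat, 'k vec) module" and g f
 assume MN: "fd_module KP M & fd_module KP N" and g: "g : Hom M N" and f: "f : Hom M (thin (down i))"
  and inj: "inj_on g (car M)"
 have lm: "left_module KP M" "left_module KP N" using MN by (simp_all add: fd_module_def)
 interpret M: lmodule KP M by (rule lmI) (rule lm)
 interpret N: lmodule KP N by (rule lmI) (rule lm)
 define xi where "xi z = f (the_inv_into (car M) g z) i" for z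
 have xi: "xi (g x) = f x i" if "x : car M" for x
  by (simp add: xi_def the_inv_into_f_f[OF inj that])
 have kc: "kclosed KP N (g ` car M)"
  by (rule submodule_kclosed[OF A lm(2) submodule_image[OF lm g submodule_carrier[OF lm(1)]]])
 have xi_add: "xi (x +[N] y) = xi x + xi y" if xy: "x : g ` car M" "y : g ` car M" for x y
 proof -
  obtain u w where uw: "u : car M" "w : car M" "x = g u" "y = g w" using xy by blast
  have "x +[N] y = g (u +[M] w)" using homD(2)[OF g uw(1,2)] uw by simp
  then show ?thesis using uw xi[of "u +[M] w"] xi[of u] xi[of w] homD(2)[OF f uw(1,2)] by simp
 qed
 have xi_scl: "xi (scal KP N c x) = c * xi x" if x: "x : g ` car M" for c x
 proof -
  obtain u where u: "u : car M" "x = g u" using x by blast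
  have fu: "f u : car (thin (down i))" by (rule homD(1)[OF f u(1)])
  have "scal KP N c x = g (scal KP M c u)" using scal_hom[OF A lm g u(1)] u by simp
  then show ?thesis
  using u xi[OF scal_closed[OF A lm(1) u(1)]] xi[of u] scal_hom[OF A lm(1) lmT f u(1)] scal_thin[OF S fu] by simp
 qed
 obtain ph where ph: "!!x y. x : car N ==> y : car N ==> ph (x +[N] y) = ph x + ph y"
  "!!c x. x : car N ==> ph (scal KP N c x) = c * ph x" "!!x. x : g ` car M ==> ph x = xi x"
  using functional_extension[OF A _ kc xi_add xi_scl] MN by blast
 have ph0: "ph \<zero>[N] = 0" using ph(2)[of "\<zero>[N]" 0] scal_zero_left[OF A lm(2), of "\<zero>[N]"] by simp
 let ?h = "%y j. if j : down i then ph (E i j *[N] y) else 0"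
 have Ed: "E i j : car KP" if "j : down i" for j using that by (simp add: down_def)
 have h: "?h : Hom N (thin (down i))"
 proof (rule hom_criterion[OF lm(2) lmT])
  fix x y assume xy: "x : car N" "y : car N"
  show "?h (x +[N] y) = ?h x +[thin (down i)] ?h y"
  proof
  fix j show "?h (x +[N] y) j = (?h x +[thin (down i)] ?h y) j"
  using xy Ed by (simp add: N.smult_r_distr ph(1))
  qed
 next
  fix c x assume x: "x : car N"
  have hx: "?h x : car (thin (down i))" by simp
  show "?h (scal KP N c x) = scal KP (thin (down i)) c (?h x)"
  unfolding scal_thin[OF S hx]
  proof
  fix j show "?h (scal KP N c x) j = c * ?h x j"
  using x Ed by (simp add: smult_scal[OF A lm(2)] ph(2))
  qed
 next
  fix j l x assume jl: "(j, l) : q" and x: "x : car N"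
  have hx: "?h x : car (thin (down i))" by simp
  show "?h (E l j *[N] x) = E l j *[thin (down i)] ?h x"
  unfolding thin_E[OF S jl hx]
  proof
  fix u show "?h (E l j *[N] x) u = (if u = l & l : down i then ?h x j else 0)"
  proof (cases "u : down i")
  case True
  then have ui: "(u, i) : q" by (simp add: down_def)
  have e: "E i u *[N] (E l j *[N] x) = (if u = l then E i j *[N] x else \<zero>[N])"
  by (rule E_smult[OF lm(2) x jl ui])
  show ?thesis
  proof (cases "u = l")
  case ul: True
  then have "j : down i" using True jl q_trans by (auto simp: down_def)
  then show ?thesis using True ul e by simp
  next
  case False then show ?thesis using True e ph0 by simp
  qed
  qed auto
  qed
 qed simp
 have ext: "?h (g x) = f x" if x: "x : car M" for x
 proof
  fix j
  have fx: "f x : car (thin (down i))" by (rule homD(1)[OF f x])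
  show "?h (g x) j = f x j"
  proof (cases "j : down i")
  case True
  then have ji: "(j, i) : q" by (simp add: down_def)
  have Ex: "E i j *[M] x : car M" by (rule E_smult_closed[OF lm(1) x ji])
  have "ph (E i j *[N] g x) = ph (g (E i j *[M] x))" using homD(3)[OF g E_closed[OF ji] x] by simp
  also have "... = f (E i j *[M] x) i" using ph(3)[OF imageI[OF Ex]] xi[OF Ex] by simp
  also have "... = (E i j *[thin (down i)] f x) i" using homD(3)[OF f E_closed[OF ji] x] by simp
  also have "... = f x j" unfolding thin_E[OF S ji fx] using v by simp
  finally show ?thesis using True by simp
  next
  case False then show ?thesis using fx by simp
  qed
 qed
 show "EX h:Hom N (thin (down i)). ALL x:car M. h (g x) = f x"
  by (rule bexI[OF _ h], rule ballI, rule ext)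
qed

text \<open>A coordinate \<open>j\<close> of a vector is carried by \<open>E i j\<close> into the simple submodule at
\<open>i\<close>.\<close>
lemma thin_down_envelope:
 assumes i: "i : V" shows "is_injective_envelope KP (thin (down i)) (vertex_simple i)"
proof -
 note S = convex_down[of i]
 note A = fdKP
 note lmT = lm_thin[OF S]
 note lmi = lm_thin[OF convex_singleton[OF i]]
 have v: "i : down i" using q_refl[OF i] by (simp add: down_def)
 have inc: "(%ph. ph) : Hom (thin {i}) (thin (down i))"
 proof (rule thin_incl(1)[OF S convex_singleton[OF i]])
  show "{i} \<subseteq> down i" using v by simp
  fix j l assume jl: "j : {i}" "l : down i" "(j, l) : q"
  have "(i, l) : q" "(l, i) : q" using jl by (simp_all add: down_def)
  from q_antisym[OF this] show "l : {i}" by simp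
 qed
 have "isomorphic KP (vertex_simple i) (thin {i})"
  by (rule iso_sym[OF lmi vertex_simple_iso(2)[OF i]])
 then obtain f where f: "f : Hom (vertex_simple i) (thin {i})" "bij_betw f (car (vertex_simple i)) (car (thin {i}))"
  unfolding isomorphic_def by blast
 have hom: "f : Hom (vertex_simple i) (thin (down i))"
  using hom_comp[OF f(1) inc] by simp
 have inj: "inj_on f (car (vertex_simple i))" and im: "f ` car (vertex_simple i) = car (thin {i})"
  using f(2) by (simp_all add: bij_betw_def)
 have ess: "U = {\<zero>[thin (down i)]}"
  if U: "submod U KP (thin (down i))" "U \<inter> f ` car (vertex_simple i) = {\<zero>[thin (down i)]}" for U
 proof -
  note UD = submoduleD[OF U(1)]
  have "ph = 0" if ph: "ph : U" for ph
  proof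
  fix j
  have phT: "ph : car (thin (down i))" using ph UD(1) by blast
  show "ph j = 0 j"
  proof (cases "j : down i")
  case True
  then have ji: "(j, i) : q" by (simp add: down_def)
  have e: "E i j *[thin (down i)] ph = (%u. if u = i then ph j else 0)"
  unfolding thin_E[OF S ji phT] using v by simp
  have "E i j *[thin (down i)] ph : U" by (rule UD(4)[OF E_closed[OF ji] ph])
  moreover have "E i j *[thin (down i)] ph : f ` car (vertex_simple i)" unfolding im e by simp
  ultimately have "E i j *[thin (down i)] ph = \<zero>[thin (down i)]" using U(2) by blast
  from fun_cong[OF this, of i] show ?thesis unfolding e by simp
  next
  case False then show ?thesis using phT by simp
  qed
  qed
  then show ?thesis using UD(2) by auto
 qed
 show ?thesis unfolding is_injective_envelope_def
  by (rule conjI[OF injective_thin_down[OF i]], rule bexI[OF _ hom], rule conjI[OF inj])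
  (intro allI impI, elim conjE, rule ess)
qed

end

lemma carrier_update_self: "(M :: ('a, 'm) module)(|carrier := car M|) = M"
 by simp

context suspension begin

definition D :: "nat => nat set" where "D i = up (vx i) \<inter> below i"
definition N :: "nat => nat set" where "N i = down (vx i) \<inter> below i"

lemma r_star: "(j, Suc n) ~: r"
 using r_dom[of j "Suc n"] by auto

lemma mem_D: assumes "i : {0..n}" shows "k : D i \<longleftrightarrow> (if i = 0 then k = Suc n else (i, k) : r)"
proof (cases "i = 0")
 case True
 then show ?thesis using q_star_left[of k] q_refl[OF V_star] by (auto simp: D_def up_def below_def vx_def)
next
 case False
 have "(i, k) : q & k : V" if "(i, k) : r" using that r_dom[OF that] by (auto simp: q_iff V_def)
 then show ?thesis using False by (auto simp: D_def up_def below_def vx_def)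
qed

lemma mem_N: assumes "i : {0..n}" shows "k : N i \<longleftrightarrow> (if i = 0 then k : V else k = i)"
proof (cases "i = 0")
 case True
 then show ?thesis using q_star[of k] by (auto simp: N_def down_def below_def vx_def)
next
 case False
 have i: "i : {1..n}" using False assms by auto
 have "k = i" if "(k, i) : q" "(i, k) : r"
  using that r_dom[OF that(2)] q_r[of i k] i r_antisym by auto
 moreover have "(i, i) : q" "(i, i) : r" "i : V" using r_refl[OF i] i by (auto simp: q_iff V_def)
 ultimately show ?thesis using False by (auto simp: N_def down_def below_def vx_def)
qed

lemma D_generated:
 assumes i: "i : {0..n}"
 shows "vx i : D i" "!!k. k : D i ==> (vx i, k) : q" "D i \<subseteq> V" "convex (D i)"
proof -
 show "vx i : D i" using i r_refl[of i] by (auto simp: mem_D[OF i] vx_def)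
 show q: "!!k. k : D i ==> (vx i, k) : q" by (simp add: D_def up_def)
 show V: "D i \<subseteq> V" using q q_dom by blast
 show "convex (D i)"
  unfolding convex_def
 proof (intro conjI ballI allI impI V)
  fix a b j assume ab: "a : D i" "b : D i" "(a, j) : q" "(j, b) : q"
  show "j : D i"
  proof (cases "i = 0")
  case True
  then show ?thesis using ab q_star_left by (simp add: mem_D)
  next
  case False
  then have "(i, a) : r" "(i, b) : r" using ab by (simp_all add: mem_D[OF i])
  moreover from this have "(j, b) : r" using ab(4) r_dom q_r by auto
  moreover from this have "(a, j) : r" using ab(3) r_dom q_r by auto
  ultimately have "(i, j) : r" using r_trans by blast
  then show ?thesis using False by (simp add: mem_D[OF i])
  qed
 qed
qed

lemma N_convex: assumes i: "i : {0..n}" shows "convex (N i)"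
 unfolding convex_def
proof (intro conjI ballI allI impI)
 show "N i \<subseteq> V" by (auto simp: N_def below_def)
 fix a b j assume ab: "a : N i" "b : N i" "(a, j) : q" "(j, b) : q"
 show "j : N i" using ab q_antisym[of j i] q_dom[OF ab(3)] by (auto simp: mem_N[OF i] split: if_splits)
qed

lemma fd_Sim: "i : {0..n} ==> fd_module KP (Sim i)"
 using indexes_simples_Sim unfolding indexes_simples_def by (elim conjE) (drule bspec, assumption, erule conjunct1)

lemma projective_cover_thin:
 assumes i: "i : {0..n}"
 shows "fd_module KP (projective_cover KP (Sim i))" "isomorphic KP (projective_cover KP (Sim i)) (thin (up (vx i)))"
proof -
 note S = convex_up[of "vx i"]
 obtain M :: "('k mat, 'k vec) module" where M: "fd_module KP M" "isomorphic KP (thin (up (vx i))) M"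
  by (rule fd_module_vec[OF fdKP fd_thin[OF S]])
 have "is_projective_cover KP (thin (up (vx i))) (Sim i)" unfolding Sim_vx by (rule thin_up_cover[OF vx_V[OF i]])
 then have cM: "is_projective_cover KP M (Sim i)"
  by (rule is_projective_cover_iso[OF fdKP _ fd_lm[OF M(1)] M(2)])
 then have P: "is_projective_cover KP (projective_cover KP (Sim i)) (Sim i)"
  unfolding projective_cover_def by (rule someI)
 then show fd: "fd_module KP (projective_cover KP (Sim i))"
  by (rule is_projective_coverE) (simp add: projective_def)
 show "isomorphic KP (projective_cover KP (Sim i)) (thin (up (vx i)))"
  by (rule iso_trans[OF projective_cover_unique[OF P cM fd_Sim[OF i]] iso_sym[OF lm_thin[OF S] M(2)]])
qed

lemma injective_envelope_thin:
 assumes i: "i : {0..n}"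
 shows "fd_module KP (injective_envelope KP (Sim i))" "isomorphic KP (injective_envelope KP (Sim i)) (thin (down (vx i)))"
proof -
 note S = convex_down[of "vx i"]
 obtain M :: "('k mat, 'k vec) module" where M: "fd_module KP M" "isomorphic KP (thin (down (vx i))) M"
  by (rule fd_module_vec[OF fdKP fd_thin[OF S]])
 have "is_injective_envelope KP (thin (down (vx i))) (Sim i)" unfolding Sim_vx by (rule thin_down_envelope[OF vx_V[OF i]])
 then have cM: "is_injective_envelope KP M (Sim i)"
  by (rule is_injective_envelope_iso[OF fdKP _ fd_lm[OF M(1)] M(2)])
 then have P: "is_injective_envelope KP (injective_envelope KP (Sim i)) (Sim i)"
  unfolding injective_envelope_def by (rule someI)
 then show fd: "fd_module KP (injective_envelope KP (Sim i))"
  by (rule is_injective_envelopeE) (simp add: injective_def)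
 show "isomorphic KP (injective_envelope KP (Sim i)) (thin (down (vx i)))"
  by (rule iso_trans[OF injective_envelope_unique[OF P cM fd_Sim[OF i]] iso_sym[OF lm_thin[OF S] M(2)]])
qed

lemma thin_restrict_D:
 assumes i: "i : {0..n}"
 shows "(%ph t. if t : D i then ph t else 0) : Hom (thin (up (vx i))) (thin (D i))"
proof (rule thin_restrict[OF convex_up D_generated(4)[OF i]])
 show "D i \<subseteq> up (vx i)" by (simp add: D_def)
 fix j l assume jl: "j : up (vx i)" "l : D i" "(j, l) : q"
 show "j : D i"
 proof (cases "i = 0")
  case True
  then have "j = Suc n" using jl(1) q_star_left by (simp add: up_def vx_def)
  then show ?thesis using True by (simp add: mem_D)
 next
  case False
  then have "(i, l) : r" using jl(2) by (simp add: mem_D[OF i])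
  then have "(j, l) : r" using jl(3) q_r[of l j] r_dom by auto
  then have "(i, j) : r" using jl(1) q_r[of j i] r_dom False by (auto simp: up_def vx_def)
  then show ?thesis using False by (simp add: mem_D[OF i])
 qed
qed

text \<open>The least submodule is the kernel of the restriction of \<open>thin (up (vx i))\<close> to \<open>D i\<close>,
since it has to contain all components at vertices outside \<open>below i\<close>.\<close>
lemma standard_thin:
 assumes i: "i : {0..n}"
 shows "fd_module KP (Del i)" "isomorphic KP (Del i) (thin (D i))"
proof -
 define P where "P = projective_cover KP (Sim i)"
 note A = fdKP
 note Su = convex_up[of "vx i"] and SD = D_generated(4)[OF i]
 have fdP: "fd_module KP P" and isoP: "isomorphic KP P (thin (up (vx i)))"
  unfolding P_def by (rule projective_cover_thin[OF i])+
 note lmP = fd_lm[OF fdP]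
 interpret P: lmodule KP P by (rule lmI) (rule lmP)
 obtain f g where f: "f : Hom P (thin (up (vx i)))" and g: "g : Hom (thin (up (vx i))) P"
  and gf: "!!x. x : car P ==> g (f x) = x" and fg: "!!y. y : car (thin (up (vx i))) ==> f (g y) = y"
  by (rule isomorphicE[OF isoP lmP]) blast
 let ?p = "%x t. if t : D i then f x t else 0"
 have p: "?p : Hom P (thin (D i))" using hom_comp[OF f thin_restrict_D[OF i]] .
 define K where "K = {x : car P. ?p x = \<zero>[thin (D i)]}"
 have onto: "?p ` car P = car (thin (D i))"
 proof (intro equalityI subsetI)
  fix ph assume ph: "ph : car (thin (D i))"
  then have phu: "ph : car (thin (up (vx i)))" by (auto simp: D_def)
  have "ph = ?p (g ph)" unfolding fg[OF phu] by (rule ext) (use ph in simp)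
  then show "ph : ?p ` car P" by (rule image_eqI) (rule homD(1)[OF g phu])
 next
  fix ph assume "ph : ?p ` car P"
  then obtain x where x: "ph = ?p x" "x : car P" by (rule imageE)
  show "ph : car (thin (D i))" unfolding x(1) by (rule homD(1)[OF p x(2)])
 qed
 have subK: "submod K KP P" unfolding K_def by (rule submodule_kernel[OF lmP lm_thin[OF SD] p])
 note lmK = lm_quot[OF lmP subK]
 have isoK: "isomorphic KP (quotient_module P K) (thin (D i))"
  by (rule first_isomorphism[OF lmP subK lm_thin[OF SD] p onto K_def])
 have fdK: "fd_module KP (quotient_module P K)"
  by (rule fd_module_surj[OF A fdP lmK quotient_hom[OF lmP subK] quot_carrier[OF lmP subK, symmetric]])
 have cfK: "composition_factors_below KP ord Sim i (quotient_module P K)"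
 proof (rule composition_factors_belowI[OF i fdK])
  fix k X assume k: "k : V" "k ~: below i" and X: "X : car (quotient_module P K)"
  obtain x where x: "X = K +>[P] x" "x : car P" using X unfolding quot_carrier[OF lmP subK] by (rule imageE)
  note Ek = E_closed[OF q_refl[OF k(1)]]
  have Ex: "E k k *[P] x : car P" by (rule P.smult_closed[OF Ek x(2)])
  have "k ~: D i" using k(2) by (simp add: D_def)
  then have "?p (E k k *[P] x) = \<zero>[thin (D i)]"
  unfolding homD(3)[OF p Ek x(2)] thin_E_id[OF SD k(1) homD(1)[OF p x(2)]] by (intro ext) simp
  then have "E k k *[P] x : K" unfolding K_def using Ex by (intro CollectI conjI)
  then show "E k k *[quotient_module P K] X = \<zero>[quotient_module P K]"
  unfolding x(1) quotient_smult[OF lmP subK Ek x(2)] quotient_module_simps(2) by (simp only: quotient_zero_iff[OF lmP subK Ex])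
 qed
 have min: "K \<subseteq> U" if U: "submod U KP P & composition_factors_below KP ord Sim i (quotient_module P U)" for U
 proof
  note sU = conjunct1[OF U]
  note UD = submoduleD[OF sU]
  have kcU: "kclosed KP P U" by (rule submodule_kclosed[OF A lmP sU])
  fix x assume "x : K"
  then have xx: "x : car P & ?p x = \<zero>[thin (D i)]" unfolding K_def by (rule CollectD)
  note x = conjunct1[OF xx] conjunct2[OF xx]
  show "x : U"
  proof (rule kclosed_components[OF lmP kcU x(1)])
  fix k assume k: "k : V"
  note Ek = E_closed[OF q_refl[OF k]]
  have Ex: "E k k *[P] x : car P" by (rule P.smult_closed[OF Ek x(1)])
  show "E k k *[P] x : U"
  proof (cases "k : below i")
  case True
  have "f x k = 0"
  proof (cases "k : up (vx i)")
  case True2: True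
  then have "k : D i" using True by (simp add: D_def)
  then show ?thesis using fun_cong[OF x(2), of k] by simp
  next
  case False then show ?thesis using homD(1)[OF f x(1)] by simp
  qed
  then have "f (E k k *[P] x) = \<zero>[thin (up (vx i))]"
  unfolding homD(3)[OF f Ek x(1)] thin_E_id[OF Su k homD(1)[OF f x(1)]] by (intro ext) simp
  then have "g (f (E k k *[P] x)) = \<zero>[P]" using hom_zero[OF lm_thin[OF Su] lmP g] by simp
  then show ?thesis using gf[OF Ex] UD(2) by simp
  next
  case False
  have "U +>[P] x : car (quotient_module P U)" unfolding quot_carrier[OF lmP sU] by (rule imageI) (rule x(1))
  from composition_factors_belowD[OF i lm_quot[OF lmP sU] conjunct2[OF U] k False this]
  have "U +>[P] (E k k *[P] x) = U"
  unfolding quotient_smult[OF lmP sU Ek x(1)] quotient_module_simps(2) .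
  then show ?thesis by (simp only: quotient_zero_iff[OF lmP sU Ex])
  qed
  qed
 qed
 have "(LEAST U. submod U KP P & composition_factors_below KP ord Sim i (quotient_module P U)) = K"
  by (rule Least_equality, rule conjI[OF subK cfK], rule min)
 then have st: "Del i = quotient_module P K"
  unfolding standard_def Let_def P_def[symmetric] by (rule arg_cong)
 show "fd_module KP (Del i)" "isomorphic KP (Del i) (thin (D i))"
  unfolding st by (rule fdK, rule isoK)
qed

lemma costandard_thin:
 assumes i: "i : {0..n}"
 shows "fd_module KP (Nab i)" "isomorphic KP (Nab i) (thin (N i))"
proof -
 define Q where "Q = injective_envelope KP (Sim i)"
 note A = fdKP
 note Sd = convex_down[of "vx i"] and SN = N_convex[OF i]
 note lmd = lm_thin[OF Sd] and lmN = lm_thin[OF SN]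
 have fdQ: "fd_module KP Q" and isoQ: "isomorphic KP Q (thin (down (vx i)))"
  unfolding Q_def by (rule injective_envelope_thin[OF i])+
 note lmQ = fd_lm[OF fdQ]
 obtain f g where f: "f : Hom Q (thin (down (vx i)))" and g: "g : Hom (thin (down (vx i))) Q"
  and gf: "!!x. x : car Q ==> g (f x) = x" and fg: "!!y. y : car (thin (down (vx i))) ==> f (g y) = y"
  by (rule isomorphicE[OF isoQ lmQ]) blast
 have inc: "(%ph. ph) : Hom (thin (N i)) (thin (down (vx i)))" "submod (car (thin (N i))) KP (thin (down (vx i)))"
 proof -
  have sub: "N i \<subseteq> down (vx i)" by (simp add: N_def)
  have high: "l : N i" if jl: "j : N i" "l : down (vx i)" "(j, l) : q" for j l
  proof (cases "i = 0")
  case True then show ?thesis using q_dom[OF jl(3)] by (simp add: mem_N)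
  next
  case False
  then have "(i, l) : q" "(l, i) : q" using jl by (simp_all add: mem_N[OF i] down_def vx_def)
  from q_antisym[OF this] show ?thesis using False i by (simp add: mem_N)
  qed
  show "(%ph. ph) : Hom (thin (N i)) (thin (down (vx i)))" by (rule thin_incl(1)[OF Sd SN sub high])
  show "submod (car (thin (N i))) KP (thin (down (vx i)))" by (rule thin_incl(2)[OF Sd SN sub high])
 qed
 have cN: "ph : car (thin (down (vx i)))" if "ph : car (thin (N i))" for ph by (rule homD(1)[OF inc(1) that])
 define K where "K = g ` car (thin (N i))"
 have subK: "submod K KP Q" unfolding K_def by (rule submodule_image[OF lmd lmQ g inc(2)])
 note KD = submoduleD[OF subK]
 note lmK = lm_sub[OF lmQ subK]
 have gN: "g : Hom (thin (N i)) Q" using hom_comp[OF inc(1) g] .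
 have gK: "g : Hom (thin (N i)) (Q(|carrier := K|))"
 proof (rule homI)
  fix ph assume ph: "ph : car (thin (N i))"
  show "g ph : car (Q(|carrier := K|))" using imageI[OF ph, of g] by (simp add: K_def)
  show "g (ph +[thin (N i)] om) = g ph +[Q(|carrier := K|)] g om" if om: "om : car (thin (N i))" for om
  using homD(2)[OF gN ph om] by simp
  show "g (a *[thin (N i)] ph) = a *[Q(|carrier := K|)] g ph" if a: "a : car KP" for a
  using homD(3)[OF gN a ph] by simp
 qed
 have fK: "f y : car (thin (N i)) & g (f y) = y" if y: "y : K" for y
 proof -
  obtain ph where ph: "y = g ph" "ph : car (thin (N i))" using y unfolding K_def by (rule imageE)
  have "f y = ph" unfolding ph(1) by (rule fg[OF cN[OF ph(2)]])
  then show ?thesis using ph by simp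
 qed
 have "isomorphic KP (thin (N i)) (Q(|carrier := K|))"
  by (rule isomorphicI[OF gK, of f]) (use fK fg[OF cN] in simp_all)
 then have isoK: "isomorphic KP (Q(|carrier := K|)) (thin (N i))" by (rule iso_sym[OF lmN])
 have fdK: "fd_module KP (Q(|carrier := K|))"
  by (rule fd_module_surj[OF A fd_thin[OF SN] lmK gK]) (simp add: K_def)
 have cfK: "composition_factors_below KP ord Sim i (Q(|carrier := K|))"
 proof (rule composition_factors_belowI[OF i fdK])
  fix k y assume k: "k : V" "k ~: below i" and y: "y : car (Q(|carrier := K|))"
  note Ek = E_closed[OF q_refl[OF k(1)]]
  have fy: "f y : car (thin (N i))" "g (f y) = y" using fK[of y] y by simp_all
  have "k ~: N i" using k(2) by (simp add: N_def)
  then have "E k k *[thin (N i)] f y = \<zero>[thin (N i)]"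
  unfolding thin_E_id[OF SN k(1) fy(1)] using fy(1) by (intro ext) simp
  then have "g (E k k *[thin (N i)] f y) = \<zero>[Q]" using hom_zero[OF lmN lmQ gN] by simp
  then show "E k k *[Q(|carrier := K|)] y = \<zero>[Q(|carrier := K|)]"
  using homD(3)[OF gN Ek fy(1)] fy(2) by simp
 qed
 have max: "U \<subseteq> K" if U: "submod U KP Q & composition_factors_below KP ord Sim i (Q(|carrier := U|))" for U
 proof
  note sU = conjunct1[OF U]
  note UD = submoduleD[OF sU]
  fix x assume x: "x : U"
  then have xQ: "x : car Q" using UD(1) by (rule rev_subsetD)
  have fx: "f x : car (thin (down (vx i)))" by (rule homD(1)[OF f xQ])
  have "f x t = 0" if t: "t ~: N i" for t
  proof (cases "t : down (vx i)")
  case True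
  then have tV: "t : V" and "t ~: below i" using t q_dom by (auto simp: N_def down_def)
  then have "E t t *[Q] x = \<zero>[Q]"
  using composition_factors_belowD[OF i lm_sub[OF lmQ sU] conjunct2[OF U] tV, of x] x by simp
  then have "E t t *[thin (down (vx i))] f x = 0"
  using homD(3)[OF f E_closed[OF q_refl[OF tV]] xQ] hom_zero[OF lmQ lmd f] by simp
  from fun_cong[OF this, of t] show ?thesis unfolding thin_E_id[OF Sd tV fx] by simp
  next
  case False then show ?thesis using fx by simp
  qed
  then have "f x : car (thin (N i))" by simp
  then show "x : K" unfolding K_def by (rule image_eqI[rotated]) (simp add: gf[OF xQ])
 qed
 have "(GREATEST U. submod U KP Q & composition_factors_below KP ord Sim i (Q(|carrier := U|))) = K"
  by (rule Greatest_equality, rule conjI[OF subK cfK], rule max)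
 then have st: "Nab i = Q(|carrier := K|)"
  unfolding costandard_def Let_def Q_def[symmetric] by (rule arg_cong)
 show "fd_module KP (Nab i)" "isomorphic KP (Nab i) (thin (N i))"
  unfolding st by (rule fdK, rule isoK)
qed

lemma standard_End:
 assumes i: "i : {0..n}"
 shows "vectorspace.dim class_ring (End_algebra KP (Del i)) = 1"
proof -
 let ?M = "Del i" and ?T = "thin (D i)" and ?v = "vx i"
 note A = fdKP
 note G = D_generated[OF i]
 note lmT = lm_thin[OF G(4)]
 note lmM = fd_lm[OF standard_thin(1)[OF i]]
 note uT = unit_thin[OF G(1)]
 obtain h g where h: "h : Hom ?M ?T" and g: "g : Hom ?T ?M"
  and gh: "!!x. x : car ?M ==> g (h x) = x" and hg: "!!y. y : car ?T ==> h (g y) = y"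
  by (rule isomorphicE[OF standard_thin(2)[OF i] lmM]) blast
 show ?thesis
 proof (rule End_dim_one[OF A lmM])
  show "car ?M ~= {\<zero>[?M]}"
  proof
  assume "car ?M = {\<zero>[?M]}"
  then have "g (unit ?v) = \<zero>[?M]" using homD(1)[OF g uT] by simp
  then have "unit ?v = 0" using hg[OF uT] hom_zero[OF lmM lmT h] by simp
  from fun_cong[OF this, of ?v] show False by (simp add: unit_def)
  qed
  fix f assume f: "f : Hom ?M ?M"
  have F: "(%ph. h (f (g ph))) : Hom ?T ?T"
  by (rule hom_comp[OF hom_comp[OF g f] h])
  define c where "c = h (f (g (unit ?v))) ?v"
  have cT: "(%ph. scal KP ?T c ph) : Hom ?T ?T" by (rule End_scal_closed[OF A lmT module_hom_id])
  have vV: "?v : V" by (rule vx_V[OF i])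
  have "E ?v ?v *[?T] unit ?v = unit ?v" using thin_E_unit[OF G(4) q_refl[OF vV] G(1)] G(1) by simp
  then have "h (f (g (unit ?v))) = E ?v ?v *[?T] h (f (g (unit ?v)))"
  using homD(3)[OF F E_closed[OF q_refl[OF vV]] uT] by simp
  also have "... = scal KP ?T c (unit ?v)"
  unfolding thin_E_id[OF G(4) vV homD(1)[OF F uT]] scal_thin[OF G(4) uT] c_def by (rule ext) (simp add: unit_def)
  finally have e: "(%ph. h (f (g ph))) (unit ?v) = (%ph. scal KP ?T c ph) (unit ?v)" .
  have "f x = scal KP ?M c x" if x: "x : car ?M" for x
  proof -
  have hx: "h x : car ?T" by (rule homD(1)[OF h x])
  have "h (f (g (h x))) = scal KP ?T c (h x)" using thin_hom_eq[OF G(4,1,2) lmT F cT e hx] .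
  then have "g (h (f x)) = g (scal KP ?T c (h x))" unfolding gh[OF x] by simp
  then show ?thesis
  using gh[OF homD(1)[OF f x]] scal_hom[OF A lmT lmM g hx] gh[OF x] by simp
  qed
  then show "EX c. ALL x:car ?M. f x = scal KP ?M c x" by (intro exI[of _ c] ballI)
 qed
qed

lemma thin_up_filtered:
 assumes i: "i : {0..n}"
 shows "filtered_by KP ((%j. thin (D j)) ` {0..n}) (thin (up (vx i)))"
proof -
 let ?X = "(%j. thin (D j)) ` {0..n}" and ?M = "thin (up (vx i))"
 note S = convex_up[of "vx i"]
 note lmM = lm_thin[OF S]
 note lmi = lm_thin[OF D_generated(4)[OF i]]
 have Xi: "thin (D i) : ?X" using i by (rule imageI)
 have i0: "0 : {0..n}" by simp
 have X0: "thin (D 0) : ?X" using i0 by (rule imageI)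
 note G0 = D_generated[OF i0]
 have full: "?M(|carrier := car ?M|) = ?M" by (rule carrier_update_self)
 have sub: "D 0 \<subseteq> up (vx i)" using q_star[OF vx_V[OF i]] by (auto simp: up_def mem_D[OF i0])
 have high: "l : D 0" if "j : D 0" "l : up (vx i)" "(j, l) : q" for j l
  using that q_star_left by (simp add: mem_D[OF i0])
 note inc = thin_incl[OF S G0(4) sub high]
 let ?U = "car (thin (D 0))"
 have z: "filtered_by KP ?X (?M(|carrier := {\<zero>[?M]}|))"
  by (rule filtered_zero[OF lm_sub[OF lmM submodule_zero[OF lmM]]]) simp
 have zU: "{\<zero>[?M]} \<subseteq> ?U" by simp
 have lm0: "left_module KP (thin (D 0))" by (rule lm_thin[OF G0(4)])
 have qU: "(%ph. ph) : Hom (?M(|carrier := ?U|)) (thin (D 0))"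
 proof (rule homI)
  fix a ph assume a: "a : car KP" and "ph : car (?M(|carrier := ?U|))"
  then have ph: "ph : ?U" by simp
  show "a *[?M(|carrier := ?U|)] ph = a *[thin (D 0)] ph" using homD(3)[OF inc(1) a ph] by simp
 qed simp_all
 have U: "filtered_by KP ?X (?M(|carrier := ?U|))"
  by (rule filtered_step[OF lmM submodule_zero[OF lmM] inc(2) zU z X0 lm0 qU]) auto
 show ?thesis
 proof (cases "i = 0")
  case True
  have "up (vx 0) = D 0" using q_star_left q_refl[OF V_star] by (auto simp: up_def vx_def mem_D[OF i0])
  then have UM: "?U = car ?M" using True by simp
  show ?thesis using U unfolding UM full .
 next
  case False
  have UM: "?U \<subseteq> car ?M" by (rule submoduleD(1)[OF inc(2)])
  have Di: "t : D 0" if "t : up (vx i)" "t ~: D i" for t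
  using that False by (auto simp: up_def vx_def q_iff mem_D[OF i] mem_D[OF i0])
  have D0: "t ~: D i" if "t : D 0" for t using that r_star False by (simp add: mem_D[OF i] mem_D[OF i0])
  have q: "(%ph t. if t : D i then ph t else 0) : Hom (?M(|carrier := car ?M|)) (thin (D i))"
  unfolding full by (rule thin_restrict_D[OF i])
  have onto: "(%ph t. if t : D i then ph t else 0) ` car ?M = car (thin (D i))"
  proof (intro equalityI subsetI)
  fix ph assume ph: "ph : car (thin (D i))"
  then have phu: "ph : car ?M" by (auto simp: D_def)
  show "ph : (%ph t. if t : D i then ph t else 0) ` car ?M"
  by (rule image_eqI[OF _ phu]) (rule ext, use ph in simp)
  next
  fix ph assume "ph : (%ph t. if t : D i then ph t else 0) ` car ?M"
  then obtain om where "ph = (%t. if t : D i then om t else 0)" by (rule imageE)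
  then show "ph : car (thin (D i))" by simp
  qed
  have ker: "?U = {ph : car ?M. (%t. if t : D i then ph t else 0) = \<zero>[thin (D i)]}"
  proof (intro equalityI subsetI)
  fix ph assume ph: "ph : ?U"
  have "(%t. if t : D i then ph t else 0) = \<zero>[thin (D i)]" by (rule ext) (use ph D0 in auto)
  then show "ph : {ph : car ?M. (%t. if t : D i then ph t else 0) = \<zero>[thin (D i)]}"
  using subsetD[OF UM ph] by (intro CollectI conjI)
  next
  fix ph assume "ph : {ph : car ?M. (%t. if t : D i then ph t else 0) = \<zero>[thin (D i)]}"
  then have xx: "ph : car ?M & (%t. if t : D i then ph t else 0) = \<zero>[thin (D i)]" by (rule CollectD)
  note ph = conjunct1[OF xx] conjunct2[OF xx]
  have "ph t = 0" if t: "t ~: D 0" for t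
  proof (cases "t : D i")
  case True then show ?thesis using fun_cong[OF ph(2), of t] by simp
  next
  case False then show ?thesis using ph(1) Di t by auto
  qed
  then show "ph : ?U" by simp
  qed
  have "filtered_by KP ?X (?M(|carrier := car ?M|))"
  by (rule filtered_step[OF lmM inc(2) submodule_carrier[OF lmM] UM U Xi lmi q onto ker])
  then show ?thesis unfolding full .
 qed
qed

lemma projective_cover_filtered:
 assumes i: "i : {0..n}"
 shows "filtered_by KP (Del ` {0..n}) (projective_cover KP (Sim i))"
proof (rule filtered_by_iso[OF thin_up_filtered[OF i] lm_thin[OF convex_up]])
 show "left_module KP (projective_cover KP (Sim i))" by (rule fd_lm[OF projective_cover_thin(1)[OF i]])
 then show "isomorphic KP (thin (up (vx i))) (projective_cover KP (Sim i))"
  by (rule iso_sym[OF _ projective_cover_thin(2)[OF i]])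
 fix M assume "M : (%j. thin (D j)) ` {0..n}"
 then obtain j where j: "M = thin (D j)" "j : {0..n}" by (rule imageE)
 show "left_module KP M" unfolding j(1) by (rule lm_thin[OF D_generated(4)[OF j(2)]])
 note lm = fd_lm[OF standard_thin(1)[OF j(2)]]
 show "EX M':Del ` {0..n}. left_module KP M' & isomorphic KP M M'"
  unfolding j(1)
  by (rule bexI[of _ "Del j"], rule conjI[OF lm iso_sym[OF lm standard_thin(2)[OF j(2)]]], rule imageI, rule j(2))
qed

text \<open>A lift of the generator of \<open>thin (D i)\<close> defines a section if it is sent to \<open>0\<close> at
\<open>*\<close>.  Its image there lies in the kernel, which has no component at \<open>*\<close> for \<open>j
> 0\<close>.\<close>
lemma standard_Ext:
 assumes i: "i : {0..n}" and j: "j : {0..n}" and ij: "i ~= 0 ==> j ~= 0"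
 shows "Ext1 KP (Del i) (Del j) =
  {Ext1_zero KP (Del i) (Del j)}"
proof (rule Ext1_eq_zeroI[OF fdKP standard_thin(1)[OF i] standard_thin(1)[OF j]])
 let ?M = "Del i" and ?N = "Del j" and ?T = "thin (D i)" and ?v = "vx i"
 fix X f g assume "(X, f, g) : extensions KP ?M ?N"
 then have X: "fd_module KP X" and f: "f : Hom ?N X" and g: "g : Hom X ?M"
  and ker: "f ` car ?N = a_kernel X ?M g" and surj: "g ` car X = car ?M"
  by (simp_all add: extensions_def)
 note A = fdKP
 note G = D_generated[OF i]
 note lmT = lm_thin[OF G(4)] and lmX = fd_lm[OF X]
 note lmM = fd_lm[OF standard_thin(1)[OF i]]
 note lmN = fd_lm[OF standard_thin(1)[OF j]]
 note uT = unit_thin[OF G(1)]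
 have vV: "?v : V" by (rule vx_V[OF i])
 note Ev = E_closed[OF q_refl[OF vV]]
 obtain h h' where h: "h : Hom ?M ?T" and h': "h' : Hom ?T ?M"
  and h'h: "!!x. x : car ?M ==> h' (h x) = x" and hh': "!!y. y : car ?T ==> h (h' y) = y"
  by (rule isomorphicE[OF standard_thin(2)[OF i] lmM]) blast
 have "h' (unit ?v) : g ` car X" unfolding surj by (rule homD(1)[OF h' uT])
 then obtain y0 where y0: "h' (unit ?v) = g y0" "y0 : car X" by (rule imageE)
 define y where "y = E ?v ?v *[X] y0"
 have y: "y : car X" "E ?v ?v *[X] y = y"
  unfolding y_def by (rule E_smult_closed[OF lmX y0(2) q_refl[OF vV]], rule E_smult_id(1)[OF lmX y0(2) q_refl[OF vV]])
 have "E ?v ?v *[?T] unit ?v = unit ?v" using thin_E_unit[OF G(4) q_refl[OF vV] G(1)] G(1) by simp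
 then have gy: "g y = h' (unit ?v)"
  unfolding y_def using homD(3)[OF g Ev y0(2)] homD(3)[OF h' Ev uT] y0(1) by simp
 have out: "E k ?v *[X] y = \<zero>[X]" if k: "(?v, k) : q" "k ~: D i" for k
 proof -
  have kV: "k : V" using q_dom[OF k(1)] by simp
  have i1: "i ~= 0"
  proof
  assume "i = 0"
  then have "k = Suc n" using k(1) q_star_left[of k] by (simp add: vx_def)
  then show False using k(2) \<open>i = 0\<close> by (simp add: mem_D)
  qed
  then have kn: "k = Suc n" using k by (auto simp: vx_def q_iff mem_D[OF i])
  have "k ~: D j" using ij[OF i1] r_star kn by (simp add: mem_D[OF j])
  note kj = this
  have Ey: "E k ?v *[X] y : car X" by (rule E_smult_closed[OF lmX y(1) k(1)])
  have "g (E k ?v *[X] y) = h' (E k ?v *[?T] unit ?v)"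
  unfolding homD(3)[OF g E_closed[OF k(1)] y(1)] gy homD(3)[OF h' E_closed[OF k(1)] uT] ..
  also have "... = \<zero>[?M]" using thin_E_unit[OF G(4) k(1) G(1)] k(2) hom_zero[OF lmT lmM h'] by simp
  finally have "E k ?v *[X] y : a_kernel X ?M g" using Ey by (simp add: a_kernel_def')
  then have "E k ?v *[X] y : f ` car ?N" unfolding ker .
  then obtain x where x: "E k ?v *[X] y = f x" "x : car ?N" by (rule imageE)
  note Ek = E_closed[OF q_refl[OF kV]]
  have Ex: "E k k *[?N] x = \<zero>[?N]"
  proof -
  note Sj = D_generated(4)[OF j]
  obtain p p' where p: "p : Hom ?N (thin (D j))" and p': "p' : Hom (thin (D j)) ?N"
  and p'p: "!!x. x : car ?N ==> p' (p x) = x" 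
  by (rule isomorphicE[OF standard_thin(2)[OF j] lmN]) blast
  have "p (E k k *[?N] x) = \<zero>[thin (D j)]"
  unfolding homD(3)[OF p Ek x(2)] thin_E_id[OF Sj kV homD(1)[OF p x(2)]]
  using kj homD(1)[OF p x(2)] by (intro ext) simp
  then have "p' (p (E k k *[?N] x)) = \<zero>[?N]" using hom_zero[OF lm_thin[OF Sj] lmN p'] by simp
  then show ?thesis unfolding p'p[OF E_smult_closed[OF lmN x(2) q_refl[OF kV]]] .
  qed
  have "E k ?v *[X] y = E k k *[X] (E k ?v *[X] y)" by (rule E_smult_id(1)[OF lmX y(1) k(1), symmetric])
  also have "... = f (E k k *[?N] x)" unfolding x(1) homD(3)[OF f Ek x(2)] ..
  also have "... = \<zero>[X]" unfolding Ex by (rule hom_zero[OF lmN lmX f])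
  finally show ?thesis .
 qed
 have "EX s:Hom ?T X. s (unit ?v) = y" by (rule thin_hom_exists[OF G(4,1,2) lmX y out])
 then obtain s where s: "s : Hom ?T X" "s (unit ?v) = y" by (rule bexE)
 have e: "(%ph. g (s ph)) (unit ?v) = h' (unit ?v)" using gy by (simp only: s(2))
 have "g (s (h x)) = x" if x: "x : car ?M" for x
  using thin_hom_eq[OF G(4,1,2) lmM hom_comp[OF s(1) g] h' e homD(1)[OF h x]] h'h[OF x] by simp
 then show "EX s:Hom ?M X. ALL x:car ?M. g (s x) = x"
  by (intro bexI[OF _ hom_comp[OF h s(1)]] ballI)
qed

lemma partial_order_ord: "partial_order_on {0..n} ord"
proof -
 have "partial_order_on {0..n} (lower_ext n r)"
  unfolding partial_order_on_def preorder_on_def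
 proof (intro conjI)
  show "lower_ext n r \<subseteq> {0..n} \<times> {0..n}" using r_dom by (auto simp: lower_ext_def)
  show "refl_on {0..n} (lower_ext n r)"
  using r_dom r_refl by (auto simp: refl_on_def lower_ext_def)
  show "trans (lower_ext n r)"
  proof (rule transI)
  fix x y z assume "(x, y) : lower_ext n r" "(y, z) : lower_ext n r"
  then show "(x, z) : lower_ext n r" using r_dom[of x y] r_dom[of y z] r_trans[of x y z] by (auto simp: lower_ext_def)
  qed
  show "antisym (lower_ext n r)"
  proof (rule antisymI)
  fix x y assume "(x, y) : lower_ext n r" "(y, x) : lower_ext n r"
  then show "x = y" using r_dom[of x y] r_dom[of y x] r_antisym[of x y] by (auto simp: lower_ext_def)
  qed
 qed
 then show ?thesis by simp
qed

theorem quasi_hereditary_suspension: "quasi_hereditary KP {0..n} ord Sim"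
 unfolding quasi_hereditary_def
proof (intro conjI ballI impI)
 fix i j assume i: "i : {0..n}" and j: "j : {0..n}"
  and ne: "Ext1 KP (Del i) (Del j) ~=
  {Ext1_zero KP (Del i) (Del j)}"
 have ij: "i ~= 0" "j = 0" using standard_Ext[OF i j] ne by blast+
 show "(i, j) : ord" using i ij(2) by (simp add: lower_ext_def)
 show "i ~= j" using ij by simp
qed (rule fdKP finite_atLeastAtMost partial_order_ord indexes_simples_Sim standard_End projective_cover_filtered, assumption?)+

end

section \<open>A family of modules\<close>

text \<open>\<open>Star b\<close> is a basis vector at \<open>*\<close>, \<open>Gen k i b\<close> the image at
\<open>k\<close> of a free generator at \<open>i\<close>, and \<open>Lift k j b\<close> the image at
\<open>k\<close> of a preimage of \<open>Star b\<close> at \<open>j\<close>.\<close>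
datatype idx = Star nat | Gen nat nat nat | Lift nat nat nat

context suspension begin

definition Mn :: "nat set" where "Mn = minimal_elements n r"

lemma Mn_dom: "j : Mn ==> j : {1..n}" by (simp add: Mn_def minimal_elements_def)

lemma Mn_min: "j : Mn ==> (i, j) : r ==> i = j"
 using r_dom[of i j] by (simp add: Mn_def minimal_elements_def)

lemma minimal_below: "k : {1..n} ==> EX j:Mn. (j, k) : r"
proof (induction k rule: less_induct)
 case (less k)
 show ?case
 proof (cases "k : Mn")
  case True then show ?thesis using r_refl[OF less.prems] by (intro bexI[of _ k])
 next
  case False
  then obtain i where i: "i : {1..n}" "(i, k) : r" "i ~= k"
  using less.prems by (auto simp: Mn_def minimal_elements_def)
  then have "i < k" using le[OF i(2)] by simp
  from less.IH[OF this i(1)] obtain j where "j : Mn" "(j, i) : r" by (rule bexE)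
  then show ?thesis using r_trans[OF _ i(2)] by (intro bexI[of _ j])
 qed
qed

lemma r_V: "(i, k) : r ==> i : V & k : V & i ~= Suc n & k ~= Suc n"
 using r_dom[of i k] by (auto simp: V_def)

lemma finite_r: "finite r"
 by (rule finite_subset[of _ "{1..n} \<times> {1..n}"]) (use r_dom in auto)

lemma finite_r_up [simp]: "finite {k. (i, k) : r}"
 by (rule finite_subset[of _ "{1..n}"]) (use r_dom in auto)

lemma finite_r_down [simp]: "finite {j. (j, k) : r & P j}" "finite {j. P j & (j, k) : r}"
 by (rule finite_subset[of _ "{1..n}"]; use r_dom in auto)+

definition idx_set :: "nat set => (nat => nat) => idx set" where
 "idx_set L m = {t. case t of Star b => b < m 0 | Gen k i b => (i, k) : r & b < m i
  | Lift k j b => j : L & (j, k) : r & b < m 0}"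

lemma idx_set_simps [simp]:
 "Star b : idx_set L m \<longleftrightarrow> b < m 0" "Gen k i b : idx_set L m \<longleftrightarrow> (i, k) : r & b < m i"
 "Lift k j b : idx_set L m \<longleftrightarrow> j : L & (j, k) : r & b < m 0"
 by (simp_all add: idx_set_def)

lemma finite_idx_set [simp]: "finite (idx_set L m)"
proof (rule finite_subset)
 let ?B = "{..<(\<Sum>i\<in>{0..n}. m i)}"
 let ?S = "Star ` ?B \<union> (%((i, k), b). Gen k i b) ` (r \<times> ?B) \<union> (%((i, k), b). Lift k i b) ` (r \<times> ?B)"
 show "finite ?S" using finite_r by simp
 have m: "b < (\<Sum>i\<in>{0..n}. m i)" if "b < m i" "i : {0..n}" for b i
  using that member_le_sum[of i "{0..n}" m] by simp
 show "idx_set L m \<subseteq> ?S"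
 proof
  fix t assume t: "t : idx_set L m"
  show "t : ?S"
  proof (cases t)
  case (Star b)
  then have "Star b : Star ` ?B" using t m[of b 0] by (intro imageI) simp
  then show ?thesis using Star by blast
  next
  case (Gen k i b)
  then have "(i, k) : r" "b < m i" using t by simp_all
  moreover from this have "b : ?B" using m[of b i] r_dom[of i k] by simp
  ultimately have "Gen k i b : (%((i, k), b). Gen k i b) ` (r \<times> ?B)" by (intro image_eqI[of _ _ "((i, k), b)"]) simp_all
  then show ?thesis using Gen by blast
  next
  case (Lift k i b)
  then have "(i, k) : r" "b < m 0" using t by simp_all
  moreover from this have "b : ?B" using m[of b 0] by simp
  ultimately have "Lift k i b : (%((i, k), b). Lift k i b) ` (r \<times> ?B)" by (intro image_eqI[of _ _ "((i, k), b)"]) simp_all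
  then show ?thesis using Lift by blast
  qed
 qed
qed

fun vtx :: "idx => nat" where
 "vtx (Star b) = Suc n" | "vtx (Gen k i b) = k" | "vtx (Lift k j b) = k"

fun move :: "nat => idx => idx option" where
 "move l (Star b) = Some (Star b)"
| "move l (Gen k i b) = (if l = Suc n then None else Some (Gen l i b))"
| "move l (Lift k j b) = Some (if l = Suc n then Star b else Lift l j b)"

definition Fam :: "nat set => (nat => nat) => ('k mat, idx => 'k) module" where
 "Fam L m = cmod (idx_set L m) vtx move"

lemma q_le_r: "(k, l) : q ==> l ~= Suc n ==> (k, l) : r"
 by (auto simp: q_iff)

lemma cdata_Fam: "cdata (idx_set L m) vtx move"
 unfolding cdata_def
proof (intro conjI ballI allI impI)
 fix t assume t: "t : idx_set L m"
 show "vtx t : V" using t r_V by (cases t) auto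
 show "move (vtx t) t = Some t" using t r_V by (cases t) auto
 fix l u assume l: "(vtx t, l) : q" and u: "move l t = Some u"
 show "u : idx_set L m" using t l u q_le_r r_trans by (cases t) (auto split: if_splits)
 show "vtx u = l" using t l u q_star_left[of l] by (cases t) (auto split: if_splits)
 fix l' assume l': "(l, l') : q"
 show "move l' u = move l' t" using u l' q_star_left[of l'] by (cases t) (auto split: if_splits)
next
 fix t l l' assume "t : idx_set L m" and l: "move l t = None" "(l, l') : q"
 then show "move l' t = None" using q_star_left[of l'] by (cases t) (auto split: if_splits)
qed simp

lemma Fam_simps [simp]:
 "car (Fam L m) = {f. ALL t. t ~: idx_set L m --> f t = 0}" "zero (Fam L m) = 0" "add (Fam L m) = (+)"
 by (simp_all add: Fam_def)

lemma lm_Fam: "left_module KP (Fam L m)" unfolding Fam_def by (rule left_module_cmod[OF cdata_Fam])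
lemma fd_Fam: "fd_module KP (Fam L m)" unfolding Fam_def by (rule fd_cmod[OF cdata_Fam])
lemma scal_Fam: "f : car (Fam L m) ==> scal KP (Fam L m) c f = (%t. c * f t)"
 using scal_cmod[OF cdata_Fam] unfolding Fam_def .

lemma Fam_closed: "M : car KP ==> f : car (Fam L m) ==> M *[Fam L m] f : car (Fam L m)"
 by (rule lmodule.smult_closed[OF lmI[OF lm_Fam]])

lemma Fam_eqI:
 assumes "f : car (Fam L m)" "g : car (Fam L m)"
  "!!b. b < m 0 ==> f (Star b) = g (Star b)"
  "!!k i b. (i, k) : r ==> b < m i ==> f (Gen k i b) = g (Gen k i b)"
  "!!k j b. j : L ==> (j, k) : r ==> b < m 0 ==> f (Lift k j b) = g (Lift k j b)"
 shows "f = g"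
proof
 fix t show "f t = g t"
 proof (cases "t : idx_set L m")
  case True then show ?thesis using assms(3-5) by (cases t) simp_all
 next
  case False then show ?thesis using assms(1,2) by simp
 qed
qed

lemma sum_single_preimage:
 assumes J: "finite J" and c: "inj_on c A" "c ` A \<subseteq> J" "!!a. a : A ==> P (c a)" "!!t. t : J ==> P t ==> t : c ` A"
 shows "(\<Sum>t\<in>J. if P t then (g t :: 'k) else 0) = (\<Sum>a\<in>A. g (c a))"
proof -
 have "(\<Sum>t\<in>J. if P t then g t else 0) = (\<Sum>t\<in>c ` A. if P t then g t else 0)"
  by (rule sum.mono_neutral_right[OF J c(2)]) (use c(4) in auto)
 also have "... = (\<Sum>t\<in>c ` A. g t)" by (rule sum.cong) (use c(3) in auto)
 also have "... = (\<Sum>a\<in>A. g (c a))" by (rule sum.reindex_cong[OF c(1)]) simp_all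
 finally show ?thesis .
qed

lemma Fam_smult_Gen:
 assumes "(i, l) : r" "b < m i"
 shows "(M *[Fam L m] f) (Gen l i b) = (\<Sum>k\<in>{k. (i, k) : r}. ent M l k * f (Gen k i b))"
proof -
 have l: "l ~= Suc n" using r_V[OF assms(1)] by simp
 have "(M *[Fam L m] f) (Gen l i b) =
  (\<Sum>t\<in>idx_set L m. if move l t = Some (Gen l i b) then ent M l (vtx t) * f t else 0)"
  using assms by (simp add: Fam_def cmod_smult cong: if_cong)
 also have "... = (\<Sum>k\<in>{k. (i, k) : r}. ent M l (vtx (Gen k i b)) * f (Gen k i b))"
 proof (rule sum_single_preimage)
  fix t assume "t : idx_set L m" "move l t = Some (Gen l i b)"
  then show "t : (%k. Gen k i b) ` {k. (i, k) : r}" using l by (cases t) auto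
 qed (use assms l in "auto intro: inj_onI")
 finally show ?thesis by simp
qed

lemma Fam_smult_Lift:
 assumes "j : L" "(j, l) : r" "b < m 0"
 shows "(M *[Fam L m] f) (Lift l j b) = (\<Sum>k\<in>{k. (j, k) : r}. ent M l k * f (Lift k j b))"
proof -
 have l: "l ~= Suc n" using r_V[OF assms(2)] by simp
 have "(M *[Fam L m] f) (Lift l j b) =
  (\<Sum>t\<in>idx_set L m. if move l t = Some (Lift l j b) then ent M l (vtx t) * f t else 0)"
  using assms by (simp add: Fam_def cmod_smult cong: if_cong)
 also have "... = (\<Sum>k\<in>{k. (j, k) : r}. ent M l (vtx (Lift k j b)) * f (Lift k j b))"
 proof (rule sum_single_preimage)
  fix t assume "t : idx_set L m" "move l t = Some (Lift l j b)"
  then show "t : (%k. Lift k j b) ` {k. (j, k) : r}" using l by (cases t) auto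
 qed (use assms l in "auto intro: inj_onI")
 finally show ?thesis by simp
qed

lemma Fam_smult_Star:
 assumes b: "b < m 0"
 shows "(M *[Fam L m] f) (Star b) = ent M (Suc n) (Suc n) * f (Star b) +
  (\<Sum>k\<in>{1..n}. ent M (Suc n) k * (\<Sum>j\<in>{j. j : L & (j, k) : r}. f (Lift k j b)))"
proof -
 let ?P = "%t. move (Suc n) t = Some (Star b)" and ?g = "%t. ent M (Suc n) (vtx t) * f t"
 let ?S = "Sigma {1..n} (%k. {j. j : L & (j, k) : r})"
 let ?J = "idx_set L m - {Star b}"
 have "(M *[Fam L m] f) (Star b) = (\<Sum>t\<in>idx_set L m. if ?P t then ?g t else 0)"
  using b by (simp add: Fam_def cmod_smult cong: if_cong)
 also have "... = (if ?P (Star b) then ?g (Star b) else 0) + (\<Sum>t\<in>?J. if ?P t then ?g t else 0)"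
  by (rule sum.remove) (use b in simp_all)
 also have "(\<Sum>t\<in>?J. if ?P t then ?g t else 0) = (\<Sum>a\<in>?S. ?g ((%(k, j). Lift k j b) a))"
 proof (rule sum_single_preimage)
  fix t assume t: "t : ?J" "?P t"
  then obtain k j where "t = Lift k j b" by (cases t) auto
  moreover from this have "(k, j) : ?S" using t r_dom[of j k] by simp
  ultimately show "t : (%(k, j). Lift k j b) ` ?S" by (intro image_eqI[of _ _ "(k, j)"]) simp_all
 qed (use b in "auto intro!: inj_onI")
 also have "... = (\<Sum>k\<in>{1..n}. \<Sum>j\<in>{j. j : L & (j, k) : r}. ent M (Suc n) k * f (Lift k j b))"
  by (subst sum.Sigma) (auto simp: case_prod_beta)
 finally show ?thesis by (simp add: sum_distrib_left)
qed

lemma Fam_E_Gen: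
 assumes "k : V" "l' : V" "(i, l) : r" "b < m i"
 shows "(E l' k *[Fam L m] f) (Gen l i b) = (if l = l' & (i, k) : r then f (Gen k i b) else 0)"
proof -
 have "(\<Sum>c\<in>{c. (i, c) : r}. ent (E l' k) l c * f (Gen c i b)) =
  (\<Sum>c\<in>{c. (i, c) : r}. if c = k then (if l = l' then f (Gen k i b) else 0) else 0)"
  by (rule sum.cong) (use assms r_V in auto)
 then show ?thesis unfolding Fam_smult_Gen[of i l b m, OF assms(3,4)] by simp
qed

lemma Fam_E_Lift:
 assumes "k : V" "l' : V" "j : L" "(j, l) : r" "b < m 0"
 shows "(E l' k *[Fam L m] f) (Lift l j b) = (if l = l' & (j, k) : r then f (Lift k j b) else 0)"
proof -
 have "(\<Sum>c\<in>{c. (j, c) : r}. ent (E l' k) l c * f (Lift c j b)) =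
  (\<Sum>c\<in>{c. (j, c) : r}. if c = k then (if l = l' then f (Lift k j b) else 0) else 0)"
  by (rule sum.cong) (use assms r_V in auto)
 then show ?thesis unfolding Fam_smult_Lift[of j L l b m, OF assms(3-5)] by simp
qed

lemma Fam_E_Star:
 assumes "k : V" "l' : V" "b < m 0"
 shows "(E l' k *[Fam L m] f) (Star b) = (if l' = Suc n then
  (if k = Suc n then f (Star b) else \<Sum>j\<in>{j. j : L & (j, k) : r}. f (Lift k j b)) else 0)"
proof -
 let ?s = "%k. \<Sum>j\<in>{j. j : L & (j, k) : r}. f (Lift k j b)"
 have "(\<Sum>c\<in>{1..n}. ent (E l' k) (Suc n) c * ?s c) = (\<Sum>c\<in>{1..n}. if c = k then (if l' = Suc n then ?s k else 0) else 0)"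
  by (rule sum.cong) (use assms in "auto simp: V_def")
 also have "... = (if k : {1..n} & l' = Suc n then ?s k else 0)" by simp
 finally show ?thesis unfolding Fam_smult_Star[of b m, OF assms(3)] using assms(1,2) by (auto simp: V_cases)
qed

lemma Fam_R_Gen:
 assumes "l' : V" "(i, l) : r" "b < m i"
 shows "(R l' S *[Fam L m] f) (Gen l i b) = (if l = l' then \<Sum>k\<in>{k. (i, k) : r} \<inter> S. f (Gen k i b) else 0)"
proof -
 have "(\<Sum>c\<in>{c. (i, c) : r}. ent (R l' S) l c * f (Gen c i b)) =
  (\<Sum>c\<in>{c. (i, c) : r}. if l = l' then (if c : S then f (Gen c i b) else 0) else 0)"
  by (rule sum.cong) (use assms r_V in auto)
 then show ?thesis unfolding Fam_smult_Gen[of i l b m, OF assms(2,3)] by (cases "l = l'") (simp_all add: sum.inter_restrict)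
qed

lemma Fam_R_Lift:
 assumes "l' : V" "j : L" "(j, l) : r" "b < m 0"
 shows "(R l' S *[Fam L m] f) (Lift l j b) = (if l = l' then \<Sum>k\<in>{k. (j, k) : r} \<inter> S. f (Lift k j b) else 0)"
proof -
 have "(\<Sum>c\<in>{c. (j, c) : r}. ent (R l' S) l c * f (Lift c j b)) =
  (\<Sum>c\<in>{c. (j, c) : r}. if l = l' then (if c : S then f (Lift c j b) else 0) else 0)"
  by (rule sum.cong) (use assms r_V in auto)
 then show ?thesis unfolding Fam_smult_Lift[of j L l b m, OF assms(2-4)] by (cases "l = l'") (simp_all add: sum.inter_restrict)
qed

lemma Fam_R_Star:
 assumes "l' : {1..n}" "b < m 0" shows "(R l' S *[Fam L m] f) (Star b) = 0"
proof -
 have l': "l' : V" "l' ~= Suc n" using assms(1) by (auto simp: V_def)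
 have "ent (R l' S) (Suc n) c = 0" if "c : V" for c using l' that by simp
 then show ?thesis unfolding Fam_smult_Star[of b m, OF assms(2)] by (simp add: V_def)
qed

subsection \<open>Direct sums and powers\<close>

definition glue :: "(nat => nat) => (idx => 'k) => (idx => 'k) => idx => 'k" where
 "glue m f f' t = (case t of Star b => if b < m 0 then f (Star b) else f' (Star (b - m 0))
  | Gen k i b => if b < m i then f (Gen k i b) else f' (Gen k i (b - m i))
  | Lift k j b => if b < m 0 then f (Lift k j b) else f' (Lift k j (b - m 0)))"

lemma glue_simps [simp]:
 "glue m f f' (Star b) = (if b < m 0 then f (Star b) else f' (Star (b - m 0)))"
 "glue m f f' (Gen k i b) = (if b < m i then f (Gen k i b) else f' (Gen k i (b - m i)))"
 "glue m f f' (Lift k j b) = (if b < m 0 then f (Lift k j b) else f' (Lift k j (b - m 0)))"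
 by (simp_all add: glue_def)

lemma Fam_direct_sum: "isomorphic KP (direct_sum (Fam L m) (Fam L m')) (Fam L (%i. m i + m' i))"
proof -
 let ?S = "Fam L (%i. m i + m' i)" and ?D = "direct_sum (Fam L m) (Fam L m')"
 let ?F = "%p. glue m (fst p) (snd p)"
 let ?G1 = "%h t. if t : idx_set L m then h t else (0 :: 'k)"
 let ?G2 = "%h t. case t of Star b => h (Star (b + m 0)) | Gen k i b => h (Gen k i (b + m i)) | Lift k j b => (h (Lift k j (b + m 0)) :: 'k)"
 have cl: "glue m f f' : car ?S" if "f : car (Fam L m)" "f' : car (Fam L m')" for f f'
 proof -
  have f0: "f' (Gen k i b) = 0" if "\<not> ((i, k) : r & b < m' i)" for k i b using \<open>f' : _\<close> that by simp
  have f1: "f' (Lift k i b) = 0" if "\<not> (i : L & (i, k) : r & b < m' 0)" for k i b using \<open>f' : _\<close> that by simp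
  have "glue m f f' t = 0" if "t ~: idx_set L (%i. m i + m' i)" for t
  using that \<open>f : _\<close> \<open>f' : _\<close> by (cases t) (auto intro!: f0 f1)
  then show ?thesis by simp
 qed
 have F: "?F : Hom ?D ?S"
 proof (rule homI)
  fix p assume p: "p : car ?D"
  then obtain f f' where pf: "p = (f, f')" "f : car (Fam L m)" "f' : car (Fam L m')"
  by (cases p) (simp add: ds_simps)
  show "?F p : car ?S" unfolding pf(1) fst_conv snd_conv by (rule cl[OF pf(2,3)])
  {
  fix p' assume "p' : car ?D"
  obtain g g' where pg: "p' = (g, g')" by (cases p')
  show "?F (p +[?D] p') = ?F p +[?S] ?F p'"
  unfolding pf(1) pg ds_simps fst_conv snd_conv Fam_simps
  proof
  fix t show "glue m (f + g) (f' + g') t = (glue m f f' + glue m g g') t" by (cases t) simp_all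
  qed
  }
  fix M assume M: "M : car KP"
  show "?F (M *[?D] p) = M *[?S] ?F p"
  unfolding pf(1) ds_simps fst_conv snd_conv
  proof (rule Fam_eqI)
  show "glue m (M *[Fam L m] f) (M *[Fam L m'] f') : car ?S"
  by (rule cl[OF Fam_closed[OF M pf(2)] Fam_closed[OF M pf(3)]])
  show "M *[?S] glue m f f' : car ?S" by (rule Fam_closed[OF M cl[OF pf(2,3)]])
  show "glue m (M *[Fam L m] f) (M *[Fam L m'] f') (Star b) = (M *[?S] glue m f f') (Star b)" if "b < m 0 + m' 0" for b
  using that by (cases "b < m 0") (simp_all add: Fam_smult_Star)
  show "glue m (M *[Fam L m] f) (M *[Fam L m'] f') (Gen k i b) = (M *[?S] glue m f f') (Gen k i b)"
  if "(i, k) : r" "b < m i + m' i" for k i b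
  using that by (cases "b < m i") (simp_all add: Fam_smult_Gen)
  show "glue m (M *[Fam L m] f) (M *[Fam L m'] f') (Lift k j b) = (M *[?S] glue m f f') (Lift k j b)"
  if "j : L" "(j, k) : r" "b < m 0 + m' 0" for k j b
  using that by (cases "b < m 0") (simp_all add: Fam_smult_Lift)
  qed
 qed
 show ?thesis
 proof (rule isomorphicI[OF F, of "%h. (?G1 h, ?G2 h)"])
  fix h assume h: "h : car ?S"
  have "?G2 h t = 0" if "t ~: idx_set L m'" for t using that h by (cases t) auto
  then show "(?G1 h, ?G2 h) : car ?D" by (simp add: ds_simps)
  show "?F (?G1 h, ?G2 h) = h"
  proof
  fix t show "?F (?G1 h, ?G2 h) t = h t" using h by (cases t) auto
  qed
 next
  fix p assume p: "p : car ?D"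
  then obtain f f' where pf: "p = (f, f')" "f : car (Fam L m)" "f' : car (Fam L m')"
  by (cases p) (simp add: ds_simps)
  have "?G1 (glue m f f') = f"
  proof
  fix t show "?G1 (glue m f f') t = f t" using pf(2) by (cases t) auto
  qed
  moreover have "?G2 (glue m f f') = f'"
  proof
  fix t show "?G2 (glue m f f') t = f' t" by (cases t) auto
  qed
  ultimately show "(?G1 (?F p), ?G2 (?F p)) = p" unfolding pf(1) fst_conv snd_conv by simp
 qed
qed

lemma Fam_zero: assumes "m = (%_. 0)" shows "car (Fam L m) = {\<zero>[Fam L m]}"
proof -
 have "t ~: idx_set L m" for t using assms by (cases t) simp_all
 then show ?thesis by (auto simp: zero_fun_def)
qed

subsection \<open>The multiplicity functors\<close>

text \<open>With these elements as \<open>a\<close>, \<open>c\<close>, \<open>d\<close>, \<open>pp_rank1\<close> speaks of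
the component at \<open>*\<close> for index \<open>0\<close>, and for \<open>i > 0\<close> of the kernel of
\<open>M\<^sub>i \<rightarrow> M\<^sub>*\<close> modulo the images from smaller vertices.\<close>
definition aF :: "nat => 'k mat" where "aF i = (if i = 0 then 0\<^sub>m (Suc n) (Suc n) else Es i)"
definition cF :: "nat => 'k mat" where "cF i = E (vx i) (vx i)"
definition rad :: "nat => nat set" where "rad i = {j. (j, i) : r & j ~= i}"
definition dF :: "nat => 'k mat" where "dF i = (if i = 0 then 0\<^sub>m (Suc n) (Suc n) else R i (rad i))"

lemma rad_closed: "i : {1..n} ==> R i (rad i) : car KP"
 by (rule R_closed) (auto simp: rad_def q_iff V_def)

lemma acdF_closed:
 assumes i: "i : {0..n}" shows "aF i : car KP" "cF i : car KP" "dF i : car KP"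
proof -
 have V: "i : V" if "i ~= 0" using i that by (auto simp: V_def)
 show "aF i : car KP" using E_closed[OF q_star[OF V]] by (auto simp: aF_def)
 show "cF i : car KP" unfolding cF_def by (rule E_closed[OF q_refl[OF vx_V[OF i]]])
 show "dF i : car KP" using rad_closed[of i] i by (auto simp: dF_def)
qed

definition top_idx :: "nat => nat => idx" where "top_idx i b = (if i = 0 then Star b else Gen i i b)"

abbreviation NF :: "(nat => nat) => ('k mat, idx => 'k) module" where "NF \<equiv> Fam Mn"

lemma NF_key:
 assumes i: "i : {0..n}" and x: "x : car (NF m)" and a: "aF i *[NF m] x = \<zero>[NF m]"
 shows "(EX w:car (NF m). cF i *[NF m] x = dF i *[NF m] w) \<longleftrightarrow> (ALL b<m i. x (top_idx i b) = 0)"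
proof (cases "i = 0")
 case True
 interpret lmodule KP "NF m" by (rule lmI) (rule lm_Fam)
 have d: "dF i *[NF m] w = 0" if "w : car (NF m)" for w
  using smult_zero_left[OF that] True by (simp add: dF_def)
 have z: "\<zero>[NF m] : car (NF m)" by (rule M.zero_closed)
 have "(cF i *[NF m] x = 0) \<longleftrightarrow> (ALL b<m 0. x (Star b) = 0)"
 proof
  assume "cF i *[NF m] x = 0"
  then have e: "(Es (Suc n) *[NF m] x) (Star b) = 0" for b using True by (simp add: cF_def vx_def)
  have "x (Star b) = (Es (Suc n) *[NF m] x) (Star b)" if "b < m 0" for b using that by (simp add: Fam_E_Star)
  then show "ALL b<m 0. x (Star b) = 0" unfolding e by (intro allI impI)
 next
  assume 0: "ALL b<m 0. x (Star b) = 0"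
  show "cF i *[NF m] x = 0"
  proof (rule Fam_eqI[OF Fam_closed[OF acdF_closed(2)[OF i] x]])
  show "(0 :: idx => 'k) : car (NF m)" by simp
  qed (use 0 True r_V in "auto simp: cF_def vx_def Fam_E_Star Fam_E_Gen Fam_E_Lift r_star")
 qed
 then show ?thesis using d z True by (auto simp: top_idx_def simp del: Fam_simps)
next
 case False
 then have iP: "i : {1..n}" and iV: "i : V" "i ~= Suc n" using i by (auto simp: V_def)
 have c: "cF i = E i i" and d: "dF i = R i (rad i)" and a': "aF i = Es i" using False by (simp_all add: cF_def dF_def vx_def aF_def)
 have lift0: "x (Lift i i b) = 0" if "i : Mn" "b < m 0" for b
 proof -
  have "{j. j : Mn & (j, i) : r} = {i}" using that(1) Mn_min[OF that(1)] r_refl[OF iP] by auto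
  then have "x (Lift i i b) = (Es i *[NF m] x) (Star b)" using that iV by (simp add: Fam_E_Star)
  also have "... = 0" using a unfolding a' by simp
  finally show ?thesis .
 qed
 show ?thesis
 proof
  assume "EX w:car (NF m). cF i *[NF m] x = dF i *[NF m] w"
  then obtain w where w: "E i i *[NF m] x = R i (rad i) *[NF m] w" unfolding c d by (rule bexE)
  have "x (Gen i i b) = 0" if b: "b < m i" for b
  proof -
  have e: "{k. (i, k) : r} \<inter> rad i = {}" using r_antisym by (auto simp: rad_def)
  have "x (Gen i i b) = (E i i *[NF m] x) (Gen i i b)" using b r_refl[OF iP] iV by (simp add: Fam_E_Gen)
  also have "... = 0" unfolding w using b r_refl[OF iP] iV e by (simp add: Fam_R_Gen)
  finally show ?thesis .
  qed
  then show "ALL b<m i. x (top_idx i b) = 0" using False by (simp add: top_idx_def)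
 next
  assume "ALL b<m i. x (top_idx i b) = 0"
  then have gen0: "x (Gen i i b) = 0" if "b < m i" for b using that False by (simp add: top_idx_def)
  define w where "w t = (case t of Star b => 0 | Gen k j b => if k = j & j : rad i & b < m j then x (Gen i j b) else 0
  | Lift k j b => if k = j & j : rad i & j : Mn & b < m 0 then x (Lift i j b) else 0)" for t
  have ws: "w (Gen k j b) = (if k = j & j : rad i & b < m j then x (Gen i j b) else 0)"
  "w (Lift k j b) = (if k = j & j : rad i & j : Mn & b < m 0 then x (Lift i j b) else 0)" for k j b
  by (simp_all add: w_def)
  have rr: "(j, j) : r" if "j : rad i" for j using that r_dom[of j i] r_refl[of j] by (simp add: rad_def)
  have "w t = 0" if "t ~: idx_set Mn m" for t using that rr by (cases t) (auto simp: ws, simp add: w_def)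
  then have wc: "w : car (NF m)" by simp
  have "E i i *[NF m] x = R i (rad i) *[NF m] w"
  proof (rule Fam_eqI[OF Fam_closed[OF E_closed[OF q_refl[OF iV(1)]] x] Fam_closed[OF rad_closed[OF iP] wc]])
  fix b assume "b < m 0"
  then show "(E i i *[NF m] x) (Star b) = (R i (rad i) *[NF m] w) (Star b)"
  using iV by (simp only: Fam_R_Star[OF iP]) (simp add: Fam_E_Star)
  next
  fix k j b assume kj: "(j, k) : r" and b: "b < m j"
  have "(\<Sum>c\<in>{c. (j, c) : r} \<inter> rad i. w (Gen c j b)) = (\<Sum>c\<in>{c. (j, c) : r} \<inter> rad i. if c = j then x (Gen i j b) else 0)"
  by (rule sum.cong) (use b in "auto simp: ws")
  also have "... = (if j : rad i then x (Gen i j b) else 0)" using rr by simp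
  finally show "(E i i *[NF m] x) (Gen k j b) = (R i (rad i) *[NF m] w) (Gen k j b)"
  using kj b iV gen0[of b] by (auto simp: Fam_E_Gen Fam_R_Gen rad_def)
  next
  fix k j b assume j: "j : Mn" and kj: "(j, k) : r" and b: "b < m 0"
  have "(\<Sum>c\<in>{c. (j, c) : r} \<inter> rad i. w (Lift c j b)) = (\<Sum>c\<in>{c. (j, c) : r} \<inter> rad i. if c = j then x (Lift i j b) else 0)"
  by (rule sum.cong) (use b j in "auto simp: ws")
  also have "... = (if j : rad i then x (Lift i j b) else 0)" using rr by simp
  finally show "(E i i *[NF m] x) (Lift k j b) = (R i (rad i) *[NF m] w) (Lift k j b)"
  using kj b j iV lift0[of b] by (auto simp: Fam_E_Lift Fam_R_Lift rad_def)
  qed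
  then show "EX w:car (NF m). cF i *[NF m] x = dF i *[NF m] w" unfolding c d by (rule bexI[OF _ wc])
 qed
qed

definition vanishes :: "('k mat, 'm) module => nat => bool" where
 "vanishes M i = pp_imp KP M (aF i) (0\<^sub>m (Suc n) (Suc n)) (cF i) (dF i)"

lemma NF_vanishes: 
 assumes i: "i : {0..n}" shows "vanishes (NF m) i \<longleftrightarrow> m i = 0"
proof -
 interpret lmodule KP "NF m" by (rule lmI) (rule lm_Fam)
 have Z: "0\<^sub>m (Suc n) (Suc n) *[NF m] z = \<zero>[NF m]" if "z : car (NF m)" for z using smult_zero_left[OF that] by simp
 have z0: "\<zero>[NF m] : car (NF m)" by (rule M.zero_closed)
 show ?thesis
 proof
  assume v: "vanishes (NF m) i"
  show "m i = 0"
  proof (rule ccontr)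
  assume "m i ~= 0"
  define x where "x t = (if t = top_idx i 0 then 1 else (0 :: 'k))" for t
  have "top_idx i 0 : idx_set Mn m" using \<open>m i ~= 0\<close> i r_refl[of i] by (auto simp: top_idx_def)
  then have x: "x : car (NF m)" by (auto simp: x_def)
  have "aF i *[NF m] x = \<zero>[NF m]"
  proof (cases "i = 0")
  case True then show ?thesis using Z[OF x] by (simp add: aF_def)
  next
  case False
  have xL: "x (Lift k j b) = 0" for k j b by (simp add: x_def top_idx_def)
  have iV: "i : V" "i ~= Suc n" using i False by (auto simp: V_def)
  show ?thesis
  proof (rule Fam_eqI[OF Fam_closed[OF acdF_closed(1)[OF i] x] z0])
  qed (use iV False r_V in "auto simp: aF_def Fam_E_Star Fam_E_Gen Fam_E_Lift xL r_star")
  qed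
  moreover from this have "EX w:car (NF m). cF i *[NF m] x = dF i *[NF m] w"
  using v Z[OF z0] unfolding vanishes_def pp_imp_def by (metis x z0)
  ultimately have "x (top_idx i 0) = 0" using NF_key[OF i x] \<open>m i ~= 0\<close> by blast
  then show False by (simp add: x_def)
  qed
 next
  assume m: "m i = 0"
  show "vanishes (NF m) i" unfolding vanishes_def pp_imp_def
  proof (intro ballI impI)
  fix x z assume x: "x : car (NF m)" and z: "z : car (NF m)" and e: "aF i *[NF m] x = 0\<^sub>m (Suc n) (Suc n) *[NF m] z"
  have "aF i *[NF m] x = \<zero>[NF m]" unfolding e by (rule Z[OF z])
  from NF_key[OF i x this] show "EX w:car (NF m). cF i *[NF m] x = dF i *[NF m] w" using m by simp
  qed
 qed
qed

lemma NF_rank1: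
 assumes i: "i : {0..n}" and m: "m i \<le> 1" shows "pp_rank1 KP (NF m) (aF i) (cF i) (dF i)"
 unfolding pp_rank1_def
proof (intro ballI impI)
 interpret lmodule KP "NF m" by (rule lmI) (rule lm_Fam)
 note lm = lm_Fam[of Mn m] and A = fdKP
 note aL = acdF_closed(1)[OF i]
 fix x y assume x: "x : car (NF m)" and y: "y : car (NF m)"
  and a: "aF i *[NF m] x = \<zero>[NF m]" "aF i *[NF m] y = \<zero>[NF m]"
 define al bt where "al = x (top_idx i 0)" "bt = y (top_idx i 0)"
 obtain s t where st: "(s, t) ~= (0, 0)" "s * al + t * bt = 0"
 proof (cases "al = 0")
  case True show ?thesis by (rule that[of 1 0]) (simp_all add: True)
 next
  case False show ?thesis by (rule that[of bt "- al"]) (simp_all add: False)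
 qed
 let ?u = "scal KP (NF m) s x +[NF m] scal KP (NF m) t y"
 have sc: "scal KP (NF m) s x : car (NF m)" "scal KP (NF m) t y : car (NF m)"
  by (rule scal_closed[OF A lm x], rule scal_closed[OF A lm y])
 have u: "?u : car (NF m)" by (rule M.a_closed[OF sc])
 have "aF i *[NF m] ?u = \<zero>[NF m]"
  unfolding smult_r_distr[OF aL sc] smult_scal[OF A lm aL x] smult_scal[OF A lm aL y] a scal_zero_right[OF A lm]
  by (rule M.l_zero[OF M.zero_closed])
 moreover have "?u (top_idx i b) = 0" if "b < m i" for b
 proof -
  have "b = 0" using that m by simp
  then show ?thesis unfolding scal_Fam[OF x] scal_Fam[OF y] using st(2) by (simp add: al_bt_def)
 qed
 ultimately have "EX w:car (NF m). cF i *[NF m] ?u = dF i *[NF m] w" using NF_key[OF i u] by blast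
 then show "EX s t. (s, t) ~= (0, 0) & (EX w:car (NF m). cF i *[NF m] (scal KP (NF m) s x +[NF m] scal KP (NF m) t y) = dF i *[NF m] w)"
  using st(1) by (intro exI[of _ s] exI[of _ t] conjI)
qed

end

lemma module_hom_subdomain:
 assumes "f : module_hom A M N" "U \<subseteq> car M" shows "f : module_hom A (M(|carrier := U|)) N"
proof (rule homI)
 fix x assume "x : car (M(|carrier := U|))"
 then have x: "x : U" by simp
 note xM = subsetD[OF assms(2) x]
 show "f x : car N" by (rule homD(1)[OF assms(1) xM])
 show "f (a *[M(|carrier := U|)] x) = a *[N] f x" if "a : car A" for a
  using homD(3)[OF assms(1) that xM] by simp
 show "f (x +[M(|carrier := U|)] y) = f x +[N] f y" if "y : car (M(|carrier := U|))" for y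
  using homD(2)[OF assms(1) xM] subsetD[OF assms(2), of y] that by simp
qed

lemma fd_submodule_std:
 fixes M :: "('a, 'x => 'k::field) module"
 assumes A: "fd_algebra A" and M: "std_module bt A M" and U: "submod U A M"
 shows "fd_module A (M(|carrier := U|))"
proof -
 have lm: "left_module A M" and bt: "finite bt" and add: "add M = (+)" and z: "zero M = 0"
  and car: "car M = {f. ALL t. t ~: bt --> f t = 0}" and sc: "!!c x. x : car M ==> scal A M c x = (%t. c * x t)"
  using M by (simp_all add: std_module_def)
 note UD = submoduleD[OF U]
 have kU: "kclosed A M U" by (rule submodule_kclosed[OF A lm U])
 have UM: "x : car M" if "x : U" for x using UD(1) that by (rule subsetD)
 have sU: "(%t. c * x t) : U" if "x : U" for c x
 proof -
  have "scal A M c x : U" using kU that unfolding kclosed_def by (elim conjE) (drule spec, drule bspec)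
  then show ?thesis unfolding sc[OF UM[OF that]] .
 qed
 have sU': "fvs.subspace U" unfolding fvs.subspace_def using UD(2,3) sU unfolding z add by (intro conjI ballI allI)
 have s0: "fvs.subspace {0 :: 'x => 'k}" by (simp add: fvs.subspace_def zero_fun_def)
 have s0U: "{0} \<subseteq> U" using UD(2) z by simp
 have supp: "f t = 0" if "f : U" "t ~: bt" for f t using UM[OF that(1)] that(2) car by simp
 obtain m :: nat and g where g: "!!b. b < m ==> g b : U"
  "!!x. x : U ==> EX al. x - (\<Sum>b<m. (%t. al b * g b t)) : {0}"
 proof (rule complement_basis[OF bt s0 sU' s0U])
  fix f t assume "f : U" "t ~: bt" then show "f t = 0" by (rule supp)
 next
  fix m :: nat and g assume "!!b. b < m ==> g b : U"
  "!!x. x : U ==> EX al. x - (\<Sum>b<m. (%t. al b * g b t)) : {0}"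
  then show thesis by (rule that)
 qed
 show ?thesis
 proof (rule fd_moduleI[OF A lm_sub[OF lm U], of "g ` {..<m}"])
  show "g ` {..<m} \<subseteq> car (M(|carrier := U|))" using g(1) by auto
  fix U' assume U': "kclosed A (M(|carrier := U|)) U'" and gU': "g ` {..<m} \<subseteq> U'"
  have U'U: "U' \<subseteq> U" and U'0: "0 : U'" and U'a: "!!x y. x : U' ==> y : U' ==> x + y : U'"
  and U's: "!!c x. x : U' ==> scal A (M(|carrier := U|)) c x : U'"
  using U' add z by (simp_all add: kclosed_def)
  have sc': "(%t. c * x t) : U'" if "x : U'" for c x
  proof -
  have "scal A (M(|carrier := U|)) c x = scal A M c x" by (simp add: scal_def)
  also have "... = (%t. c * x t)" by (rule sc[OF UM[OF subsetD[OF U'U that]]])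
  finally show ?thesis using U's[OF that, of c] by simp
  qed
  have sum: "(\<Sum>b<m'. (%t. al b * g b t)) : U'" if "m' \<le> m" for m' al
  using that
  proof (induction m')
  case 0 show ?case using U'0 by (simp add: zero_fun_def)
  next
  case (Suc m')
  have m': "m' \<le> m" using Suc.prems by simp
  have "g m' : U'" by (rule subsetD[OF gU' imageI]) (use Suc.prems in simp)
  then show ?case unfolding sum.lessThan_Suc by (intro U'a Suc.IH[OF m'] sc')
  qed
  show "car (M(|carrier := U|)) \<subseteq> U'"
  proof
  fix x assume "x : car (M(|carrier := U|))"
  then have "x : U" by simp
  then obtain al where "x - (\<Sum>b<m. (%t. al b * g b t)) : {0}" using g(2) by blast
  then have "x - (\<Sum>b<m. (%t. al b * g b t)) = 0" by (rule singletonD)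
  then have x: "x = (\<Sum>b<m. (%t. al b * g b t))" by (rule eq_iff_diff_eq_0[THEN iffD2])
  show "x : U'" by (subst x) (rule sum[OF order_refl])
  qed
 qed simp
qed

context suspension begin

section \<open>Tilting conditions\<close>

abbreviation Z :: "'k mat" where "Z \<equiv> 0\<^sub>m (Suc n) (Suc n)"

definition low :: "nat => nat => nat set" where "low i k = {j. (j, k) : r & (i, j) ~: r}"

text \<open>The maps \<open>M\<^sub>i \<rightarrow> M\<^sub>*\<close> are onto, and \<open>M\<close> is free over
\<open>\<P>\<close>: if the image at \<open>k\<close> of a vector at \<open>i\<close> is a sum of images from
vertices not above \<open>i\<close>, then that vector is itself a sum of images from vertices below
\<open>i\<close>.\<close>
definition tilt :: "('k mat, 'm) module => bool" where
 "tilt M \<longleftrightarrow> (ALL i:{1..n}. pp_imp KP M Z Z (Es (Suc n)) (Es i)) &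
  (ALL i k. (i, k) : r --> pp_imp KP M (E k i) (R k (low i k)) (E i i) (R i (rad i)))"

lemma r_q: "(i, k) : r ==> (i, k) : q" by (simp add: q_iff)

lemma tilt_closed:
 shows "Z : car KP" "Es (Suc n) : car KP" "i : {1..n} ==> Es i : car KP"
  "(i, k) : r ==> E k i : car KP" "(i, k) : r ==> R k (low i k) : car KP"
  "(i, k) : r ==> E i i : car KP" "(i, k) : r ==> R i (rad i) : car KP"
proof -
 show "Es (Suc n) : car KP" by (rule E_closed[OF q_refl[OF V_star]])
 show "i : {1..n} ==> Es i : car KP" by (rule E_closed[OF q_star]) (simp add: V_def)
 show "(i, k) : r ==> E k i : car KP" by (rule E_closed[OF r_q])
 show "(i, k) : r ==> R k (low i k) : car KP" using r_V r_q by (intro R_closed) (auto simp: low_def)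
 show "(i, k) : r ==> E i i : car KP" using r_V by (intro E_closed q_refl) simp
 show "(i, k) : r ==> R i (rad i) : car KP" using r_dom by (intro rad_closed) simp
qed (rule KP_closed)

lemma tilt_iso:
 assumes "left_module KP M" "isomorphic KP M M'" "tilt M" shows "tilt M'"
 unfolding tilt_def
proof (intro conjI ballI allI impI)
 fix i assume "i : {1..n}"
 then show "pp_imp KP M' Z Z (Es (Suc n)) (Es i)"
  using assms(3) unfolding tilt_def by (intro pp_imp_iso[OF assms(1,2)] tilt_closed) simp_all
next
 fix i k assume "(i, k) : r"
 then show "pp_imp KP M' (E k i) (R k (low i k)) (E i i) (R i (rad i))"
  using assms(3) unfolding tilt_def by (intro pp_imp_iso[OF assms(1,2)] tilt_closed) simp_all
qed

lemma tilt_direct_sum: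
 assumes lm: "left_module KP M" "left_module KP M'"
 shows "tilt (direct_sum M M') \<longleftrightarrow> tilt M & tilt M'"
proof -
 have 1: "pp_imp KP (direct_sum M M') Z Z (Es (Suc n)) (Es i) \<longleftrightarrow>
  pp_imp KP M Z Z (Es (Suc n)) (Es i) & pp_imp KP M' Z Z (Es (Suc n)) (Es i)"
  if "i : {1..n}" for i by (rule pp_imp_direct_sum[OF lm]) (rule tilt_closed(3)[OF that] tilt_closed(1,2))+
 have 2: "pp_imp KP (direct_sum M M') (E k i) (R k (low i k)) (E i i) (R i (rad i)) \<longleftrightarrow>
  pp_imp KP M (E k i) (R k (low i k)) (E i i) (R i (rad i)) &
  pp_imp KP M' (E k i) (R k (low i k)) (E i i) (R i (rad i))"
  if "(i, k) : r" for i k by (rule pp_imp_direct_sum[OF lm]) (rule tilt_closed(4-7)[OF that])+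
 show ?thesis
  unfolding tilt_def
 proof (intro iffI conjI ballI allI impI; (elim conjE)?)
 qed (use 1 2 in blast)+
qed

lemma tilt_power:
 assumes lm: "left_module KP M" and M: "tilt M" shows "tilt (power_module M m)"
 unfolding tilt_def
proof (intro conjI ballI allI impI)
 fix i assume "i : {1..n}"
 then show "pp_imp KP (power_module M m) Z Z (Es (Suc n)) (Es i)"
  using M unfolding tilt_def by (intro pp_imp_power[OF lm] tilt_closed) simp_all
next
 fix i k assume "(i, k) : r"
 then show "pp_imp KP (power_module M m) (E k i) (R k (low i k)) (E i i) (R i (rad i))"
  using M unfolding tilt_def by (intro pp_imp_power[OF lm] tilt_closed) simp_all
qed

lemma pp_surj_iff:
 assumes lm: "left_module KP M"
 shows "pp_imp KP M Z Z c d \<longleftrightarrow> (ALL x:car M. EX w:car M. c *[M] x = d *[M] w)"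
proof -
 interpret lmodule KP M by (rule lmI) (rule lm)
 have Z: "Z *[M] z = \<zero>[M]" if "z : car M" for z using smult_zero_left[OF that] by simp
 show ?thesis
 proof
  assume pp: "pp_imp KP M Z Z c d"
  show "ALL x:car M. EX w:car M. c *[M] x = d *[M] w"
  proof
  fix x assume x: "x : car M"
  show "EX w:car M. c *[M] x = d *[M] w" using pp[unfolded pp_imp_def, rule_format, OF x x refl] .
  qed
 next
  assume "ALL x:car M. EX w:car M. c *[M] x = d *[M] w"
  then show "pp_imp KP M Z Z c d" unfolding pp_imp_def by (intro ballI impI) (erule bspec)
 qed
qed

lemma surj_filtered:
 assumes fil: "filtered_by KP X M" and lm: "left_module KP M" and i: "i : V"
  and X: "!!N'. N' : X ==> left_module KP N'"
  and surj: "!!N'. N' : X ==> pp_imp KP N' Z Z (Es (Suc n)) (Es i)"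
 shows "pp_imp KP M Z Z (Es (Suc n)) (Es i)"
proof -
 interpret lmodule KP M by (rule lmI) (rule lm)
 let ?c = "Es (Suc n)" and ?d = "Es i"
 have c: "?c : car KP" by (rule tilt_closed)
 have d: "?d : car KP" by (rule E_closed[OF q_star[OF i]])
 let ?P = "%U. ALL x:U. EX w:U. ?c *[M] x = ?d *[M] w"
 have "?P (car M)"
 proof (rule filtered_induct[OF fil lm X, where P = ?P])
  show "?P {\<zero>[M]}" using c d by simp
  fix U V' N' p assume U: "submod U KP M" and V': "submod V' KP M" and UV: "U \<subseteq> V'" and N': "N' : X"
  and p: "p : Hom (M(|carrier := V'|)) N'" "p ` V' = car N'" "U = {x : V'. p x = \<zero>[N']}" and IH: "?P U"
  note lmN = X[OF N'] and lmV = lm_sub[OF lm V']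
  interpret N: lmodule KP N' by (rule lmI) (rule lmN)
  note VD = submoduleD[OF V']
  have pD: "p (x +[M] y) = p x +[N'] p y" "p (-[M] x) = -[N'] p x" "a : car KP ==> p (a *[M] x) = a *[N'] p x" "p x : car N'"
  if "x : V'" "y : V'" for x y a
  proof -
  show "p (x +[M] y) = p x +[N'] p y" using homD(2)[OF p(1), of x y] that by simp
  show px: "p x : car N'" using homD(1)[OF p(1), of x] that by simp
  show "a : car KP ==> p (a *[M] x) = a *[N'] p x" using homD(3)[OF p(1), of a x] that by simp
  have "p (-[M] x) +[N'] p x = \<zero>[N']"
  using homD(2)[OF p(1), of "-[M] x" x] that VD(5)[OF that(1)] M.l_neg[OF subsetD[OF VD(1) that(1)]]
  hom_zero[OF lmV lmN p(1)] by simp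
  moreover have "p (-[M] x) : car N'" using homD(1)[OF p(1), of "-[M] x"] VD(5)[OF that(1)] by simp
  ultimately show "p (-[M] x) = -[N'] p x" using px by (simp add: N.M.minus_equality)
  qed
  show "?P V'"
  proof
  fix x assume x: "x : V'"
  have xM: "x : car M" by (rule subsetD[OF VD(1) x])
  have "EX w:car N'. ?c *[N'] p x = ?d *[N'] w"
  using surj[OF N'] pD(4)[OF x x] unfolding pp_surj_iff[OF lmN] by (rule bspec)
  then obtain w' where w': "w' : car N'" "?c *[N'] p x = ?d *[N'] w'" by (rule bexE)
  have "w' : p ` V'" unfolding p(2) by (rule w'(1))
  then obtain w where w: "w' = p w" "w : V'" by (rule imageE)
  have wM: "w : car M" by (rule subsetD[OF VD(1) w(2)])
  have cx: "?c *[M] x : V'" and dw: "?d *[M] w : V'" by (rule VD(4)[OF c x], rule VD(4)[OF d w(2)])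
  note cxM = subsetD[OF VD(1) cx] and dwM = subsetD[OF VD(1) dw]
  let ?u = "?c *[M] x +[M] -[M] (?d *[M] w)"
  have uV: "?u : V'" by (rule VD(3)[OF cx VD(5)[OF dw]])
  have "p ?u = \<zero>[N']"
  unfolding pD(1)[OF cx VD(5)[OF dw]] pD(2)[OF dw dw] pD(3)[OF x x c] pD(3)[OF w(2) w(2) d] w'(2) w(1)
  by (rule N.M.r_neg) (rule N.smult_closed[OF d pD(4)[OF w(2) w(2)]])
  then have uU: "?u : U" unfolding p(3) using uV by (intro CollectI conjI)
  have cc: "?c *[M] (?c *[M] x) = ?c *[M] x" "?c *[M] (?d *[M] w) = ?d *[M] w"
  by (rule E_smult_id(1)[OF lm xM q_refl[OF V_star]], rule E_smult_id(1)[OF lm wM q_star[OF i]])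
  have cu: "?c *[M] ?u = ?u"
  unfolding smult_r_distr[OF c cxM M.a_inv_closed[OF dwM]] smult_minus_right[OF c dwM] cc ..
  have "EX v:U. ?c *[M] ?u = ?d *[M] v" using IH uU by (rule bspec)
  then obtain v where v: "v : U" "?c *[M] ?u = ?d *[M] v" by (rule bexE)
  have vM: "v : car M" using subsetD[OF UV v(1)] VD(1) by blast
  have "?d *[M] (v +[M] w) = ?u +[M] ?d *[M] w" unfolding smult_r_distr[OF d vM wM] using v(2) cu by simp
  also have "... = ?c *[M] x" using cxM dwM by (simp add: M.a_assoc M.l_neg)
  finally show "EX w:V'. ?c *[M] x = ?d *[M] w"
  by (intro bexI[of _ "v +[M] w"]) (simp, rule VD(3)[OF subsetD[OF UV v(1)] w(2)])
  qed
 qed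
 then show ?thesis unfolding pp_surj_iff[OF lm] .
qed

lemma thin_N_surj:
 assumes j: "j : {0..n}" and i: "i : {1..n}"
 shows "pp_imp KP (thin (N j)) Z Z (Es (Suc n)) (Es i)"
 unfolding pp_surj_iff[OF lm_thin[OF N_convex[OF j]]]
proof
 note S = N_convex[OF j]
 have iV: "i : V" using i by (simp add: V_def)
 fix x assume x: "x : car (thin (N j))"
 let ?w = "%u. if u = i & i : N j & Suc n : N j then x (Suc n) else 0"
 have w: "?w : car (thin (N j))" by simp
 have iN: "i : N j" if "Suc n : N j" using that j iV by (auto simp: mem_N[OF j] split: if_splits)
 show "EX w:car (thin (N j)). Es (Suc n) *[thin (N j)] x = Es i *[thin (N j)] w"
 proof (rule bexI[OF _ w])
  show "Es (Suc n) *[thin (N j)] x = Es i *[thin (N j)] ?w"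
  unfolding thin_E[OF S q_refl[OF V_star] x] thin_E[OF S q_star[OF iV] w] by (rule ext) (simp add: iN)
 qed
qed

lemma thin_R:
 assumes "finite S" "S \<subseteq> V" "k : V"
 shows "(R k T *[thin S] f) u = (if u = k & k : S then \<Sum>t\<in>S \<inter> T. f t else 0)"
proof -
 have "(\<Sum>t\<in>S. ent (R k T) u t * f t) = (if u = k then \<Sum>t\<in>S \<inter> T. f t else 0)" if "u : S"
 proof -
  have "(\<Sum>t\<in>S. ent (R k T) u t * f t) = (\<Sum>t\<in>S. if u = k then (if t : T then f t else 0) else 0)"
  by (rule sum.cong) (use assms(2,3) that in "auto simp: subset_iff")
  also have "... = (if u = k then \<Sum>t\<in>S \<inter> T. f t else 0)"
  using assms(1) by (cases "u = k") (simp_all add: sum.inter_restrict)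
  finally show ?thesis .
 qed
 then show ?thesis by (auto simp: thin_smult)
qed

text \<open>For \<open>i = i0\<close> the coordinate at \<open>i\<close> vanishes, because the right-hand side has no
terms at \<open>k\<close>; for larger \<open>i\<close> the generator at \<open>i0\<close> provides the
witness.\<close>
lemma thin_D_free:
 assumes i0: "i0 : {0..n}" and ik: "(i, k) : r"
 shows "pp_imp KP (thin (D i0)) (E k i) (R k (low i k)) (E i i) (R i (rad i))"
 unfolding pp_imp_def
proof (intro ballI impI)
 note S = D_generated(4)[OF i0] and SV = D_generated(3)[OF i0]
 have fin: "finite (D i0)" by (rule finite_subset[OF SV finite_V])
 have V: "i : V" "k : V" using r_V[OF ik] by simp_all
 fix x z assume x: "x : car (thin (D i0))" and z: "z : car (thin (D i0))"
  and e: "E k i *[thin (D i0)] x = R k (low i k) *[thin (D i0)] z"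
 have key: "x i = 0 \<or> i : D i0 & i0 : D i0 \<inter> rad i"
 proof (cases "i : D i0")
  case False then show ?thesis using x by simp
 next
  case True
  have 0: "i0 ~= 0"
  proof
  assume "i0 = 0"
  then show False using True r_V[OF ik] by (simp add: mem_D)
  qed
  have i0i: "(i0, i) : r" using True 0 mem_D[OF i0, of i] by simp
  show ?thesis
  proof (cases "i = i0")
  case eq: True
  have kD: "k : D i0" using ik eq 0 mem_D[OF i0, of k] by simp
  have "D i0 \<inter> low i k = {}" using eq 0 by (auto simp: low_def mem_D[OF i0])
  then have "x i = 0"
  using fun_cong[OF e, of k] kD unfolding thin_E[OF S r_q[OF ik] x] thin_R[OF fin SV V(2)] by simp
  then show ?thesis by simp
  next
  case False
  then show ?thesis using True 0 i0i r_refl[of i0] i0 by (auto simp: rad_def mem_D[OF i0])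
  qed
 qed
 let ?w = "%u. if u = i0 & i0 : D i0 \<inter> rad i then x i else 0"
 have w: "?w : car (thin (D i0))" by simp
 show "EX w:car (thin (D i0)). E i i *[thin (D i0)] x = R i (rad i) *[thin (D i0)] w"
 proof (rule bexI[OF _ w], rule ext)
  fix u
  have "(\<Sum>t\<in>D i0 \<inter> rad i. ?w t) = (\<Sum>t\<in>D i0 \<inter> rad i. if t = i0 then x i else 0)" by (rule sum.cong) auto
  also have "... = (if i0 : D i0 \<inter> rad i then x i else 0)" using fin by simp
  finally show "(E i i *[thin (D i0)] x) u = (R i (rad i) *[thin (D i0)] ?w) u"
  unfolding thin_E[OF S q_refl[OF V(1)] x] thin_R[OF fin SV V(1)] using key by auto
 qed
qed

text \<open>The elements of the incidence algebra of \<open>\<P>\<close> itself.\<close>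
definition inner :: "'k mat => bool" where
 "inner a \<longleftrightarrow> a : car KP & (ALL u:V. ent a (Suc n) u = 0 & ent a u (Suc n) = 0)"

definition eP :: "'k mat" where
 "eP = mat (Suc n) (Suc n) (%(a, b). if a = b & a < n then 1 else 0)"

lemma eP_entry: "u : V ==> t : V ==> ent eP u t = (if u = t & u ~= Suc n then 1 else 0)"
 by (auto simp: eP_def V_def)

lemma eP_mat: "eP : carrier_mat (Suc n) (Suc n)" by (simp add: eP_def)

lemma eP_closed: "eP : car KP"
 by (rule KP_I[OF eP_mat]) (use q_refl in "auto simp: eP_entry")

lemma inner_eP:
 assumes "inner a" shows "eP * a = a" "a * eP = a"
proof -
 have a: "a : carrier_mat (Suc n) (Suc n)" using assms KP_mat unfolding inner_def by blast
 have z: "u : V ==> ent a (Suc n) u = 0" "u : V ==> ent a u (Suc n) = 0" for u using assms unfolding inner_def by blast+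
 have m: "eP * a : carrier_mat (Suc n) (Suc n)" "a * eP : carrier_mat (Suc n) (Suc n)"
  using a eP_mat by (simp_all add: mult_carrier_mat)
 show "eP * a = a"
 proof (rule KP_eqI[OF m(1) a])
  fix u t assume ut: "u : V" "t : V"
  have "ent (eP * a) u t = (\<Sum>j\<in>V. if j = u then (if u = Suc n then 0 else ent a u t) else 0)"
  unfolding KP_mult_entry[OF eP_mat a ut] by (rule sum.cong) (use ut in "auto simp: eP_entry")
  then show "ent (eP * a) u t = ent a u t" using ut z by simp
 qed
 show "a * eP = a"
 proof (rule KP_eqI[OF m(2) a])
  fix u t assume ut: "u : V" "t : V"
  have "ent (a * eP) u t = (\<Sum>j\<in>V. if j = t then (if t = Suc n then 0 else ent a u t) else 0)"
  unfolding KP_mult_entry[OF a eP_mat ut] by (rule sum.cong) (use ut in "auto simp: eP_entry")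
  then show "ent (a * eP) u t = ent a u t" using ut z by simp
 qed
qed

lemma inner_thin:
 assumes i: "i : {0..n}" and a: "inner a" and ph: "ph : car (thin (D i))"
 shows "a *[thin (up (vx i))] (eP *[thin (D i)] ph) = a *[thin (D i)] ph"
proof
 fix u
 note SV = D_generated(3)[OF i]
 have fin: "finite (D i)" by (rule finite_subset[OF SV finite_V])
 have z: "u : V ==> ent a (Suc n) u = 0" "u : V ==> ent a u (Suc n) = 0" for u using a unfolding inner_def by blast+
 have upV: "up (vx i) \<subseteq> V" using q_dom by (auto simp: up_def)
 have finu: "finite (up (vx i))" by (rule finite_subset[OF upV finite_V])
 have DU: "D i \<subseteq> up (vx i)" by (simp add: D_def)
 have e: "(eP *[thin (D i)] ph) t = (if t : D i & t ~= Suc n then ph t else 0)" for t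
 proof (cases "t : D i")
  case True
  have "(\<Sum>s\<in>D i. ent eP t s * ph s) = (\<Sum>s\<in>D i. if s = t then (if t ~= Suc n then ph t else 0) else 0)"
  by (rule sum.cong) (use SV True in "auto simp: eP_entry subset_iff")
  then show ?thesis using True fin by (simp add: thin_smult)
 qed (simp add: thin_smult)
 have uD: "u = Suc n" if u: "u : up (vx i)" "u ~: D i"
 proof (cases "i = 0")
  case True then show ?thesis using u(1) q_star_left[of u] by (simp add: up_def vx_def)
 next
  case False then show ?thesis using u by (simp add: mem_D[OF i] up_def vx_def q_iff)
 qed
 have "(\<Sum>t\<in>up (vx i). ent a u t * (eP *[thin (D i)] ph) t) = (\<Sum>t\<in>D i. ent a u t * ph t)" if u: "u : V"
 proof -
  have "(\<Sum>t\<in>up (vx i). ent a u t * (eP *[thin (D i)] ph) t) = (\<Sum>t\<in>D i. ent a u t * (eP *[thin (D i)] ph) t)"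
  by (rule sum.mono_neutral_right[OF finu DU]) (simp add: e)
  also have "... = (\<Sum>t\<in>D i. ent a u t * ph t)" by (rule sum.cong) (use z(2)[OF u] in "auto simp: e")
  finally show ?thesis .
 qed
 then show "(a *[thin (up (vx i))] (eP *[thin (D i)] ph)) u = (a *[thin (D i)] ph) u"
  using upV DU uD z(1) SV by (auto simp: thin_smult subset_iff)
qed

text \<open>Over \<open>\<P>\<close> the sequence splits: \<open>thin (up (vx i0))\<close> is projective, so
\<open>p\<close> has a partial section \<open>s\<close>, and \<open>rh\<close> is a retraction onto the kernel
that commutes with inner elements.\<close>
lemma free_extension:
 assumes lm: "left_module KP W" and i0: "i0 : {0..n}"
  and p: "p : Hom W (thin (D i0))" "p ` car W = car (thin (D i0))"
  and inn: "inner a" "inner b" "inner c" "inner d"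
  and thinpp: "pp_imp KP (thin (D i0)) a b c d"
  and IH: "!!x z. x : car W ==> z : car W ==> p x = 0 ==> p z = 0 ==> a *[W] x = b *[W] z ==>
  EX w:car W. c *[W] x = d *[W] w"
 shows "pp_imp KP W a b c d"
proof -
 interpret lmodule KP W by (rule lmI) (rule lm)
 let ?v = "vx i0" and ?T = "thin (D i0)" and ?P = "thin (up (vx i0))"
 note G = D_generated[OF i0]
 note S = convex_up[of ?v]
 note lmT = lm_thin[OF G(4)] and lmP = lm_thin[OF S]
 have vV: "?v : V" by (rule vx_V[OF i0])
 have v: "?v : up ?v" "!!k. k : up ?v ==> (?v, k) : q" using q_refl[OF vV] by (auto simp: up_def)
 have cl: "a : car KP" "b : car KP" "c : car KP" "d : car KP" using inn by (simp_all add: inner_def)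
 note e = eP_closed
 have "unit ?v : p ` car W" unfolding p(2) by (rule unit_thin[OF G(1)])
 then obtain y0 where y0: "unit ?v = p y0" "y0 : car W" by (rule imageE)
 define y where "y = E ?v ?v *[W] y0"
 have y: "y : car W" "E ?v ?v *[W] y = y"
  unfolding y_def by (rule E_smult_closed[OF lm y0(2) q_refl[OF vV]], rule E_smult_id(1)[OF lm y0(2) q_refl[OF vV]])
 have py: "p y = unit ?v"
  unfolding y_def homD(3)[OF p(1) E_closed[OF q_refl[OF vV]] y0(2)] y0(1)[symmetric]
  using thin_E_unit[OF G(4) q_refl[OF vV] G(1)] G(1) by simp
 have "EX s:Hom ?P W. s (unit ?v) = y"
  by (rule thin_hom_exists[OF S v lm y]) (auto simp: up_def)
 then obtain s where s: "s : Hom ?P W" "s (unit ?v) = y" by (rule bexE)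
 have ru: "(%ph t. if t : D i0 then ph t else 0) (unit ?v) = unit ?v" by (rule ext) (use G(1) in "simp add: unit_def")
 have es: "(%ph. p (s ph)) (unit ?v) = (%ph t. if t : D i0 then ph t else 0) (unit ?v)" unfolding ru s(2) by (rule py)
 have ps: "p (s ph) = (%t. if t : D i0 then ph t else 0)" if "ph : car ?P" for ph
  using thin_hom_eq[OF S v lmT hom_comp[OF s(1) p(1)] thin_restrict_D[OF i0] es that] .
 have TP: "ph : car ?P" if "ph : car ?T" for ph using that by (auto simp: D_def)
 define si where "si x = s (eP *[?T] p x)" for x
 have pe: "eP *[?T] ph : car ?T" if "ph : car ?T" for ph
  by (rule lmodule.smult_closed[OF lmI[OF lmT] e that])
 have sc: "s (eP *[?T] ph) : car W" if "ph : car ?T" for ph by (rule homD(1)[OF s(1) TP[OF pe[OF that]]])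
 have as: "g *[W] s (eP *[?T] ph) = s (g *[?T] ph)" if "inner g" "ph : car ?T" for g ph
 proof -
  have "g : car KP" using that(1) by (simp add: inner_def)
  from homD(3)[OF s(1) this TP[OF pe[OF that(2)]]] show ?thesis
  unfolding inner_thin[OF i0 that] by simp
 qed
 define rh where "rh x = eP *[W] x -[W] si x" for x
 have pc: "p x : car ?T" if "x : car W" for x by (rule homD(1)[OF p(1) that])
 have sic: "si x : car W" if "x : car W" for x unfolding si_def by (rule sc[OF pc[OF that]])
 have rhc: "rh x : car W" if "x : car W" for x
  unfolding rh_def by (rule M.minus_closed[OF smult_closed[OF e that] sic[OF that]])
 have prh: "p (rh x) = 0" if x: "x : car W" for x
 proof -
  have "p (rh x) = p (eP *[W] x) -[?T] p (si x)"
  unfolding rh_def by (rule module_hom_diff[OF lm lmT p(1) smult_closed[OF e x] sic[OF x]])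
  also have "p (si x) = eP *[?T] p x"
  unfolding si_def ps[OF TP[OF pe[OF pc[OF x]]]] by (rule ext) (use pe[OF pc[OF x]] in simp)
  also have "p (eP *[W] x) = eP *[?T] p x" by (rule homD(3)[OF p(1) e x])
  also have "eP *[?T] p x -[?T] eP *[?T] p x = \<zero>[?T]"
  using lmodule.right_minus_eq[OF lmI[OF lmT] pe[OF pc[OF x]] pe[OF pc[OF x]]] by (rule iffD2) (rule refl)
  finally show ?thesis by simp
 qed
 have grh: "g *[W] rh x = g *[W] x -[W] s (g *[?T] p x)" if g: "inner g" and x: "x : car W" for g x
 proof -
  have gL: "g : car KP" using g by (simp add: inner_def)
  have ge: "g *[W] (eP *[W] x) = g *[W] x" using smult_assoc[OF gL e x] inner_eP(2)[OF g] by simp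
  have ex: "eP *[W] x : car W" by (rule smult_closed[OF e x])
  show ?thesis
  unfolding rh_def a_minus_def smult_r_distr[OF gL ex M.a_inv_closed[OF sic[OF x]]] smult_minus_right[OF gL sic[OF x]] ge
  unfolding si_def as[OF g pc[OF x]] ..
 qed
 show ?thesis unfolding pp_imp_def
 proof (intro ballI impI)
  fix x z assume x: "x : car W" and z: "z : car W" and eq: "a *[W] x = b *[W] z"
  have pq: "a *[?T] p x = b *[?T] p z"
  using homD(3)[OF p(1) cl(1) x] homD(3)[OF p(1) cl(2) z] eq by simp
  obtain w0 where w0: "w0 : car ?T" "c *[?T] p x = d *[?T] w0"
  using thinpp[unfolded pp_imp_def, rule_format, OF pc[OF x] pc[OF z] pq] by (rule bexE)
  have "a *[W] rh x = b *[W] rh z" unfolding grh[OF inn(1) x] grh[OF inn(2) z] pq eq ..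
  from IH[OF rhc[OF x] rhc[OF z] prh[OF x] prh[OF z] this]
  obtain w' where w': "w' : car W" "c *[W] rh x = d *[W] w'" by (rule bexE)
  have sw: "s (eP *[?T] w0) : car W" by (rule sc[OF w0(1)])
  have sd: "s (d *[?T] w0) : car W" unfolding as[OF inn(4) w0(1), symmetric] by (rule smult_closed[OF cl(4) sw])
  have "c *[W] x -[W] s (d *[?T] w0) = d *[W] w'" using w'(2) unfolding grh[OF inn(3) x] w0(2) .
  then have "c *[W] x -[W] s (d *[?T] w0) +[W] s (d *[?T] w0) = d *[W] w' +[W] s (d *[?T] w0)" by simp
  moreover have "c *[W] x -[W] s (d *[?T] w0) +[W] s (d *[?T] w0) = c *[W] x"
  using smult_closed[OF cl(3) x] sd by (simp add: a_minus_def M.a_assoc M.l_neg)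
  ultimately have "c *[W] x = d *[W] (w' +[W] s (eP *[?T] w0))"
  unfolding smult_r_distr[OF cl(4) w'(1) sw] as[OF inn(4) w0(1)] by simp
  then show "EX w:car W. c *[W] x = d *[W] w" by (rule bexI) (rule M.a_closed[OF w'(1) sw])
 qed
qed

lemma free_filtered:
 assumes fil: "filtered_by KP X M" and lm: "left_module KP M"
  and X: "!!N'. N' : X ==> left_module KP N'" "!!N'. N' : X ==> EX i0:{0..n}. isomorphic KP N' (thin (D i0))"
  and inn: "inner a" "inner b" "inner c" "inner d"
  and thinpp: "!!i0. i0 : {0..n} ==> pp_imp KP (thin (D i0)) a b c d"
 shows "pp_imp KP M a b c d"
proof -
 interpret lmodule KP M by (rule lmI) (rule lm)
 have cl: "c : car KP" "d : car KP" using inn by (simp_all add: inner_def)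
 have "pp_imp KP (M(|carrier := car M|)) a b c d"
 proof (rule filtered_induct[OF fil lm X(1), where P = "%U. pp_imp KP (M(|carrier := U|)) a b c d"])
  show "pp_imp KP (M(|carrier := {\<zero>[M]}|)) a b c d" using cl by (simp add: pp_imp_def)
  fix U V' N' p assume U: "submod U KP M" and V': "submod V' KP M" and UV: "U \<subseteq> V'" and N': "N' : X"
  and p: "p : Hom (M(|carrier := V'|)) N'" "p ` V' = car N'" "U = {x : V'. p x = \<zero>[N']}"
  and IH: "pp_imp KP (M(|carrier := U|)) a b c d"
  note lmV = lm_sub[OF lm V']
  obtain i0 where i0: "i0 : {0..n}" "isomorphic KP N' (thin (D i0))" using X(2)[OF N'] by (rule bexE)
  note lmT = lm_thin[OF D_generated(4)[OF i0(1)]]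
  obtain h g where h: "h : Hom N' (thin (D i0))" and g: "g : Hom (thin (D i0)) N'"
  and gh: "!!x. x : car N' ==> g (h x) = x" and hg: "!!y. y : car (thin (D i0)) ==> h (g y) = y"
  by (rule isomorphicE[OF i0(2) X(1)[OF N']]) blast
  have hp: "(%x. h (p x)) : Hom (M(|carrier := V'|)) (thin (D i0))" by (rule hom_comp[OF p(1) h])
  have onto: "(%x. h (p x)) ` car (M(|carrier := V'|)) = car (thin (D i0))"
  proof (intro equalityI subsetI)
  fix ph assume ph: "ph : car (thin (D i0))"
  have "g ph : p ` V'" unfolding p(2) by (rule homD(1)[OF g ph])
  then obtain x where x: "g ph = p x" "x : V'" by (rule imageE)
  have "ph = h (p x)" using hg[OF ph] x(1) by simp
  then show "ph : (%x. h (p x)) ` car (M(|carrier := V'|))" by (rule image_eqI) (use x(2) in simp)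
  next
  fix ph assume "ph : (%x. h (p x)) ` car (M(|carrier := V'|))"
  then obtain x where x: "ph = h (p x)" "x : car (M(|carrier := V'|))" by (rule imageE)
  show "ph : car (thin (D i0))" unfolding x(1) by (rule homD(1)[OF hp x(2)])
  qed
  show "pp_imp KP (M(|carrier := V'|)) a b c d"
  proof (rule free_extension[OF lmV i0(1) hp onto inn thinpp[OF i0(1)]])
  fix x z assume xz: "x : car (M(|carrier := V'|))" "z : car (M(|carrier := V'|))" "h (p x) = 0" "h (p z) = 0"
  and eq: "a *[M(|carrier := V'|)] x = b *[M(|carrier := V'|)] z"
  have mem: "y : U" if "y : car (M(|carrier := V'|))" "h (p y) = 0" for y
  proof -
  have "p y = g (h (p y))" using gh[OF homD(1)[OF p(1) that(1)]] by simp
  also have "... = \<zero>[N']" unfolding that(2) using hom_zero[OF lmT X(1)[OF N'] g] by simp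
  finally show ?thesis unfolding p(3) using that(1) by simp
  qed
  have "EX w:car (M(|carrier := U|)). c *[M(|carrier := U|)] x = d *[M(|carrier := U|)] w"
  using IH[unfolded pp_imp_def, rule_format, of x z] mem[OF xz(1,3)] mem[OF xz(2,4)] eq by simp
  then obtain w where "w : U" "c *[M] x = d *[M] w" by (rule bexE) simp
  then show "EX w:car (M(|carrier := V'|)). c *[M(|carrier := V'|)] x = d *[M(|carrier := V'|)] w"
  using UV by (intro bexI[of _ w]) (simp_all add: subset_iff)
  qed
 qed
 then show ?thesis by simp
qed

lemma inner_E: "(i, k) : r ==> inner (E k i)"
 unfolding inner_def using r_V[of i k] r_q[of i k] by auto

lemma inner_R: "k : {1..n} ==> (!!j. j : S ==> (j, k) : r) ==> inner (R k S)"
 unfolding inner_def using r_q r_star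
 by (intro conjI ballI R_closed) (auto simp: V_def r_V dest: r_V)

theorem filtered_imp_tilt:
 assumes lm: "left_module KP M"
  and fil: "filtered_by KP (Del ` {0..n}) M" "filtered_by KP (Nab ` {0..n}) M"
 shows "tilt M"
 unfolding tilt_def
proof (intro conjI ballI allI impI)
 fix i assume i: "i : {1..n}"
 then have iV: "i : V" by (simp add: V_def)
 show "pp_imp KP M Z Z (Es (Suc n)) (Es i)"
 proof (rule surj_filtered[OF fil(2) lm iV])
  fix N' assume "N' : Nab ` {0..n}"
  then obtain j where j: "N' = Nab j" "j : {0..n}" by (rule imageE)
  show lmN: "left_module KP N'" unfolding j(1) by (rule fd_lm[OF costandard_thin(1)[OF j(2)]])
  have "isomorphic KP (thin (N j)) N'" unfolding j(1)
  by (rule iso_sym[OF lmN[unfolded j(1)] costandard_thin(2)[OF j(2)]])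
  then show "pp_imp KP N' Z Z (Es (Suc n)) (Es i)"
  by (rule pp_imp_iso[OF lm_thin[OF N_convex[OF j(2)]] _ _ _ _ _ thin_N_surj[OF j(2) i]])
  (rule tilt_closed tilt_closed(3)[OF i])+
 qed
next
 fix i k assume ik: "(i, k) : r"
 have dom: "i : {1..n}" "k : {1..n}" using r_dom[OF ik] by simp_all
 have inn: "inner (E k i)" "inner (R k (low i k))" "inner (E i i)" "inner (R i (rad i))"
  using inner_E[OF ik] inner_R[of k "low i k"] inner_E[OF r_refl[OF dom(1)]] inner_R[of i "rad i"] dom
  by (simp_all add: low_def rad_def)
 show "pp_imp KP M (E k i) (R k (low i k)) (E i i) (R i (rad i))"
 proof (rule free_filtered[OF fil(1) lm _ _ inn])
  fix N' assume "N' : Del ` {0..n}"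
  then obtain j where j: "N' = Del j" "j : {0..n}" by (rule imageE)
  show "left_module KP N'" unfolding j(1) by (rule fd_lm[OF standard_thin(1)[OF j(2)]])
  show "EX i0:{0..n}. isomorphic KP N' (thin (D i0))" unfolding j(1) by (rule bexI[of _ j], rule standard_thin(2)[OF j(2)], rule j(2))
 qed (rule thin_D_free[OF _ ik])
qed


section \<open>Filtrations of the normal forms\<close>

text \<open>First the kernel of the maps to \<open>*\<close>, by simple factors; then one factor \<open>thin V\<close> for
each basis vector at \<open>*\<close>.\<close>
lemma NF_costandard:
 "filtered_by KP (Nab ` {0..n}) (NF m)"
proof -
 let ?M = "NF m" and ?X = "(%j. thin (N j)) ` {0..n}"
 note lm = lm_Fam[of Mn m] and A = fdKP
 interpret lmodule KP ?M by (rule lmI) (rule lm)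
 define ev where "ev k x b = (Es k *[?M] x) (Star b)" for k x b
 have Es: "Es k : car KP" if "k : V" for k by (rule E_closed[OF q_star[OF that]])
 have ev_add: "ev k (x + y) b = ev k x b + ev k y b" if "k : V" "x : car ?M" "y : car ?M" for k x y b
  using smult_r_distr[OF Es[OF that(1)] that(2,3)] by (simp add: ev_def)
 have ev_scal: "ev k (scal KP ?M c x) b = c * ev k x b" if "k : V" "x : car ?M" for k x b c
  unfolding ev_def smult_scal[OF A lm Es[OF that(1)] that(2)] scal_Fam[OF smult_closed[OF Es[OF that(1)] that(2)]] ..
 have ev_E: "ev k (E l j *[?M] x) b = (if k = l then ev j x b else 0)" if "(j, l) : q" "k : V" "x : car ?M" for k l j x b
  unfolding ev_def E_smult[OF lm that(3,1) q_star[OF that(2)]] by simp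
 have ev_out: "ev k x b = 0" if "k : V" "x : car ?M" "m 0 \<le> b" for k x b
  using smult_closed[OF Es[OF that(1)] that(2)] that(3) by (simp add: ev_def)
 have ev_0: "ev k 0 b = 0" if "k : V" for k b using smult_zero_right[OF Es[OF that]] by (simp add: ev_def)
 define U where "U c = {x : car ?M. ALL k:V. ALL b. c \<le> b --> ev k x b = 0}" for c
 have UI: "x : U c" if "x : car ?M" "!!k b. k : V ==> c \<le> b ==> ev k x b = 0" for x c
  unfolding U_def using that by (intro CollectI conjI ballI allI impI)
 have UD: "x : car ?M" "k : V ==> c \<le> b ==> ev k x b = 0" if "x : U c" for x c k b
  using that unfolding U_def by blast+
 have sub: "submod (U c) KP ?M" for c
 proof (rule submodule_criterion[OF lm])
  show "kclosed KP ?M (U c)"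
  unfolding kclosed_def
  proof (intro conjI ballI allI)
  show "U c \<subseteq> car ?M" using UD(1) by (rule subsetI)
  show "\<zero>[?M] : U c" by (rule UI) (simp_all add: ev_0)
  fix x assume x: "x : U c"
  show "scal KP ?M d x : U c" for d
  by (rule UI[OF scal_closed[OF A lm UD(1)[OF x]]]) (simp only: ev_scal[OF _ UD(1)[OF x]] UD(2)[OF x] mult_zero_right)
  fix y assume y: "y : U c"
  show "x +[?M] y : U c"
  proof (rule UI[OF M.a_closed[OF UD(1)[OF x] UD(1)[OF y]]])
  fix k b assume kb: "k : V" "c \<le> b"
  show "ev k (x +[?M] y) b = 0"
  using ev_add[OF kb(1) UD(1)[OF x] UD(1)[OF y]] UD(2)[OF x kb] UD(2)[OF y kb] by simp
  qed
  qed
  fix j l x assume jl: "(j, l) : q" and x: "x : U c"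
  show "E l j *[?M] x : U c"
  proof (rule UI[OF E_smult_closed[OF lm UD(1)[OF x] jl]])
  fix k b assume kb: "k : V" "c \<le> b"
  show "ev k (E l j *[?M] x) b = 0" unfolding ev_E[OF jl kb(1) UD(1)[OF x]] using UD(2)[OF x _ kb(2), of j] q_dom[OF jl] by simp
  qed
 qed
 have i0: "0 : {0..n}" by simp
 have N0: "N 0 = V" by (rule Set.set_eqI) (simp add: mem_N)
 have cV: "convex V" using N_convex[OF i0] unfolding N0 .
 have fil: "filtered_by KP ?X (?M(|carrier := U c|))" for c
 proof (induction c)
  case 0
  have fd: "fd_module KP (?M(|carrier := U 0|))"
  by (rule fd_submodule_std[OF A _ sub]) (unfold Fam_def, rule std_cmod[OF cdata_Fam])
  have star: "E k k *[?M(|carrier := U 0|)] x = \<zero>[?M(|carrier := U 0|)]"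
  if k: "k : V" "k ~: {1..n}" and x: "x : car (?M(|carrier := U 0|))" for k x
  proof -
  have kn: "k = Suc n" using k by (auto simp: V_def)
  have xU: "x : U 0" using x by simp
  note xM = UD(1)[OF xU]
  have "Es (Suc n) *[?M] x = \<zero>[?M]"
  proof (rule Fam_eqI[OF smult_closed[OF Es[OF V_star] xM] M.zero_closed])
  fix b show "(Es (Suc n) *[?M] x) (Star b) = \<zero>[?M] (Star b)"
  using UD(2)[OF xU V_star, of b] by (simp add: ev_def)
  qed (use r_star in "auto simp: Fam_E_Gen Fam_E_Lift")
  then show ?thesis using kn by simp
  qed
  have f: "filtered_by KP ((%k. thin {k}) ` {1..n}) (?M(|carrier := U 0|))"
  by (rule filtered_components[OF fd star])
  show ?case
  proof (rule filtered_by_iso[OF f lm_sub[OF lm sub] lm_sub[OF lm sub] iso_refl])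
  fix N' :: "('k mat, nat => 'k) module" assume "N' : (%k. thin {k}) ` {1..n}"
  then obtain k where k: "N' = thin {k}" "k : {1..n}" by (rule imageE)
  then have kV: "k : V" and k0: "k : {0..n}" by (auto simp: V_def)
  show lmN: "left_module KP N'" unfolding k(1) by (rule lm_thin[OF convex_singleton[OF kV]])
  have "N k = {k}" using k(2) by (intro Set.set_eqI) (simp add: mem_N[OF k0])
  then have "N' = thin (N k)" using k(1) by simp
  then have "N' : ?X" using k0 by (rule image_eqI)
  then show "EX N'':?X. left_module KP N'' & isomorphic KP N' N''" using lmN iso_refl by (intro bexI[of _ N'] conjI)
  qed
 next
  case (Suc c)
  have UU: "U c \<subseteq> U (Suc c)"
  proof
  fix x assume x: "x : U c"
  show "x : U (Suc c)" by (rule UI[OF UD(1)[OF x]]) (rule UD(2)[OF x], simp_all)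
  qed
  show ?case
  proof (cases "c < m 0")
  case False
  have "U (Suc c) \<subseteq> U c"
  proof
  fix x assume x: "x : U (Suc c)"
  show "x : U c" by (rule UI[OF UD(1)[OF x]]) (rule ev_out[OF _ UD(1)[OF x]], use False in simp_all)
  qed
  then have "U (Suc c) = U c" using UU by (rule subset_antisym)
  then show ?thesis using Suc by simp
  next
  case c: True
  let ?q = "%x k. if k : V then ev k x c else 0"
  have q: "?q : Hom ?M (thin V)"
  proof (rule hom_criterion[OF lm lm_thin[OF cV]])
  fix x assume x: "x : car ?M"
  show qx: "?q x : car (thin V)" by simp
  show "?q (x +[?M] y) = ?q x +[thin V] ?q y" if y: "y : car ?M" for y
  by (rule ext) (simp add: ev_add[OF _ x y] del: Fam_simps(1))
  show "?q (scal KP ?M d x) = scal KP (thin V) d (?q x)" for d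
  unfolding scal_thin[OF cV qx] by (rule ext) (simp add: ev_scal[OF _ x])
  fix j l assume jl: "(j, l) : q"
  show "?q (E l j *[?M] x) = E l j *[thin V] ?q x"
  unfolding thin_E[OF cV jl qx] using q_dom[OF jl] by (intro ext) (simp add: ev_E[OF jl _ x])
  qed
  have qU: "?q : Hom (?M(|carrier := U (Suc c)|)) (thin V)"
  by (rule module_hom_subdomain[OF q submoduleD(1)[OF sub]])
  have onto: "?q ` U (Suc c) = car (thin V)"
  proof (intro equalityI subsetI)
  fix ph assume ph: "ph : car (thin V)"
  define jm where "jm k = (SOME j. j : Mn & (j, k) : r)" for k
  have jm: "jm k : Mn" "(jm k, k) : r" if k: "k : {1..n}" for k
  proof -
  have "jm k : Mn & (jm k, k) : r" unfolding jm_def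
  by (rule someI_ex) (use minimal_below[OF k] in blast)
  then show "jm k : Mn" "(jm k, k) : r" by simp_all
  qed
  define x where "x t = (case t of Star b => if b = c then ph (Suc n) else 0 | Gen k i b => 0
  | Lift k j b => if k : {1..n} & b = c & j = jm k then ph k else 0)" for t
  have xs: "x (Star b) = (if b = c then ph (Suc n) else 0)" "x (Gen k i b) = 0"
  "x (Lift k j b) = (if k : {1..n} & b = c & j = jm k then ph k else 0)" for b k i j
  by (simp_all add: x_def)
  have "x t = 0" if "t ~: idx_set Mn m" for t using that c jm by (cases t) (auto simp: xs)
  then have xM: "x : car ?M" by simp
  have evx: "ev k x b = (if b = c then ph k else 0)" if k: "k : V" for k b
  proof (cases "b < m 0")
  case b: True
  show ?thesis
  proof (cases "k = Suc n")
  case True then show ?thesis using b by (simp add: ev_def Fam_E_Star xs)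
  next
  case False
  then have kP: "k : {1..n}" using k by (auto simp: V_def)
  have "ev k x b = (\<Sum>j\<in>{j. j : Mn & (j, k) : r}. x (Lift k j b))" using b k False by (simp add: ev_def Fam_E_Star)
  also have "... = (\<Sum>j\<in>{j. j : Mn & (j, k) : r}. if j = jm k then (if b = c then ph k else 0) else 0)"
  by (rule sum.cong) (use kP in "auto simp: xs")
  also have "... = (if b = c then ph k else 0)" using jm[OF kP] by simp
  finally show ?thesis .
  qed
  next
  case False then show ?thesis using ev_out[OF k xM] c by simp
  qed
  have "x : U (Suc c)" by (rule UI[OF xM]) (simp add: evx)
  moreover have "ph = ?q x" by (rule ext) (use ph in "simp add: evx")
  ultimately show "ph : ?q ` U (Suc c)" by (intro image_eqI[where x = x])
  next
  fix ph assume "ph : ?q ` U (Suc c)"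
  then obtain x where "ph = ?q x" by (rule imageE)
  then show "ph : car (thin V)" by simp
  qed
  have ker: "U c = {x : U (Suc c). ?q x = \<zero>[thin V]}"
  proof (intro equalityI subsetI)
  fix x assume x: "x : U c"
  have "?q x = \<zero>[thin V]" by (rule ext) (simp add: UD(2)[OF x])
  then show "x : {x : U (Suc c). ?q x = \<zero>[thin V]}" using subsetD[OF UU x] by (intro CollectI conjI)
  next
  fix x assume "x : {x : U (Suc c). ?q x = \<zero>[thin V]}"
  then have xx: "x : U (Suc c) & ?q x = \<zero>[thin V]" by (rule CollectD)
  note x = conjunct1[OF xx] and q0 = conjunct2[OF xx]
  show "x : U c"
  proof (rule UI[OF UD(1)[OF x]])
  fix k b assume kb: "k : V" "c \<le> b"
  show "ev k x b = 0"
  proof (cases "b = c")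
  case True then show ?thesis using fun_cong[OF q0, of k] kb(1) by simp
  next
  case False then show ?thesis using UD(2)[OF x kb(1), of b] kb(2) by simp
  qed
  qed
  qed
  have "thin (N 0) : ?X" using i0 by (rule imageI)
  then have XV: "thin V : ?X" unfolding N0 .
  show ?thesis by (rule filtered_step[OF lm sub sub UU Suc XV lm_thin[OF cV] qU onto ker])
  qed
 qed
 have "U (m 0) = car ?M"
 proof (intro equalityI subsetI)
  fix x assume "x : U (m 0)" then show "x : car ?M" by (rule UD(1))
 next
  fix x assume x: "x : car ?M" show "x : U (m 0)" by (rule UI[OF x]) (rule ev_out[OF _ x])
 qed
 then have fM: "filtered_by KP ?X ?M" using fil[of "m 0"] by (simp only: carrier_update_self)
 show ?thesis
 proof (rule filtered_by_iso[OF fM lm lm iso_refl])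
  fix N' assume "N' : ?X"
  then obtain j where j: "N' = thin (N j)" "j : {0..n}" by (rule imageE)
  show "left_module KP N'" unfolding j(1) by (rule lm_thin[OF N_convex[OF j(2)]])
  note lmj = fd_lm[OF costandard_thin(1)[OF j(2)]]
  show "EX N'':Nab ` {0..n}. left_module KP N'' & isomorphic KP N' N''"
  unfolding j(1) by (rule bexI[of _ "Nab j"], rule conjI[OF lmj iso_sym[OF lmj costandard_thin(2)[OF j(2)]]], rule imageI, rule j(2))
 qed
qed

fun tag :: "idx => idx" where
 "tag (Star b) = Star b" | "tag (Gen k i b) = Gen 0 i b" | "tag (Lift k j b) = Lift 0 j b"

fun tidx :: "idx => nat" where
 "tidx (Star b) = 0" | "tidx (Gen k i b) = i" | "tidx (Lift k j b) = j"

fun idx_at :: "nat => idx => idx" where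
 "idx_at k (Star b) = Star b" | "idx_at k (Gen k' i b) = Gen k i b" | "idx_at k (Lift k' j b) = Lift k j b"

text \<open>Submodules spanned by the images of sets of generators, enlarged by one generator at a time, the ones at
\<open>*\<close> first.\<close>
lemma NF_standard:
 "filtered_by KP (Del ` {0..n}) (NF m)"
proof -
 let ?M = "NF m" and ?X = "(%j. thin (D j)) ` {0..n}" and ?J = "idx_set Mn m"
 note lm = lm_Fam[of Mn m] and A = fdKP
 interpret lmodule KP ?M by (rule lmI) (rule lm)
 define U where "U G = {f : car ?M. ALL t. tag t ~: G --> f t = 0}" for G
 have UI: "f : U G" if "f : car ?M" "!!t. tag t ~: G ==> f t = 0" for f G
  unfolding U_def using that by (intro CollectI conjI allI impI)
 have UD: "f : car ?M" "tag t ~: G ==> f t = 0" if "f : U G" for f G t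
  using that unfolding U_def by blast+
 have Ut: "f (Star b) = 0 \<or> Star b : G" "f (Gen k i b) = 0 \<or> Gen 0 i b : G" "f (Lift k j b) = 0 \<or> Lift 0 j b : G"
  if "f : U G" for f G b k i j
  using UD(2)[OF that, of "Star b"] UD(2)[OF that, of "Gen k i b"] UD(2)[OF that, of "Lift k j b"] by auto
 define good where "good G \<longleftrightarrow> (ALL b j. b < m 0 --> Lift 0 j b : G --> Star b : G)" for G
 have sub: "submod (U G) KP ?M" if G: "good G" for G
 proof (rule submoduleI[OF lm])
  show "U G \<subseteq> car ?M" using UD(1) by (rule subsetI)
  show "\<zero>[?M] : U G" by (rule UI) simp_all
  fix f assume f: "f : U G"
  show "f +[?M] g : U G" if g: "g : U G" for g
  by (rule UI[OF M.a_closed[OF UD(1)[OF f] UD(1)[OF g]]]) (simp add: UD(2)[OF f] UD(2)[OF g])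
  fix a assume a: "a : car KP"
  have af: "a *[?M] f : car ?M" by (rule smult_closed[OF a UD(1)[OF f]])
  show "a *[?M] f : U G"
  proof (rule UI[OF af])
  fix t assume t: "tag t ~: G"
  show "(a *[?M] f) t = 0"
  proof (cases "t : ?J")
  case False then show ?thesis using af by simp
  next
  case True
  show ?thesis
  proof (cases t)
  case (Star b)
  have "f (Lift k j b) = 0" for k j using Ut(3)[OF f, of k j b] G Star t True unfolding good_def by auto
  moreover have "f (Star b) = 0" using Ut(1)[OF f, of b] Star t by simp
  ultimately show ?thesis using Star True by (simp add: Fam_smult_Star)
  next
  case (Gen l i b)
  have "f (Gen k i b) = 0" for k using Ut(2)[OF f, of k i b] Gen t by simp
  then show ?thesis using Gen True by (simp add: Fam_smult_Gen)
  next
  case (Lift l j b)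
  have "f (Lift k j b) = 0" for k using Ut(3)[OF f, of k j b] Lift t by simp
  then show ?thesis using Lift True by (simp add: Fam_smult_Lift)
  qed
  qed
  qed
 qed
 have step: "filtered_by KP ?X (?M(|carrier := U (insert g G)|))"
  if fil: "filtered_by KP ?X (?M(|carrier := U G|))" and G: "good G" "good (insert g G)" and g: "g : tag ` ?J" "g ~: G"
  and star: "!!b j. g = Star b ==> Lift 0 j b ~: G" for g G
 proof -
  obtain t0 where t0: "g = tag t0" "t0 : ?J" using g(1) by (rule imageE)
  have i: "tidx g : {0..n}" using t0 r_dom by (cases t0) auto
  note SD = D_generated(4)[OF i] and SV = D_generated(3)[OF i]
  have at_all: "idx_at k g : ?J & tag (idx_at k g) = g & vtx (idx_at k g) = k" if k: "k : D (tidx g)" for k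
  proof (cases t0)
  case (Star b)
  then have "tidx g = 0" using t0(1) by simp
  then have "k = Suc n" using k mem_D[of 0 k] by simp
  then show ?thesis using Star t0 by simp
  next
  case (Gen l i' b)
  then have rb: "(i', l) : r" "b < m i'" and ti: "tidx g = i'" using t0 by simp_all
  have "(i', k) : r" using k r_dom[OF rb(1)] mem_D[of i' k] ti by simp
  then show ?thesis using Gen t0(1) rb by simp
  next
  case (Lift l i' b)
  then have rb: "(i', l) : r" "b < m 0" "i' : Mn" and ti: "tidx g = i'" using t0 by simp_all
  have "(i', k) : r" using k r_dom[OF rb(1)] mem_D[of i' k] ti by simp
  then show ?thesis using Lift t0(1) rb by simp
  qed
  have at_J: "idx_at k g : ?J" "tag (idx_at k g) = g" "vtx (idx_at k g) = k" if "k : D (tidx g)" for k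
  using at_all[OF that] by simp_all
  have inv_all: "t = idx_at (vtx t) g & vtx t : D (tidx g)" if t: "t : ?J" "tag t = g" for t
  proof (cases t)
  case (Star b)
  then show ?thesis using t mem_D[of 0 "Suc n"] by auto
  next
  case (Gen l i' b)
  then have il: "(i', l) : r" using t by simp
  have "l : D i'" using il r_dom[OF il] mem_D[of i' l] by simp
  then show ?thesis using Gen t(2) by auto
  next
  case (Lift l i' b)
  then have il: "(i', l) : r" using t by simp
  have "l : D i'" using il r_dom[OF il] mem_D[of i' l] by simp
  then show ?thesis using Lift t(2) by auto
  qed
  have at_inv: "t = idx_at (vtx t) g" "vtx t : D (tidx g)" if "t : ?J" "tag t = g" for t
  using inv_all[OF that] by simp_all
  let ?q = "%f k. if k : D (tidx g) then f (idx_at k g) else 0"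
  have UU: "U G \<subseteq> U (insert g G)"
  proof
  fix f assume f: "f : U G"
  show "f : U (insert g G)" by (rule UI[OF UD(1)[OF f]]) (rule UD(2)[OF f], simp)
  qed
  have q: "?q : Hom (?M(|carrier := U (insert g G)|)) (thin (D (tidx g)))"
  proof (rule homI)
  fix f assume "f : car (?M(|carrier := U (insert g G)|))"
  then have f: "f : U (insert g G)" by simp
  show "?q f : car (thin (D (tidx g)))" by simp
  show "?q (f +[?M(|carrier := U (insert g G)|)] f') = ?q f +[thin (D (tidx g))] ?q f'" for f' by (rule ext) simp
  fix a assume a: "a : car KP"
  have "(a *[?M] f) (idx_at k g) = (\<Sum>t\<in>D (tidx g). ent a k t * f (idx_at t g))" if k: "k : D (tidx g)" for k
  proof (cases t0)
  case (Star b)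
  have D0: "D 0 = {Suc n}" by (rule Set.set_eqI) (simp add: mem_D)
  have "f (Lift k j b) = 0" for k j
  using Ut(3)[OF f, of k j b] star[of b j] t0(1) Star by auto
  then show ?thesis using Star t0 k D0 by (simp add: Fam_smult_Star)
  next
  case (Gen l i' b)
  then have "{k. (i', k) : r} = D i'" using t0 r_V[of i' l] r_dom[of i' l] by (auto simp: mem_D)
  moreover have "(i', k) : r" using k Gen t0 calculation by auto
  ultimately show ?thesis using Gen t0 by (simp add: Fam_smult_Gen)
  next
  case (Lift l i' b)
  then have "{k. (i', k) : r} = D i'" using t0 r_V[of i' l] r_dom[of i' l] by (auto simp: mem_D)
  moreover have "(i', k) : r" using k Lift t0 calculation by auto
  ultimately show ?thesis using Lift t0 by (simp add: Fam_smult_Lift)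
  qed
  then show "?q (a *[?M(|carrier := U (insert g G)|)] f) = a *[thin (D (tidx g))] ?q f"
  by (intro ext) (simp add: thin_smult)
  qed
  have onto: "?q ` U (insert g G) = car (thin (D (tidx g)))"
  proof (intro equalityI subsetI)
  fix ph assume ph: "ph : car (thin (D (tidx g)))"
  define f where "f t = (if t : ?J & tag t = g then ph (vtx t) else 0)" for t
  have "f : U (insert g G)" by (rule UI) (simp_all add: f_def)
  moreover have "ph = ?q f" by (rule ext) (use ph at_J in "simp add: f_def")
  ultimately show "ph : ?q ` U (insert g G)" by (intro image_eqI[where x = f])
  next
  fix ph assume "ph : ?q ` U (insert g G)"
  then obtain f where "ph = ?q f" by (rule imageE)
  then show "ph : car (thin (D (tidx g)))" by simp
  qed
  have ker: "U G = {f : U (insert g G). ?q f = \<zero>[thin (D (tidx g))]}"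
  proof (intro equalityI subsetI)
  fix f assume f: "f : U G"
  have "?q f = \<zero>[thin (D (tidx g))]" by (rule ext) (use UD(2)[OF f] at_J(2) g(2) in simp)
  then show "f : {f : U (insert g G). ?q f = \<zero>[thin (D (tidx g))]}" using subsetD[OF UU f] by (intro CollectI conjI)
  next
  fix f assume "f : {f : U (insert g G). ?q f = \<zero>[thin (D (tidx g))]}"
  then have ff: "f : U (insert g G) & ?q f = \<zero>[thin (D (tidx g))]" by (rule CollectD)
  note f = conjunct1[OF ff] and q0 = conjunct2[OF ff]
  show "f : U G"
  proof (rule UI[OF UD(1)[OF f]])
  fix t assume t: "tag t ~: G"
  show "f t = 0"
  proof (cases "tag t = g & t : ?J")
  case True
  then show ?thesis using fun_cong[OF q0, of "vtx t"] at_inv[of t] by simp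
  next
  case False
  then show ?thesis using UD(1)[OF f] UD(2)[OF f, of t] t by auto
  qed
  qed
  qed
  have X: "thin (D (tidx g)) : ?X" using i by (rule imageI)
  show ?thesis by (rule filtered_step[OF lm sub[OF G(1)] sub[OF G(2)] UU fil X lm_thin[OF SD] q onto ker])
 qed
 let ?S = "Star ` {..<m 0}" and ?T = "tag ` ?J"
 have gS: "good G" if "G \<subseteq> ?S" for G using that unfolding good_def by auto
 have stars: "filtered_by KP ?X (?M(|carrier := U G|))" if "finite G" "G \<subseteq> ?S" for G
  using that
 proof (induction G rule: finite_induct)
  case empty
  have "f = 0" if "f : U {}" for f by (rule ext) (use UD(2)[OF that] in simp)
  then have "U {} = {\<zero>[?M]}" using submoduleD(2)[OF sub[OF gS[of "{}"]]] by auto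
  then show ?case using filtered_zero[OF lm_sub[OF lm submodule_zero[OF lm]], of ?X] by simp
 next
  case (insert g G)
  have GS: "G \<subseteq> ?S" using insert.prems by simp
  obtain b where b: "g = Star b" "b < m 0" using insert.prems by auto
  have gT: "g : ?T" by (rule image_eqI[of _ _ "Star b"]) (simp_all add: b)
  show ?case by (rule step[OF insert.IH[OF GS] gS[OF GS] gS[OF insert.prems] gT insert.hyps(2)]) (use GS in auto)
 qed
 have gT: "good (?S \<union> G)" for G unfolding good_def by auto
 have all: "filtered_by KP ?X (?M(|carrier := U (?S \<union> G)|))" if "finite G" "G \<subseteq> ?T" for G
  using that
 proof (induction G rule: finite_induct)
  case empty show ?case using stars[of ?S] by simp
 next
  case (insert g G)
  have IH: "filtered_by KP ?X (?M(|carrier := U (?S \<union> G)|))" using insert by simp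
  show ?case
  proof (cases "g : ?S")
  case True
  then have "?S \<union> insert g G = ?S \<union> G" by auto
  then show ?thesis using IH by simp
  next
  case False
  have e: "?S \<union> insert g G = insert g (?S \<union> G)" by simp
  have gi: "good (insert g (?S \<union> G))" using gT[of "insert g G"] unfolding e .
  have gm: "g : ?T" using insert.prems by simp
  have nS: "g ~= Star b" for b
  proof
  assume gb: "g = Star b"
  obtain t where t: "g = tag t" "t : ?J" using gm by (rule imageE)
  then have "b < m 0" using gb by (cases t) auto
  then show False using False gb by simp
  qed
  show ?thesis unfolding e
  by (rule step[OF IH gT gi gm]) (use False insert.hyps(2) nS in auto)
  qed
 qed
 have "U (?S \<union> ?T) = car ?M"
 proof (intro equalityI subsetI)
  fix f assume "f : U (?S \<union> ?T)" then show "f : car ?M" by (rule UD(1))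
 next
  fix f assume f: "f : car ?M"
  show "f : U (?S \<union> ?T)"
  proof (rule UI[OF f])
  fix t assume "tag t ~: ?S \<union> ?T"
  then have "t ~: ?J" by blast
  then show "f t = 0" using f by simp
  qed
 qed
 then have fM: "filtered_by KP ?X ?M" using all[of ?T] by (simp only: carrier_update_self finite_imageI finite_idx_set subset_refl)
 show ?thesis
 proof (rule filtered_by_iso[OF fM lm lm iso_refl])
  fix N' assume "N' : ?X"
  then obtain j where j: "N' = thin (D j)" "j : {0..n}" by (rule imageE)
  show "left_module KP N'" unfolding j(1) by (rule lm_thin[OF D_generated(4)[OF j(2)]])
  note lmj = fd_lm[OF standard_thin(1)[OF j(2)]]
  show "EX N'':Del ` {0..n}. left_module KP N'' & isomorphic KP N' N''"
  unfolding j(1) by (rule bexI[of _ "Del j"], rule conjI[OF lmj iso_sym[OF lmj standard_thin(2)[OF j(2)]]], rule imageI, rule j(2))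
 qed
qed

end

lemma complement_basis_ex:
 fixes W K :: "('x => 'k::field) set"
 assumes "finite bt" "fvs.subspace W" "fvs.subspace K" "W \<subseteq> K" "!!f t. f : K ==> t ~: bt ==> f t = 0"
 shows "EX (m :: nat) g. (ALL b<m. g b : K) & (ALL x:K. EX al. x - (\<Sum>b<m. (%t. al b * g b t)) : W) &
  (ALL al. (\<Sum>b<m. (%t. al b * g b t)) : W --> (ALL b<m. al b = 0))"
proof (rule complement_basis[OF assms(1-4)])
 fix f t assume "f : K" "t ~: bt" then show "f t = 0" by (rule assms(5))
next
 fix m :: nat and g
 assume g: "!!b. b < m ==> g b : K" "!!x. x : K ==> EX al. x - (\<Sum>b<m. (%t. al b * g b t)) : W"
  "!!al b. (\<Sum>b<m. (%t. al b * g b t)) : W ==> b < m ==> al b = 0"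
 show ?thesis
  by (rule exI[of _ m], rule exI[of _ g], intro conjI allI ballI impI) (erule g(1), erule g(2), erule g(3), assumption)
qed

context suspension begin

section \<open>Tilting modules are in normal form\<close>

context
 fixes X :: "('k mat, 'x => 'k) module" and bt :: "'x set"
 assumes std: "std_module bt KP X"
begin

lemma Xlm: "left_module KP X" using std by (simp add: std_module_def)
interpretation lmodule KP X by (rule lmI) (rule Xlm)

lemma X_simps: "add X = (+)" "zero X = 0" "car X = {f. ALL t. t ~: bt --> f t = 0}" "finite bt"
 and X_scal: "x : car X ==> scal KP X c x = (%s. c * x s)"
 using std by (simp_all add: std_module_def)

lemma X_add: "x : car X ==> y : car X ==> x + y : car X" by (simp add: X_simps)
lemma X_mult: "x : car X ==> (%s. c * x s) : car X" by (simp add: X_simps)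
lemma X_zero: "0 : car X" by (simp add: X_simps)
lemma X_diff: "x : car X ==> y : car X ==> x - y : car X" by (simp add: X_simps)

lemma X_smult_mult: "a : car KP ==> x : car X ==> a *[X] (%s. c * x s) = (%s. c * (a *[X] x) s)"
 using smult_scal[OF fdKP Xlm, of a x c] X_scal[of x c] X_scal[OF smult_closed, of a x c] by simp

lemma X_smult_add: "a : car KP ==> x : car X ==> y : car X ==> a *[X] (x + y) = a *[X] x + a *[X] y"
 using smult_r_distr[of a x y] by (simp only: X_simps(1))

lemma X_smult_zero: "a : car KP ==> a *[X] 0 = 0"
 using smult_zero_right[of a] by (simp only: X_simps(2))

lemma X_smult_diff:
 assumes a: "a : car KP" and x: "x : car X" and y: "y : car X"
 shows "a *[X] (x - y) = a *[X] x - a *[X] y"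
proof -
 have "a *[X] x = a *[X] ((x - y) + y)" by simp
 also have "... = a *[X] (x - y) + a *[X] y" by (rule X_smult_add[OF a X_diff[OF x y] y])
 finally show ?thesis by simp
qed

lemma X_sum:
 assumes "finite A" "!!t. t : A ==> v t : car X"
 shows "(\<Sum>t\<in>A. (%s. c t * v t s)) : car X"
 using assms
proof (induction A rule: finite_induct)
 case empty show ?case using X_zero by (simp only: sum.empty)
next
 case (insert t A)
 show ?case unfolding sum.insert[OF insert.hyps]
  by (rule X_add[OF X_mult[OF insert.prems] insert.IH[OF insert.prems]]) simp_all
qed

lemma X_smult_sum:
 assumes "finite A" "a : car KP" "!!t. t : A ==> v t : car X"
 shows "a *[X] (\<Sum>t\<in>A. (%s. c t * v t s)) = (\<Sum>t\<in>A. (%s. c t * (a *[X] v t) s))"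
 using assms(1,3)
proof (induction A rule: finite_induct)
 case empty show ?case using X_smult_zero[OF assms(2)] by (simp only: sum.empty)
next
 case (insert t A)
 have v: "v t : car X" and vA: "!!t. t : A ==> v t : car X" using insert.prems by simp_all
 show ?case unfolding sum.insert[OF insert.hyps]
  by (simp only: X_smult_add[OF assms(2) X_mult[OF v] X_sum[OF insert.hyps(1) vA]] insert.IH[OF vA] X_smult_mult[OF assms(2) v])
qed

lemma R_mem:
 assumes U: "submod U KP X" and w: "w : car X" and k: "k : V" and S: "finite S" "!!j. j : S ==> (j, k) : q"
  and E: "!!j. j : S ==> E k j *[X] w : U"
 shows "R k S *[X] w : U"
 using S E
proof (induction S rule: finite_induct)
 case empty
 show ?case unfolding R_empty[OF k] using smult_zero_left[OF w] submoduleD(2)[OF U] by simp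
next
 case (insert j S)
 have jV: "j : V" using q_dom[OF insert.prems(1)[of j]] by simp
 have cl: "R k S : car KP" "E k j : car KP" using insert.prems(1) by (auto intro!: R_closed k)
 have "R k (insert j S) *[X] w = R k S *[X] w +[X] E k j *[X] w"
  unfolding R_insert[OF k jV insert.hyps(2)] using smult_l_distr[OF cl w] by simp
 then show ?case using submoduleD(3)[OF U] insert by simp
qed

text \<open>A homomorphism is determined by a compatible choice of images of the basis vectors.\<close>
lemma Fam_hom:
 assumes e: "!!t. t : idx_set L m ==> e t : car X"
  and compat: "!!t l. t : idx_set L m ==> (vtx t, l) : q ==>
  E l (vtx t) *[X] e t = (case move l t of None => 0 | Some u => e u)"
 shows "(%f. \<Sum>t\<in>idx_set L m. (%s. f t * e t s)) : Hom (Fam L m) X"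
proof (rule hom_criterion[OF lm_Fam Xlm])
 let ?J = "idx_set L m" and ?ph = "%f. \<Sum>t\<in>idx_set L m. (%s. f t * e t s)"
 note cd = cdata_Fam[of L m]
 fix f assume f: "f : car (Fam L m)"
 have phc: "?ph f : car X" by (rule X_sum[OF finite_idx_set e])
 show "?ph f : car X" by (rule phc)
 show "?ph (f +[Fam L m] g) = ?ph f +[X] ?ph g" for g
 proof (rule ext)
  fix s show "?ph (f +[Fam L m] g) s = (?ph f +[X] ?ph g) s"
  unfolding X_simps(1) Fam_simps plus_fun_apply sum_fun_apply distrib_right by (rule sum.distrib)
 qed
 show "?ph (scal KP (Fam L m) c f) = scal KP X c (?ph f)" for c
 proof (rule ext)
  fix s show "?ph (scal KP (Fam L m) c f) s = scal KP X c (?ph f) s"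
  unfolding scal_Fam[OF f] X_scal[OF phc] sum_fun_apply sum_distrib_left mult.assoc ..
 qed
 fix k l assume kl: "(k, l) : q"
 have Ee: "E l k *[X] e t = (if vtx t = k then (case move l t of None => 0 | Some u => e u) else 0)" if t: "t : ?J" for t
 proof (cases "vtx t = k")
  case True then show ?thesis using compat[OF t, of l] kl by simp
 next
  case False
  have tV: "(vtx t, vtx t) : q" by (rule q_refl[OF cdata_facts(2)[OF cd t]])
  have "e t = E (vtx t) (vtx t) *[X] e t" using compat[OF t tV] cdata_facts(3)[OF cd t] by simp
  then have "E l k *[X] e t = E l k *[X] (E (vtx t) (vtx t) *[X] e t)" by simp
  also have "... = 0" using E_smult[OF Xlm e[OF t] tV kl] False X_simps(2) by simp
  finally show ?thesis using False by simp
 qed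
 show "?ph (E l k *[Fam L m] f) = E l k *[X] ?ph f"
 proof (rule ext)
  fix s
  have inn: "(\<Sum>u\<in>?J. (if vtx u = l then (if vtx t = k & move l t = Some u then f t else 0) else 0) * e u s)
  = f t * (E l k *[X] e t) s" if t: "t : ?J" for t
  proof (cases "vtx t = k & move l t ~= None")
  case True
  then obtain u0 where u0: "move l t = Some u0" "vtx t = k" by auto
  have "u0 : ?J & vtx u0 = l" by (rule cdata_facts(4)[OF cd t _ u0(1)]) (simp add: u0(2) kl)
  then have "(\<Sum>u\<in>?J. (if vtx u = l then (if vtx t = k & move l t = Some u then f t else 0) else 0) * e u s)
  = (\<Sum>u\<in>?J. if u = u0 then f t * e u0 s else 0)"
  by (intro sum.cong) (use u0 in auto)
  then show ?thesis using \<open>u0 : ?J & _\<close> u0 Ee[OF t] by simp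
  next
  case False
  then have "(\<Sum>u\<in>?J. (if vtx u = l then (if vtx t = k & move l t = Some u then f t else 0) else 0) * e u s) = 0"
  by (intro sum.neutral) auto
  then show ?thesis using False Ee[OF t] by auto
  qed
  have "?ph (E l k *[Fam L m] f) s = (\<Sum>u\<in>?J. (E l k *[Fam L m] f) u * e u s)" by (simp add: sum_fun_apply)
  also have "... = (\<Sum>u\<in>?J. \<Sum>t\<in>?J. (if vtx u = l then (if vtx t = k & move l t = Some u then f t else 0) else 0) * e u s)"
  proof (rule sum.cong[OF refl])
  fix u assume u: "u : ?J"
  show "(E l k *[Fam L m] f) u * e u s =
  (\<Sum>t\<in>?J. (if vtx u = l then (if vtx t = k & move l t = Some u then f t else 0) else 0) * e u s)"
  using u unfolding Fam_def cmod_E[OF cd kl] by (cases "vtx u = l") (simp_all add: sum_distrib_right)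
  qed
  also have "... = (\<Sum>t\<in>?J. \<Sum>u\<in>?J. (if vtx u = l then (if vtx t = k & move l t = Some u then f t else 0) else 0) * e u s)"
  by (rule sum.swap)
  also have "... = (\<Sum>t\<in>?J. f t * (E l k *[X] e t) s)" by (rule sum.cong[OF refl inn])
  also have "... = (\<Sum>t\<in>?J. (%s. f t * (E l k *[X] e t) s)) s" by (simp add: sum_fun_apply)
  finally have eq: "?ph (E l k *[Fam L m] f) s = (\<Sum>t\<in>?J. (%s. f t * (E l k *[X] e t) s)) s" .
  have sm: "E l k *[X] ?ph f = (\<Sum>t\<in>?J. (%s. f t * (E l k *[X] e t) s))"
  by (rule X_smult_sum[OF finite_idx_set E_closed[OF kl] e])
  show "?ph (E l k *[Fam L m] f) s = (E l k *[X] ?ph f) s"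
  unfolding sm by (rule eq)
 qed
qed

lemma Fam_support:
 fixes e :: "idx => 'x => 'k"
 assumes "!!t. t : idx_set L m ==> t ~: c ` {..<M} ==> f t = 0" "c ` {..<M} \<subseteq> idx_set L m" "inj c"
 shows "(\<Sum>t\<in>idx_set L m. (%s. f t * e t s)) = (\<Sum>b<(M::nat). (%s. f (c b) * e (c b) s))"
proof -
 have "(\<Sum>t\<in>idx_set L m. (%s. f t * e t s)) = (\<Sum>t\<in>c ` {..<M}. (%s. f t * e t s))"
  by (rule sum.mono_neutral_right[OF finite_idx_set assms(2)]) (auto simp: assms(1) zero_fun_def)
 also have "... = (\<Sum>b<M. (%s. f (c b) * e (c b) s))"
  by (rule sum.reindex_cong[OF inj_on_subset[OF assms(3) subset_UNIV]]) simp_all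
 finally show ?thesis .
qed

text \<open>Choose bases \<open>g 0\<close> of the component at \<open>*\<close> and \<open>g i\<close> of the subquotient
of index \<open>i\<close>, and lift \<open>g 0\<close> to all minimal vertices.  Their images span, by
induction along \<open>\<P>\<close>: lifts correct a vector at \<open>k\<close> to one in the kernel of the
map to \<open>*\<close>, which is a combination of the \<open>g k\<close> up to images from below.  They are
independent because freeness separates the terms of a relation, starting with the largest \<open>i\<close>.\<close>
theorem tilt_normal_form:
 assumes tilt: "tilt X"
 shows "EX m. isomorphic KP (NF m) X"
proof -
 note A = fdKP
 have X0: "\<zero>[X] = 0" by (simp add: X_simps)
 define KK where "KK i = {x : car X. cF i *[X] x = x & aF i *[X] x = 0}" for i
 define WW where "WW i = {x : KK i. EX w:car X. x = dF i *[X] w}" for i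
 have KKI: "x : KK i" if "x : car X" "cF i *[X] x = x" "aF i *[X] x = 0" for x i
  unfolding KK_def using that by (intro CollectI conjI)
 have KKD: "x : car X" "cF i *[X] x = x" "aF i *[X] x = 0" if "x : KK i" for x i
  using that unfolding KK_def by simp_all
 have WWI: "x : WW i" if "x : KK i" "w : car X" "x = dF i *[X] w" for x w i
  unfolding WW_def using that by blast
 have KK_add: "x + y : KK i" if i: "i : {0..n}" and xy: "x : KK i" "y : KK i" for x y i
  by (rule KKI[OF X_add[OF KKD(1)[OF xy(1)] KKD(1)[OF xy(2)]]])
  (simp_all only: X_smult_add[OF acdF_closed(1)[OF i] KKD(1)[OF xy(1)] KKD(1)[OF xy(2)]]
  X_smult_add[OF acdF_closed(2)[OF i] KKD(1)[OF xy(1)] KKD(1)[OF xy(2)]] KKD(2,3)[OF xy(1)] KKD(2,3)[OF xy(2)] add_0)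
 have KK_mult: "(%s. c * x s) : KK i" if i: "i : {0..n}" and x: "x : KK i" for x i c
  by (rule KKI[OF X_mult[OF KKD(1)[OF x]]])
  (simp_all add: X_smult_mult[OF acdF_closed(1)[OF i] KKD(1)[OF x]]
  X_smult_mult[OF acdF_closed(2)[OF i] KKD(1)[OF x]] KKD(2,3)[OF x] zero_fun_def)
 have KK_0: "0 : KK i" if i: "i : {0..n}" for i
  by (rule KKI[OF X_zero X_smult_zero[OF acdF_closed(2)[OF i]] X_smult_zero[OF acdF_closed(1)[OF i]]])
 have sKK: "fvs.subspace (KK i)" if i: "i : {0..n}" for i
  unfolding fvs.subspace_def using KK_add[OF i] KK_mult[OF i] KK_0[OF i] by (intro conjI ballI allI)
 have sWW: "fvs.subspace (WW i)" if i: "i : {0..n}" for i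
  unfolding fvs.subspace_def
 proof (intro conjI ballI allI)
  note dL = acdF_closed(3)[OF i]
  show "0 : WW i" by (rule WWI[OF KK_0[OF i] X_zero]) (simp only: X_smult_zero[OF dL])
  fix x assume "x : WW i"
  then obtain w where w: "x : KK i" "w : car X" "x = dF i *[X] w" unfolding WW_def by blast
  show "(%t. c * x t) : WW i" for c
  by (rule WWI[OF KK_mult[OF i w(1)] X_mult[OF w(2)]]) (simp only: X_smult_mult[OF dL w(2)] w(3))
  fix y assume "y : WW i"
  then obtain w' where w': "y : KK i" "w' : car X" "y = dF i *[X] w'" unfolding WW_def by blast
  show "x + y : WW i"
  by (rule WWI[OF KK_add[OF i w(1) w'(1)] X_add[OF w(2) w'(2)]]) (simp only: X_smult_add[OF dL w(2) w'(2)] w(3) w'(3))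
 qed
 let ?Q = "%i m g. (ALL b<m. g b : KK i) & (ALL x:KK i. EX al. x - (\<Sum>b<m. (%t. al b * g b t)) : WW i) &
  (ALL al. (\<Sum>b<(m::nat). (%t. al b * g b t)) : WW i --> (ALL b<m. al b = 0))"
 have "ALL i:{0..n}. EX m g. ?Q i m g"
 proof
  fix i assume i: "i : {0..n}"
  have WK: "WW i \<subseteq> KK i" unfolding WW_def by (rule Collect_subset)
  show "EX m g. ?Q i m g"
  proof (rule complement_basis_ex[OF X_simps(4) sWW[OF i] sKK[OF i] WK])
  fix f t assume "f : KK i" "t ~: bt"
  then show "f t = 0" using KKD(1)[of f i] by (simp add: X_simps)
  qed
 qed
 from bchoice[OF this] obtain m where "ALL i:{0..n}. EX g. ?Q i (m i) g" by (rule exE)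
 from bchoice[OF this] obtain g where mg: "ALL i:{0..n}. ?Q i (m i) (g i)" by (rule exE)
 have g: "g i b : KK i" if "i : {0..n}" "b < m i" for i b
  using bspec[OF mg that(1)] that(2) by (elim conjE) (erule allE, erule mp)
 have gspan: "EX al. x - (\<Sum>b<m i. (%t. al b * g i b t)) : WW i" if "i : {0..n}" "x : KK i" for i x
  using bspec[OF mg that(1)] that(2) by (elim conjE) (erule bspec)
 have gind: "al b = 0" if "i : {0..n}" "(\<Sum>b<m i. (%t. al b * g i b t)) : WW i" "b < m i" for i al b
  using bspec[OF mg that(1)] that(2,3) by blast
 have i0: "(0::nat) : {0..n}" by simp
 have W0: "x = 0" if "x : WW 0" for x
 proof -
  obtain w where "w : car X" "x = dF 0 *[X] w" using \<open>x : WW 0\<close> unfolding WW_def by blast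
  then show ?thesis using smult_zero_left[of w] X0 by (simp add: dF_def)
 qed
 have g0: "Es (Suc n) *[X] g 0 b = g 0 b" "g 0 b : car X" if "b < m 0" for b
  using KKD(1,2)[OF g[OF i0 that]] by (simp_all add: cF_def vx_def)
 have gi: "E i i *[X] g i b = g i b" "Es i *[X] g i b = 0" "g i b : car X" if "i : {1..n}" "b < m i" for i b
  using KKD[OF g[of i b]] that by (auto simp: cF_def vx_def aF_def)
 have surj: "EX w:car X. Es (Suc n) *[X] x = Es i *[X] w" if "i : {1..n}" "x : car X" for i x
  using tilt that unfolding tilt_def pp_surj_iff[OF Xlm] by blast
 have "EX h. ALL b<m 0. h b : car X & E i i *[X] h b = h b & Es i *[X] h b = g 0 b" if i: "i : {1..n}" for i
 proof -
  have iV: "i : V" using i by (simp add: V_def)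
  have "EX w. w : car X & E i i *[X] w = w & Es i *[X] w = g 0 b" if b: "b < m 0" for b
  proof -
  obtain w where w: "w : car X" "Es (Suc n) *[X] g 0 b = Es i *[X] w"
  using surj[OF i g0(2)[OF b]] by (rule bexE)
  show ?thesis
  by (rule exI[of _ "E i i *[X] w"], intro conjI E_smult_closed[OF Xlm w(1) q_refl[OF iV]] E_smult_id(1)[OF Xlm w(1) q_refl[OF iV]])
  (simp only: E_smult_id(2)[OF Xlm w(1) q_star[OF iV]] w(2)[symmetric] g0(1)[OF b])
  qed
  then have "ALL b:{..<m 0}. EX w. w : car X & E i i *[X] w = w & Es i *[X] w = g 0 b"
  by (intro ballI) (simp only: lessThan_iff)
  from bchoice[OF this] show ?thesis by (simp only: Ball_def lessThan_iff)
 qed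
 then have "ALL i:{1..n}. EX h. ALL b<m 0. h b : car X & E i i *[X] h b = h b & Es i *[X] h b = g 0 b" by (rule ballI)
 from bchoice[OF this] obtain h where hh: "ALL i:{1..n}. ALL b<m 0. h i b : car X & E i i *[X] h i b = h i b & Es i *[X] h i b = g 0 b"
  by (rule exE)
 have h: "h i b : car X" "E i i *[X] h i b = h i b" "Es i *[X] h i b = g 0 b" if "i : {1..n}" "b < m 0" for i b
  using bspec[OF hh that(1)] that(2) by simp_all
 define e where "e t = (case t of Star b => g 0 b | Gen k i b => E k i *[X] g i b | Lift k j b => E k j *[X] h j b)" for t
 have es: "e (Star b) = g 0 b" "e (Gen k i b) = E k i *[X] g i b" "e (Lift k j b) = E k j *[X] h j b" for b k i j
  by (simp_all add: e_def)
 let ?J = "idx_set Mn m"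
 have ec: "e t : car X" if t: "t : ?J" for t
 proof (cases t)
  case (Star b) then show ?thesis using t g0(2) by (simp add: es)
 next
  case (Gen k i b)
  then have "(i, k) : r" "b < m i" using t by simp_all
  then show ?thesis unfolding Gen es using r_dom r_q gi(3) by (intro E_smult_closed[OF Xlm]) blast+
 next
  case (Lift k j b)
  then have "(j, k) : r" "b < m 0" using t by simp_all
  then show ?thesis unfolding Lift es using r_dom r_q h(1) by (intro E_smult_closed[OF Xlm]) blast+
 qed
 have compat: "E l (vtx t) *[X] e t = (case move l t of None => 0 | Some u => e u)" if t: "t : ?J" and l: "(vtx t, l) : q" for t l
 proof (cases t)
  case (Star b)
  then have "l = Suc n" "b < m 0" using t l q_star_left by simp_all
  then show ?thesis using g0(1) Star by (simp add: es)
 next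
  case (Gen k i b)
  then have ik: "(i, k) : r" "b < m i" "(k, l) : q" using t l by simp_all
  have iP: "i : {1..n}" using r_dom[OF ik(1)] by simp
  have "E l (vtx t) *[X] e t = E l i *[X] g i b"
  using E_smult[OF Xlm gi(3)[OF iP ik(2)] r_q[OF ik(1)] ik(3)] Gen by (simp add: es)
  then show ?thesis using Gen gi(2)[OF iP ik(2)] by (simp add: es)
 next
  case (Lift k j b)
  then have jk: "(j, k) : r" "b < m 0" "(k, l) : q" using t l by simp_all
  have jP: "j : {1..n}" using r_dom[OF jk(1)] by simp
  have "E l (vtx t) *[X] e t = E l j *[X] h j b"
  using E_smult[OF Xlm h(1)[OF jP jk(2)] r_q[OF jk(1)] jk(3)] Lift by (simp add: es)
  then show ?thesis using Lift h(3)[OF jP jk(2)] by (simp add: es)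
 qed
 define ph where "ph f = (\<Sum>t\<in>?J. (%s. f t * e t s))" for f
 have ph: "ph : Hom (NF m) X" unfolding ph_def by (rule Fam_hom[OF ec compat])
 let ?Im = "ph ` car (NF m)"
 have subIm: "submod ?Im KP X" by (rule submodule_image[OF lm_Fam Xlm ph submodule_carrier[OF lm_Fam]])
 note ImD = submoduleD[OF subIm]
 have kIm: "kclosed KP X ?Im" by (rule submodule_kclosed[OF A Xlm subIm])
 have ImX: "x : car X" if "x : ?Im" for x by (rule subsetD[OF ImD(1) that])
 have Im_add: "x + y : ?Im" if "x : ?Im" "y : ?Im" for x y using ImD(3)[OF that] by (simp only: X_simps(1))
 have Im_mult: "(%s. c * x s) : ?Im" if "x : ?Im" for c x
 proof -
  have "scal KP X c x : ?Im" using kIm that unfolding kclosed_def by (elim conjE) (drule spec, drule bspec)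
  then show ?thesis unfolding X_scal[OF ImX[OF that]] .
 qed
 have Im_sum: "(\<Sum>b<M. (%s. al b * v b s)) : ?Im" if "!!b. b < M ==> v b : ?Im" for M :: nat and al v
  using that
 proof (induction M)
  case 0 show ?case using ImD(2) unfolding X0 by (simp only: lessThan_0 sum.empty)
 next
  case (Suc M)
  have v: "v M : ?Im" "!!b. b < M ==> v b : ?Im" using Suc.prems by simp_all
  show ?case unfolding sum.lessThan_Suc by (rule Im_add[OF Suc.IH[OF v(2)] Im_mult[OF v(1)]])
 qed
 have eIm: "e t : ?Im" if t: "t : ?J" for t
 proof (rule image_eqI)
  show "(%u. if u = t then 1 else 0) : car (NF m)" using t by simp
  show "e t = ph (%u. if u = t then 1 else 0)"
  proof
  fix s
  have "(\<Sum>u\<in>?J. (if u = t then 1 else 0) * e u s) = (\<Sum>u\<in>?J. if u = t then e t s else 0)" by (rule sum.cong) auto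
  then show "e t s = ph (%u. if u = t then 1 else 0) s" using t by (simp add: ph_def sum_fun_apply)
  qed
 qed
 have star_span: "EX al. x = (\<Sum>b<m 0. (%t. al b * g 0 b t))" if x: "x : car X" "Es (Suc n) *[X] x = x" for x
 proof -
  have "x : KK 0" by (rule KKI[OF x(1)]) (use x smult_zero_left[OF x(1)] X0 in "simp_all add: cF_def vx_def aF_def")
  from gspan[OF i0 this] obtain al where "x - (\<Sum>b<m 0. (%t. al b * g 0 b t)) : WW 0" by (rule exE)
  from W0[OF this] have "x = (\<Sum>b<m 0. (%t. al b * g 0 b t))" by (rule eq_iff_diff_eq_0[THEN iffD2])
  then show ?thesis by (intro exI)
 qed
 have comp: "E k k *[X] x : ?Im" if k: "k : {1..n}" and x: "x : car X" for k x
  using k x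
 proof (induction k arbitrary: x rule: less_induct)
  case (less k)
  note k = less.prems(1) and x = less.prems(2)
  have kV: "k : V" using k by (simp add: V_def)
  define y where "y = E k k *[X] x"
  have y: "y : car X" "E k k *[X] y = y"
  unfolding y_def by (rule E_smult_closed[OF Xlm x q_refl[OF kV]], rule E_smult_id(1)[OF Xlm x q_refl[OF kV]])
  note Esk = q_star[OF kV] and Ekk = q_refl[OF kV]
  have "EX al. Es k *[X] y = (\<Sum>b<m 0. (%t. al b * g 0 b t))"
  by (rule star_span[OF E_smult_closed[OF Xlm y(1) Esk] E_smult_id(1)[OF Xlm y(1) Esk]])
  then obtain al where al: "Es k *[X] y = (\<Sum>b<m 0. (%t. al b * g 0 b t))" by (rule exE)
  obtain j where j: "j : Mn" "(j, k) : r" using minimal_below[OF k] by (rule bexE)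
  have jP: "j : {1..n}" by (rule Mn_dom[OF j(1)])
  define L where "L = (\<Sum>b<m 0. (%t. al b * e (Lift k j b) t))"
  have LJ: "Lift k j b : ?J" if "b < m 0" for b using j that by simp
  have LIm: "L : ?Im" unfolding L_def by (rule Im_sum[OF eIm[OF LJ]])
  have EL: "a *[X] L = (\<Sum>b<m 0. (%s. al b * (a *[X] e (Lift k j b)) s))" if "a : car KP" for a
  unfolding L_def by (rule X_smult_sum[OF _ that ec[OF LJ]]) simp_all
  have cL: "E l k *[X] e (Lift k j b) = (case move l (Lift k j b) of None => 0 | Some u => e u)" if "b < m 0" "(k, l) : q" for b l
  using compat[OF LJ[OF that(1)], of l] that(2) by simp
  have kn: "k ~= Suc n" using k by simp
  have "E k k *[X] L = L" unfolding EL[OF E_closed[OF Ekk]] unfolding L_def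
  by (rule sum.cong[OF refl]) (simp only: cL[OF _ Ekk] lessThan_iff move.simps kn if_False option.case)
  moreover have "Es k *[X] L = Es k *[X] y" unfolding EL[OF E_closed[OF Esk]] al
  by (rule sum.cong[OF refl]) (simp only: cL[OF _ Esk] lessThan_iff move.simps simp_thms if_True option.case, simp only: es)
  ultimately have yL: "y - L : KK k"
  using X_smult_diff[OF E_closed[OF Ekk] y(1) ImX[OF LIm]] X_smult_diff[OF E_closed[OF Esk] y(1) ImX[OF LIm]] y k
  by (intro KKI[OF X_diff[OF y(1) ImX[OF LIm]]]) (simp_all add: cF_def aF_def vx_def)
  have k0: "k : {0..n}" using k by simp
  obtain al' where "y - L - (\<Sum>b<m k. (%t. al' b * g k b t)) : WW k" using gspan[OF k0 yL] by (rule exE)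
  then obtain w where w: "w : car X" "y - L - (\<Sum>b<m k. (%t. al' b * g k b t)) = dF k *[X] w" unfolding WW_def by blast
  have dk: "dF k = R k (rad k)" using k by (simp add: dF_def)
  have gIm: "(\<Sum>b<m k. (%t. al' b * g k b t)) : ?Im"
  proof (rule Im_sum)
  fix b assume b: "b < m k"
  have "e (Gen k k b) : ?Im" by (rule eIm) (use b r_refl[OF k] in simp)
  then show "g k b : ?Im" unfolding es gi(1)[OF k b] .
  qed
  have RIm: "R k (rad k) *[X] w : ?Im"
  proof (rule R_mem[OF subIm w(1) kV])
  show "finite (rad k)" by (simp add: rad_def)
  fix j assume j: "j : rad k"
  then have jk: "(j, k) : r" "j ~= k" by (simp_all add: rad_def)
  show "(j, k) : q" by (rule r_q[OF jk(1)])
  have "j < k" using le[OF jk(1)] jk(2) by simp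
  then have "E j j *[X] w : ?Im" using less.IH[of j w] r_dom[OF jk(1)] w(1) by blast
  from ImD(4)[OF E_closed[OF r_q[OF jk(1)]] this] show "E k j *[X] w : ?Im"
  unfolding E_smult_id(2)[OF Xlm w(1) r_q[OF jk(1)]] .
  qed
  have yeq: "y = L + ((\<Sum>b<m k. (%t. al' b * g k b t)) + R k (rad k) *[X] w)"
  unfolding dk[symmetric] w(2)[symmetric] by simp
  show ?case unfolding y_def[symmetric] by (subst yeq) (rule Im_add[OF LIm Im_add[OF gIm RIm]])
 qed
 have onto: "?Im = car X"
 proof (rule subset_antisym[OF ImD(1)], rule subsetI)
  fix x assume x: "x : car X"
  show "x : ?Im"
  proof (rule kclosed_components[OF Xlm kIm x])
  fix k assume k: "k : V"
  show "E k k *[X] x : ?Im"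
  proof (cases "k = Suc n")
  case True
  note ss = q_refl[OF V_star]
  obtain al where "Es (Suc n) *[X] x = (\<Sum>b<m 0. (%t. al b * g 0 b t))"
  using star_span[OF E_smult_closed[OF Xlm x ss] E_smult_id(1)[OF Xlm x ss]] by (rule exE)
  moreover have "(\<Sum>b<m 0. (%t. al b * g 0 b t)) : ?Im"
  proof (rule Im_sum)
  fix b assume "b < m 0"
  then have "e (Star b) : ?Im" by (intro eIm) simp
  then show "g 0 b : ?Im" unfolding es .
  qed
  ultimately show ?thesis using True by simp
  next
  case False then show ?thesis using comp[of k x] k x by (simp add: V_cases)
  qed
  qed
 qed
 have ker: "f = 0" if f: "f : car (NF m)" and 0: "ph f = 0" for f
 proof -
  have Fc: "a *[NF m] F : car (NF m)" if "a : car KP" "F : car (NF m)" for a F by (rule Fam_closed[OF that])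
  have phE: "ph (a *[NF m] F) = a *[X] ph F" if "a : car KP" "F : car (NF m)" for a F by (rule homD(3)[OF ph that])
  have zero_WW: "0 : WW 0" by (rule fvs.subspace_0[OF sWW[OF i0]])
  have star: "F (Star b) = 0" if F: "F : car (NF m)" and F0: "ph F = 0" and b: "b < m 0"
  and Fs: "!!t. t : ?J ==> t ~: Star ` {..<m 0} ==> F t = 0" for F b
  proof -
  have "ph F = (\<Sum>b<m 0. (%s. F (Star b) * e (Star b) s))"
  unfolding ph_def by (rule Fam_support[OF Fs]) (auto intro: injI)
  then have "(\<Sum>b<m 0. (%s. F (Star b) * g 0 b s)) = 0" using F0 by (simp only: es)
  then have "(\<Sum>b<m 0. (%s. F (Star b) * g 0 b s)) : WW 0" using zero_WW by simp
  from gind[OF i0 this b] show ?thesis .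
  qed
  have fstar: "f (Star b) = 0" if b: "b < m 0" for b
  proof -
  have ss: "Es (Suc n) : car KP" by (rule E_closed[OF q_refl[OF V_star]])
  have "(Es (Suc n) *[NF m] f) (Star b) = 0"
  proof (rule star[OF Fc[OF ss f] _ b])
  show "ph (Es (Suc n) *[NF m] f) = 0" unfolding phE[OF ss f] 0 by (rule X_smult_zero[OF ss])
  fix t assume "t : ?J" "t ~: Star ` {..<m 0}"
  then show "(Es (Suc n) *[NF m] f) t = 0" by (cases t) (auto simp: Fam_E_Gen Fam_E_Lift r_star)
  qed
  then show ?thesis using b by (simp add: Fam_E_Star)
  qed
  have fk: "(ALL b<m i. f (Gen k i b) = 0) & (i : Mn --> (ALL b<m 0. f (Lift k i b) = 0))" if ik: "(i, k) : r" for i k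
  using ik
  proof (induction "n - i" arbitrary: i rule: less_induct)
  case less
  note ik = less.prems
  have iP: "i : {1..n}" and kP: "k : {1..n}" using r_dom[OF ik] by simp_all
  have iV: "i : V" "i ~= Suc n" and kV: "k : V" "k ~= Suc n" using r_V[OF ik] by simp_all
  have IH: "f (Gen k i' b) = 0" "i' : Mn ==> b < m 0 ==> f (Lift k i' b) = 0"
  if i': "(i, i') : r" "i' ~= i" "(i', k) : r" and b: "b < m i' \<or> b < m 0 & i' : Mn \<or> f (Gen k i' b) = 0" for i' b
  proof -
  have "i < i'" using le[OF i'(1)] i'(2) by simp
  then have lt: "n - i' < n - i" using r_dom[OF i'(1)] by auto
  note H = less.hyps[OF lt i'(3)]
  show "i' : Mn ==> b < m 0 ==> f (Lift k i' b) = 0" using H by blast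
  show "f (Gen k i' b) = 0"
  proof (cases "b < m i'")
  case True then show ?thesis using H by blast
  next
  case False then show ?thesis using f by simp
  qed
  qed
  define F where "F t = (case t of Star b => 0 | Gen l i' b => if l = i' & (i', k) : r then f (Gen k i' b) else 0
  | Lift l j b => if l = j & (j, k) : r & j : Mn then f (Lift k j b) else 0)" for t
  have Fs: "F (Star b) = 0" "F (Gen l i' b) = (if l = i' & (i', k) : r then f (Gen k i' b) else 0)"
  "F (Lift l j b) = (if l = j & (j, k) : r & j : Mn then f (Lift k j b) else 0)" for b l i' j
  by (simp_all add: F_def)
  have rr: "(j, j) : r" if "(j, k) : r" for j k using r_dom[OF that] r_refl[of j] by simp
  have "F t = 0" if "t ~: ?J" for t using that f rr by (cases t) (auto simp: Fs)
  then have F: "F : car (NF m)" by simp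
  note L1 = E_closed[OF q_refl[OF kV(1)]] and L2 = tilt_closed(4)[OF ik] and L3 = tilt_closed(5)[OF ik]
  and L4 = tilt_closed(6)[OF ik] and L5 = tilt_closed(7)[OF ik] and L6 = tilt_closed(3)[OF iP]
  have dec: "E k k *[NF m] f = E k i *[NF m] F + R k (low i k) *[NF m] F"
  proof (rule Fam_eqI[OF Fc[OF L1 f]])
  show "E k i *[NF m] F + R k (low i k) *[NF m] F : car (NF m)"
  using Fc[OF L2 F] Fc[OF L3 F] by simp
  next
  fix b assume b: "b < m 0"
  show "(E k k *[NF m] f) (Star b) = (E k i *[NF m] F + R k (low i k) *[NF m] F) (Star b)"
  using b kV iV Fam_R_Star[of k b m Mn "low i k" F, OF kP b] by (simp add: Fam_E_Star)
  next
  fix l i' b assume il: "(i', l) : r" and b: "b < m i'"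
  have "(\<Sum>c\<in>{c. (i', c) : r} \<inter> low i k. F (Gen c i' b)) = (\<Sum>c\<in>{c. (i', c) : r} \<inter> low i k. if c = i' then f (Gen k i' b) else 0)"
  by (rule sum.cong) (auto simp: Fs low_def)
  also have "... = (if i' : low i k then f (Gen k i' b) else 0)" using rr by (auto simp: low_def)
  finally show "(E k k *[NF m] f) (Gen l i' b) = (E k i *[NF m] F + R k (low i k) *[NF m] F) (Gen l i' b)"
  using il b kV iV rr[OF il] IH(1)[of i' b] r_refl[OF iP] ik by (auto simp: Fam_E_Gen Fam_R_Gen low_def Fs)
  next
  fix l i' b assume iM: "i' : Mn" and il: "(i', l) : r" and b: "b < m 0"
  have "(\<Sum>c\<in>{c. (i', c) : r} \<inter> low i k. F (Lift c i' b)) = (\<Sum>c\<in>{c. (i', c) : r} \<inter> low i k. if c = i' then f (Lift k i' b) else 0)"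
  by (rule sum.cong) (use iM in "auto simp: Fs low_def")
  also have "... = (if i' : low i k then f (Lift k i' b) else 0)" using rr by (auto simp: low_def)
  finally show "(E k k *[NF m] f) (Lift l i' b) = (E k i *[NF m] F + R k (low i k) *[NF m] F) (Lift l i' b)"
  using il b iM kV iV rr[OF il] IH(2)[of i' b] r_refl[OF iP] ik by (auto simp: Fam_E_Lift Fam_R_Lift low_def Fs)
  qed
  have phF: "ph F : car X" by (rule homD(1)[OF ph F])
  have "E k i *[X] ph F + R k (low i k) *[X] ph F = ph (E k k *[NF m] f)"
  unfolding dec using homD(2)[OF ph Fc[OF L2 F] Fc[OF L3 F]] phE[OF L2 F] phE[OF L3 F] by (simp add: X_simps(1))
  also have "... = 0" unfolding phE[OF L1 f] 0 by (rule X_smult_zero[OF L1])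
  finally have s: "E k i *[X] ph F + R k (low i k) *[X] ph F = 0" .
  have neg: "R k (low i k) *[X] (0 - ph F) = - (R k (low i k) *[X] ph F)"
  unfolding X_smult_diff[OF L3 X_zero phF] X_smult_zero[OF L3] by simp
  have eq: "E k i *[X] ph F = R k (low i k) *[X] (0 - ph F)"
  unfolding neg using s by (simp only: eq_neg_iff_add_eq_0)
  have pp: "pp_imp KP X (E k i) (R k (low i k)) (E i i) (R i (rad i))" using tilt ik unfolding tilt_def by blast
  obtain w where w: "w : car X" "E i i *[X] ph F = R i (rad i) *[X] w"
  using pp[unfolded pp_imp_def, rule_format, OF phF X_diff[OF X_zero phF] eq] by (rule bexE)
  have lift: "f (Lift k i b) = 0" if iM: "i : Mn" and b: "b < m 0" for b
  proof -
  have re: "rad i = {}" using Mn_min[OF iM] by (auto simp: rad_def)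
  have "R i (rad i) *[X] w = 0" unfolding re R_empty[OF iV(1)] using smult_zero_left[OF w(1)] X0 by simp
  then have "Es i *[X] ph F = 0"
  using E_smult_id(2)[OF Xlm phF q_star[OF iV(1)]] w(2) X_smult_zero[OF L6] by simp
  then have z: "ph (Es i *[NF m] F) = 0" unfolding phE[OF L6 F] .
  have "(Es i *[NF m] F) (Star b) = 0"
  proof (rule star[OF Fc[OF L6 F] z b])
  fix t assume "t : ?J" "t ~: Star ` {..<m 0}"
  then show "(Es i *[NF m] F) t = 0" using iV by (cases t) (auto simp: Fam_E_Gen Fam_E_Lift r_star)
  qed
  moreover have "{j. j : Mn & (j, i) : r} = {i}" using iM Mn_min[OF iM] r_refl[OF iP] by auto
  ultimately show ?thesis using b iV iM ik by (simp add: Fam_E_Star Fs)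
  qed
  have gen: "f (Gen k i b) = 0" if b: "b < m i" for b
  proof -
  let ?F = "E i i *[NF m] F"
  have FG: "?F (Gen i i b) = f (Gen k i b)" if "b < m i" for b
  using that iV ik r_refl[OF iP] by (simp add: Fam_E_Gen Fs)
  have "ph ?F = (\<Sum>b<m i. (%s. ?F (Gen i i b) * e (Gen i i b) s))"
  unfolding ph_def
  proof (rule Fam_support)
  show "(%b. Gen i i b) ` {..<m i} \<subseteq> ?J" using r_refl[OF iP] by auto
  show "inj (%b. Gen i i b)" by (rule injI) simp
  fix t assume t: "t : ?J" "t ~: (%b. Gen i i b) ` {..<m i}"
  show "?F t = 0"
  proof (cases t)
  case (Star b) then show ?thesis using t iV by (simp add: Fam_E_Star)
  next
  case (Gen l i' b) then show ?thesis using t iV by (auto simp: Fam_E_Gen Fs)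
  next
  case (Lift l j b) then show ?thesis using t iV lift by (auto simp: Fam_E_Lift Fs)
  qed
  qed
  also have "... = (\<Sum>b<m i. (%s. f (Gen k i b) * g i b s))"
  by (rule sum.cong[OF refl]) (simp only: FG lessThan_iff es gi(1)[OF iP])
  finally have y: "E i i *[X] ph F = (\<Sum>b<m i. (%s. f (Gen k i b) * g i b s))" unfolding phE[OF L4 F] .
  have i0n: "i : {0..n}" using iP by simp
  have "(\<Sum>b<m i. (%s. f (Gen k i b) * g i b s)) : KK i"
  by (rule fvs.subspace_sum[OF sKK[OF i0n]]) (rule KK_mult[OF i0n g[OF i0n]], simp)
  then have "(\<Sum>b<m i. (%s. f (Gen k i b) * g i b s)) : WW i"
  by (rule WWI[OF _ w(1)]) (use y w(2) iP in "simp add: dF_def")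
  from gind[OF i0n this b] show ?thesis .
  qed
  show ?case using gen lift by blast
  qed
  show ?thesis
  proof (rule Fam_eqI[OF f])
  show "(0 :: idx => 'k) : car (NF m)" by simp
  qed (use fstar fk in auto)
 qed
 have "inj_on ph (car (NF m))"
 proof (rule inj_onI)
  fix f f' assume ff: "f : car (NF m)" "f' : car (NF m)" "ph f = ph f'"
  interpret NF: lmodule KP "NF m" by (rule lmI) (rule lm_Fam)
  have d: "f -[NF m] f' : car (NF m)" by (rule NF.M.minus_closed[OF ff(1,2)])
  have "ph (f -[NF m] f') = ph f -[X] ph f'" by (rule module_hom_diff[OF lm_Fam Xlm ph ff(1,2)])
  also have "... = 0" unfolding X0[symmetric] by (rule right_minus_eq[THEN iffD2]) (use ff homD(1)[OF ph] in auto)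
  finally have "f -[NF m] f' = \<zero>[NF m]" using ker[OF d] by simp
  then show "f = f'" by (rule NF.right_minus_eq[OF ff(1,2), THEN iffD1])
 qed
 then have "bij_betw ph (car (NF m)) (car X)" unfolding bij_betw_def using onto by (rule conjI)
 then have "isomorphic KP (NF m) X" unfolding isomorphic_def by (rule bexI[OF _ ph])
 then show ?thesis by (intro exI)
qed

end

theorem tilt_imp_normal_form:
 fixes M :: "('k mat, 'm) module"
 assumes M: "fd_module KP M" and tilt: "tilt M"
 shows "EX m. isomorphic KP (NF m) M"
proof -
 note lmM = fd_lm[OF M]
 obtain bt and X :: "('k mat, 'm => 'k) module" where X: "std_module bt KP X" "isomorphic KP M X"
  by (rule fd_module_std[OF fdKP M])
 obtain m where m: "isomorphic KP (NF m) X"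
  using tilt_normal_form[OF X(1) tilt_iso[OF lmM X(2) tilt]] by (rule exE)
 have "isomorphic KP (NF m) M" by (rule iso_trans[OF m iso_sym[OF lmM X(2)]])
 then show ?thesis by (intro exI)
qed


section \<open>The characteristic tilting module\<close>

lemma NF_tilt: "tilt (NF m)"
 by (rule filtered_imp_tilt[OF lm_Fam NF_standard NF_costandard])

lemma Z_zero: "\<zero>[KP] = Z" by simp

lemma vanishes_iso:
 assumes "left_module KP M" "isomorphic KP M M'" "i : {0..n}" "vanishes M i" shows "vanishes M' i"
 using assms(4) unfolding vanishes_def
 by (rule pp_imp_iso[OF assms(1,2) acdF_closed(1)[OF assms(3)] tilt_closed(1) acdF_closed(2,3)[OF assms(3)]])

lemma vanishes_direct_sum:
 assumes "left_module KP M" "left_module KP M'" "i : {0..n}"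
 shows "vanishes (direct_sum M M') i \<longleftrightarrow> vanishes M i & vanishes M' i"
 unfolding vanishes_def
 by (rule pp_imp_direct_sum[OF assms(1,2) acdF_closed(1)[OF assms(3)] tilt_closed(1) acdF_closed(2,3)[OF assms(3)]])

lemma vanishes_power:
 assumes "left_module KP M" "i : {0..n}" "vanishes M i" shows "vanishes (power_module M k) i"
 using assms(3) unfolding vanishes_def
 by (rule pp_imp_power[OF assms(1) acdF_closed(1)[OF assms(2)] tilt_closed(1) acdF_closed(2,3)[OF assms(2)]])

text \<open>Only the zero module has all multiplicities \<open>0\<close>.\<close>
lemma all_vanish:
 assumes M: "fd_module KP M" "tilt M" and v: "!!i. i : {0..n} ==> vanishes M i"
 shows "car M = {\<zero>[M]}"
proof -
 note lm = fd_lm[OF M(1)]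
 obtain m where m: "isomorphic KP (NF m) M" using tilt_imp_normal_form[OF M] by (rule exE)
 have mi: "m i = 0" if i: "i : {0..n}" for i
  using vanishes_iso[OF lm iso_sym[OF lm_Fam m] i v[OF i]] NF_vanishes[OF i] by simp
 have "t ~: idx_set Mn m" for t
  using mi r_dom by (cases t) (auto simp: mi)
 then have c: "car (NF m) = {\<zero>[NF m]}" by (auto simp: zero_fun_def)
 obtain f where f: "f : Hom (NF m) M" "bij_betw f (car (NF m)) (car M)"
  using m unfolding isomorphic_def by (rule bexE)
 have "car M = f ` car (NF m)" using f(2) unfolding bij_betw_def by simp
 then show ?thesis unfolding c using hom_zero[OF lm_Fam lm f(1)] by simp
qed

lemma Fam_cong: "(!!i. i : {0..n} ==> m i = m' i) ==> Fam L m = Fam L m'"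
proof -
 assume e: "!!i. i : {0..n} ==> m i = m' i"
 have "t : idx_set L m \<longleftrightarrow> t : idx_set L m'" for t
 proof (cases t)
  case (Gen k i b) then show ?thesis using e[of i] r_dom[of i k] by auto
 qed (use e[of 0] in auto)
 then have "idx_set L m = idx_set L m'" by (rule Set.set_eqI)
 then show ?thesis by (simp add: Fam_def)
qed

lemma power_NF:
 assumes lm: "left_module KP T" and iso: "isomorphic KP T (NF (%_. 1))"
 shows "isomorphic KP (power_module T k) (NF (%_. k))"
proof (induction k)
 case 0
 let ?P = "power_module T 0" and ?Z = "NF (%_. 0)"
 have c: "car ?P = {\<zero>[?P]}" by (simp add: power_module_def restrict_def)
 have z: "car ?Z = {\<zero>[?Z]}" by (rule Fam_zero) simp
 interpret Z: lmodule KP ?Z by (rule lmI) (rule lm_Fam)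
 have h: "(%_. \<zero>[?Z]) : Hom ?P ?Z"
  by (rule homI) (use Z.M.zero_closed Z.M.l_zero[OF Z.M.zero_closed] Z.smult_zero_right in "simp_all del: Fam_simps")
 have "bij_betw (%_. \<zero>[?Z]) (car ?P) (car ?Z)" unfolding c z by (simp add: bij_betw_def)
 then show ?case unfolding isomorphic_def by (rule bexI[OF _ h])
next
 case (Suc k)
 have 1: "isomorphic KP (power_module T (Suc k)) (direct_sum (power_module T k) T)"
  by (rule iso_sym[OF lm_sum[OF left_module_power[OF lm] lm] power_module_Suc[OF lm]])
 have 2: "isomorphic KP (direct_sum (power_module T k) T) (direct_sum (NF (%_. k)) (NF (%_. 1)))"
  by (rule iso_sum[OF Suc iso])
 have 3: "isomorphic KP (direct_sum (NF (%_. k)) (NF (%_. 1))) (NF (%_. Suc k))"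
  using Fam_direct_sum[of Mn "%_. k" "%_. 1"] by simp
 show ?case by (rule iso_trans[OF 1 iso_trans[OF 2 3]])
qed

lemma NF_iso_filtered:
 assumes lm: "left_module KP M" and iso: "isomorphic KP (NF m) M"
 shows "filtered_by KP (Del ` {0..n}) M & filtered_by KP (Nab ` {0..n}) M"
proof
 have s: "left_module KP N'" if "N' : Del ` {0..n}" for N'
  using that fd_lm[OF standard_thin(1)] by auto
 have c: "left_module KP N'" if "N' : Nab ` {0..n}" for N'
  using that fd_lm[OF costandard_thin(1)] by auto
 show "filtered_by KP (Del ` {0..n}) M"
  by (rule filtered_by_iso[OF NF_standard lm_Fam lm iso s]) (use s iso_refl in blast)+
 show "filtered_by KP (Nab ` {0..n}) M"
  by (rule filtered_by_iso[OF NF_costandard lm_Fam lm iso c]) (use c iso_refl in blast)+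
qed

lemma rank1_sum:
 assumes M: "left_module KP M" and M1: "left_module KP M1" and M2: "left_module KP M2"
  and iso: "isomorphic KP M (direct_sum M1 M2)" and i: "i : {0..n}"
  and rk: "pp_rank1 KP M (aF i) (cF i) (dF i)"
 shows "pp_rank1 KP M1 (aF i) (cF i) (dF i)" "vanishes M1 i \<or> vanishes M2 i"
proof -
 note acd = acdF_closed[OF i]
 have "pp_rank1 KP (direct_sum M1 M2) (aF i) (cF i) (dF i)"
  by (rule pp_rank1_iso[OF fdKP M lm_sum[OF M1 M2] iso acd rk])
 note S = pp_rank1_direct_sum[OF fdKP M1 M2 acd this]
 show "pp_rank1 KP M1 (aF i) (cF i) (dF i)" by (rule S(1))
 show "vanishes M1 i \<or> vanishes M2 i" using S(2) unfolding Z_zero vanishes_def .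
qed

theorem characteristic_tilting_NF:
 fixes T :: "('k mat, 'k vec) module"
 assumes fd: "fd_module KP T" and iso: "isomorphic KP (NF (%_. 1)) T"
 shows "characteristic_tilting_module KP {0..n} ord Sim T"
 unfolding characteristic_tilting_module_def
proof (intro conjI allI impI fd)
 note lmT = fd_lm[OF fd]
 note iso' = iso_sym[OF lm_Fam iso]
 have tT: "tilt T" by (rule tilt_iso[OF lm_Fam iso NF_tilt])
 show "multiplicity_free KP T"
  unfolding multiplicity_free_def
 proof (intro allI impI notI)
  fix M1 M2 :: "('k mat, 'k vec) module"
  assume a: "fd_module KP M1 & indecomposable KP M1 & fd_module KP M2"
  and i: "isomorphic KP T (direct_sum (direct_sum M1 M1) M2)"
  have fd1: "fd_module KP M1" and ind: "indecomposable KP M1" and fd2: "fd_module KP M2" using a by simp_all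
  note lm1 = fd_lm[OF fd1] and lm2 = fd_lm[OF fd2]
  note lm11 = lm_sum[OF lm1 lm1]
  have "tilt (direct_sum (direct_sum M1 M1) M2)" by (rule tilt_iso[OF lmT i tT])
  then have t1: "tilt M1" unfolding tilt_direct_sum[OF lm11 lm2] tilt_direct_sum[OF lm1 lm1] by simp
  have "vanishes M1 j" if j: "j : {0..n}" for j
  proof -
  have "pp_rank1 KP (NF (%_. 1)) (aF j) (cF j) (dF j)" by (rule NF_rank1[OF j]) simp
  from rank1_sum(1)[OF lm_Fam lm11 lm2 iso_trans[OF iso i] j this]
  have "pp_rank1 KP (direct_sum M1 M1) (aF j) (cF j) (dF j)" .
  from rank1_sum(2)[OF lm11 lm1 lm1 iso_refl j this] show ?thesis by simp
  qed
  from all_vanish[OF fd1 t1 this] show False using ind unfolding indecomposable_def by simp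
 qed
 fix M :: "('k mat, 'k vec) module" assume M: "fd_module KP M"
 note lmM = fd_lm[OF M]
 show "in_add KP T M \<longleftrightarrow> filtered_by KP (Del ` {0..n}) M & filtered_by KP (Nab ` {0..n}) M"
 proof
  assume "in_add KP T M"
  then obtain k and M' :: "('k mat, 'k vec) module" where M': "fd_module KP M'" "isomorphic KP (direct_sum M M') (power_module T k)"
  unfolding in_add_def by blast
  note lm' = fd_lm[OF M'(1)]
  have "tilt (direct_sum M M')"
  by (rule tilt_iso[OF left_module_power[OF lmT] iso_sym[OF lm_sum[OF lmM lm'] M'(2)] tilt_power[OF lmT tT]])
  then have "tilt M" unfolding tilt_direct_sum[OF lmM lm'] by simp
  then obtain m where "isomorphic KP (NF m) M" using tilt_imp_normal_form[OF M] by blast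
  then show "filtered_by KP (Del ` {0..n}) M & filtered_by KP (Nab ` {0..n}) M"
  by (rule NF_iso_filtered[OF lmM])
 next
  assume f: "filtered_by KP (Del ` {0..n}) M & filtered_by KP (Nab ` {0..n}) M"
  have "tilt M" by (rule filtered_imp_tilt[OF lmM conjunct1[OF f] conjunct2[OF f]])
  then obtain m where m: "isomorphic KP (NF m) M" using tilt_imp_normal_form[OF M] by blast
  define k where "k = (\<Sum>i\<in>{0..n}. m i)"
  have mk: "m i + (k - m i) = k" if "i : {0..n}" for i
  using member_le_sum[of i "{0..n}" m] that by (simp add: k_def)
  obtain M' :: "('k mat, 'k vec) module" where M': "fd_module KP M'" "isomorphic KP (NF (%i. k - m i)) M'"
  by (rule fd_module_vec[OF fdKP fd_Fam])
  have 1: "isomorphic KP (direct_sum M M') (direct_sum (NF m) (NF (%i. k - m i)))"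
  by (rule iso_sum[OF iso_sym[OF lm_Fam m] iso_sym[OF lm_Fam M'(2)]])
  have "NF (%i. m i + (k - m i)) = NF (%_. k)" by (rule Fam_cong[OF mk])
  then have 2: "isomorphic KP (direct_sum (NF m) (NF (%i. k - m i))) (NF (%_. k))"
  using Fam_direct_sum[of Mn m "%i. k - m i"] by simp
  have 3: "isomorphic KP (NF (%_. k)) (power_module T k)"
  by (rule iso_sym[OF left_module_power[OF lmT] power_NF[OF lmT iso']])
  have "isomorphic KP (direct_sum M M') (power_module T k)" by (rule iso_trans[OF 1 iso_trans[OF 2 3]])
  then show "in_add KP T M" unfolding in_add_def using M'(1) by blast
 qed
qed

lemma in_add_self:
 fixes T :: "('k mat, 'k vec) module"
 assumes fd: "fd_module KP T" shows "in_add KP T T"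
proof -
 note lmT = fd_lm[OF fd]
 interpret lmodule KP T by (rule lmI) (rule lmT)
 obtain M' :: "('k mat, 'k vec) module" where M': "fd_module KP M'" "isomorphic KP (NF (%_. 0)) M'"
  by (rule fd_module_vec[OF fdKP fd_Fam])
 note lm' = fd_lm[OF M'(1)]
 interpret M': lmodule KP M' by (rule lmI) (rule lm')
 have c: "car M' = {\<zero>[M']}"
 proof (rule all_vanish[OF M'(1) tilt_iso[OF lm_Fam M'(2) NF_tilt]])
  fix i assume i: "i : {0..n}"
  show "vanishes M' i" by (rule vanishes_iso[OF lm_Fam M'(2) i]) (simp add: NF_vanishes[OF i])
 qed
 let ?F = "%p. \<lambda>i\<in>{..<Suc 0}. fst p"
 have ps: "car (power_module T 1) = {..<Suc 0} \<rightarrow>\<^sub>E car T"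
  "!!x y. x +[power_module T 1] y = (\<lambda>i\<in>{..<Suc 0}. x i +[T] y i)"
  "!!a x. a *[power_module T 1] x = (\<lambda>i\<in>{..<Suc 0}. a *[T] x i)" by (simp_all add: power_module_def)
 have F: "?F : Hom (direct_sum T M') (power_module T 1)"
 proof (rule homI)
  fix p assume p: "p : car (direct_sum T M')"
  obtain x x' where px: "p = (x, x')" by (cases p)
  have x: "x : car T" using p px by (simp add: ds_simps)
  show "?F p : car (power_module T 1)" unfolding ps px using x by auto
  show "?F (p +[direct_sum T M'] p') = ?F p +[power_module T 1] ?F p'" for p'
  unfolding ps px by (cases p') (auto simp: ds_simps)
  show "?F (a *[direct_sum T M'] p) = a *[power_module T 1] ?F p" for a
  unfolding ps px by (auto simp: ds_simps)
 qed
 have "isomorphic KP (direct_sum T M') (power_module T 1)"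
 proof (rule isomorphicI[OF F, of "%x. (x 0, \<zero>[M'])"])
  fix y assume y: "y : car (power_module T 1)"
  then show "(y 0, \<zero>[M']) : car (direct_sum T M')" unfolding ps by (auto simp: ds_simps)
  show "?F (y 0, \<zero>[M']) = y" using y unfolding ps by (auto simp: PiE_def extensional_def)
 next
  fix p assume p: "p : car (direct_sum T M')"
  then show "(?F p 0, \<zero>[M']) = p" using c by (cases p) (simp add: ds_simps)
 qed
 then show ?thesis unfolding in_add_def using M'(1) by blast
qed

text \<open>If \<open>m i = 0\<close> then no power of \<open>T\<close> has the module with all multiplicities
\<open>1\<close> as a summand; if \<open>m i > 1\<close> then the indecomposable module with the single
multiplicity \<open>m i = 1\<close> occurs twice in \<open>T\<close>.\<close>
theorem characteristic_tilting_unique: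
 assumes T: "characteristic_tilting_module KP {0..n} ord Sim T"
 shows "fd_module KP T" "isomorphic KP (NF (%_. 1)) T"
proof -
 show fd: "fd_module KP T" using T unfolding characteristic_tilting_module_def by blast
 have mf: "multiplicity_free KP T" using T unfolding characteristic_tilting_module_def by blast
 have iff: "in_add KP T M \<longleftrightarrow> filtered_by KP (Del ` {0..n}) M & filtered_by KP (Nab ` {0..n}) M"
  if "fd_module KP M" for M using T that unfolding characteristic_tilting_module_def by blast
 note lmT = fd_lm[OF fd]
 note f = iff[OF fd, THEN iffD1, OF in_add_self[OF fd]]
 have tT: "tilt T" by (rule filtered_imp_tilt[OF lmT conjunct1[OF f] conjunct2[OF f]])
 obtain m where m: "isomorphic KP (NF m) T" using tilt_imp_normal_form[OF fd tT] by (rule exE)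
 have ge: "m i ~= 0" if i: "i : {0..n}" for i
 proof
  assume mi: "m i = 0"
  obtain T1 :: "('k mat, 'k vec) module" where T1: "fd_module KP T1" "isomorphic KP (NF (%_. 1)) T1"
  by (rule fd_module_vec[OF fdKP fd_Fam])
  note lm1 = fd_lm[OF T1(1)]
  have "in_add KP T T1" by (rule iff[OF T1(1), THEN iffD2, OF NF_iso_filtered[OF lm1 T1(2)]])
  then obtain k and M' :: "('k mat, 'k vec) module" where M': "fd_module KP M'" "isomorphic KP (direct_sum T1 M') (power_module T k)"
  unfolding in_add_def by blast
  note lm' = fd_lm[OF M'(1)]
  have "vanishes (NF m) i" using NF_vanishes[OF i] mi by simp
  from vanishes_power[OF lmT i vanishes_iso[OF lm_Fam m i this]]
  have "vanishes (power_module T k) i" .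
  from vanishes_iso[OF left_module_power[OF lmT] iso_sym[OF lm_sum[OF lm1 lm'] M'(2)] i this]
  have "vanishes T1 i" unfolding vanishes_direct_sum[OF lm1 lm' i] by simp
  from vanishes_iso[OF lm1 iso_sym[OF lm_Fam T1(2)] i this]
  show False using NF_vanishes[OF i, of "%_. 1"] by simp
 qed
 have le1: "m i \<le> 1" if i: "i : {0..n}" for i
 proof (rule ccontr)
  assume gt: "\<not> m i \<le> 1"
  let ?de = "%j. if j = i then 1 else (0::nat)" and ?m = "%j. if j = i then m i - 2 else m j"
  obtain M1 :: "('k mat, 'k vec) module" where M1: "fd_module KP M1" "isomorphic KP (NF ?de) M1"
  by (rule fd_module_vec[OF fdKP fd_Fam])
  obtain M2 :: "('k mat, 'k vec) module" where M2: "fd_module KP M2" "isomorphic KP (NF ?m) M2"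
  by (rule fd_module_vec[OF fdKP fd_Fam])
  note lm1 = fd_lm[OF M1(1)] and lm2 = fd_lm[OF M2(1)]
  have "(%j. (?de j + ?de j) + ?m j) = m" by (rule ext) (use gt in auto)
  then have 1: "isomorphic KP (direct_sum (NF (%j. ?de j + ?de j)) (NF ?m)) (NF m)"
  using Fam_direct_sum[of Mn "%j. ?de j + ?de j" ?m] by simp
  have 2: "isomorphic KP (direct_sum (direct_sum (NF ?de) (NF ?de)) (NF ?m)) (direct_sum (NF (%j. ?de j + ?de j)) (NF ?m))"
  by (rule iso_sum[OF Fam_direct_sum iso_refl])
  have 3: "isomorphic KP (direct_sum (direct_sum (NF ?de) (NF ?de)) (NF ?m)) (direct_sum (direct_sum M1 M1) M2)"
  by (rule iso_sum[OF iso_sum[OF M1(2) M1(2)] M2(2)])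
  have lmD: "left_module KP (direct_sum (direct_sum (NF ?de) (NF ?de)) (NF ?m))"
  by (intro lm_sum lm_Fam)
  have 4: "isomorphic KP T (direct_sum (direct_sum M1 M1) M2)"
  by (rule iso_trans[OF iso_sym[OF lmD iso_trans[OF 2 iso_trans[OF 1 m]]] 3])
  have t1: "tilt M1" by (rule tilt_iso[OF lm_Fam M1(2) NF_tilt])
  have "indecomposable KP M1"
  unfolding indecomposable_def
  proof (intro conjI allI impI lm1)
  show "car M1 ~= {\<zero>[M1]}"
  proof
  assume c: "car M1 = {\<zero>[M1]}"
  interpret M1: lmodule KP M1 by (rule lmI) (rule lm1)
  have "vanishes M1 i" unfolding vanishes_def pp_imp_def c
  using M1.smult_zero_right[OF acdF_closed(2)[OF i]] M1.smult_zero_right[OF acdF_closed(3)[OF i]] by simp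
  from vanishes_iso[OF lm1 iso_sym[OF lm_Fam M1(2)] i this]
  show False using NF_vanishes[OF i, of ?de] by simp
  qed
  fix N1 N2 :: "('k mat, 'k vec) module"
  assume a: "fd_module KP N1 & fd_module KP N2 & isomorphic KP M1 (direct_sum N1 N2)"
  have fN: "fd_module KP N1" "fd_module KP N2" and iN: "isomorphic KP M1 (direct_sum N1 N2)" using a by simp_all
  note lN = fd_lm[OF fN(1)] fd_lm[OF fN(2)]
  have tN: "tilt N1 & tilt N2" using tilt_iso[OF lm1 iN t1] unfolding tilt_direct_sum[OF lN] .
  note iso = iso_trans[OF M1(2) iN]
  have other: "vanishes N1 j & vanishes N2 j" if j: "j : {0..n}" "j ~= i" for j
  proof -
  have "vanishes (NF ?de) j" using NF_vanishes[OF j(1), of ?de] j(2) by simp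
  from vanishes_iso[OF lm_Fam iso j(1) this] show ?thesis unfolding vanishes_direct_sum[OF lN j(1)] .
  qed
  have "pp_rank1 KP (NF ?de) (aF i) (cF i) (dF i)" by (rule NF_rank1[OF i]) simp
  from rank1_sum(2)[OF lm_Fam lN iso i this]
  show "car N1 = {\<zero>[N1]} \<or> car N2 = {\<zero>[N2]}"
  proof
  assume "vanishes N1 i"
  then have "!!j. j : {0..n} ==> vanishes N1 j" using other by blast
  from all_vanish[OF fN(1) conjunct1[OF tN] this] show ?thesis by simp
  next
  assume "vanishes N2 i"
  then have "!!j. j : {0..n} ==> vanishes N2 j" using other by blast
  from all_vanish[OF fN(2) conjunct2[OF tN] this] show ?thesis by simp
  qed
  qed
  then show False using mf 4 M1(1) M2(1) unfolding multiplicity_free_def by blast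
 qed
 have "NF m = NF (%_. 1)"
 proof (rule Fam_cong)
  fix i assume i: "i : {0..n}" show "m i = 1" using ge[OF i] le1[OF i] by simp
 qed
 then show "isomorphic KP (NF (%_. 1)) T" using m by simp
qed

theorem characteristic_tilting_exists: "EX T. characteristic_tilting_module KP {0..n} ord Sim T"
proof -
 obtain T :: "('k mat, 'k vec) module" where T: "fd_module KP T" "isomorphic KP (NF (%_. 1)) T"
  by (rule fd_module_vec[OF fdKP fd_Fam])
 show ?thesis by (rule exI[of _ T], rule characteristic_tilting_NF[OF T])
qed


section \<open>Endomorphisms of the tilting module\<close>

lemma Fam_E_r:
 assumes x: "x : car (Fam L m)" and kl: "(k, l) : r"
 shows "(E l k *[Fam L m] x) (Star b) = 0"
  "(E l k *[Fam L m] x) (Gen l' i b) = (if l' = l then x (Gen k i b) else 0)"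
  "(E l k *[Fam L m] x) (Lift l' j b) = (if l' = l then x (Lift k j b) else 0)"
proof -
 have V: "k : V" "l : V" "l ~= Suc n" using r_V[OF kl] by simp_all
 have Ex: "E l k *[Fam L m] x : car (Fam L m)" by (rule Fam_closed[OF E_closed[OF r_q[OF kl]] x])
 have out: "(E l k *[Fam L m] x) t = 0" "x t = 0" if "t ~: idx_set L m" for t using Ex x that by simp_all
 show "(E l k *[Fam L m] x) (Star b) = 0"
  using V out(1)[of "Star b"] by (cases "b < m 0") (simp_all add: Fam_E_Star)
 show "(E l k *[Fam L m] x) (Gen l' i b) = (if l' = l then x (Gen k i b) else 0)"
 proof (cases "Gen l' i b : idx_set L m")
  case True then show ?thesis using V out(2)[of "Gen k i b"] by (auto simp: Fam_E_Gen)
 next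
  case False
  have "x (Gen k i b) = 0" if "l' = l" by (rule out(2)) (use False that r_trans[OF _ kl] in auto)
  then show ?thesis using out(1)[OF False] by simp
 qed
 show "(E l k *[Fam L m] x) (Lift l' j b) = (if l' = l then x (Lift k j b) else 0)"
 proof (cases "Lift l' j b : idx_set L m")
  case True then show ?thesis using V out(2)[of "Lift k j b"] by (auto simp: Fam_E_Lift)
 next
  case False
  have "x (Lift k j b) = 0" if "l' = l" by (rule out(2)) (use False that r_trans[OF _ kl] in auto)
  then show ?thesis using out(1)[OF False] by simp
 qed
qed

lemma Fam_E_star:
 assumes x: "x : car (Fam L m)" and k: "k : V" and L: "L \<subseteq> {1..n}"
 shows "(Es k *[Fam L m] x) (Gen l' i b) = 0" "(Es k *[Fam L m] x) (Lift l' j b) = 0"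
  "(Es k *[Fam L m] x) (Star b) = (if k = Suc n then x (Star b) else \<Sum>j\<in>L. x (Lift k j b))"
proof -
 have Ex: "Es k *[Fam L m] x : car (Fam L m)" by (rule Fam_closed[OF E_closed[OF q_star[OF k]] x])
 have out: "(Es k *[Fam L m] x) t = 0" "x t = 0" if "t ~: idx_set L m" for t using Ex x that by simp_all
 show "(Es k *[Fam L m] x) (Gen l' i b) = 0"
  using out(1)[of "Gen l' i b"] k r_V[of i l'] by (cases "Gen l' i b : idx_set L m") (auto simp: Fam_E_Gen)
 show "(Es k *[Fam L m] x) (Lift l' j b) = 0"
  using out(1)[of "Lift l' j b"] k r_V[of j l'] by (cases "Lift l' j b : idx_set L m") (auto simp: Fam_E_Lift)
 show "(Es k *[Fam L m] x) (Star b) = (if k = Suc n then x (Star b) else \<Sum>j\<in>L. x (Lift k j b))"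
 proof (cases "b < m 0")
  case True
  have "(\<Sum>j\<in>{j. j : L & (j, k) : r}. x (Lift k j b)) = (\<Sum>j\<in>L. x (Lift k j b))"
  proof (rule sum.mono_neutral_left)
  show "finite L" by (rule finite_subset[OF L]) simp
  show "{j. j : L & (j, k) : r} \<subseteq> L" by (rule Collect_restrict)
  show "ALL j:L - {j. j : L & (j, k) : r}. x (Lift k j b) = 0" using out(2)[of "Lift k _ b"] by simp
  qed
  then show ?thesis using True k by (simp add: Fam_E_Star)
 next
  case False
  then show ?thesis using out(1)[of "Star b"] out(2) by simp
 qed
qed

definition m1 :: "nat => nat" where "m1 i = (if i = 0 \<or> i : Mn then 1 else 0)"
abbreviation TT :: "('k mat, idx => 'k) module" where "TT \<equiv> Fam {1..n} m1"
definition jm :: "nat => nat" where "jm k = (SOME j. j : Mn & (j, k) : r)"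

lemma jm: "k : {1..n} ==> jm k : Mn & (jm k, k) : r"
 unfolding jm_def by (rule someI_ex) (use minimal_below[of k] in blast)

lemma q_cases: "(k, l) : q ==> ((k, l) : r ==> P) ==> (k : V ==> l = Suc n ==> P) ==> P"
 by (auto simp: q_iff)

text \<open>A free generator at a vertex \<open>i\<close> that is not minimal is replaced by its sum with the lift at the
minimal vertex \<open>jm i\<close>; this sum is no longer sent to \<open>0\<close>.\<close>
lemma NF_TT: "isomorphic KP (NF (%_. 1)) TT"
proof -
 let ?N = "NF (%_. 1)"
 define I where "I j = {i : {1..n} - Mn. jm i = j}" for j
 define G where "G x t = (case t of Star b => x (Star b) | Gen k i b => if i : Mn then x (Gen k i b) else 0
  | Lift k j b => if j : Mn then x (Lift k j b) - (\<Sum>i\<in>I j. x (Gen k i b)) else x (Gen k j b))" for x :: "idx => 'k" and t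
 define H where "H y t = (case t of Star b => y (Star b) | Gen k i b => if i : Mn then y (Gen k i b) else y (Lift k i b)
  | Lift k j b => if j : Mn then y (Lift k j b) + (\<Sum>i\<in>I j. y (Lift k i b)) else 0)" for y :: "idx => 'k" and t
 have Gs: "G x (Star b) = x (Star b)" "G x (Gen k i b) = (if i : Mn then x (Gen k i b) else 0)"
  "G x (Lift k j b) = (if j : Mn then x (Lift k j b) - (\<Sum>i\<in>I j. x (Gen k i b)) else x (Gen k j b))" for x b k i j
  by (simp_all add: G_def)
 have Hs: "H y (Star b) = y (Star b)" "H y (Gen k i b) = (if i : Mn then y (Gen k i b) else y (Lift k i b))"
  "H y (Lift k j b) = (if j : Mn then y (Lift k j b) + (\<Sum>i\<in>I j. y (Lift k i b)) else 0)" for y b k i j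
  by (simp_all add: H_def)
 have ID: "i : {1..n}" "i ~: Mn" "(j, i) : r" if "i : I j" for i j using that jm[of i] by (auto simp: I_def)
 have Mn0: "Mn \<subseteq> {1..n}" using Mn_dom by (rule subsetI)
 have Gc: "G x : car TT" if x: "x : car ?N" for x
 proof -
  have x0: "x t = 0" if "t ~: idx_set Mn (%_. 1)" for t using x that by simp
  have "G x t = 0" if t: "t ~: idx_set {1..n} m1" for t
  proof (cases t)
  case (Star b) then show ?thesis using t x0[of "Star b"] by (simp add: Gs m1_def)
  next
  case (Gen k i b) then show ?thesis using t x0[of "Gen k i b"] by (auto simp: Gs m1_def)
  next
  case (Lift k j b)
  have "x (Gen k j b) = 0" if "j ~: Mn" by (rule x0) (use t Lift r_dom[of j k] in "auto simp: m1_def")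
  moreover have "x (Lift k j b) = 0" by (rule x0) (use t Lift r_dom[of j k] in "auto simp: m1_def")
  moreover have "x (Gen k i b) = 0" if "i : I j" for i
  by (rule x0) (use t Lift r_dom[of j k] r_trans[OF ID(3)[OF that], of k] in "auto simp: m1_def")
  ultimately show ?thesis using Lift by (simp add: Gs)
  qed
  then show ?thesis by simp
 qed
 have G: "G : Hom ?N TT"
 proof (rule hom_criterion[OF lm_Fam lm_Fam])
  fix x assume x: "x : car ?N"
  show Gx: "G x : car TT" by (rule Gc[OF x])
  show "G (x +[?N] y) = G x +[TT] G y" for y
  proof
  fix t show "G (x +[?N] y) t = (G x +[TT] G y) t" by (cases t) (simp_all add: Gs sum.distrib)
  qed
  show "G (scal KP ?N c x) = scal KP TT c (G x)" for c
  unfolding scal_Fam[OF x] scal_Fam[OF Gx]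
  proof
  fix t show "G (%t. c * x t) t = c * G x t" by (cases t) (simp_all add: Gs sum_distrib_left right_diff_distrib)
  qed
  fix k l assume kl: "(k, l) : q"
  then show "G (E l k *[?N] x) = E l k *[TT] G x"
  proof (rule q_cases)
  assume kl: "(k, l) : r"
  note Ex = Fam_E_r[OF x kl] and EG = Fam_E_r[OF Gx kl]
  show ?thesis
  proof
  fix t show "G (E l k *[?N] x) t = (E l k *[TT] G x) t"
  by (cases t) (simp_all add: Gs Ex EG del: One_nat_def)
  qed
  next
  assume k: "k : V" and l: "l = Suc n"
  note Ex = Fam_E_star[OF x k Mn0] and EG = Fam_E_star[OF Gx k subset_refl]
  show ?thesis unfolding l
  proof
  fix t show "G (Es k *[?N] x) t = (Es k *[TT] G x) t"
  proof (cases t)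
  case (Star b)
  have "(\<Sum>j\<in>{1..n}. G x (Lift k j b)) = (\<Sum>j\<in>Mn. x (Lift k j b))"
  proof -
  have "(\<Sum>j\<in>{1..n}. G x (Lift k j b)) = (\<Sum>j\<in>{1..n} - Mn. G x (Lift k j b)) + (\<Sum>j\<in>Mn. G x (Lift k j b))"
  by (rule sum.subset_diff[OF Mn0]) simp
  also have "(\<Sum>j\<in>{1..n} - Mn. G x (Lift k j b)) = (\<Sum>j\<in>{1..n} - Mn. x (Gen k j b))"
  by (rule sum.cong) (auto simp: Gs)
  also have "(\<Sum>j\<in>Mn. G x (Lift k j b)) = (\<Sum>j\<in>Mn. x (Lift k j b) - (\<Sum>i\<in>I j. x (Gen k i b)))"
  by (rule sum.cong) (auto simp: Gs)
  also have "... = (\<Sum>j\<in>Mn. x (Lift k j b)) - (\<Sum>j\<in>Mn. \<Sum>i\<in>I j. x (Gen k i b))" by (rule sum_subtractf)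
  also have "(\<Sum>j\<in>Mn. \<Sum>i\<in>I j. x (Gen k i b)) = (\<Sum>j\<in>{1..n} - Mn. x (Gen k j b))"
  unfolding I_def by (rule sum.group) (use jm finite_subset[OF Mn0] in auto)
  finally show ?thesis by simp
  qed
  then show ?thesis using Star by (simp add: Gs Ex EG del: One_nat_def)
  qed (simp_all add: Gs Ex EG del: One_nat_def)
  qed
  qed
 qed
 show ?thesis
 proof (rule isomorphicI[OF G, of H])
  fix x assume x: "x : car ?N"
  have xL: "x (Lift k j b) = 0" if "j ~: Mn" for k j b using x that by simp
  show "H (G x) = x"
  proof
  fix t show "H (G x) t = x t"
  proof (cases t)
  case (Lift k j b)
  have "(\<Sum>i\<in>I j. G x (Lift k i b)) = (\<Sum>i\<in>I j. x (Gen k i b))" by (rule sum.cong) (simp_all add: Gs ID(2))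
  then show ?thesis using Lift xL by (simp add: Hs Gs)
  qed (simp_all add: Hs Gs)
  qed
 next
  fix y assume y: "y : car TT"
  have y0: "y t = 0" if "t ~: idx_set {1..n} m1" for t using y that by simp
  have "H y t = 0" if t: "t ~: idx_set Mn (%_. 1)" for t
  proof (cases t)
  case (Star b) then show ?thesis using t y0[of "Star b"] by (simp add: Hs m1_def)
  next
  case (Gen k i b)
  have "y (Gen k i b) = 0" by (rule y0) (use t Gen in "auto simp: m1_def split: if_splits")
  moreover have "y (Lift k i b) = 0" by (rule y0) (use t Gen in "auto simp: m1_def")
  ultimately show ?thesis using Gen by (simp add: Hs)
  next
  case (Lift k j b)
  have "y (Lift k j b) = 0" if "j : Mn" by (rule y0) (use t Lift that in "auto simp: m1_def")
  moreover have "y (Lift k i b) = 0" if "i : I j" "j : Mn" for i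
  by (rule y0) (use t Lift that r_trans[OF ID(3)[OF that(1)], of k] in "auto simp: m1_def")
  ultimately show ?thesis using Lift by (simp add: Hs)
  qed
  then show "H y : car ?N" by simp
  have yG: "y (Gen k i b) = 0" if "i ~: Mn" for k i b by (rule y0) (use that r_dom[of i k] in "auto simp: m1_def")
  show "G (H y) = y"
  proof
  fix t show "G (H y) t = y t"
  proof (cases t)
  case (Lift k j b)
  have "(\<Sum>i\<in>I j. H y (Gen k i b)) = (\<Sum>i\<in>I j. y (Lift k i b))" by (rule sum.cong) (simp_all add: Hs ID(2))
  then show ?thesis using Lift by (simp add: Hs Gs)
  qed (use yG in "simp_all add: Hs Gs")
  qed
 qed
qed


context
 fixes p :: nat
 assumes Mnp: "Mn = {1..p}" and n1: "n \<ge> 1"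
begin

lemma p_le: "p \<le> n"
proof (rule ccontr)
 assume "\<not> p \<le> n"
 then have "p : Mn" unfolding Mnp by simp
 then show False using Mn_dom[of p] \<open>\<not> p \<le> n\<close> by simp
qed

definition pi :: "nat => nat" where "pi a = (if a < p then Suc a else Suc (a - p))"
definition gidx :: "nat => nat => idx" where
 "gidx k a = (if a < p then Gen k (Suc a) 0 else Lift k (Suc (a - p)) 0)"
definition row :: "(idx => 'k) => nat => nat => 'k" where "row x k a = x (gidx k a)"

lemma pi_dom: "a < p + n ==> pi a : {1..n}" using p_le by (auto simp: pi_def)

lemma gidx_J: "a < p + n ==> gidx k a : idx_set {1..n} m1 \<longleftrightarrow> (pi a, k) : r"
 using pi_dom[of a] by (auto simp: gidx_def pi_def m1_def Mnp)

lemma row_zero: "x : car TT ==> a < p + n ==> (pi a, k) ~: r ==> row x k a = 0"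
 using gidx_J[of a k] by (simp add: row_def)

lemma TT_eqI:
 assumes x: "x : car TT" and y: "y : car TT" and s: "x (Star 0) = y (Star 0)"
  and rw: "!!k a. k : {1..n} ==> a < p + n ==> row x k a = row y k a"
 shows "x = y"
proof (rule Fam_eqI[OF x y])
 fix b assume "b < m1 0" then show "x (Star b) = y (Star b)" using s by (simp add: m1_def)
next
 fix k i b assume ik: "(i, k) : r" and b: "b < m1 i"
 have i: "i : {1..p}" "b = 0" using b r_dom[OF ik] by (auto simp: m1_def Mnp split: if_splits)
 then have "Suc (i - 1) = i" "i - 1 < p" "i - 1 < p + n" by auto
 then show "x (Gen k i b) = y (Gen k i b)" using rw[of k "i - 1"] r_dom[OF ik] i(2) by (simp add: row_def gidx_def)
next
 fix k j b assume jk: "(j, k) : r" and b: "b < m1 0"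
 obtain i where i: "j = Suc i" using r_dom[OF jk] by (cases j) auto
 then show "x (Lift k j b) = y (Lift k j b)" using rw[of k "p + i"] r_dom[OF jk] b by (simp add: row_def gidx_def m1_def)
qed

lemma row_add: "row (x + y) k a = row x k a + row y k a" by (simp add: row_def)
lemma row_mult: "row (%t. c * x t) k a = c * row x k a" by (simp add: row_def)

lemma row_E:
 assumes "x : car TT" "(k, l) : r"
 shows "row (E l k *[TT] x) l' a = (if l' = l then row x k a else 0)" "(E l k *[TT] x) (Star 0) = 0"
 using Fam_E_r[OF assms] by (simp_all add: row_def gidx_def)

lemma row_Es:
 assumes "x : car TT" "k : V"
 shows "row (Es k *[TT] x) l' a = 0"
  "(Es k *[TT] x) (Star 0) = (if k = Suc n then x (Star 0) else \<Sum>b\<in>{p..<p + n}. row x k b)"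
proof -
 note Es = Fam_E_star[OF assms subset_refl]
 show "row (Es k *[TT] x) l' a = 0" using Es by (simp add: row_def gidx_def)
 have "(\<Sum>b\<in>{p..<p + n}. row x k b) = (\<Sum>j\<in>{1..n}. x (Lift k j 0))"
  by (rule sum.reindex_bij_witness[of _ "%j. p + (j - 1)" "%b. Suc (b - p)"]) (auto simp: row_def gidx_def)
 then show "(Es k *[TT] x) (Star 0) = (if k = Suc n then x (Star 0) else \<Sum>b\<in>{p..<p + n}. row x k b)"
  using Es(3) by simp
qed

definition mk :: "(nat => nat => 'k) => 'k => idx => 'k" where
 "mk rh s t = (case t of Star b => if b = 0 then s else 0
  | Gen k i b => if b = 0 & i : Mn & (i, k) : r then rh k (i - 1) else 0
  | Lift k j b => if b = 0 & (j, k) : r then rh k (p + (j - 1)) else 0)"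

lemma mk_closed: "mk rh s : car TT"
proof -
 have "mk rh s t = 0" if "t ~: idx_set {1..n} m1" for t
  using that r_dom by (cases t) (auto simp: mk_def m1_def)
 then show ?thesis by simp
qed

lemma mk_row: "a < p + n ==> row (mk rh s) k a = (if (pi a, k) : r then rh k a else 0)"
 by (auto simp: row_def mk_def gidx_def pi_def Mnp)

lemma mk_star: "mk rh s (Star 0) = s" by (simp add: mk_def)

definition ga :: "nat => idx => 'k" where "ga a = mk (%k b. if k = pi a & b = a then 1 else 0) 0"
definition des :: "idx => 'k" where "des = mk (%k b. 0) 1"

lemma ga: "ga a : car TT" "ga a (Star 0) = 0"
  "a < p + n ==> b < p + n ==> row (ga a) k b = (if k = pi a & b = a then 1 else 0)"
proof -
 show "ga a : car TT" unfolding ga_def by (rule mk_closed)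
 show "ga a (Star 0) = 0" unfolding ga_def by (rule mk_star)
 show "a < p + n ==> b < p + n ==> row (ga a) k b = (if k = pi a & b = a then 1 else 0)"
  using r_refl[OF pi_dom[of a]] unfolding ga_def by (auto simp: mk_row)
qed

lemma des: "des : car TT" "des (Star 0) = 1" "b < p + n ==> row des k b = 0"
proof -
 show "des : car TT" unfolding des_def by (rule mk_closed)
 show "des (Star 0) = 1" unfolding des_def by (rule mk_star)
 show "b < p + n ==> row des k b = 0" unfolding des_def by (simp add: mk_row)
qed

text \<open>The matrices of \<open>\<L>'\<close> in coordinates, with the common row sum \<open>c\<close> of the lower
right block.\<close>
definition Lmat :: "'k => 'k mat => bool" where
 "Lmat c F \<longleftrightarrow> F : carrier_mat (p + n) (p + n) &
  (ALL a<p + n. ALL b<p + n. F $$ (a, b) ~= 0 --> (pi b, pi a) : r) &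
  (ALL a<p + n. (\<Sum>b\<in>{p..<p + n}. F $$ (a, b)) = (if a < p then 0 else c))"

lemma LmatD:
 assumes "Lmat c F"
 shows "F : carrier_mat (p + n) (p + n)" "a < p + n ==> b < p + n ==> (pi b, pi a) ~: r ==> F $$ (a, b) = 0"
  "a < p + n ==> (\<Sum>b\<in>{p..<p + n}. F $$ (a, b)) = (if a < p then 0 else c)"
 using assms unfolding Lmat_def by blast+

definition hF :: "'k => 'k mat => (idx => 'k) => idx => 'k" where
 "hF c F x = mk (%k b. \<Sum>a<p + n. row x k a * F $$ (a, b)) (c * x (Star 0))"

lemma hF_closed: "hF c F x : car TT" unfolding hF_def by (rule mk_closed)
lemma hF_star: "hF c F x (Star 0) = c * x (Star 0)" unfolding hF_def by (rule mk_star)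

lemma hF_row:
 assumes F: "Lmat c F" and x: "x : car TT" and b: "b < p + n"
 shows "row (hF c F x) k b = (\<Sum>a<p + n. row x k a * F $$ (a, b))"
proof (cases "(pi b, k) : r")
 case True then show ?thesis unfolding hF_def mk_row[OF b] by simp
next
 case False
 have "row x k a * F $$ (a, b) = 0" if "a < p + n" for a
 proof (cases "(pi a, k) : r")
  case True
  then have "(pi b, pi a) ~: r" using False r_trans by blast
  then show ?thesis using LmatD(2)[OF F that b] by simp
 next
  case False then show ?thesis using row_zero[OF x that] by simp
 qed
 then have "(\<Sum>a<p + n. row x k a * F $$ (a, b)) = 0" by (intro sum.neutral) simp
 then show ?thesis using False unfolding hF_def mk_row[OF b] by simp
qed

lemma hF_hom:
 assumes F: "Lmat c F" shows "hF c F : Hom TT TT"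
proof (rule hom_criterion[OF lm_Fam lm_Fam])
 fix x assume x: "x : car TT"
 show "hF c F x : car TT" by (rule hF_closed)
 {
  fix y assume y: "y : car TT"
  have xy: "x + y : car TT" using x y by simp
  have "hF c F (x + y) = hF c F x + hF c F y"
  proof (rule TT_eqI[OF hF_closed])
  show "hF c F x + hF c F y : car TT" using hF_closed[of c F x] hF_closed[of c F y] by simp
  show "hF c F (x + y) (Star 0) = (hF c F x + hF c F y) (Star 0)"
  by (simp only: plus_fun_apply hF_star distrib_left)
  fix k a assume "a < p + n"
  then show "row (hF c F (x + y)) k a = row (hF c F x + hF c F y) k a"
  by (simp only: row_add hF_row[OF F xy] hF_row[OF F x] hF_row[OF F y] distrib_right sum.distrib)
  qed
  then show "hF c F (x +[TT] y) = hF c F x +[TT] hF c F y" by (simp only: Fam_simps)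
 }
 {
  fix d
  have dx: "(%t. d * x t) : car TT" using x by simp
  show "hF c F (scal KP TT d x) = scal KP TT d (hF c F x)"
  unfolding scal_Fam[OF x] scal_Fam[OF hF_closed]
  proof (rule TT_eqI[OF hF_closed])
  show "(%t. d * hF c F x t) : car TT" using hF_closed[of c F x] by simp
  show "hF c F (%t. d * x t) (Star 0) = d * hF c F x (Star 0)" by (simp only: hF_star mult.left_commute)
  fix k a assume "a < p + n"
  then show "row (hF c F (%t. d * x t)) k a = row (%t. d * hF c F x t) k a"
  by (simp only: row_mult hF_row[OF F dx] hF_row[OF F x] sum_distrib_left mult.assoc)
  qed
 }
 fix k l assume kl: "(k, l) : q"
 note Ex = Fam_closed[OF E_closed[OF kl] x] and EF = Fam_closed[OF E_closed[OF kl] hF_closed]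
 from kl show "hF c F (E l k *[TT] x) = E l k *[TT] hF c F x"
 proof (rule q_cases)
  assume kr: "(k, l) : r"
  show ?thesis
  proof (rule TT_eqI[OF hF_closed EF])
  show "hF c F (E l k *[TT] x) (Star 0) = (E l k *[TT] hF c F x) (Star 0)"
  by (simp only: hF_star row_E(2)[OF x kr] row_E(2)[OF hF_closed kr] mult_zero_right)
  fix l' a assume a: "a < p + n"
  show "row (hF c F (E l k *[TT] x)) l' a = row (E l k *[TT] hF c F x) l' a"
  unfolding hF_row[OF F Ex a] row_E(1)[OF x kr] row_E(1)[OF hF_closed kr] hF_row[OF F x a] by simp
  qed
 next
  assume k: "k : V" and l: "l = Suc n"
  show ?thesis
  proof (rule TT_eqI[OF hF_closed EF])
  fix l' a assume a: "a < p + n"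
  show "row (hF c F (E l k *[TT] x)) l' a = row (E l k *[TT] hF c F x) l' a"
  unfolding hF_row[OF F Ex a] unfolding l row_Es(1)[OF x k] row_Es(1)[OF hF_closed k] by simp
  next
  show "hF c F (E l k *[TT] x) (Star 0) = (E l k *[TT] hF c F x) (Star 0)"
  proof (cases "k = Suc n")
  case True
  then show ?thesis unfolding hF_star l row_Es(2)[OF x k] row_Es(2)[OF hF_closed k] by (simp add: hF_star)
  next
  case False
  have "(\<Sum>b\<in>{p..<p + n}. row (hF c F x) k b) = (\<Sum>b\<in>{p..<p + n}. \<Sum>a<p + n. row x k a * F $$ (a, b))"
  by (rule sum.cong) (simp_all add: hF_row[OF F x])
  also have "... = (\<Sum>a<p + n. \<Sum>b\<in>{p..<p + n}. row x k a * F $$ (a, b))" by (rule sum.swap)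
  also have "... = (\<Sum>a<p + n. row x k a * (if a < p then 0 else c))"
  by (rule sum.cong) (simp_all add: sum_distrib_left[symmetric] LmatD(3)[OF F])
  also have "... = (\<Sum>a\<in>{p..<p + n}. row x k a * (if a < p then 0 else c))"
  by (rule sum.mono_neutral_right) auto
  also have "... = c * (\<Sum>a\<in>{p..<p + n}. row x k a)"
  unfolding sum_distrib_left by (rule sum.cong) auto
  finally show ?thesis using False unfolding hF_star l row_Es(2)[OF x k] row_Es(2)[OF hF_closed k] by simp
  qed
  qed
 qed
qed

definition matF :: "((idx => 'k) => idx => 'k) => 'k mat" where
 "matF f = mat (p + n) (p + n) (%(a, b). row (f (ga a)) (pi a) b)"

lemma matF_entry: "a < p + n ==> b < p + n ==> matF f $$ (a, b) = row (f (ga a)) (pi a) b"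
 by (simp add: matF_def)

lemma pi_V: "a < p + n ==> pi a : V" using pi_dom[of a] by (simp add: V_def)

lemma ga_star: "a < p + n ==> Es (pi a) *[TT] ga a = (if a < p then 0 else des)"
proof (rule TT_eqI[OF Fam_closed[OF E_closed[OF q_star] ga(1)]])
 assume a: "a < p + n"
 show "pi a : V" by (rule pi_V[OF a])
 show "(if a < p then 0 else des) : car TT" using des(1) by simp
 have ne: "pi a ~= Suc n" using pi_dom[OF a] by simp
 have "(\<Sum>b\<in>{p..<p + n}. row (ga a) (pi a) b) = (\<Sum>b\<in>{p..<p + n}. if b = a then 1 else 0)"
  by (rule sum.cong) (simp_all add: ga(3)[OF a])
 then show "(Es (pi a) *[TT] ga a) (Star 0) = (if a < p then 0 else des) (Star 0)"
  unfolding row_Es(2)[OF ga(1) pi_V[OF a]] using ne a des(2) by simp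
 fix k b assume b: "b < p + n"
 show "row (Es (pi a) *[TT] ga a) k b = row (if a < p then 0 else des) k b"
  unfolding row_Es(1)[OF ga(1) pi_V[OF a]] using des(3)[OF b] by (simp add: row_def)
qed

lemma ga_E: "a < p + n ==> E (pi a) (pi a) *[TT] ga a = ga a"
proof (rule TT_eqI[OF Fam_closed[OF E_closed[OF q_refl] ga(1)] ga(1)])
 assume a: "a < p + n"
 note rr = r_refl[OF pi_dom[OF a]]
 show "pi a : V" by (rule pi_V[OF a])
 show "(E (pi a) (pi a) *[TT] ga a) (Star 0) = ga a (Star 0)" unfolding row_E(2)[OF ga(1) rr] ga(2) ..
 fix k b assume b: "b < p + n"
 show "row (E (pi a) (pi a) *[TT] ga a) k b = row (ga a) k b" unfolding row_E(1)[OF ga(1) rr] ga(3)[OF a b] by simp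
qed

lemma matF_Lmat:
 assumes f: "f : Hom TT TT" shows "Lmat (f des (Star 0)) (matF f)"
 unfolding Lmat_def
proof (intro conjI allI impI)
 show "matF f : carrier_mat (p + n) (p + n)" by (simp add: matF_def)
 fix a assume a: "a < p + n"
 have fga: "f (ga a) : car TT" by (rule homD(1)[OF f ga(1)])
 show "(pi b, pi a) : r" if b: "b < p + n" and ne: "matF f $$ (a, b) ~= 0" for b
  using row_zero[OF fga b, of "pi a"] ne matF_entry[OF a b, of f] by auto
 have ne: "pi a ~= Suc n" using pi_dom[OF a] by simp
 have f0: "f 0 = 0" using hom_zero[OF lm_Fam lm_Fam f] by simp
 have "(\<Sum>b\<in>{p..<p + n}. matF f $$ (a, b)) = (\<Sum>b\<in>{p..<p + n}. row (f (ga a)) (pi a) b)"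
  by (rule sum.cong) (simp_all add: matF_entry[OF a])
 also have "... = (Es (pi a) *[TT] f (ga a)) (Star 0)" unfolding row_Es(2)[OF fga pi_V[OF a]] using ne by simp
 also have "... = f (Es (pi a) *[TT] ga a) (Star 0)"
  unfolding homD(3)[OF f E_closed[OF q_star[OF pi_V[OF a]]] ga(1)] ..
 also have "... = (if a < p then 0 else f des (Star 0))" unfolding ga_star[OF a] using f0 by simp
 finally show "(\<Sum>b\<in>{p..<p + n}. matF f $$ (a, b)) = (if a < p then 0 else f des (Star 0))" .
qed

text \<open>Both sides agree on the generators \<open>ga a\<close>, and these generate \<open>TT\<close>.\<close>
lemma hom_eq_hF:
 assumes f: "f : Hom TT TT" and x: "x : car TT"
 shows "f x = hF (f des (Star 0)) (matF f) x"
proof -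
 let ?c = "f des (Star 0)" and ?F = "matF f"
 note A = fdKP and lm = lm_Fam[of "{1..n}" m1]
 note F = matF_Lmat[OF f]
 note g = hF_hom[OF F]
 let ?Eq = "{y : car TT. f y = hF ?c ?F y}"
 have EqI: "y : ?Eq" if "y : car TT" "f y = hF ?c ?F y" for y using that by simp
 have EqD: "y : car TT" "f y = hF ?c ?F y" if "y : ?Eq" for y using that by simp_all
 have cl: "y + z : ?Eq" "(%t. d * y t) : ?Eq" "(0 :: idx => 'k) : ?Eq" "e : car KP ==> e *[TT] y : ?Eq"
  if y: "y : ?Eq" and z: "z : ?Eq" for y z d e
 proof -
  note yc = EqD(1)[OF y] and zc = EqD(1)[OF z]
  have "f (y +[TT] z) = hF ?c ?F (y +[TT] z)"
  unfolding homD(2)[OF f yc zc] homD(2)[OF g yc zc] EqD(2)[OF y] EqD(2)[OF z] ..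
  then show "y + z : ?Eq" using yc zc by (intro EqI) simp_all
  have "f (scal KP TT d y) = hF ?c ?F (scal KP TT d y)"
  unfolding scal_hom[OF A lm lm f yc] scal_hom[OF A lm lm g yc] EqD(2)[OF y] ..
  then show "(%t. d * y t) : ?Eq" unfolding scal_Fam[OF yc] using yc by (intro EqI) simp_all
  show "(0 :: idx => 'k) : ?Eq" using hom_zero[OF lm lm f] hom_zero[OF lm lm g] by (intro EqI) simp_all
  assume e: "e : car KP"
  show "e *[TT] y : ?Eq"
  by (rule EqI[OF Fam_closed[OF e yc]]) (simp only: homD(3)[OF f e yc] homD(3)[OF g e yc] EqD(2)[OF y])
 qed
 have gaEq: "ga a : ?Eq" if a: "a < p + n" for a
 proof (rule EqI[OF ga(1)])
  note rr = r_refl[OF pi_dom[OF a]]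
  have fc: "f (ga a) : car TT" by (rule homD(1)[OF f ga(1)])
  have e: "f (ga a) = E (pi a) (pi a) *[TT] f (ga a)"
  using homD(3)[OF f E_closed[OF r_q[OF rr]] ga(1)[of a]] ga_E[OF a] by simp
  show "f (ga a) = hF ?c ?F (ga a)"
  proof (rule TT_eqI[OF fc hF_closed])
  show "f (ga a) (Star 0) = hF ?c ?F (ga a) (Star 0)"
  using row_E(2)[OF fc rr] e by (simp add: hF_star ga(2))
  fix k b assume b: "b < p + n"
  have "row (f (ga a)) k b = row (E (pi a) (pi a) *[TT] f (ga a)) k b" using e by simp
  also have "... = (if k = pi a then ?F $$ (a, b) else 0)" unfolding row_E(1)[OF fc rr] matF_entry[OF a b] ..
  also have "... = (\<Sum>a'<p + n. if a' = a then (if k = pi a then ?F $$ (a, b) else 0) else 0)" using a by simp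
  also have "... = (\<Sum>a'<p + n. row (ga a) k a' * ?F $$ (a', b))"
  by (rule sum.cong) (simp_all add: ga(3)[OF a])
  finally show "row (f (ga a)) k b = row (hF ?c ?F (ga a)) k b" unfolding hF_row[OF F ga(1) b] .
  qed
 qed
 have dEq: "des : ?Eq"
 proof (rule EqI[OF des(1)])
  have fc: "f des : car TT" by (rule homD(1)[OF f des(1)])
  have a: "p < p + n" using n1 by simp
  have "f des = Es (pi p) *[TT] f (ga p)"
  using homD(3)[OF f E_closed[OF q_star[OF pi_V[OF a]]] ga(1)[of p]] ga_star[OF a] by simp
  then have rw: "row (f des) k b = 0" for k b using row_Es(1)[OF homD(1)[OF f ga(1)] pi_V[OF a]] by simp
  show "f des = hF ?c ?F des"
  proof (rule TT_eqI[OF fc hF_closed])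
  show "f des (Star 0) = hF ?c ?F des (Star 0)" by (simp add: hF_star des(2))
  fix k b assume b: "b < p + n"
  show "row (f des) k b = row (hF ?c ?F des) k b" unfolding rw hF_row[OF F des(1) b] by (simp add: des(3))
  qed
 qed
 have sums: "(\<Sum>a<M. (%t. d a * v a t)) : ?Eq" if "!!a. a < M ==> v a : ?Eq" for M :: nat and d v
  using that
 proof (induction M)
  case 0 show ?case using cl(3)[OF dEq dEq] by (simp only: lessThan_0 sum.empty)
 next
  case (Suc M)
  have v: "v M : ?Eq" "!!a. a < M ==> v a : ?Eq" using Suc.prems by simp_all
  show ?case unfolding sum.lessThan_Suc by (rule cl(1)[OF Suc.IH[OF v(2)] cl(2)[OF v(1) v(1)]])
 qed
 have kc: "kclosed KP TT ?Eq"
  unfolding kclosed_def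
 proof (intro conjI ballI allI)
  show "?Eq \<subseteq> car TT" by (rule Collect_restrict)
  show "\<zero>[TT] : ?Eq" using cl(3)[OF dEq dEq] by (simp only: Fam_simps(2))
  fix y assume y: "y : ?Eq"
  show "y +[TT] z : ?Eq" if "z : ?Eq" for z using cl(1)[OF y that] by (simp only: Fam_simps(3))
  show "scal KP TT d y : ?Eq" for d unfolding scal_Fam[OF EqD(1)[OF y]] by (rule cl(2)[OF y y])
 qed
 have "x : ?Eq"
 proof (rule kclosed_components[OF lm kc x])
  fix k assume k: "k : V"
  note Ex = Fam_closed[OF E_closed[OF q_refl[OF k]] x]
  show "E k k *[TT] x : ?Eq"
  proof (cases "k = Suc n")
  case True
  have dc: "(%t. x (Star 0) * des t) : car TT" using des(1) by simp
  have "E k k *[TT] x = (%t. x (Star 0) * des t)"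
  proof (rule TT_eqI[OF Ex dc])
  show "(E k k *[TT] x) (Star 0) = x (Star 0) * des (Star 0)" using row_Es(2)[OF x V_star] True des(2) by simp
  fix l b assume b: "b < p + n"
  show "row (E k k *[TT] x) l b = row (%t. x (Star 0) * des t) l b"
  using row_Es(1)[OF x V_star] True des(3)[OF b] by (simp add: row_mult)
  qed
  then show ?thesis using cl(2)[OF dEq dEq] by simp
  next
  case False
  then have kP: "k : {1..n}" using k by (auto simp: V_def)
  note kk = r_refl[OF kP]
  define v where "v a = (if (pi a, k) : r then E k (pi a) *[TT] ga a else 0)" for a
  have vEq: "v a : ?Eq" if "a < p + n" for a
  using cl(3)[OF dEq dEq] cl(4)[OF gaEq[OF that] gaEq[OF that] E_closed[OF r_q]] by (simp only: v_def split: if_split) blast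
  have vs: "v a (Star 0) = 0" for a using row_E(2)[OF ga(1)[of a], of "pi a" k] by (simp add: v_def)
  have vr: "row (v a) l b = (if (pi a, k) : r & l = k & b = a then 1 else 0)"
  if a: "a < p + n" and b: "b < p + n" for a b l
  using row_E[OF ga(1)[of a], of "pi a" k] ga(3)[OF a b] by (auto simp: v_def row_def)
  note sEq = sums[of "p + n" v "row x k", OF vEq]
  have "E k k *[TT] x = (\<Sum>a<p + n. (%t. row x k a * v a t))"
  proof (rule TT_eqI[OF Ex EqD(1)[OF sEq]])
  show "(E k k *[TT] x) (Star 0) = (\<Sum>a<p + n. (%t. row x k a * v a t)) (Star 0)"
  unfolding row_E(2)[OF x kk] sum_fun_apply by (rule sum.neutral[symmetric]) (simp add: vs)
  fix l b assume b: "b < p + n"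
  have "row (\<Sum>a<p + n. (%t. row x k a * v a t)) l b = (\<Sum>a<p + n. row x k a * row (v a) l b)"
  unfolding row_def sum_fun_apply ..
  also have "... = (\<Sum>a<p + n. if a = b then (if (pi b, k) : r & l = k then row x k b else 0) else 0)"
  by (rule sum.cong) (use b in "auto simp: vr")
  also have "... = (if l = k then row x k b else 0)" using b row_zero[OF x b, of k] by auto
  finally show "row (E k k *[TT] x) l b = row (\<Sum>a<p + n. (%t. row x k a * v a t)) l b"
  unfolding row_E(1)[OF x kk] by simp
  qed
  then show ?thesis using sEq by simp
  qed
 qed
 then show ?thesis by (rule EqD(2))
qed

text \<open>For \<open>a < p\<close> the order allows a nonzero entry in the upper right block only at column \<open>p +
a\<close>, and the vanishing row sum excludes it.\<close>
lemma L'_carrier: "F : car (L'_algebra n p r) \<longleftrightarrow> (EX c. Lmat c F)"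
proof
 assume "F : car (L'_algebra n p r)"
 then obtain D0 D1 Z0 M where F: "F = four_block_mat D0 (0\<^sub>m p n) (D1 @\<^sub>r Z0) M"
  and D0: "D0 : diagonal_mats p" and D1: "D1 : diagonal_mats p" and Z0: "Z0 : Z_mats n p r" and M: "M : one_incidence_mats n r"
  unfolding L'_algebra_def by auto
 have dim: "D0 : carrier_mat p p" "D1 : carrier_mat p p" "Z0 : carrier_mat (n - p) p" "M : carrier_mat n n"
  using D0 D1 Z0 M by (auto simp: diagonal_mats_def Z_mats_def one_incidence_mats_def incidence_mats_def)
 have pn: "p + (n - p) = n" using p_le by simp
 have DZ: "D1 @\<^sub>r Z0 : carrier_mat n p" using carrier_append_rows[OF dim(2,3)] pn by simp
 obtain c where c: "M *\<^sub>v vec n (%_. 1) = c \<cdot>\<^sub>v vec n (%_. 1)" using M unfolding one_incidence_mats_def by blast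
 have ent: "F $$ (a, b) = (if a < p then if b < p then D0 $$ (a, b) else 0
  else if b < p then (if a - p < p then D1 $$ (a - p, b) else Z0 $$ (a - p - p, b)) else M $$ (a - p, b - p))"
  if "a < p + n" "b < p + n" for a b
  using that dim DZ pn unfolding F append_rows_def by auto
 have "Lmat c F"
  unfolding Lmat_def
 proof (intro conjI allI impI)
  show "F : carrier_mat (p + n) (p + n)" unfolding F using dim DZ by (simp add: four_block_carrier_mat)
  fix a assume a: "a < p + n"
  {
  fix b assume b: "b < p + n" and ne: "F $$ (a, b) ~= 0"
  show "(pi b, pi a) : r"
  proof (cases "b < p")
  case bp: True
  have eqr: "(pi b, pi a) : r" if "pi b = pi a" using that r_refl[OF pi_dom[OF a]] by simp
  show ?thesis
  proof (cases "a < p")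
  case True
  then have "a = b" using ne ent[OF a b] bp D0 dim(1) by (auto simp: diagonal_mats_def diagonal_mat_def)
  then show ?thesis using eqr by simp
  next
  case ap: False
  show ?thesis
  proof (cases "a - p < p")
  case True
  then have "a - p = b" using ne ent[OF a b] bp ap D1 dim(2) by (auto simp: diagonal_mats_def diagonal_mat_def)
  then show ?thesis using eqr bp ap by (simp add: pi_def)
  next
  case False
  then have z: "Z0 $$ (a - p - p, b) ~= 0" using ne ent[OF a b] bp ap by simp
  have "Suc b : {1..p}" "Suc (a - p - p) : {1..n - p}" using bp False a by auto
  moreover have "ALL i:{1..p}. ALL j:{1..n - p}. Z0 $$ (j - 1, i - 1) ~= 0 --> (i, j + p) : r" using Z0 unfolding Z_mats_def by blast
  ultimately have "(Suc b, Suc (a - p - p) + p) : r" using z by fastforce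
  then show ?thesis using bp ap False by (simp add: pi_def)
  qed
  qed
  next
  case bp: False
  then have ap: "\<not> a < p" and m: "M $$ (a - p, b - p) ~= 0" using ne ent[OF a b] by (auto split: if_splits)
  have "Suc (a - p) : {1..n}" "Suc (b - p) : {1..n}" using a b bp ap by auto
  moreover have "ALL i:{1..n}. ALL j:{1..n}. M $$ (j - 1, i - 1) ~= 0 --> (i, j) : r" using M unfolding one_incidence_mats_def incidence_mats_def by blast
  ultimately have "(Suc (b - p), Suc (a - p)) : r" using m by fastforce
  then show ?thesis using bp ap by (simp add: pi_def)
  qed
  }
  show "(\<Sum>b\<in>{p..<p + n}. F $$ (a, b)) = (if a < p then 0 else c)"
  proof (cases "a < p")
  case True
  then show ?thesis by (simp add: ent[OF a])
  next
  case False
  then have an: "a - p < n" using a by simp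
  have "(\<Sum>b\<in>{p..<p + n}. F $$ (a, b)) = (\<Sum>b\<in>{0..<n}. M $$ (a - p, b))"
  by (rule sum.reindex_bij_witness[of _ "%b. b + p" "%b. b - p"]) (use False in "auto simp: ent[OF a]")
  also have "... = (M *\<^sub>v vec n (%_. 1)) $ (a - p)" using an dim(4) by (simp add: scalar_prod_def)
  also have "... = c" unfolding c using an by simp
  finally show ?thesis using False by simp
  qed
 qed
 then show "EX c. Lmat c F" by (rule exI)
next
 assume "EX c. Lmat c F"
 then obtain c where F: "Lmat c F" by (rule exE)
 note FD = LmatD[OF F]
 let ?D0 = "mat p p (%(a, b). F $$ (a, b))" and ?D1 = "mat p p (%(a, b). F $$ (p + a, b))"
  and ?Z = "mat (n - p) p (%(a, b). F $$ (p + (p + a), b))" and ?M = "mat n n (%(a, b). F $$ (p + a, p + b))"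
 have pn: "p + (n - p) = n" using p_le by simp
 have min: "b = a" if "a < p" "b < p" "(Suc b, Suc a) : r" for a b
  using Mn_min[of "Suc a" "Suc b"] that Mnp by simp
 have up0: "F $$ (a, b) = 0" if a: "a < p" and b: "p \<le> b" "b < p + n" for a b
 proof -
  have a': "a < p + n" using a by simp
  have z: "F $$ (a, b') = 0" if b': "b' : {p..<p + n}" "b' ~= p + a" for b'
  proof (rule FD(2)[OF a'])
  show "b' < p + n" using b' by simp
  show "(pi b', pi a) ~: r"
  proof
  assume "(pi b', pi a) : r"
  then have "pi b' = pi a" using Mn_min[of "pi a" "pi b'"] a Mnp by (simp add: pi_def)
  then show False using b' a by (auto simp: pi_def)
  qed
  qed
  show ?thesis
  proof (cases "b = p + a")
  case True
  have "(\<Sum>b'\<in>{p..<p + n}. F $$ (a, b')) = (\<Sum>b'\<in>{p..<p + n}. if b' = p + a then F $$ (a, p + a) else 0)"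
  by (rule sum.cong) (use z in auto)
  then have "F $$ (a, p + a) = 0" using FD(3)[OF a'] a p_le by simp
  then show ?thesis using True by simp
  next
  case False then show ?thesis using z[of b] b by simp
  qed
 qed
 have FE: "F = four_block_mat ?D0 (0\<^sub>m p n) (?D1 @\<^sub>r ?Z) ?M"
 proof (rule eq_matI)
  fix a b assume "a < dim_row (four_block_mat ?D0 (0\<^sub>m p n) (?D1 @\<^sub>r ?Z) ?M)" "b < dim_col (four_block_mat ?D0 (0\<^sub>m p n) (?D1 @\<^sub>r ?Z) ?M)"
  then have ab: "a < p + n" "b < p + n" by simp_all
  show "F $$ (a, b) = four_block_mat ?D0 (0\<^sub>m p n) (?D1 @\<^sub>r ?Z) ?M $$ (a, b)"
  using ab pn up0[of a b] unfolding append_rows_def by auto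
 qed (use FD(1) in simp_all)
 have ne: "(pi b, pi a) : r" if "F $$ (a, b) ~= 0" "a < p + n" "b < p + n" for a b using FD(2)[OF that(2,3)] that(1) by blast
 have "?D0 : diagonal_mats p"
  using min ne by (fastforce simp: diagonal_mats_def diagonal_mat_def pi_def)
 moreover have "?D1 : diagonal_mats p"
  using min ne p_le by (fastforce simp: diagonal_mats_def diagonal_mat_def pi_def)
 moreover have "?Z : Z_mats n p r"
  unfolding Z_mats_def
 proof (intro CollectI conjI ballI impI)
  fix i j assume ij: "i : {1..p}" "j : {1..n - p}" and nz: "?Z $$ (j - 1, i - 1) ~= 0"
  then have "F $$ (p + (p + (j - 1)), i - 1) ~= 0" by auto
  from ne[OF this] have "(pi (i - 1), pi (p + (p + (j - 1)))) : r" using ij p_le by auto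
  moreover have "pi (i - 1) = i" "pi (p + (p + (j - 1))) = j + p" using ij by (auto simp: pi_def)
  ultimately show "(i, j + p) : r" by simp
 qed simp
 moreover have "?M : one_incidence_mats n r"
  unfolding one_incidence_mats_def incidence_mats_def
 proof (intro CollectI conjI ballI impI exI[of _ c])
  fix i j assume ij: "i : {1..n}" "j : {1..n}" and nz: "?M $$ (j - 1, i - 1) ~= 0"
  then have "F $$ (p + (j - 1), p + (i - 1)) ~= 0" by auto
  from ne[OF this] have "(pi (p + (i - 1)), pi (p + (j - 1))) : r" using ij by auto
  moreover have "pi (p + (i - 1)) = i" "pi (p + (j - 1)) = j" using ij by (auto simp: pi_def)
  ultimately show "(i, j) : r" by simp
 next
  show "?M *\<^sub>v vec n (%_. 1) = c \<cdot>\<^sub>v vec n (%_. 1)"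
  proof (rule eq_vecI)
  fix a assume "a < dim_vec (c \<cdot>\<^sub>v vec n (%_. (1 :: 'k)))"
  then have a: "a < n" by simp
  have "(?M *\<^sub>v vec n (%_. 1)) $ a = (\<Sum>b\<in>{0..<n}. F $$ (p + a, p + b))" using a by (simp add: scalar_prod_def)
  also have "... = (\<Sum>b\<in>{p..<p + n}. F $$ (p + a, b))"
  by (rule sum.reindex_bij_witness[of _ "%b. b - p" "%b. p + b"]) auto
  also have "... = c" using FD(3)[of "p + a"] a by simp
  finally show "(?M *\<^sub>v vec n (%_. 1)) $ a = (c \<cdot>\<^sub>v vec n (%_. 1)) $ a" using a by simp
  qed simp
 qed simp
 ultimately have "EX D D' Z M. F = four_block_mat D (0\<^sub>m p n) (D' @\<^sub>r Z) M &
  D : diagonal_mats p & D' : diagonal_mats p & Z : Z_mats n p r & M : one_incidence_mats n r"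
  using FE by (intro exI conjI)
 then show "F : car (L'_algebra n p r)" unfolding L'_algebra_def by simp
qed

lemma L'_simps:
 "mult (L'_algebra n p r :: ('k, 'k mat) module) = (*)" "add (L'_algebra n p r :: ('k, 'k mat) module) = (+)"
 "one (L'_algebra n p r :: ('k, 'k mat) module) = 1\<^sub>m (p + n)" "smult (L'_algebra n p r :: ('k, 'k mat) module) = (\<cdot>\<^sub>m)"
 by (simp_all add: L'_algebra_def module_mat_def ring_mat_def)

text \<open>Composition of endomorphisms reverses the order of right multiplications, which is undone by the opposite
algebra.\<close>
theorem End_isomorphic_L':
 fixes T :: "('k mat, 'm) module"
 assumes lmT: "left_module KP T" and iso: "isomorphic KP TT T"
 shows "algebra_isomorphic (op_algebra (End_algebra KP T)) (L'_algebra n p r)"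
proof -
 note A = fdKP and lm = lm_Fam[of "{1..n}" m1]
 obtain h g where h: "h : Hom TT T" and g: "g : Hom T TT"
  and gh: "!!x. x : car TT ==> g (h x) = x" and hg: "!!y. y : car T ==> h (g y) = y"
  by (rule isomorphicE[OF iso lm]) blast
 let ?E = "End_algebra KP T" and ?L = "L'_algebra n p r :: ('k, 'k mat) module"
 define c' where "c' f x = g (f (h x))" for f x
 define Th where "Th f = matF (c' f)" for f
 have hc: "h x : car T" if "x : car TT" for x by (rule homD(1)[OF h that])
 have c'h: "c' f : Hom TT TT" if "f : car ?E" for f
  using hom_comp[OF hom_comp[OF h End_hom[OF A lmT that]] g] unfolding c'_def .
 have cT: "f (h x) : car T" if "f : car ?E" "x : car TT" for f x
  by (rule homD(1)[OF End_hom[OF A lmT that(1)] hc[OF that(2)]])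
 have mat_eq: "Th f = F" if F: "F : carrier_mat (p + n) (p + n)"
  and e: "!!a b. a < p + n ==> b < p + n ==> row (c' f (ga a)) (pi a) b = F $$ (a, b)" for f F
  by (rule eq_matI) (use F e in "auto simp: Th_def matF_def")
 have ThL: "Lmat (c' f des (Star 0)) (Th f)" if "f : car ?E" for f unfolding Th_def by (rule matF_Lmat[OF c'h[OF that]])
 have Thc: "Th f : carrier_mat (p + n) (p + n)" for f by (simp add: Th_def matF_def)
 have closed: "Th f : car ?L" if "f : car ?E" for f unfolding L'_carrier using ThL[OF that] by (intro exI)
 have opS: "car (op_algebra ?E) = car ?E" "!!x y. x \<otimes>\<^bsub>op_algebra ?E\<^esub> y = y \<otimes>\<^bsub>?E\<^esub> x"
  "!!x y. x +[op_algebra ?E] y = x +[?E] y" "one (op_algebra ?E) = one ?E" "!!c x. c *[op_algebra ?E] x = c *[?E] x"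
  by (simp_all add: op_algebra_def)
 have Th_add: "Th (f1 +[?E] f2) = Th f1 + Th f2" if f: "f1 : car ?E" "f2 : car ?E" for f1 f2
 proof (rule mat_eq)
  show "Th f1 + Th f2 : carrier_mat (p + n) (p + n)" using Thc by simp
  fix a b assume ab: "a < p + n" "b < p + n"
  have "c' (f1 +[?E] f2) (ga a) = c' f1 (ga a) + c' f2 (ga a)"
  using homD(2)[OF g cT[OF f(1) ga(1)] cT[OF f(2) ga(1)]] hc[OF ga(1)] by (simp add: c'_def End_algebra_simps)
  then show "row (c' (f1 +[?E] f2) (ga a)) (pi a) b = (Th f1 + Th f2) $$ (a, b)"
  using ab Thc by (simp add: row_add Th_def matF_def)
 qed
 have Th_scal: "Th (c *[?E] f) = c \<cdot>\<^sub>m Th f" if f: "f : car ?E" for c f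
 proof (rule mat_eq)
  show "c \<cdot>\<^sub>m Th f : carrier_mat (p + n) (p + n)" using Thc by simp
  fix a b assume ab: "a < p + n" "b < p + n"
  have "c' (c *[?E] f) (ga a) = scal KP TT c (c' f (ga a))"
  using scal_hom[OF A lmT lm g cT[OF f ga(1)]] hc[OF ga(1)] by (simp add: c'_def End_algebra_simps)
  also have "... = (%t. c * c' f (ga a) t)" by (rule scal_Fam[OF homD(1)[OF c'h[OF f] ga(1)]])
  finally show "row (c' (c *[?E] f) (ga a)) (pi a) b = (c \<cdot>\<^sub>m Th f) $$ (a, b)"
  using ab by (simp add: row_mult Th_def matF_def)
 qed
 have Th_mult: "Th (f2 \<otimes>\<^bsub>?E\<^esub> f1) = Th f1 * Th f2" if f: "f1 : car ?E" "f2 : car ?E" for f1 f2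
 proof (rule mat_eq)
  show "Th f1 * Th f2 : carrier_mat (p + n) (p + n)" using Thc by (simp add: mult_carrier_mat[of _ _ "p + n"])
  fix a b assume ab: "a < p + n" "b < p + n"
  have x: "c' f1 (ga a) : car TT" by (rule homD(1)[OF c'h[OF f(1)] ga(1)])
  have "c' (f2 \<otimes>\<^bsub>?E\<^esub> f1) (ga a) = c' f2 (c' f1 (ga a))"
  using hc[OF ga(1)] hg[OF cT[OF f(1) ga(1)]] by (simp add: c'_def End_algebra_simps compose_def)
  also have "... = hF (c' f2 des (Star 0)) (Th f2) (c' f1 (ga a))" unfolding Th_def by (rule hom_eq_hF[OF c'h[OF f(2)] x])
  finally have "row (c' (f2 \<otimes>\<^bsub>?E\<^esub> f1) (ga a)) (pi a) b = (\<Sum>d<p + n. row (c' f1 (ga a)) (pi a) d * Th f2 $$ (d, b))"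
  using hF_row[OF ThL[OF f(2)] x ab(2)] by simp
  also have "... = (\<Sum>d<p + n. Th f1 $$ (a, d) * Th f2 $$ (d, b))"
  by (rule sum.cong) (simp_all add: Th_def matF_entry ab)
  also have "... = (Th f1 * Th f2) $$ (a, b)" by (rule index_mult_sum[OF Thc Thc ab, symmetric])
  finally show "row (c' (f2 \<otimes>\<^bsub>?E\<^esub> f1) (ga a)) (pi a) b = (Th f1 * Th f2) $$ (a, b)" .
 qed
 have Th_one: "Th \<one>\<^bsub>?E\<^esub> = 1\<^sub>m (p + n)"
 proof (rule mat_eq)
  fix a b assume ab: "a < p + n" "b < p + n"
  have "c' \<one>\<^bsub>?E\<^esub> (ga a) = ga a" using gh[OF ga(1)] hc[OF ga(1)] by (simp add: c'_def End_algebra_simps)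
  then show "row (c' \<one>\<^bsub>?E\<^esub> (ga a)) (pi a) b = 1\<^sub>m (p + n) $$ (a, b)" using ab ga(3)[OF ab] by auto
 qed simp
 have inj: "inj_on Th (car ?E)"
 proof (rule inj_onI)
  fix f1 f2 assume f: "f1 : car ?E" "f2 : car ?E" and eq: "Th f1 = Th f2"
  have pp: "p < p + n" using n1 by simp
  have cc: "c' f1 des (Star 0) = c' f2 des (Star 0)"
  using LmatD(3)[OF ThL[OF f(1)] pp] LmatD(3)[OF ThL[OF f(2)] pp] eq by simp
  show "f1 = f2"
  proof (rule End_eqI[OF A lmT f])
  fix y assume y: "y : car T"
  have gy: "g y : car TT" by (rule homD(1)[OF g y])
  have "c' f1 (g y) = c' f2 (g y)"
  using hom_eq_hF[OF c'h[OF f(1)] gy] hom_eq_hF[OF c'h[OF f(2)] gy] cc eq unfolding Th_def by simp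
  then have "g (f1 y) = g (f2 y)" unfolding c'_def hg[OF y] .
  then have "h (g (f1 y)) = h (g (f2 y))" by simp
  then show "f1 y = f2 y"
  unfolding hg[OF homD(1)[OF End_hom[OF A lmT f(1)] y]] hg[OF homD(1)[OF End_hom[OF A lmT f(2)] y]] .
  qed
 qed
 have surj: "Th ` car ?E = car ?L"
 proof (intro equalityI subsetI)
  fix F assume "F : Th ` car ?E"
  then obtain f where f: "F = Th f" "f : car ?E" by (rule imageE)
  show "F : car ?L" unfolding f(1) by (rule closed[OF f(2)])
 next
  fix F assume "F : car ?L"
  then obtain c where F: "Lmat c F" unfolding L'_carrier by (rule exE)
  define f where "f = restrict (%y. h (hF c F (g y))) (car T)"
  have fE: "f : car ?E"
  unfolding f_def by (rule End_memI[OF A lmT hom_comp[OF hom_comp[OF g hF_hom[OF F]] h]])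
  have "Th f = F"
  proof (rule mat_eq[OF LmatD(1)[OF F]])
  fix a b assume ab: "a < p + n" "b < p + n"
  have "c' f (ga a) = hF c F (ga a)"
  unfolding c'_def f_def using hc[OF ga(1)] gh[OF ga(1)] gh[OF hF_closed] by simp
  then have "row (c' f (ga a)) (pi a) b = (\<Sum>d<p + n. row (ga a) (pi a) d * F $$ (d, b))"
  using hF_row[OF F ga(1) ab(2)] by simp
  also have "... = (\<Sum>d<p + n. if d = a then F $$ (a, b) else 0)"
  by (rule sum.cong) (simp_all add: ga(3)[OF ab(1)])
  also have "... = F $$ (a, b)" using ab by simp
  finally show "row (c' f (ga a)) (pi a) b = F $$ (a, b)" .
  qed
  then show "F : Th ` car ?E" using fE by (intro image_eqI[where x = f]) simp_all
 qed
 have "Th : ring_iso (op_algebra ?E) ?L"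
  unfolding ring_iso_def
 proof (intro CollectI conjI)
  show "Th : Ring.ring_hom (op_algebra ?E) ?L"
  by (rule ring_hom_memI) (simp_all only: opS L'_simps closed Th_mult Th_add Th_one)
  show "bij_betw Th (car (op_algebra ?E)) (car ?L)" unfolding bij_betw_def opS using inj surj by (rule conjI)
 qed
 moreover have "Th : module_hom class_ring (op_algebra ?E) ?L"
  by (rule homI) (simp_all only: opS L'_simps closed Th_add Th_scal)
 ultimately show ?thesis unfolding algebra_isomorphic_def by blast
qed

end

end


theorem corollary3p3:
  fixes n p :: nat and r :: "nat rel"
    and \<Lambda> :: "('k::alg_closed_field, 'k mat) module"
  assumes "n \<ge> 1"
    and "partial_order_on {1..n} r"
    and "\<forall>i j. (i, j) \<in> r \<longrightarrow> i \<le> j"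
    and "minimal_elements n r = {1..p}"
    and "\<Lambda> = upper_suspension_algebra n r"
  shows "quasi_hereditary \<Lambda> {0..n} ((lower_ext n r)\<inverse>) (suspension_simple n) \<and>
    (\<exists>T. characteristic_tilting_module \<Lambda> {0..n} ((lower_ext n r)\<inverse>) (suspension_simple n) T) \<and>
    algebra_isomorphic
      (ringel_dual \<Lambda> {0..n} ((lower_ext n r)\<inverse>) (suspension_simple n))
      (L'_algebra n p r)"
proof -
  interpret suspension n r "TYPE('k)" by unfold_locales (use assms(2,3) in auto)
  have Mn: "Mn = {1..p}" unfolding Mn_def by (rule assms(4))
  let ?T = "SOME T. characteristic_tilting_module (upper_suspension_algebra n r :: ('k, 'k mat) module) {0..n} ((lower_ext n r)\<inverse>) (suspension_simple n) T"
  have T: "characteristic_tilting_module (upper_suspension_algebra n r :: ('k, 'k mat) module) {0..n} ((lower_ext n r)\<inverse>) (suspension_simple n) ?T"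
    by (rule someI_ex[OF characteristic_tilting_exists])
  note U = characteristic_tilting_unique[OF T]
  have iso: "isomorphic (upper_suspension_algebra n r) (Fam {1..n} m1) ?T"
    by (rule iso_trans[OF iso_sym[OF lm_Fam NF_TT] U(2)])
  show ?thesis
    unfolding assms(5) ringel_dual_def
    by (intro conjI quasi_hereditary_suspension characteristic_tilting_exists
        End_isomorphic_L'[OF Mn assms(1) fd_lm[OF U(1)] iso])
qed

end
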